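(* Let $\Gamma$ be a compact connected metric graph, let $\kappa\in L_\infty(\Gamma)$ satisfy $\operatorname{ess\,inf}_\Gamma\kappa\ge\kappa_0>0$, let $a:\Gamma\to\mathbb R$ be Lipschitz and positive with $a_0=\min_\Gamma a>0$, and let $\alpha\in\mathbb R$. Suppose that either $\alpha\ge0$, or, with $S=|\alpha|/d_0$ and $d_0=\min_vd_v$, one has $\kappa_0^2>4S/\min_el_e$ and $2S\max_el_e\le a_0$. Let $u=L_\alpha^{-\beta}f$ be the solution of $L_\alpha^\beta u=f$ with $f\in L_2(\Gamma)$, and let $u^Q_{h,k}=Q_{h,k,\beta}P_hf$ be its finite element/quadrature approximation with quadrature step size $k>0$ (defined in the context). If $0<\beta<1$ and $\sigma<\beta$, then there exists $C=C_\sigma>0$ such that $$\|u-u^Q_{h,k}\|_{L_2(\Gamma)}\le C\big(\hat h^{2\sigma}+e^{-\frac{\pi^2}{2k}}\big)\|f\|_{L_2(\Gamma)}.$$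
   Context: A compact metric graph $\Gamma$ consists of a finite vertex set $\mathcal V$ and a finite edge set $\mathcal E$ (loops and multiple edges allowed); each edge $e$ is identified with $[0,l_e]$, $0<l_e<\infty$; $\Gamma$ carries the shortest-path metric; $\mathcal E_v$ is the set of edges incident to $v$ (a loop at $v$ counted twice) and $d_v=|\mathcal E_v|$. $\partial_eu(v)$ is the derivative of $u$ along $e$ at $v$ in the direction away from $v$. $L_2(\Gamma)=\bigoplus_eL_2(e)$ with inner product $(\cdot,\cdot)$; $\widetilde H^2(\Gamma)=\bigoplus_eH^2(e)$; $C(\Gamma)$ is the space of continuous functions on $\Gamma$; $H^1(\Gamma)$ is the space of continuous functions on $\Gamma$ in $H^1(e)$ on each edge. $L_\alpha$ acts on each edge by $(L_\alpha u)_e=-(a_eu_e')'+\kappa_e^2u_e$ with domain $\{u\in\widetilde H^2(\Gamma)\cap C(\Gamma): a(v)\sum_{e\in\mathcal E_v}\partial_eu(v)=\alpha u(v)\ \forall v\in\mathcal V\}$ (generalized Kirchhoff conditions); under the hypotheses it is self-adjoint and positive definite with compact inverse, and its fractional powers are defined spectrally. Its bilinear form is $\mathfrak h_\alpha(f,g)=(\kappa^2f,g)+\sum_e\int_ea f_e'g_e'\,dx+\sum_v\alpha f(v)g(v)$ on $H^1(\Gamma)$. Finite elements: each edge $e$ is subdivided into $n_e\ge2$ intervals of equal length $h_e=l_e/n_e$; $V_h\subset H^1(\Gamma)$ consists of the continuous functions on $\Gamma$ affine on every subinterval; $\hat h=\max_eh_e$; $P_h:L_2(\Gamma)\to V_h$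 is the $L_2(\Gamma)$-orthogonal projection; $L_h:V_h\to V_h$ is defined by $(L_hu,w)=\mathfrak h_\alpha(u,w)$ for $u,w\in V_h$. Quadrature: for step size $k>0$, $$Q_{h,k,\beta}=\frac{2k\sin(\pi\beta)}{\pi}\sum_{l=-K^-}^{K^+}e^{2\beta lk}\big(\mathrm{Id}_{V_h}+e^{2lk}L_h\big)^{-1},\quad K^-=\Big\lceil\frac{\pi^2}{4\beta k^2}\Big\rceil,\ K^+=\Big\lceil\frac{\pi^2}{4(1-\beta)k^2}\Big\rceil.$$
   Formalization: The constant C may depend on an arbitrary upper bound k0 for the quadrature step size (0<k≤k0); a C uniform over all k>0 does not exist, since the l=0 term of Q grows linearly as k→∞ while the right-hand side stays bounded. *)

theory Defs
  imports "HOL-Analysis.Analysis" "Graph_Theory.Digraph_Component"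
begin

section \<open>Compact metric graphs\<close>

text \<open>
  A metric graph is a finite multigraph (loops and parallel edges allowed) together with edge
  lengths.  The orientation of an arc only records its identification with the interval
  \<open>{0..len e}\<close>: the coordinate 0 sits at \<open>tail G e\<close> and \<open>len e\<close> at \<open>head G e\<close>.
  A function on the graph is a family \<open>'e \<Rightarrow> real \<Rightarrow> real\<close>, of which only the values at
  \<open>e \<in> arcs G\<close> and \<open>x \<in> {0..len e}\<close> are meaningful.
\<close>

type_synonym 'e gfun = "'e \<Rightarrow> real \<Rightarrow> real"

text \<open>At least one edge is required, so that the extrema over the edge set make sense.\<close>

definition compact_metric_graph :: "('v,'e) pre_digraph \<Rightarrow> ('e \<Rightarrow> real) \<Rightarrow> bool" where
  "compact_metric_graph G len \<longleftrightarrow>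
     fin_digraph G \<and> arcs G \<noteq> {} \<and> (\<forall>e\<in>arcs G. 0 < len e)"

definition gpoints :: "('v,'e) pre_digraph \<Rightarrow> ('e \<Rightarrow> real) \<Rightarrow> ('e \<times> real) set" where
  "gpoints G len = {(e, x). e \<in> arcs G \<and> 0 \<le> x \<and> x \<le> len e}"

text \<open>
  An edge end is a pair of an arc and a Boolean; \<open>(e, False)\<close> is the end of \<open>e\<close> at its tail,
  \<open>(e, True)\<close> the one at its head.  A loop at \<open>v\<close> contributes both its ends to \<open>ends_at G v\<close>.
\<close>

definition end_vertex :: "('v,'e) pre_digraph \<Rightarrow> 'e \<times> bool \<Rightarrow> 'v" where
  "end_vertex G h = (if snd h then head G (fst h) else tail G (fst h))"

definition end_point :: "('e \<Rightarrow> real) \<Rightarrow> 'e \<times> bool \<Rightarrow> 'e \<times> real" where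
  "end_point len h = (fst h, if snd h then len (fst h) else 0)"

definition ends_at :: "('v,'e) pre_digraph \<Rightarrow> 'v \<Rightarrow> ('e \<times> bool) set" where
  "ends_at G v = {h \<in> arcs G \<times> UNIV. end_vertex G h = v}"

definition gdegree :: "('v,'e) pre_digraph \<Rightarrow> 'v \<Rightarrow> nat" where
  "gdegree G v = card (ends_at G v)"

text \<open>
  \<open>path_length G len p q r\<close>: there is a path of length \<open>r\<close> from \<open>p\<close> to \<open>q\<close>.  A path moves along
  edges, and passes at no cost from one edge end to another one at the same vertex.
\<close>

inductive path_length ::
  "('v,'e) pre_digraph \<Rightarrow> ('e \<Rightarrow> real) \<Rightarrow> 'e \<times> real \<Rightarrow> 'e \<times> real \<Rightarrow> real \<Rightarrow> bool"
  for G :: "('v,'e) pre_digraph" and len :: "'e \<Rightarrow> real" where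
  trivial: "p \<in> gpoints G len \<Longrightarrow> path_length G len p p 0"
| along: "path_length G len p (e, x) r \<Longrightarrow> (e, y) \<in> gpoints G len \<Longrightarrow>
    path_length G len p (e, y) (r + \<bar>x - y\<bar>)"
| through: "path_length G len p (end_point len h) r \<Longrightarrow> h \<in> ends_at G v \<Longrightarrow> h' \<in> ends_at G v \<Longrightarrow>
    path_length G len p (end_point len h') r"

definition gdist :: "('v,'e) pre_digraph \<Rightarrow> ('e \<Rightarrow> real) \<Rightarrow> 'e \<times> real \<Rightarrow> 'e \<times> real \<Rightarrow> real" where
  "gdist G len p q = Inf {r. path_length G len p q r}"

text \<open>
  \<open>gdist\<close> vanishes between the coordinates of one and the same vertex, so that functions which are
  continuous or Lipschitz with respect to it have well-defined values at the vertices.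
\<close>

definition graph_continuous :: "('v,'e) pre_digraph \<Rightarrow> ('e \<Rightarrow> real) \<Rightarrow> 'e gfun \<Rightarrow> bool" where
  "graph_continuous G len u \<longleftrightarrow>
     (\<forall>(e, x)\<in>gpoints G len. \<forall>\<epsilon>>0. \<exists>\<delta>>0. \<forall>(e', y)\<in>gpoints G len.
        gdist G len (e, x) (e', y) < \<delta> \<longrightarrow> \<bar>u e x - u e' y\<bar> < \<epsilon>)"

definition graph_Lipschitz :: "('v,'e) pre_digraph \<Rightarrow> ('e \<Rightarrow> real) \<Rightarrow> 'e gfun \<Rightarrow> bool" where
  "graph_Lipschitz G len u \<longleftrightarrow>
     (\<exists>M. \<forall>(e, x)\<in>gpoints G len. \<forall>(e', y)\<in>gpoints G len.
        \<bar>u e x - u e' y\<bar> \<le> M * gdist G len (e, x) (e', y))"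

definition vertex_value ::
  "('v,'e) pre_digraph \<Rightarrow> ('e \<Rightarrow> real) \<Rightarrow> 'e gfun \<Rightarrow> 'v \<Rightarrow> real" where
  "vertex_value G len u v = (THE c. \<forall>h\<in>ends_at G v. case_prod u (end_point len h) = c)"

text \<open>Derivative at an edge end, in the direction pointing into the edge.\<close>

definition end_derivative :: "('e \<Rightarrow> real) \<Rightarrow> 'e gfun \<Rightarrow> 'e \<times> bool \<Rightarrow> real" where
  "end_derivative len u h = (case h of (e, b) \<Rightarrow>
     vector_derivative (\<lambda>t. u e (if b then len e - t else t)) (at 0 within {0..len e}))"

section \<open>Lebesgue and Sobolev spaces\<close>

definition L2_interval :: "real \<Rightarrow> (real \<Rightarrow> real) \<Rightarrow> bool" where
  "L2_interval l f \<longleftrightarrow> f \<in> borel_measurable (lebesgue_on {0..l}) \<and>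
     integrable (lebesgue_on {0..l}) (\<lambda>x. (f x)\<^sup>2)"

text \<open>
  \<open>weak_deriv l f g\<close>: the function \<open>g\<close>, in \<open>L\<^sub>2\<close>, is a weak derivative of \<open>f\<close> on the open interval
  from 0 to \<open>l\<close>, tested against compactly supported \<open>C\<^sup>1\<close> functions.
\<close>

definition weak_deriv :: "real \<Rightarrow> (real \<Rightarrow> real) \<Rightarrow> (real \<Rightarrow> real) \<Rightarrow> bool" where
  "weak_deriv l f g \<longleftrightarrow> L2_interval l g \<and>
     (\<forall>\<psi> \<psi>' c d. 0 < c \<longrightarrow> d < l \<longrightarrow> (\<forall>x. x \<notin> {c..d} \<longrightarrow> \<psi> x = 0) \<longrightarrow>
        (\<forall>x. (\<psi> has_real_derivative \<psi>' x) (at x)) \<longrightarrow> continuous_on UNIV \<psi>' \<longrightarrow>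
        (LINT x|lebesgue_on {0..l}. f x * \<psi>' x) = - (LINT x|lebesgue_on {0..l}. g x * \<psi> x))"

text \<open>Weak derivatives are unique up to null sets; \<open>wderiv\<close> picks a representative.\<close>

definition wderiv :: "real \<Rightarrow> (real \<Rightarrow> real) \<Rightarrow> real \<Rightarrow> real" where
  "wderiv l f = (SOME g. weak_deriv l f g)"

definition H1_interval :: "real \<Rightarrow> (real \<Rightarrow> real) \<Rightarrow> bool" where
  "H1_interval l f \<longleftrightarrow> L2_interval l f \<and> (\<exists>g. weak_deriv l f g)"

definition H2_interval :: "real \<Rightarrow> (real \<Rightarrow> real) \<Rightarrow> bool" where
  "H2_interval l f \<longleftrightarrow> H1_interval l f \<and> H1_interval l (wderiv l f)"

definition L2_graph :: "('v,'e) pre_digraph \<Rightarrow> ('e \<Rightarrow> real) \<Rightarrow> 'e gfun \<Rightarrow> bool" where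
  "L2_graph G len f \<longleftrightarrow> (\<forall>e\<in>arcs G. L2_interval (len e) (f e))"

definition Linf_graph :: "('v,'e) pre_digraph \<Rightarrow> ('e \<Rightarrow> real) \<Rightarrow> 'e gfun \<Rightarrow> bool" where
  "Linf_graph G len f \<longleftrightarrow> (\<forall>e\<in>arcs G. f e \<in> borel_measurable (lebesgue_on {0..len e}) \<and>
     (\<exists>M. AE x in lebesgue_on {0..len e}. \<bar>f e x\<bar> \<le> M))"

definition L2_inner :: "('v,'e) pre_digraph \<Rightarrow> ('e \<Rightarrow> real) \<Rightarrow> 'e gfun \<Rightarrow> 'e gfun \<Rightarrow> real" where
  "L2_inner G len f g = (\<Sum>e\<in>arcs G. LINT x|lebesgue_on {0..len e}. f e x * g e x)"

definition L2_norm :: "('v,'e) pre_digraph \<Rightarrow> ('e \<Rightarrow> real) \<Rightarrow> 'e gfun \<Rightarrow> real" where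
  "L2_norm G len f = sqrt (L2_inner G len f f)"

section \<open>The operator and its fractional powers\<close>

definition L_op :: "('e \<Rightarrow> real) \<Rightarrow> 'e gfun \<Rightarrow> 'e gfun \<Rightarrow> 'e gfun \<Rightarrow> 'e gfun" where
  "L_op len a \<kappa> u = (\<lambda>e x.
     - wderiv (len e) (\<lambda>y. a e y * wderiv (len e) (u e) y) x + (\<kappa> e x)\<^sup>2 * u e x)"

definition L_dom ::
  "('v,'e) pre_digraph \<Rightarrow> ('e \<Rightarrow> real) \<Rightarrow> 'e gfun \<Rightarrow> real \<Rightarrow> 'e gfun set" where
  "L_dom G len a \<alpha> = {u. (\<forall>e\<in>arcs G. H2_interval (len e) (u e)) \<and> graph_continuous G len u \<and>
     (\<forall>v\<in>verts G. vertex_value G len a v * (\<Sum>h\<in>ends_at G v. end_derivative len u h)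
        = \<alpha> * vertex_value G len u v)}"

text \<open>
  A complete orthonormal system of \<open>L\<^sub>2\<close> consisting of eigenfunctions \<open>\<phi> j\<close> of the operator,
  with positive eigenvalues \<open>\<mu> j\<close>.
\<close>

definition eigenbasis :: "('v,'e) pre_digraph \<Rightarrow> ('e \<Rightarrow> real) \<Rightarrow> 'e gfun \<Rightarrow> 'e gfun \<Rightarrow> real \<Rightarrow>
    (nat \<Rightarrow> 'e gfun) \<Rightarrow> (nat \<Rightarrow> real) \<Rightarrow> bool" where
  "eigenbasis G len a \<kappa> \<alpha> \<phi> \<mu> \<longleftrightarrow>
     (\<forall>j. \<phi> j \<in> L_dom G len a \<alpha> \<and> 0 < \<mu> j \<and>
        (\<forall>e\<in>arcs G. AE x in lebesgue_on {0..len e}. L_op len a \<kappa> (\<phi> j) e x = \<mu> j * \<phi> j e x)) \<and>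
     (\<forall>i j. L2_inner G len (\<phi> i) (\<phi> j) = (if i = j then 1 else 0)) \<and>
     (\<forall>f. L2_graph G len f \<longrightarrow>
        (\<lambda>m. L2_norm G len (\<lambda>e x. f e x - (\<Sum>j<m. L2_inner G len f (\<phi> j) * \<phi> j e x)))
          \<longlonglongrightarrow> 0)"

text \<open>
  \<open>frac_power_eq G len a \<kappa> \<alpha> \<beta> u f\<close>: the function \<open>u\<close> belongs to the domain of the \<open>\<beta>\<close>-th power of
  the operator and is mapped to \<open>f\<close> by it, that is,
  \<open>f = \<Sum>j. \<mu> j powr \<beta> * L2_inner u (\<phi> j) * \<phi> j\<close> with convergence in \<open>L\<^sub>2\<close>.
  The choice of the eigenbasis is immaterial.
\<close>

definition frac_power_eq :: "('v,'e) pre_digraph \<Rightarrow> ('e \<Rightarrow> real) \<Rightarrow> 'e gfun \<Rightarrow> 'e gfun \<Rightarrow> real \<Rightarrow>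
    real \<Rightarrow> 'e gfun \<Rightarrow> 'e gfun \<Rightarrow> bool" where
  "frac_power_eq G len a \<kappa> \<alpha> \<beta> u f \<longleftrightarrow> L2_graph G len u \<and> L2_graph G len f \<and>
     (\<exists>\<phi> \<mu>. eigenbasis G len a \<kappa> \<alpha> \<phi> \<mu> \<and>
        (\<lambda>m. L2_norm G len (\<lambda>e x. f e x -
              (\<Sum>j<m. (\<mu> j) powr \<beta> * L2_inner G len u (\<phi> j) * \<phi> j e x))) \<longlonglongrightarrow> 0)"

definition bilinear_form :: "('v,'e) pre_digraph \<Rightarrow> ('e \<Rightarrow> real) \<Rightarrow> 'e gfun \<Rightarrow> 'e gfun \<Rightarrow> real \<Rightarrow>
    'e gfun \<Rightarrow> 'e gfun \<Rightarrow> real" where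
  "bilinear_form G len a \<kappa> \<alpha> f g =
     L2_inner G len (\<lambda>e x. (\<kappa> e x)\<^sup>2 * f e x) g
     + (\<Sum>e\<in>arcs G. LINT x|lebesgue_on {0..len e}.
          a e x * wderiv (len e) (f e) x * wderiv (len e) (g e) x)
     + (\<Sum>v\<in>verts G. \<alpha> * vertex_value G len f v * vertex_value G len g v)"

section \<open>Finite elements and quadrature\<close>

text \<open>The subdivision is given by the number \<open>n e\<close> of subintervals of each edge.\<close>

definition mesh :: "('v,'e) pre_digraph \<Rightarrow> ('e \<Rightarrow> nat) \<Rightarrow> bool" where
  "mesh G n \<longleftrightarrow> (\<forall>e\<in>arcs G. 2 \<le> n e)"

definition mesh_size :: "('v,'e) pre_digraph \<Rightarrow> ('e \<Rightarrow> real) \<Rightarrow> ('e \<Rightarrow> nat) \<Rightarrow> real" where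
  "mesh_size G len n = Max ((\<lambda>e. len e / real (n e)) ` arcs G)"

text \<open>
  Members of \<open>Vh\<close> are set to 0 at the meaningless arguments, so that each finite element function
  has exactly one representative and the elements described below are unique.
\<close>

definition Vh :: "('v,'e) pre_digraph \<Rightarrow> ('e \<Rightarrow> real) \<Rightarrow> ('e \<Rightarrow> nat) \<Rightarrow> 'e gfun set" where
  "Vh G len n = {u. graph_continuous G len u \<and>
     (\<forall>e x. (e, x) \<notin> gpoints G len \<longrightarrow> u e x = 0) \<and>
     (\<forall>e\<in>arcs G. \<forall>i<n e. \<exists>p q. \<forall>x\<in>{real i * (len e / real (n e))..real (Suc i) * (len e / real (n e))}.
        u e x = p + q * x)}"

definition Ph :: "('v,'e) pre_digraph \<Rightarrow> ('e \<Rightarrow> real) \<Rightarrow> ('e \<Rightarrow> nat) \<Rightarrow> 'e gfun \<Rightarrow> 'e gfun" where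
  "Ph G len n f = (THE u. u \<in> Vh G len n \<and>
     (\<forall>w\<in>Vh G len n. L2_inner G len u w = L2_inner G len f w))"

definition Lh :: "('v,'e) pre_digraph \<Rightarrow> ('e \<Rightarrow> real) \<Rightarrow> 'e gfun \<Rightarrow> 'e gfun \<Rightarrow> real \<Rightarrow>
    ('e \<Rightarrow> nat) \<Rightarrow> 'e gfun \<Rightarrow> 'e gfun" where
  "Lh G len a \<kappa> \<alpha> n u = (THE z. z \<in> Vh G len n \<and>
     (\<forall>w\<in>Vh G len n. L2_inner G len z w = bilinear_form G len a \<kappa> \<alpha> u w))"

definition Lh_resolvent :: "('v,'e) pre_digraph \<Rightarrow> ('e \<Rightarrow> real) \<Rightarrow> 'e gfun \<Rightarrow> 'e gfun \<Rightarrow> real \<Rightarrow>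
    ('e \<Rightarrow> nat) \<Rightarrow> real \<Rightarrow> 'e gfun \<Rightarrow> 'e gfun" where
  "Lh_resolvent G len a \<kappa> \<alpha> n t =
     inv_into (Vh G len n) (\<lambda>u e x. u e x + t * Lh G len a \<kappa> \<alpha> n u e x)"

definition K_minus :: "real \<Rightarrow> real \<Rightarrow> int" where
  "K_minus \<beta> k = \<lceil>pi\<^sup>2 / (4 * \<beta> * k\<^sup>2)\<rceil>"

definition K_plus :: "real \<Rightarrow> real \<Rightarrow> int" where
  "K_plus \<beta> k = \<lceil>pi\<^sup>2 / (4 * (1 - \<beta>) * k\<^sup>2)\<rceil>"

definition Q_approx :: "('v,'e) pre_digraph \<Rightarrow> ('e \<Rightarrow> real) \<Rightarrow> 'e gfun \<Rightarrow> 'e gfun \<Rightarrow> real \<Rightarrow>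
    ('e \<Rightarrow> nat) \<Rightarrow> real \<Rightarrow> real \<Rightarrow> 'e gfun \<Rightarrow> 'e gfun" where
  "Q_approx G len a \<kappa> \<alpha> n k \<beta> g = (\<lambda>e x. 2 * k * sin (pi * \<beta>) / pi *
     (\<Sum>l\<in>{- K_minus \<beta> k..K_plus \<beta> k}. exp (2 * \<beta> * of_int l * k) *
        Lh_resolvent G len a \<kappa> \<alpha> n (exp (2 * of_int l * k)) g e x))"

end

theory Submission
  imports Defs "HOL-Complex_Analysis.Complex_Analysis" "HOL-Library.Function_Algebras"
begin

text \<open>
  Expanding in eigenfunctions, the exact solution multiplies the coefficient of \<open>f\<close> at the eigenvalue
  \<open>\<mu>\<close> by \<open>x\<^sup>\<beta>\<close>, where \<open>x = 1 / \<mu>\<close>, whereas the quadrature applied to the exact operator multiplies it by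
  \<open>q(x) = (2 k sin(\<pi>\<beta>) / \<pi>) \<Sum>\<^sub>l e\<^bsup>2\<beta>lk\<^esup> x / (x + e\<^bsup>2lk\<^esup>)\<close>.  Up to geometric tails \<open>q\<close> is a trapezoidal sum, and
  the residue theorem for the integrand times a cotangent, on a rectangle of half height \<open>\<pi>/4\<close>, gives
  \<open>\<bar>x\<^sup>\<beta> - q(x)\<bar> \<le> C e\<^bsup>-\<pi>\<^sup>2/2k\<^esup>\<close> uniformly for bounded \<open>x\<close>.

  Replacing each exact resolvent by its Galerkin counterpart costs at most \<open>4 \<delta> / (\<delta> + t)\<close> in norm, where \<open>t\<close>
  is the parameter of the resolvent and \<open>\<delta>\<close> a multiple of the square of the mesh size (Cea's lemma and duality,
  for finite eigenfunction expansions, with nodal interpolation).  Weighted with the quadrature weights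
  these errors sum to \<open>4 q(\<delta>)\<close>, which by the same scalar estimate is at most \<open>4 \<delta>\<^sup>\<beta> + C e\<^bsup>-\<pi>\<^sup>2/2k\<^esup>\<close>.
\<close>

section \<open>Quadrature of a scalar power\<close>

text \<open>\<open>frac_power_eq\<close> supplies an eigenbasis, and the exact operator is only ever
  seen through it: finite combinations of eigenfunctions have explicit images and explicit
  resolvents, and completeness together with the contractivity of the discrete resolvents carries
  the estimates to all of L2. Up to height \<pi>/4, half the height of the poles of 1 / (1 + exp (2
  z)), the real part of exp (2 z) is nonnegative, so the integrand is at most twice its value on the
  real line; a cotangent of frequency \<pi>/k then yields exactly
  \<open>exp (- pi^2 / (2 * k))\<close>, the size to which \<open>K_minus\<close> and
  \<open>K_plus\<close> cut the tails. The resolvent bound has to have the form \<delta> / (\<delta>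
  + t): a bound \<delta> / t would be far too large at the nodes with small t, while \<delta> /
  (\<delta> + t) is the very summand of the quadrature at x = \<delta>. On the analytic side,
  derivatives are weak ones chosen up to null sets and \<open>a\<close> is merely Lipschitz; hence
  functions are rewritten as integrals (\<open>antideriv\<close>), for which end point values,
  products and integration by parts are exact.\<close>

lemma Gamma_reflection_real:
  fixes b :: real
  assumes "0 < b" "b < 1"
  shows "Gamma b * Gamma (1 - b) = pi / sin (pi * b)"
proof -
  have "complex_of_real (Gamma b * Gamma (1 - b)) = Gamma (of_real b) * Gamma (1 - of_real b)"
    by (metis Gamma_complex_of_real of_real_1 of_real_diff of_real_mult)
  also have "\<dots> = of_real pi / sin (of_real pi * of_real b)"
    by (rule Gamma_reflection_complex)
  also have "\<dots> = of_real (pi / sin (pi * b))"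
    by (simp add: sin_of_real flip: of_real_mult)
  finally show ?thesis
    using of_real_eq_iff by blast
qed

text \<open>The substitution t = exp (2 y) / (1 + exp (2 y)) turns this into half the Beta integral
  with parameters b and 1 - b, which the reflection formula evaluates. Up to the step size, the
  value is the reciprocal of the factor in front of the quadrature sum.\<close>

lemma has_integral_exp_logistic:
  fixes b :: real
  assumes b: "0 < b" "b < 1"
  shows "(\<lambda>y. exp (2 * b * y) / (1 + exp (2 * y))) absolutely_integrable_on UNIV"
    and "integral UNIV (\<lambda>y. exp (2 * b * y) / (1 + exp (2 * y))) = pi / (2 * sin (pi * b))"
proof -
  let ?f = "\<lambda>t::real. t powr (b - 1) * (1 - t) powr ((1 - b) - 1) / 2"
  let ?g = "\<lambda>y::real. exp (2 * y) / (1 + exp (2 * y))"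
  let ?h = "\<lambda>y::real. 2 * exp (2 * y) / (1 + exp (2 * y))\<^sup>2"
  have pos: "1 + exp (2 * y) \<noteq> 0" for y :: real
    using exp_gt_zero[of "2 * y"] by linarith
  have deriv: "(?g has_field_derivative ?h y) (at y within UNIV)" for y
    using pos[of y] by (auto intro!: derivative_eq_intros simp: power2_eq_square field_simps)
  have inj: "inj ?g"
  proof (rule injI)
    fix x y :: real
    assume "?g x = ?g y"
    then have "exp (2 * x) = exp (2 * y)"
      using pos[of x] pos[of y] by (simp add: field_simps)
    then show "x = y" by simp
  qed
  have range: "range ?g = {0<..<1}"
  proof
    show "range ?g \<subseteq> {0<..<1}"
      using pos by (auto simp: field_simps add_pos_pos)
    show "{0<..<1} \<subseteq> range ?g"
    proof
      fix t :: real
      assume t: "t \<in> {0<..<1}"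
      then have "t = ?g (ln (t / (1 - t)) / 2)"
        by (simp add: field_simps)
      then show "t \<in> range ?g" by blast
    qed
  qed
  have "((\<lambda>t. t powr (b - 1) * (1 - t) powr ((1 - b) - 1)) has_integral Beta b (1 - b)) {0..1}"
    using has_integral_Beta_real[of b "1 - b"] b by simp
  then have "(?f has_integral Beta b (1 - b) / 2) {0<..<1}"
    by (metis has_integral_Icc_iff_Ioo has_integral_divide)
  moreover have "Beta b (1 - b) = pi / sin (pi * b)"
    using Gamma_reflection_real[OF b] by (simp add: Beta_def)
  ultimately have I: "(?f has_integral pi / (2 * sin (pi * b))) (range ?g)"
    unfolding range by (simp add: mult.commute)
  then have "?f absolutely_integrable_on range ?g \<and> integral (range ?g) ?f = pi / (2 * sin (pi * b))"
    using range by (intro conjI nonnegative_absolutely_integrable_1 has_integral_integrable integral_unique) auto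
  then have main: "(\<lambda>y. \<bar>?h y\<bar> * ?f (?g y)) absolutely_integrable_on UNIV \<and>
      integral UNIV (\<lambda>y. \<bar>?h y\<bar> * ?f (?g y)) = pi / (2 * sin (pi * b))"
    by (intro iffD2[OF has_absolute_integral_change_of_variables_1'[OF _ deriv inj]]) simp_all
  have eq: "\<bar>?h y\<bar> * ?f (?g y) = exp (2 * b * y) / (1 + exp (2 * y))" for y
  proof -
    define w where "w = 1 + exp (2 * y)"
    have w: "w > 0" unfolding w_def by (simp add: add_pos_pos)
    have "1 - ?g y = 1 / w" using w unfolding w_def by (simp add: field_simps)
    then have "?f (?g y) = (exp (2 * y) / w) powr (b - 1) * (1 / w) powr (- b) / 2"
      by (simp add: w_def)
    also have "\<dots> = exp (2 * y * (b - 1)) / w powr (b - 1) * w powr b / 2"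
      using w by (simp add: powr_divide exp_powr_real powr_minus field_simps)
    also have "\<dots> = exp (2 * y * (b - 1)) * w / 2"
      using w by (simp add: powr_diff)
    finally have "\<bar>?h y\<bar> * ?f (?g y) = (2 * exp (2 * y) / w\<^sup>2) * (exp (2 * y * (b - 1)) * w / 2)"
      using w by (simp add: w_def)
    also have "\<dots> = (exp (2 * y) * exp (2 * y * (b - 1))) / w"
      using w by (simp add: power2_eq_square)
    also have "exp (2 * y) * exp (2 * y * (b - 1)) = exp (2 * b * y)"
      by (simp add: exp_add [symmetric] algebra_simps)
    finally show ?thesis by (simp add: w_def)
  qed
  show "(\<lambda>y. exp (2 * b * y) / (1 + exp (2 * y))) absolutely_integrable_on UNIV"
    and "integral UNIV (\<lambda>y. exp (2 * b * y) / (1 + exp (2 * y))) = pi / (2 * sin (pi * b))"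
    using main unfolding eq by auto
qed

section \<open>Bounds for the cotangent on the sides of a rectangle\<close>

text \<open>In the upper half plane the cotangent tends to -i: cot w + i equals exp (i w) / sin w,
  and |sin w| is at least sinh (Im w). This is the source of the exponential accuracy, since it
  measures how far the cotangent is from a constant on the horizontal sides. The second claim is the
  mirror image in the lower half plane, by oddness.\<close>

lemma cmod_cot_add_i_le:
  assumes "0 < y" "Im w = y"
  shows "cmod (cos w / sin w + \<i>) \<le> 2 * exp (- 2 * y) / (1 - exp (- 2 * y))"
    and "cmod (cos (- w) / sin (- w) - \<i>) \<le> 2 * exp (- 2 * y) / (1 - exp (- 2 * y))"
proof -
  define s where "s = (exp y - exp (- y)) / 2"
  have s: "s > 0" using assms(1) by (simp add: s_def)
  have "s\<^sup>2 \<le> (cmod (sin w))\<^sup>2"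
    unfolding norm_sin_squared s_def assms(2)
  proof -
    define a where "a = exp y"
    have a: "exp (2 * y) = a * a" "exp (- y) = inverse a" "exp y = a" "a > 0"
      by (simp_all add: exp_double power2_eq_square exp_minus a_def)
    have "((exp y - exp (- y)) / 2)\<^sup>2 = (exp (2 * y) + inverse (exp (2 * y)) - 2) / 4"
      unfolding a(1-3) using a(4) by (simp add: power2_eq_square field_simps)
    also have "\<dots> \<le> (exp (2 * y) + inverse (exp (2 * y)) - 2 * cos (2 * Re w)) / 4"
      by simp
    finally show "((exp y - exp (- y)) / 2)\<^sup>2 \<le> (exp (2 * y) + inverse (exp (2 * y)) - 2 * cos (2 * Re w)) / 4" .
  qed
  then have le: "s \<le> cmod (sin w)"
    using power2_le_imp_le norm_ge_zero by blast
  then have nz: "sin w \<noteq> 0" using s by auto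
  have "cos w / sin w + \<i> = (cos w + \<i> * sin w) / sin w"
    using nz by (simp add: field_simps)
  also have "cos w + \<i> * sin w = exp (\<i> * w)"
    by (simp add: exp_Euler)
  finally have "cmod (cos w / sin w + \<i>) = exp (- y) / cmod (sin w)"
    by (simp add: norm_divide assms(2))
  also have "\<dots> \<le> exp (- y) / s"
    using le s by (intro divide_left_mono mult_pos_pos) auto
  also have "\<dots> = 2 * exp (- 2 * y) / (1 - exp (- 2 * y))"
  proof -
    define a where "a = exp (- y)"
    have a: "exp (- 2 * y) = a * a" "0 < a" "a < 1"
      using assms(1) by (simp_all add: a_def flip: exp_add)
    have ey: "exp y = 1 / a" by (simp add: a_def exp_minus field_simps)
    have "a * a < 1" using a mult_strict_mono[of a 1 a 1] by simp
    then show ?thesis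
      using a(2) unfolding s_def a(1) ey a_def[symmetric] by (simp add: divide_simps)
  qed
  finally show *: "cmod (cos w / sin w + \<i>) \<le> 2 * exp (- 2 * y) / (1 - exp (- 2 * y))" .
  have "cos (- w) / sin (- w) - \<i> = - (cos w / sin w + \<i>)" by simp
  then show "cmod (cos (- w) / sin (- w) - \<i>) \<le> 2 * exp (- 2 * y) / (1 - exp (- 2 * y))"
    using * by (metis norm_minus_cancel)
qed

text \<open>Halfway between its poles the cotangent has modulus |tanh (Im w)|, because there |cos w|
  = |sinh (Im w)| and |sin w| = cosh (Im w). The vertical sides of the rectangle are placed at such
  abscissas.\<close>

lemma cmod_cot_le_1:
  assumes "Re w = pi / 2 + of_int n * pi"
  shows "cmod (cos w / sin w) \<le> 1" "sin w \<noteq> 0"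
proof -
  have c: "cos (Re w) = 0" using assms by (auto simp: cos_zero_iff_int2 algebra_simps)
  have "cos (2 * Re w) = -1" using c by (simp add: cos_double_cos)
  then have s: "(cmod (sin w))\<^sup>2 = (exp (2 * Im w) + inverse (exp (2 * Im w)) + 2) / 4"
    by (simp add: norm_sin_squared)
  also have "\<dots> \<ge> (cmod (cos w))\<^sup>2"
  proof -
    have "exp (2 * Im w) = exp (Im w) * exp (Im w)"
      by (simp add: exp_double power2_eq_square)
    then have "(exp (Im w) - inverse (exp (Im w)))\<^sup>2 / 4 = (exp (2 * Im w) + inverse (exp (2 * Im w)) - 2) / 4"
      by (simp add: power2_eq_square field_simps)
    then show "(cmod (cos w))\<^sup>2 \<le> (exp (2 * Im w) + inverse (exp (2 * Im w)) + 2) / 4"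
      unfolding norm_cos_squared c by simp
  qed
  finally have "cmod (cos w) \<le> cmod (sin w)" using power2_le_imp_le norm_ge_zero by blast
  moreover have "(cmod (sin w))\<^sup>2 > 0"
    unfolding s by (intro divide_pos_pos add_pos_pos) simp_all
  ultimately show "cmod (cos w / sin w) \<le> 1" "sin w \<noteq> 0"
    by (simp_all add: norm_divide divide_le_eq_1)
qed

section \<open>Contour integrals along rectangles\<close>

lemma contour_integral_linepath_horizontal:
  assumes "A < B"
  shows "contour_integral (linepath (Complex A c) (Complex B c)) f = integral {A..B} (\<lambda>t. f (Complex t c))"
proof -
  have "contour_integral (linepath (Complex A c) (Complex B c)) f
      = contour_integral (linepath (of_real A) (of_real B)) (\<lambda>z. f (z + \<i> * c))"
  proof -
    have "linepath (Complex A c) (Complex B c) x = linepath (of_real A) (of_real B) x + \<i> * c" for x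
      by (simp add: linepath_def complex_eq_iff algebra_simps)
    moreover have "Complex B c - Complex A c = of_real B - of_real A"
      by (simp add: complex_eq_iff)
    ultimately show ?thesis
      unfolding contour_integral_integral by simp
  qed
  also have "\<dots> = integral {A..B} (\<lambda>t. f (of_real t + \<i> * c))"
    using assms by (subst contour_integral_linepath_Reals_eq) auto
  also have "(\<lambda>t. f (of_real t + \<i> * c)) = (\<lambda>t. f (Complex t c))"
    by (simp add: Complex_eq)
  finally show ?thesis .
qed

text \<open>The upper side is traversed from right to left, hence the minus sign. The vertical sides
  stay contour integrals because they are only going to be estimated.\<close>

lemma contour_integral_rectpath:
  assumes "A < B" "continuous_on (path_image (rectpath (Complex A c) (Complex B d))) f"
  shows "contour_integral (rectpath (Complex A c) (Complex B d)) f =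
    integral {A..B} (\<lambda>t. f (Complex t c)) - integral {A..B} (\<lambda>t. f (Complex t d)) +
    contour_integral (linepath (Complex B c) (Complex B d)) f +
    contour_integral (linepath (Complex A d) (Complex A c)) f"
proof -
  let ?l1 = "linepath (Complex A c) (Complex B c)" and ?l2 = "linepath (Complex B c) (Complex B d)"
    and ?l3 = "linepath (Complex B d) (Complex A d)" and ?l4 = "linepath (Complex A d) (Complex A c)"
  have rect: "rectpath (Complex A c) (Complex B d) = ?l1 +++ ?l2 +++ ?l3 +++ ?l4"
    by (simp add: rectpath_def Let_def)
  have cont: "continuous_on (closed_segment (Complex A c) (Complex B c)) f"
    "continuous_on (closed_segment (Complex B c) (Complex B d)) f"
    "continuous_on (closed_segment (Complex B d) (Complex A d)) f"
    "continuous_on (closed_segment (Complex A d) (Complex A c)) f"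
    by (rule continuous_on_subset[OF assms(2)], auto simp: rect path_image_join)+
  note int = cont[THEN contour_integrable_continuous_linepath]
  have "contour_integral ?l3 f = - contour_integral (linepath (Complex A d) (Complex B d)) f"
    using cont(3) by (rule contour_integral_reverse_linepath)
  then show ?thesis
    using int assms(1)
    by (simp add: rect contour_integral_linepath_horizontal contour_integrable_joinI)
qed

lemma path_image_rectpath_Complex:
  assumes "A \<le> B" "c \<le> d"
  shows "path_image (rectpath (Complex A c) (Complex B d)) =
    {z. Re z \<in> {A, B} \<and> Im z \<in> {c..d} \<or> Re z \<in> {A..B} \<and> Im z \<in> {c, d}}"
  using assms by (subst path_image_rectpath) (auto simp: complex_eq_iff)

lemma cmod_contour_integral_vertical_le:
  assumes "c \<le> d" "\<And>y. y \<in> {c..d} \<Longrightarrow> cmod (f (Complex A y)) \<le> M" "0 \<le> M"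
  shows "cmod (contour_integral (linepath (Complex A c) (Complex A d)) f) \<le> M * (d - c)"
    and "cmod (contour_integral (linepath (Complex A d) (Complex A c)) f) \<le> M * (d - c)"
proof -
  have seg: "closed_segment (Complex A c) (Complex A d) = {z. Re z = A \<and> Im z \<in> {c..d}}"
    using assms(1) by (simp add: closed_segment_same_Re closed_segment_eq_real_ivl)
  have eq: "z = Complex A (Im z)" if "Re z = A" for z
    using that by (simp add: complex_eq_iff)
  have M: "cmod (f z) \<le> M" if "z \<in> closed_segment (Complex A c) (Complex A d)" for z
    using that assms(2)[of "Im z"] eq[of z] by (auto simp: seg)
  have n: "cmod (Complex A d - Complex A c) = d - c" "cmod (Complex A c - Complex A d) = d - c"
    using assms(1) by (simp_all add: cmod_def)
  have "cmod (contour_integral (linepath (Complex A x) (Complex A y)) f) \<le> M * cmod (Complex A y - Complex A x)"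
    if xy: "x = c \<and> y = d \<or> x = d \<and> y = c" for x y
  proof (cases "f contour_integrable_on linepath (Complex A x) (Complex A y)")
    case True
    show ?thesis
      by (rule contour_integral_bound_linepath[OF True assms(3)])
         (use M xy in \<open>auto simp: closed_segment_commute\<close>)
  next
    case False
    \<comment> \<open>A contour integral that does not exist has the value 0 by convention.\<close>
    then show ?thesis using assms(3) by (simp add: not_integrable_contour_integral)
  qed
  from this[of c d] this[of d c] show
    "cmod (contour_integral (linepath (Complex A c) (Complex A d)) f) \<le> M * (d - c)"
    "cmod (contour_integral (linepath (Complex A d) (Complex A c)) f) \<le> M * (d - c)"
    using n by auto
qed

section \<open>The trapezoidal rule for the logistic kernel\<close>

text \<open>The poles sit where 2 Im z is an odd multiple of \<pi>. For |y| at most \<pi>/4 the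
  number exp (2 z) has nonnegative real part, so |1 + exp (2 z)| dominates both 1 and exp (2 t),
  hence their mean; this costs the factor 2.\<close>

lemma logistic_strip:
  fixes b :: real
  defines "G \<equiv> \<lambda>z::complex. exp (2 * of_real b * z) / (1 + exp (2 * z))"
  shows "G holomorphic_on {z. \<bar>Im z\<bar> < pi / 2}"
    and "\<bar>y\<bar> \<le> pi / 4 \<Longrightarrow> cmod (G (Complex t y)) \<le> 2 * (exp (2 * b * t) / (1 + exp (2 * t)))"
    and "G (of_real t) = of_real (exp (2 * b * t) / (1 + exp (2 * t)))"
proof -
  have nz: "1 + exp (2 * z) \<noteq> 0" if "\<bar>Im z\<bar> < pi / 2" for z :: complex
  proof
    assume "1 + exp (2 * z) = 0"
    then have "exp (2 * z) = exp (\<i> * pi)"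
      by (simp add: add_eq_0_iff)
    then obtain n :: int where n: "2 * z = \<i> * pi + of_int (2 * n) * pi * \<i>"
      unfolding exp_eq by auto
    from arg_cong[OF this, of Im] have "2 * Im z = (1 + 2 * of_int n) * pi"
      by (simp add: algebra_simps)
    then have "\<bar>1 + 2 * real_of_int n\<bar> * pi = \<bar>2 * Im z\<bar>"
      by (simp add: abs_mult)
    then have "\<bar>1 + 2 * real_of_int n\<bar> * pi < 1 * pi"
      using that by simp
    then have "\<bar>1 + 2 * real_of_int n\<bar> < 1"
      using mult_less_cancel_right_pos[OF pi_gt_zero] by blast
    then have "\<bar>1 + 2 * n\<bar> < 1" by linarith
    then show False by presburger
  qed
  show "G holomorphic_on {z. \<bar>Im z\<bar> < pi / 2}"
    unfolding G_def using nz by (intro holomorphic_intros) auto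
  show "G (of_real t) = of_real (exp (2 * b * t) / (1 + exp (2 * t)))"
    by (simp add: G_def flip: exp_of_real)
  show "cmod (G (Complex t y)) \<le> 2 * (exp (2 * b * t) / (1 + exp (2 * t)))" if y: "\<bar>y\<bar> \<le> pi / 4"
  proof -
    define w where "w = exp (2 * Complex t y)"
    have cw: "cmod w = exp (2 * t)" by (simp add: w_def)
    have "Re w = exp (2 * t) * cos (2 * y)" by (simp add: w_def Re_exp)
    then have Re: "Re w \<ge> 0"
      using y by (simp add: cos_ge_zero)
    have "cmod (1 + w) \<ge> 1"
      using Re complex_Re_le_cmod[of "1 + w"] by simp
    moreover have "(cmod w)\<^sup>2 \<le> (cmod (1 + w))\<^sup>2"
      unfolding cmod_power2 using Re by (simp add: power2_eq_square algebra_simps)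
    then have "cmod (1 + w) \<ge> cmod w" using power2_le_imp_le norm_ge_zero by blast
    ultimately have le: "(1 + exp (2 * t)) / 2 \<le> cmod (1 + w)" and pos: "0 < cmod (1 + w)"
      using cw by (simp, linarith)
    have "cmod (G (Complex t y)) = exp (2 * b * t) / cmod (1 + w)"
      by (simp add: G_def w_def norm_divide)
    also have "\<dots> \<le> exp (2 * b * t) / ((1 + exp (2 * t)) / 2)"
      using le pos by (intro divide_left_mono mult_pos_pos) (simp_all add: add_pos_pos)
    also have "\<dots> = 2 * (exp (2 * b * t) / (1 + exp (2 * t)))"
      by (simp only: divide_divide_eq_right times_divide_eq_right mult.commute[of 2])
    finally show ?thesis .
  qed
qed

text \<open>The contour integral of G(z) cot (\<pi> (z + s) / k) over a rectangle whose vertical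
  sides lie midway between grid points is 2 i k times the sum. On the upper and lower sides the
  cotangent is replaced by -i and i up to an error of order \<epsilon>, and Cauchy's theorem shifts
  the remaining integrals of G to the real axis. The terms \<open>g A\<close> and \<open>g B\<close>
  collect the vertical sides, which disappear only as N grows.\<close>

lemma trapezoid_logistic_finite:
  fixes b k s :: real and N :: nat
  assumes b: "0 < b" "b < 1" and k: "0 < k"
  defines "g \<equiv> \<lambda>y. exp (2 * b * y) / (1 + exp (2 * y))"
    and "\<epsilon> \<equiv> exp (- pi\<^sup>2 / (2 * k))"
    and "A \<equiv> - (real N + 1 / 2) * k - s" and "B \<equiv> (real N + 1 / 2) * k - s"
  shows "\<bar>k * (\<Sum>l\<in>{- int N..int N}. g (of_int l * k - s)) - integral {A..B} g\<bar>
    \<le> 4 * \<epsilon> / (1 - \<epsilon>) * (pi / (2 * sin (pi * b))) + pi * (g A + g B)"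
proof -
  define G where "G = (\<lambda>z::complex. exp (2 * of_real b * z) / (1 + exp (2 * z)))"
  define w where "w = (\<lambda>z::complex. of_real (pi / k) * (z + of_real s))"
  define ct where "ct = (\<lambda>z. cos (w z) / sin (w z))"
  \<comment> \<open>After scaling by \<pi> / k this height gives 2 Im w = \<pi>^2 / (2 k), the
    exponent in \<epsilon>.\<close>
  define d where "d = pi / 4"
  define I where "I = pi / (2 * sin (pi * b))"
  define U where "U = {z. \<bar>Im z\<bar> < pi / 2}"
  \<comment> \<open>The margin 3/4 lies between 1/2 and 1: \<open>S\<close> contains the rectangle,
    but no zero of the sine with |l| > N.\<close>
  define S where "S = {z. \<bar>Re z + s\<bar> < (real N + 3 / 4) * k \<and> \<bar>Im z\<bar> < pi / 2}"
  define pt where "pt = (\<lambda>l::int. complex_of_real (of_int l * k - s))"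
  have pt: "Re (pt l) = of_int l * k - s" "Im (pt l) = 0" for l by (simp_all add: pt_def)
  define P where "P = pt ` {- int N..int N}"
  note strip = logistic_strip[where b = b]
  have AB: "A < B" using k by (simp add: A_def B_def mult_strict_right_mono)
  have d: "0 < d" "d < pi / 2" by (simp_all add: d_def)
  have Gh: "G holomorphic_on U" using strip(1) by (simp add: U_def G_def)
  have Gb: "cmod (G (Complex t y)) \<le> 2 * g t" if "\<bar>y\<bar> \<le> d" for t y
    using strip(2)[of y t] that by (simp add: d_def g_def G_def)
  have gpos: "0 < g t" for t unfolding g_def by (simp add: add_pos_pos)
  have int_g: "g absolutely_integrable_on UNIV" "integral UNIV g = I"
    using has_integral_exp_logistic[OF b] by (simp_all add: g_def I_def)
  have int_g': "g integrable_on {A..B}"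
    using int_g(1) set_lebesgue_integral_eq_integral(1) integrable_on_subinterval[of g UNIV] by blast
  have J_le: "integral {A..B} g \<le> I"
    using int_g int_g' gpos set_lebesgue_integral_eq_integral(1)
    by (metis integral_subset_le less_imp_le subset_UNIV)
  have w_Re: "Re (w z) = pi / k * (Re z + s)" and w_Im: "Im (w z) = pi / k * Im z" for z
    by (simp_all add: w_def)
  have wh: "w holomorphic_on X" for X unfolding w_def by (intro holomorphic_intros)
  have openS: "open S" and convS: "convex S"
  proof -
    have eq: "S = {z. - (real N + 3/4) * k - s < Re z} \<inter> {z. Re z < (real N + 3/4) * k - s}
        \<inter> {z. - pi / 2 < Im z} \<inter> {z. Im z < pi / 2}"
      by (auto simp: S_def abs_less_iff algebra_simps)
    show "open S" unfolding eq
      by (intro open_Int open_halfspace_Re_gt open_halfspace_Re_lt open_halfspace_Im_gt open_halfspace_Im_lt)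
    show "convex S" unfolding eq
      by (intro convex_Int convex_halfspace_Re_gt convex_halfspace_Re_lt convex_halfspace_Im_gt convex_halfspace_Im_lt)
  qed
  have SU: "S \<subseteq> U" by (auto simp: S_def U_def)
  have convU: "convex U"
  proof -
    have eq: "U = {z. - pi / 2 < Im z} \<inter> {z. Im z < pi / 2}" by (auto simp: U_def)
    show ?thesis unfolding eq by (intro convex_Int convex_halfspace_Im_gt convex_halfspace_Im_lt)
  qed
  have scale: "pi / k * r = x * pi \<longleftrightarrow> r = x * k" for r x
  proof -
    have "pi / k * r = x * pi \<longleftrightarrow> (r / k) * pi = x * pi" by (simp add: mult.commute)
    also have "\<dots> \<longleftrightarrow> r = x * k" using k by (simp add: divide_eq_eq)
    finally show ?thesis .
  qed
  have sin0: "sin (w z) = 0 \<longleftrightarrow> (\<exists>l::int. z = pt l)" for z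
  proof -
    have "sin (w z) = 0 \<longleftrightarrow> (\<exists>l::int. w z = of_real (of_int l * pi))"
      by (simp add: sin_eq_0 mult.commute)
    also have "\<dots> \<longleftrightarrow> (\<exists>l::int. z = pt l)"
    proof (intro ex_cong1)
      fix l :: int
      show "w z = of_real (of_int l * pi) \<longleftrightarrow> z = pt l"
        unfolding complex_eq_iff using k scale[of "Re z + s" "of_int l"] by (auto simp: w_Re w_Im pt)
    qed
    finally show ?thesis .
  qed
  have zeros: "sin (w z) \<noteq> 0" if "z \<in> S - P" for z
  proof
    assume "sin (w z) = 0"
    then obtain l :: int where l: "z = pt l" using sin0 by blast
    then have "\<bar>of_int l * k\<bar> < (real N + 3 / 4) * k" using that by (simp add: S_def pt)
    then have "\<bar>of_int l\<bar> * k < (real N + 3 / 4) * k" using k by (simp add: abs_mult)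
    then have "\<bar>real_of_int l\<bar> < real N + 3 / 4" using k by simp
    then have "\<bar>l\<bar> \<le> int N" by linarith
    then have "l \<in> {- int N..int N}" by auto
    then have "z \<in> P" using l by (simp add: P_def)
    then show False using that by simp
  qed
  have Gch: "(\<lambda>z. G z * ct z) holomorphic_on S - P"
    unfolding ct_def using zeros SU
    by (intro holomorphic_intros holomorphic_on_subset[OF Gh] wh) auto
  let ?R = "rectpath (Complex A (- d)) (Complex B d)"
  have img: "path_image ?R = {z. Re z \<in> {A, B} \<and> Im z \<in> {- d..d} \<or> Re z \<in> {A..B} \<and> Im z \<in> {- d, d}}"
    using AB d by (intro path_image_rectpath_Complex) auto
  have zin: "\<bar>Re z + s\<bar> < (real N + 3 / 4) * k" if "Re z \<in> {A..B}" for z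
  proof -
    have "\<bar>Re z + s\<bar> \<le> (real N + 1 / 2) * k" using that by (auto simp: A_def B_def abs_le_iff algebra_simps)
    also have "\<dots> < (real N + 3 / 4) * k" using k by simp
    finally show ?thesis .
  qed
  have imgS: "path_image ?R \<subseteq> S" using zin AB d by (auto simp: img S_def)
  have Pin: "z \<in> box (Complex A (- d)) (Complex B d)" if "z \<in> P" for z
  proof -
    from that obtain l where l: "z = pt l" "l \<in> {- int N..int N}"
      unfolding P_def by (rule imageE)
    have *: "of_int l * k \<le> real N * k" "- real N * k \<le> of_int l * k"
      using l(2) k by (intro mult_right_mono; simp)+
    have e: "(real N + 1 / 2) * k = real N * k + k / 2" "- (real N + 1 / 2) * k = - (real N * k) - k / 2"
      by (simp_all add: algebra_simps)
    show ?thesis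
      unfolding l(1) in_box_complex_iff A_def B_def complex.sel pt e greaterThanLessThan_iff
      using * k d by (intro conjI; linarith)
  qed
  have imgP: "path_image ?R \<subseteq> S - P"
  proof -
    have "path_image ?R = cbox (Complex A (- d)) (Complex B d) - box (Complex A (- d)) (Complex B d)"
      using AB d by (intro path_image_rectpath_cbox_minus_box) auto
    then show ?thesis using imgS Pin by blast
  qed
  have P_S: "P \<subseteq> S"
  proof
    fix z assume "z \<in> P"
    then have "z \<in> box (Complex A (- d)) (Complex B d)" by (rule Pin)
    then show "z \<in> S" using zin[of z] d by (auto simp: in_box_complex_iff S_def)
  qed
  have res: "residue (\<lambda>z. G z * ct z) (pt l) = of_real (k / pi * g (of_int l * k - s))"
    if "l \<in> {- int N..int N}" for l :: int
  proof -
    define p where "p = pt l"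
    have wp: "w p = of_real (pi * of_int l)" using k by (simp add: p_def pt_def w_def)
    have "cos (w p) = of_real (cos (pi * of_int l))" unfolding wp by (rule cos_of_real)
    moreover have "(cos (pi * real_of_int l))\<^sup>2 = 1"
      using sin_cos_squared_add[of "pi * real_of_int l"] sin_int_2pin by (simp add: sin_zero_iff_int2 mult.commute)
    ultimately have cp: "cos (w p) \<noteq> 0" by (metis of_real_eq_0_iff power_zero_numeral zero_neq_one)
    have Gp: "G p = of_real (g (of_int l * k - s))" unfolding p_def pt_def g_def G_def by (rule strip(3))
    \<comment> \<open>At a simple zero of the sine the residue is the numerator divided by the
      derivative (\<pi> / k) cos (w p); the cosines cancel.\<close>
    have "residue (\<lambda>z. (G z * cos (w z)) / sin (w z)) p = (G p * cos (w p)) / (of_real (pi / k) * cos (w p))"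
    proof (rule residue_simple_pole_deriv)
      show "(\<lambda>z. G z * cos (w z)) holomorphic_on S" "(\<lambda>z. sin (w z)) holomorphic_on S"
        by (intro holomorphic_intros holomorphic_on_subset[OF Gh SU] wh)+
      show "open S" "p \<in> S" using openS P_S that by (auto simp: P_def p_def)
      show "topological_space_class.connected S" using convS by (rule convex_connected)
      show "((\<lambda>z. sin (w z)) has_field_derivative of_real (pi / k) * cos (w p)) (at p)"
        unfolding w_def using k by (auto intro!: derivative_eq_intros)
      show "G p * cos (w p) \<noteq> 0" using cp Gp gpos[of "of_int l * k - s"] by simp
      show "sin (w p) = 0" using sin0 by (auto simp: p_def)
      show "of_real (pi / k) * cos (w p) \<noteq> 0" using cp k by simp
    qed
    then show ?thesis using cp Gp k by (simp add: ct_def p_def field_simps)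
  qed
  have inj: "inj_on pt {- int N..int N}"
    using k by (auto simp: inj_on_def complex_eq_iff pt)
  define T where "T = (\<Sum>l\<in>{- int N..int N}. g (of_int l * k - s))"
  have "contour_integral ?R (\<lambda>z. G z * ct z) =
      2 * pi * \<i> * (\<Sum>p\<in>P. winding_number ?R p * residue (\<lambda>z. G z * ct z) p)"
  proof (rule Residue_theorem)
    show "\<forall>z. z \<notin> S \<longrightarrow> winding_number ?R z = 0"
      using convS imgS
      by (auto intro!: winding_number_zero_outside[of _ S] simp: openS)
  qed (use openS convS Gch imgP in \<open>auto simp: P_def convex_connected\<close>)
  also have "(\<Sum>p\<in>P. winding_number ?R p * residue (\<lambda>z. G z * ct z) p)
      = (\<Sum>p\<in>P. residue (\<lambda>z. G z * ct z) p)"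
    using Pin winding_number_rectpath by (intro sum.cong) auto
  also have "\<dots> = (\<Sum>l\<in>{- int N..int N}. of_real (k / pi * g (of_int l * k - s)))"
    unfolding P_def using res by (subst sum.reindex[OF inj]) simp
  also have "\<dots> = of_real (k / pi * T)"
    by (simp add: T_def sum_distrib_left)
  finally have R1: "contour_integral ?R (\<lambda>z. G z * ct z) = 2 * \<i> * of_real (k * T)"
    by simp
  let ?F = "\<lambda>z. G z * ct z"
  have sin_nz: "sin (w z) \<noteq> 0" if "z \<in> path_image ?R" for z
    using zeros that imgP by blast
  have contG: "continuous_on X G" if "X \<subseteq> U" for X
    using Gh that holomorphic_on_imp_continuous_on continuous_on_subset by blast
  have contF: "continuous_on (path_image ?R) ?F"
    using Gch imgP holomorphic_on_imp_continuous_on continuous_on_subset by blast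
  define V where "V = contour_integral (linepath (Complex B (- d)) (Complex B d)) ?F +
    contour_integral (linepath (Complex A d) (Complex A (- d))) ?F"
  have R2: "contour_integral ?R ?F = integral {A..B} (\<lambda>t. ?F (Complex t (- d))) -
      integral {A..B} (\<lambda>t. ?F (Complex t d)) + V"
    unfolding V_def using contour_integral_rectpath[OF AB contF] by simp
  define IG where "IG = (\<lambda>c. integral {A..B} (\<lambda>t. G (Complex t c)))"
  have IG0: "IG 0 = of_real (integral {A..B} g)"
  proof -
    have "IG 0 = integral {A..B} (of_real \<circ> g)"
      unfolding IG_def using strip(3) by (simp add: Complex_eq g_def G_def comp_def)
    also have "\<dots> = of_real (integral {A..B} g)"
      using int_g' by (rule integral_linear) (rule bounded_linear_of_real)
    finally show ?thesis .
  qed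
  \<comment> \<open>Shifting the line of integration costs only the two vertical sides, each bounded
    by its length times \<open>2 * g\<close>.\<close>
  have Cau: "cmod (IG c - IG c') \<le> 2 * (g A + g B) * (c' - c)" if c: "- d \<le> c" "c < c'" "c' \<le> d" for c c'
  proof -
    let ?R' = "rectpath (Complex A c) (Complex B c')"
    have img': "path_image ?R' \<subseteq> U"
      using AB c d by (subst path_image_rectpath_Complex) (auto simp: U_def)
    have "(G has_contour_integral 0) ?R'"
      by (rule Cauchy_theorem_convex_simple[OF Gh convU _ img']) auto
    then have "contour_integral ?R' G = 0" by (rule contour_integral_unique)
    then have "IG c - IG c' = - contour_integral (linepath (Complex B c) (Complex B c')) G
        - contour_integral (linepath (Complex A c') (Complex A c)) G"
      unfolding IG_def using contour_integral_rectpath[OF AB contG[OF img']]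
      by (simp add: algebra_simps eq_neg_iff_add_eq_0)
    also have "cmod \<dots> \<le> 2 * g B * (c' - c) + 2 * g A * (c' - c)"
    proof -
      have *: "cmod (G (Complex x y)) \<le> 2 * g x" if "y \<in> {c..c'}" for x y
        by (rule Gb) (use that c in auto)
      have "cmod (contour_integral (linepath (Complex B c) (Complex B c')) G) \<le> 2 * g B * (c' - c)"
        using c gpos[of B] * by (intro cmod_contour_integral_vertical_le) auto
      moreover have "cmod (contour_integral (linepath (Complex A c') (Complex A c)) G) \<le> 2 * g A * (c' - c)"
        using c gpos[of A] * by (intro cmod_contour_integral_vertical_le) auto
      ultimately show ?thesis
        by (intro order.trans[OF norm_triangle_ineq4] add_mono) simp_all
    qed
    finally show ?thesis by (simp add: algebra_simps)
  qed
  have V_le: "cmod V \<le> 2 * g B * (2 * d) + 2 * g A * (2 * d)"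
  proof -
    have ct_le: "cmod (ct (Complex x y)) \<le> 1" if "x = A \<or> x = B" for x y
    proof -
      have "Re (w (Complex x y)) = pi / 2 + of_int (if x = B then int N else - int N - 1) * pi"
        using that AB scale[of "x + s" "1 / 2 + of_int (if x = B then int N else - int N - 1)"]
        by (auto simp: w_Re A_def B_def algebra_simps)
      then show ?thesis unfolding ct_def by (rule cmod_cot_le_1)
    qed
    have F_le: "cmod (?F (Complex x y)) \<le> 2 * g x" if "x = A \<or> x = B" "y \<in> {- d..d}" for x y
    proof -
      have "cmod (?F (Complex x y)) = cmod (G (Complex x y)) * cmod (ct (Complex x y))" by (rule norm_mult)
      also have "\<dots> \<le> (2 * g x) * 1"
        using that Gb[of y x] ct_le[of x y] gpos[of x] by (intro mult_mono) auto
      finally show ?thesis by simp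
    qed
    have "cmod (contour_integral (linepath (Complex B (- d)) (Complex B d)) ?F) \<le> 2 * g B * (d - (- d))"
      using d gpos[of B] F_le[of B] by (intro cmod_contour_integral_vertical_le) auto
    moreover have "cmod (contour_integral (linepath (Complex A d) (Complex A (- d))) ?F) \<le> 2 * g A * (d - (- d))"
      using d gpos[of A] F_le[of A] by (intro cmod_contour_integral_vertical_le) auto
    ultimately show ?thesis
      unfolding V_def by (intro order.trans[OF norm_triangle_ineq] add_mono) simp_all
  qed
  define q where "q = 2 * \<epsilon> / (1 - \<epsilon>)"
  have eps: "0 < \<epsilon>" "\<epsilon> < 1" using k by (simp_all add: \<epsilon>_def)
  have y: "0 < pi / k * d" "exp (- 2 * (pi / k * d)) = \<epsilon>"
    using k by (simp_all add: d_def \<epsilon>_def power2_eq_square field_simps)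
  have contH: "continuous_on {A..B} (\<lambda>t. f (Complex t c))"
    if "continuous_on (path_image ?R) f" "c = d \<or> c = - d" for f :: "complex \<Rightarrow> complex" and c
  proof (rule continuous_on_compose2[OF that(1)])
    show "continuous_on {A..B} (\<lambda>t. Complex t c)"
      by (simp add: Complex_eq continuous_intros)
    show "(\<lambda>t. Complex t c) ` {A..B} \<subseteq> path_image ?R" using that(2) d by (auto simp: img)
  qed
  have contGR: "continuous_on (path_image ?R) G" using imgS SU by (intro contG) auto
  \<comment> \<open>Here \<kappa> is the limit of the cotangent: -i on the upper side, i on the
    lower side.\<close>
  have horiz: "cmod (integral {A..B} (\<lambda>t. ?F (Complex t c)) - \<kappa> * IG c) \<le> 2 * q * I"
    if c: "c = d \<and> \<kappa> = - \<i> \<or> c = - d \<and> \<kappa> = \<i>" for c \<kappa>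
  proof -
    have ctk: "cmod (ct (Complex t c) - \<kappa>) \<le> q" for t
      using c
    proof
      assume c': "c = d \<and> \<kappa> = - \<i>"
      then have "Im (w (Complex t c)) = pi / k * d" by (simp add: w_Im)
      from cmod_cot_add_i_le(1)[OF y(1) this] show ?thesis
        unfolding y(2) ct_def q_def using c' by simp
    next
      assume c': "c = - d \<and> \<kappa> = \<i>"
      then have "Im (- w (Complex t c)) = pi / k * d" by (simp add: w_Im)
      from cmod_cot_add_i_le(2)[OF y(1) this] show ?thesis
        unfolding y(2) ct_def q_def using c' by simp
    qed
    have cd: "c = d \<or> c = - d" "\<bar>c\<bar> \<le> d" using c d by auto
    have "integral {A..B} (\<lambda>t. ?F (Complex t c)) - \<kappa> * IG c
        = integral {A..B} (\<lambda>t. ?F (Complex t c) - \<kappa> * G (Complex t c))"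
      unfolding IG_def using contH[OF contF cd(1)] contH[OF contGR cd(1)]
      by (subst integral_diff) (auto intro!: integrable_continuous_real continuous_intros)
    also have "cmod \<dots> \<le> integral {A..B} (\<lambda>t. 2 * q * g t)"
    proof (rule integral_norm_bound_integral)
      show "(\<lambda>t. ?F (Complex t c) - \<kappa> * G (Complex t c)) integrable_on {A..B}"
        using contH[OF contF cd(1)] contH[OF contGR cd(1)]
        by (auto intro!: integrable_continuous_real continuous_intros)
      show "(\<lambda>t. 2 * q * g t) integrable_on {A..B}" using int_g' by (rule integrable_on_mult_right)
      fix t
      have "?F (Complex t c) - \<kappa> * G (Complex t c) = G (Complex t c) * (ct (Complex t c) - \<kappa>)"
        by (simp add: algebra_simps)
      also have "cmod \<dots> \<le> (2 * g t) * q"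
        unfolding norm_mult using Gb[OF cd(2), of t] ctk gpos[of t] by (intro mult_mono) auto
      finally show "cmod (?F (Complex t c) - \<kappa> * G (Complex t c)) \<le> 2 * q * g t" by (simp only: ac_simps)
    qed
    also have "\<dots> = 2 * q * integral {A..B} g" by simp
    also have "\<dots> \<le> 2 * q * I" using J_le eps by (intro mult_left_mono) (simp_all add: q_def)
    finally show ?thesis .
  qed
  define E1 where "E1 = integral {A..B} (\<lambda>t. ?F (Complex t (- d))) - \<i> * IG (- d)"
  define E2 where "E2 = integral {A..B} (\<lambda>t. ?F (Complex t d)) + \<i> * IG d"
  have E: "cmod E1 \<le> 2 * q * I" "cmod E2 \<le> 2 * q * I"
    using horiz[of "- d" \<i>] horiz[of d "- \<i>"] by (simp_all add: E1_def E2_def)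
  \<comment> \<open>The lower side enters with sign + and the upper one with -, so the limits i and
    -i of the cotangent reinforce each other to 2 i times the integral of G.\<close>
  have "2 * \<i> * of_real (k * T - integral {A..B} g)
      = (E1 - E2 + V) + \<i> * ((IG (- d) - IG 0) - (IG 0 - IG d))"
    using R1 R2 by (simp add: E1_def E2_def IG0 algebra_simps)
  then have "cmod (2 * \<i> * of_real (k * T - integral {A..B} g))
      \<le> cmod ((E1 - E2) + V) + cmod (\<i> * ((IG (- d) - IG 0) - (IG 0 - IG d)))"
    using norm_triangle_ineq by metis
  also have "\<dots> \<le> ((cmod E1 + cmod E2) + cmod V) + (cmod (IG (- d) - IG 0) + cmod (IG 0 - IG d))"
    unfolding norm_mult norm_ii mult_1
    by (intro add_mono order.refl norm_triangle_ineq4 order.trans[OF norm_triangle_ineq[of "E1 - E2" V]])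
  also have "\<dots> \<le> ((2 * q * I + 2 * q * I) + (2 * g B * (2 * d) + 2 * g A * (2 * d))) +
      (2 * (g A + g B) * (0 - - d) + 2 * (g A + g B) * (d - 0))"
    using d by (intro add_mono E V_le Cau) auto
  \<comment> \<open>The vertical sides of the first contour and the two shifts each contribute 4 d
    (g A + g B), where 4 d = \<pi>. The outer factor 2 is the modulus of 2 i on the left.\<close>
  also have "\<dots> = 2 * (2 * q * I + pi * (g A + g B))"
    by (simp add: d_def algebra_simps)
  finally have "\<bar>k * T - integral {A..B} g\<bar> \<le> 2 * q * I + pi * (g A + g B)"
    unfolding norm_mult norm_of_real by simp
  then show ?thesis by (simp add: q_def T_def I_def)
qed

section \<open>Truncation of the trapezoidal sum\<close>

text \<open>This is a lower Riemann sum of exp (- c y): by 1 + c k \<le> exp (c k) each term is at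
  most an increment of - exp (- c y) / c, and the increments telescope. The bound is uniform in
  M.\<close>

lemma geometric_tail_le:
  fixes c k :: real and K M :: int
  assumes "0 < c" "0 < k" "K \<le> M"
  shows "k * (\<Sum>l\<in>{K<..M}. exp (- c * (of_int l * k))) \<le> exp (- c * (of_int K * k)) / c"
proof -
  have "k * (\<Sum>l\<in>{K<..M}. exp (- c * (of_int l * k)))
      \<le> (exp (- c * (of_int K * k)) - exp (- c * (of_int M * k))) / c"
    using assms(3)
  proof (induction M rule: int_ge_induct)
    case (step M)
    have "{K<..M + 1} = insert (M + 1) {K<..M}" using step.hyps by auto
    then have "k * (\<Sum>l\<in>{K<..M + 1}. exp (- c * (of_int l * k)))
        = k * exp (- c * (of_int (M + 1) * k)) + k * (\<Sum>l\<in>{K<..M}. exp (- c * (of_int l * k)))"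
      by (simp add: algebra_simps)
    moreover have "k * exp (- c * (of_int (M + 1) * k))
        \<le> (exp (- c * (of_int M * k)) - exp (- c * (of_int (M + 1) * k))) / c"
    proof -
      define r where "r = exp (- c * (of_int (M + 1) * k))"
      have e: "exp (- c * (of_int M * k)) = exp (c * k) * r"
        by (simp add: r_def algebra_simps flip: exp_add)
      have "(c * k) * r \<le> (exp (c * k) - 1) * r"
      proof (rule mult_right_mono)
        show "c * k \<le> exp (c * k) - 1" using exp_ge_add_one_self[of "c * k"] by linarith
      qed (simp add: r_def)
      then have "c * (k * r) \<le> exp (c * k) * r - r" by (simp add: algebra_simps)
      then show ?thesis unfolding e r_def[symmetric] using assms(1) by (simp add: pos_le_divide_eq mult.commute)
    qed
    ultimately show ?case using step.IH by (simp add: diff_divide_distrib)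
  qed simp
  also have "\<dots> \<le> exp (- c * (of_int K * k)) / c"
    using assms(1) by (intro divide_right_mono) auto
  finally show ?thesis .
qed

text \<open>The decay is like exp (2 b y) on the left and exp (- 2 (1 - b) y) on the right, the two
  rates that also determine \<open>K_minus\<close> and \<open>K_plus\<close>.\<close>

lemma tendsto_exp_logistic:
  fixes b :: real
  assumes b: "0 < b" "b < 1"
  shows "((\<lambda>y. exp (2 * b * y) / (1 + exp (2 * y))) \<longlongrightarrow> 0) at_bot"
    and "((\<lambda>y. exp (2 * b * y) / (1 + exp (2 * y))) \<longlongrightarrow> 0) at_top"
proof -
  have p: "0 < 1 + exp (2 * y)" for y :: real by (simp add: add_pos_pos)
  have "((\<lambda>y. exp (2 * b * y)) \<longlongrightarrow> 0) at_bot"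
    by (rule filterlim_compose[OF exp_at_bot]) (use b in \<open>simp add: filterlim_tendsto_pos_mult_at_bot[OF tendsto_const] filterlim_ident\<close>)
  then show "((\<lambda>y. exp (2 * b * y) / (1 + exp (2 * y))) \<longlongrightarrow> 0) at_bot"
  proof (rule Lim_null_comparison[rotated], intro always_eventually allI)
    fix y
    have "exp (2 * b * y) / (1 + exp (2 * y)) \<le> exp (2 * b * y) / 1"
      using p by (intro divide_left_mono) auto
    then show "norm (exp (2 * b * y) / (1 + exp (2 * y))) \<le> exp (2 * b * y)"
      using p[of y] by simp
  qed
  have "((\<lambda>y. exp (- ((2 - 2 * b) * y))) \<longlongrightarrow> 0) at_top"
    by (rule filterlim_compose[OF exp_at_bot], subst filterlim_uminus_at_bot)
      (use b in \<open>simp add: filterlim_tendsto_pos_mult_at_top[OF tendsto_const] filterlim_ident\<close>)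
  then show "((\<lambda>y. exp (2 * b * y) / (1 + exp (2 * y))) \<longlongrightarrow> 0) at_top"
  proof (rule Lim_null_comparison[rotated], intro always_eventually allI)
    fix y
    have "exp (2 * b * y) / (1 + exp (2 * y)) \<le> exp (2 * b * y) / exp (2 * y)"
      using p by (intro divide_left_mono) auto
    also have "\<dots> = exp (- ((2 - 2 * b) * y))"
      by (simp add: algebra_simps flip: exp_diff)
    finally show "norm (exp (2 * b * y) / (1 + exp (2 * y))) \<le> exp (- ((2 - 2 * b) * y))"
      using p[of y] by simp
  qed
qed

lemma integral_expanding_intervals:
  fixes g :: "real \<Rightarrow> real"
  assumes "(g has_integral I) UNIV" "filterlim A at_bot F" "filterlim B at_top F"
  shows "((\<lambda>n. integral {A n..B n} g) \<longlongrightarrow> I) F"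
proof (rule tendstoI)
  fix e :: real
  assume "0 < e"
  then obtain R where R: "0 < R" "\<And>a b. ball 0 R \<subseteq> cbox a b \<Longrightarrow> norm (integral (cbox a b) g - I) < e"
    using assms(1) unfolding has_integral_alt' by auto
  have "\<forall>\<^sub>F n in F. A n \<le> - R" "\<forall>\<^sub>F n in F. R \<le> B n"
    using assms(2,3) by (auto simp: filterlim_at_bot filterlim_at_top)
  then show "\<forall>\<^sub>F n in F. dist (integral {A n..B n} g) I < e"
  proof eventually_elim
    case (elim n)
    have "ball 0 R \<subseteq> cbox (A n) (B n)" using elim by (auto simp: dist_real_def)
    from R(2)[OF this] show ?case by (simp add: dist_real_def)
  qed
qed

text \<open>Letting N grow removes the vertical sides and turns the integral into its value
  \<open>I\<close> over the line. The symmetric sums are compared with an arbitrary number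
  \<open>T\<close>; the asymmetric truncated sum will be inserted for it, with its tails as
  \<open>D\<close>.\<close>

lemma trapezoid_logistic:
  fixes b k s :: real
  assumes b: "0 < b" "b < 1" and k: "0 < k"
  defines "g \<equiv> \<lambda>y. exp (2 * b * y) / (1 + exp (2 * y))"
    and "\<epsilon> \<equiv> exp (- pi\<^sup>2 / (2 * k))" and "I \<equiv> pi / (2 * sin (pi * b))"
  assumes tail: "\<And>N. K \<le> int N \<Longrightarrow>
    \<bar>k * (\<Sum>l\<in>{- int N..int N}. g (of_int l * k - s)) - T\<bar> \<le> D"
  shows "\<bar>T - I\<bar> \<le> 4 * \<epsilon> / (1 - \<epsilon>) * I + D"
proof -
  define A where "A = (\<lambda>N::nat. - (real N + 1 / 2) * k - s)"
  define B where "B = (\<lambda>N::nat. (real N + 1 / 2) * k - s)"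
  have limB: "filterlim B at_top sequentially"
    unfolding B_def using k by real_asymp
  have limA: "filterlim A at_bot sequentially"
    unfolding A_def using k by real_asymp
  have gA: "(\<lambda>N. g (A N)) \<longlonglongrightarrow> 0" and gB: "(\<lambda>N. g (B N)) \<longlonglongrightarrow> 0"
    unfolding g_def using filterlim_compose[OF tendsto_exp_logistic(1)[OF b] limA]
      filterlim_compose[OF tendsto_exp_logistic(2)[OF b] limB] by auto
  have "(g has_integral I) UNIV"
    using has_integral_exp_logistic[OF b] set_lebesgue_integral_eq_integral(1)
    unfolding g_def I_def by (metis has_integral_integrable_integral)
  then have lim: "(\<lambda>N. integral {A N..B N} g) \<longlonglongrightarrow> I"
    using limA limB by (rule integral_expanding_intervals)
  have l1: "(\<lambda>N. \<bar>T - integral {A N..B N} g\<bar>) \<longlonglongrightarrow> \<bar>T - I\<bar>"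
    by (intro tendsto_intros lim)
  have l2: "(\<lambda>N. 4 * \<epsilon> / (1 - \<epsilon>) * I + pi * (g (A N) + g (B N)) + D) \<longlonglongrightarrow> 4 * \<epsilon> / (1 - \<epsilon>) * I + pi * (0 + 0) + D"
    by (intro tendsto_intros gA gB)
  have l3: "\<forall>\<^sub>F N in sequentially. \<bar>T - integral {A N..B N} g\<bar>
      \<le> 4 * \<epsilon> / (1 - \<epsilon>) * I + pi * (g (A N) + g (B N)) + D"
  proof (rule eventually_mono[OF eventually_ge_at_top[of "nat K"]])
    fix N assume "nat K \<le> N"
    then have "K \<le> int N" by simp
    from tail[OF this] trapezoid_logistic_finite[OF b k, where N = N and s = s]
    show "\<bar>T - integral {A N..B N} g\<bar> \<le> 4 * \<epsilon> / (1 - \<epsilon>) * I + pi * (g (A N) + g (B N)) + D"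
      unfolding A_def B_def g_def \<epsilon>_def I_def by linarith
  qed
  show ?thesis using tendsto_le[OF sequentially_bot l2 l1 l3] by simp
qed

text \<open>With s = ln x / 2 the summand is x^b times the logistic kernel at l k - s, so all x
  share one trapezoidal estimate, and the two cut-offs make both geometric tails of order exp (-
  \<pi>^2 / (2 k)). The bound \<open>k0\<close> keeps 1 - \<epsilon> away from 0. No constant could
  serve all k: the term l = 0 with its factor k grows without bound, while the right-hand side does
  not.\<close>

lemma sinc_quadrature_error:
  fixes b X k0 :: real
  assumes b: "0 < b" "b < 1" and X: "0 < X" and k0: "0 < k0"
  obtains C where "0 < C"
    "\<And>k x. \<lbrakk>0 < k; k \<le> k0; 0 < x; x \<le> X\<rbrakk> \<Longrightarrow>
      \<bar>x powr b - 2 * k * sin (pi * b) / pi * (\<Sum>l\<in>{- K_minus b k..K_plus b k}.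
          exp (2 * b * of_int l * k) * (x / (x + exp (2 * of_int l * k))))\<bar>
        \<le> C * exp (- pi\<^sup>2 / (2 * k))"
proof -
  define I where "I = pi / (2 * sin (pi * b))"
  have sinp: "0 < sin (pi * b)" using b by (intro sin_gt_zero) auto
  have I: "0 < I" using sinp by (simp add: I_def)
  define \<epsilon>0 where "\<epsilon>0 = exp (- pi\<^sup>2 / (2 * k0))"
  have e0: "0 < \<epsilon>0" "\<epsilon>0 < 1" using k0 by (simp_all add: \<epsilon>0_def)
  \<comment> \<open>The factor 1 / I restores the normalisation. The first summand is the
    trapezoidal error; the second consists of the upper tail, bounded through x \<le> X, and the
    lower tail.\<close>
  define C where "C = 1 / I * (X powr b * (4 / (1 - \<epsilon>0) * I) + (X / (2 * (1 - b)) + 1 / (2 * b)))"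
  have "0 < C" unfolding C_def using I e0 b X
    by (intro mult_pos_pos add_pos_pos divide_pos_pos) auto
  moreover have "\<bar>x powr b - 2 * k * sin (pi * b) / pi * (\<Sum>l\<in>{- K_minus b k..K_plus b k}.
          exp (2 * b * of_int l * k) * (x / (x + exp (2 * of_int l * k))))\<bar>
        \<le> C * exp (- pi\<^sup>2 / (2 * k))" (is "?lhs \<le> _")
    if k: "0 < k" "k \<le> k0" and x: "0 < x" "x \<le> X" for k x
  proof -
    define s where "s = ln x / 2"
    define g where "g = (\<lambda>y. exp (2 * b * y) / (1 + exp (2 * y)))"
    define h where "h = (\<lambda>l::int. exp (2 * b * of_int l * k) * (x / (x + exp (2 * of_int l * k))))"
    define \<epsilon> where "\<epsilon> = exp (- pi\<^sup>2 / (2 * k))"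
    define E where "E = x powr b"
    have E: "0 < E" "E \<le> X powr b" using x b by (auto simp: E_def intro: powr_mono2)
    have e: "0 < \<epsilon>" "\<epsilon> \<le> \<epsilon>0" using k by (auto simp: \<epsilon>_def \<epsilon>0_def divide_left_mono)
    have hpos: "0 \<le> h l" for l using x by (simp add: h_def add_pos_pos less_imp_le)
    have hg: "h l = E * g (of_int l * k - s)" for l
    proof -
      have "exp (2 * (of_int l * k - s)) = exp (2 * of_int l * k) / x"
        using x by (simp add: s_def exp_diff algebra_simps)
      then have d: "1 + exp (2 * (of_int l * k - s)) = (x + exp (2 * of_int l * k)) / x"
        using x by (simp add: add_divide_distrib)
      have n: "exp (2 * b * (of_int l * k - s)) = exp (2 * b * of_int l * k) / E"
        using x by (simp add: s_def E_def powr_def exp_diff algebra_simps)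
      have "x + exp (2 * of_int l * k) > 0" using x by (simp add: add_pos_pos)
      then show ?thesis using x E unfolding g_def h_def d n by (simp add: divide_simps)
    qed
    have K: "0 \<le> K_minus b k" "0 \<le> K_plus b k"
    proof -
      have "0 \<le> pi\<^sup>2 / (4 * b * k\<^sup>2)" "0 \<le> pi\<^sup>2 / (4 * (1 - b) * k\<^sup>2)" using b k by simp_all
      then show "0 \<le> K_minus b k" "0 \<le> K_plus b k"
        unfolding K_minus_def K_plus_def zero_le_ceiling by linarith+
    qed
    have tail: "\<bar>k * (\<Sum>l\<in>{- int N..int N}. h l) - k * (\<Sum>l\<in>{- K_minus b k..K_plus b k}. h l)\<bar>
        \<le> (X / (2 * (1 - b)) + 1 / (2 * b)) * \<epsilon>"
      if N: "max (K_minus b k) (K_plus b k) \<le> int N" for N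
    proof -
      let ?Km = "K_minus b k" and ?Kp = "K_plus b k"
      have "{- int N..int N} = {- ?Km..?Kp} \<union> ({?Kp<..int N} \<union> {- int N..<- ?Km})"
        using N K by auto
      moreover have "{- ?Km..?Kp} \<inter> ({?Kp<..int N} \<union> {- int N..<- ?Km}) = {}"
        "{?Kp<..int N} \<inter> {- int N..<- ?Km} = {}"
        using K by auto
      ultimately have "(\<Sum>l\<in>{- int N..int N}. h l) = (\<Sum>l\<in>{- ?Km..?Kp}. h l) +
          ((\<Sum>l\<in>{?Kp<..int N}. h l) + (\<Sum>l\<in>{- int N..<- ?Km}. h l))"
        by (simp add: sum.union_disjoint)
      then have "\<bar>k * (\<Sum>l\<in>{- int N..int N}. h l) - k * (\<Sum>l\<in>{- ?Km..?Kp}. h l)\<bar>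
          = k * (\<Sum>l\<in>{?Kp<..int N}. h l) + k * (\<Sum>l\<in>{- int N..<- ?Km}. h l)"
        using k hpos by (simp add: algebra_simps sum_nonneg)
      also have "k * (\<Sum>l\<in>{?Kp<..int N}. h l) \<le> X / (2 * (1 - b)) * \<epsilon>"
      proof -
        have "h l \<le> X * exp (- (2 * (1 - b)) * (of_int l * k))" for l
        proof -
          have "h l \<le> exp (2 * b * of_int l * k) * (X / exp (2 * of_int l * k))"
            unfolding h_def using x by (intro mult_left_mono frac_le) auto
          also have "\<dots> = X * exp (- (2 * (1 - b)) * (of_int l * k))"
          proof -
            have "exp (2 * b * of_int l * k) = exp (2 * of_int l * k) * exp (- (2 * (1 - b)) * (of_int l * k))"
              by (simp add: algebra_simps flip: exp_add)
            then show ?thesis by simp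
          qed
          finally show ?thesis .
        qed
        then have "k * (\<Sum>l\<in>{?Kp<..int N}. h l)
            \<le> k * (\<Sum>l\<in>{?Kp<..int N}. X * exp (- (2 * (1 - b)) * (of_int l * k)))"
          using k by (intro mult_left_mono sum_mono) auto
        also have "\<dots> = X * (k * (\<Sum>l\<in>{?Kp<..int N}. exp (- (2 * (1 - b)) * (of_int l * k))))"
          by (simp add: sum_distrib_left mult_ac)
        also have "\<dots> \<le> X * (exp (- (2 * (1 - b)) * (of_int ?Kp * k)) / (2 * (1 - b)))"
          using X b k N by (intro mult_left_mono geometric_tail_le) auto
        also have "\<dots> \<le> X * (\<epsilon> / (2 * (1 - b)))"
        proof -
          \<comment> \<open>\<open>K_plus\<close> is chosen to make the exponent 2 (1 - b) K k at
            least \<pi>^2 / (2 k).\<close>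
          have "pi\<^sup>2 / (4 * (1 - b) * k\<^sup>2) \<le> of_int ?Kp" unfolding K_plus_def by (rule le_of_int_ceiling)
          then have "pi\<^sup>2 / (4 * (1 - b) * k\<^sup>2) * (2 * (1 - b) * k) \<le> of_int ?Kp * (2 * (1 - b) * k)"
            using b k by (intro mult_right_mono) auto
          also have "pi\<^sup>2 / (4 * (1 - b) * k\<^sup>2) * (2 * (1 - b) * k) = pi\<^sup>2 / (2 * k)"
            using b k by (simp add: power2_eq_square divide_simps)
          finally show ?thesis unfolding \<epsilon>_def using X b
            by (intro mult_left_mono divide_right_mono) (auto simp: algebra_simps)
        qed
        finally show ?thesis by simp
      qed
      also have "k * (\<Sum>l\<in>{- int N..<- ?Km}. h l) \<le> 1 / (2 * b) * \<epsilon>"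
      proof -
        have "(\<Sum>l\<in>{- int N..<- ?Km}. h l) = (\<Sum>l\<in>{?Km<..int N}. h (- l))"
          by (rule sum.reindex_bij_witness[of _ uminus uminus]) auto
        moreover have "h (- l) \<le> exp (- (2 * b) * (of_int l * k))" for l
        proof -
          have "h (- l) \<le> exp (2 * b * of_int (- l) * k) * 1"
            unfolding h_def using x by (intro mult_left_mono) (auto simp: divide_le_eq_1 add_pos_pos)
          then show ?thesis by (simp add: algebra_simps)
        qed
        ultimately have "k * (\<Sum>l\<in>{- int N..<- ?Km}. h l) \<le> k * (\<Sum>l\<in>{?Km<..int N}. exp (- (2 * b) * (of_int l * k)))"
          using k by (auto intro!: mult_left_mono sum_mono)
        also have "\<dots> \<le> exp (- (2 * b) * (of_int ?Km * k)) / (2 * b)"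
          using b k N by (intro geometric_tail_le) auto
        also have "\<dots> \<le> \<epsilon> / (2 * b)"
        proof -
          have "pi\<^sup>2 / (4 * b * k\<^sup>2) \<le> of_int ?Km" unfolding K_minus_def by (rule le_of_int_ceiling)
          then have "pi\<^sup>2 / (4 * b * k\<^sup>2) * (2 * b * k) \<le> of_int ?Km * (2 * b * k)"
            using b k by (intro mult_right_mono) auto
          also have "pi\<^sup>2 / (4 * b * k\<^sup>2) * (2 * b * k) = pi\<^sup>2 / (2 * k)"
            using b k by (simp add: power2_eq_square divide_simps)
          finally show ?thesis unfolding \<epsilon>_def using b
            by (intro divide_right_mono) (auto simp: algebra_simps)
        qed
        finally show ?thesis by simp
      qed
      finally show ?thesis by (simp add: algebra_simps)
    qed
    define D where "D = (X / (2 * (1 - b)) + 1 / (2 * b)) * \<epsilon>"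
    define T where "T = k * (\<Sum>l\<in>{- K_minus b k..K_plus b k}. h l)"
    \<comment> \<open>The trapezoidal estimate concerns the sum divided by E = x^b. After
      multiplying back, the tails D are absolute errors again, whereas the trapezoidal error gains
      the factor E, at most X^b.\<close>
    have tail': "\<bar>k * (\<Sum>l\<in>{- int N..int N}. g (of_int l * k - s)) - T / E\<bar> \<le> D / E"
      if N: "max (K_minus b k) (K_plus b k) \<le> int N" for N
    proof -
      have "k * (\<Sum>l\<in>{- int N..int N}. g (of_int l * k - s)) - T / E = (k * (\<Sum>l\<in>{- int N..int N}. h l) - T) / E"
        using E by (simp add: hg sum_distrib_left[symmetric] diff_divide_distrib)
      then show "\<bar>k * (\<Sum>l\<in>{- int N..int N}. g (of_int l * k - s)) - T / E\<bar> \<le> D / E"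
        using tail[OF N] E by (simp add: T_def D_def abs_divide divide_right_mono)
    qed
    have "\<bar>T / E - I\<bar> \<le> 4 * \<epsilon> / (1 - \<epsilon>) * I + D / E"
      unfolding I_def \<epsilon>_def
      by (rule trapezoid_logistic[OF b k(1)], rule tail'[unfolded g_def])
    then have "E * \<bar>T / E - I\<bar> \<le> E * (4 * \<epsilon> / (1 - \<epsilon>) * I + D / E)"
      using E by (intro mult_left_mono) auto
    moreover have "E * \<bar>T / E - I\<bar> = \<bar>T - E * I\<bar>"
    proof -
      have "E * \<bar>T / E - I\<bar> = \<bar>E * (T / E - I)\<bar>" using E by (simp add: abs_mult)
      also have "E * (T / E - I) = T - E * I" using E by (simp add: algebra_simps)
      finally show ?thesis .
    qed
    moreover have "E * (4 * \<epsilon> / (1 - \<epsilon>) * I + D / E) \<le> X powr b * (4 * \<epsilon> / (1 - \<epsilon>0) * I) + D"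
    proof -
      have "4 * \<epsilon> / (1 - \<epsilon>) \<le> 4 * \<epsilon> / (1 - \<epsilon>0)"
        using e e0 by (intro divide_left_mono mult_pos_pos) auto
      then have "E * (4 * \<epsilon> / (1 - \<epsilon>) * I) \<le> X powr b * (4 * \<epsilon> / (1 - \<epsilon>0) * I)"
        using E I e e0 by (intro mult_mono mult_right_mono) auto
      moreover have "E * (4 * \<epsilon> / (1 - \<epsilon>) * I + D / E) = E * (4 * \<epsilon> / (1 - \<epsilon>) * I) + D"
        using E by (simp add: distrib_left)
      ultimately show ?thesis by simp
    qed
    ultimately have main: "\<bar>T - E * I\<bar> \<le> X powr b * (4 * \<epsilon> / (1 - \<epsilon>0) * I) + D" by linarith
    have "?lhs = \<bar>E - T / I\<bar>"
      unfolding T_def h_def E_def I_def by (simp add: mult_ac)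
    also have "\<dots> = 1 / I * \<bar>T - E * I\<bar>"
    proof -
      have "E - T / I = - (1 / I * (T - E * I))" using I by (simp add: field_simps)
      then show ?thesis using I by (simp add: abs_mult)
    qed
    also have "\<dots> \<le> 1 / I * (X powr b * (4 * \<epsilon> / (1 - \<epsilon>0) * I) + D)"
      using main I by (intro mult_left_mono) auto
    also have "\<dots> = C * \<epsilon>" by (simp add: C_def D_def algebra_simps)
    finally show ?thesis by (simp add: \<epsilon>_def)
  qed
  ultimately show ?thesis by (rule that)
qed

section \<open>Galerkin approximation of functions of an operator\<close>

text \<open>Used twice in a row, this makes \<open>'e gfun\<close> a real vector space, so that
  \<open>subspace\<close> and \<open>linear\<close> apply to functions on the graph.\<close>

instantiation "fun" :: (type, real_vector) real_vector
begin

definition scaleR_fun :: "real \<Rightarrow> ('a \<Rightarrow> 'b) \<Rightarrow> 'a \<Rightarrow> 'b" where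
  "scaleR_fun c f = (\<lambda>x. c *\<^sub>R f x)"

instance
  by standard (simp_all add: scaleR_fun_def fun_eq_iff scaleR_add_left scaleR_add_right)

end

lemma scaleR_fun_apply [simp]: "(c *\<^sub>R f) x = c *\<^sub>R f x"
  by (simp add: scaleR_fun_def)

lemma sum_fun_apply: "(\<Sum>i\<in>I. f i) x = (\<Sum>i\<in>I. f i x)"
  by (induction I rule: infinite_finite_induct) simp_all

text \<open>Cancels one norm after a Cauchy-Schwarz step, including the case of norm 0.\<close>

lemma mult_self_le_imp_le:
  fixes x y :: real
  assumes "x * x \<le> y * x" "0 \<le> x" "0 \<le> y"
  shows "x \<le> y"
  using assms by (cases "x = 0") (auto simp: mult_le_cancel_right)

section \<open>Semi-inner products and Riesz representation\<close>

text \<open>Semidefinite only, because functions that agree almost everywhere are not identified;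
  restricted to a carrier, because the integral is additive only for integrable products.\<close>

locale semi_inner =
  fixes ip :: "'a::real_vector \<Rightarrow> 'a \<Rightarrow> real" and H :: "'a set"
  assumes subspace_H: "subspace H"
    and sym: "\<lbrakk>x \<in> H; y \<in> H\<rbrakk> \<Longrightarrow> ip x y = ip y x"
    and add_left: "\<lbrakk>x \<in> H; y \<in> H; z \<in> H\<rbrakk> \<Longrightarrow> ip (x + y) z = ip x z + ip y z"
    and scale_left: "\<lbrakk>x \<in> H; y \<in> H\<rbrakk> \<Longrightarrow> ip (r *\<^sub>R x) y = r * ip x y"
    and nonneg: "x \<in> H \<Longrightarrow> 0 \<le> ip x x"
begin

lemmas mem_0 = subspace_0[OF subspace_H]
lemmas mem_add = subspace_add[OF subspace_H]
lemmas mem_diff = subspace_diff[OF subspace_H]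
lemmas mem_scale = subspace_scale[OF subspace_H]
lemmas mem_sum = subspace_sum[OF subspace_H]
lemmas mem = mem_0 mem_add mem_diff mem_scale mem_sum

lemma add_right: "\<lbrakk>x \<in> H; y \<in> H; z \<in> H\<rbrakk> \<Longrightarrow> ip z (x + y) = ip z x + ip z y"
  using sym add_left mem_add by metis

lemma scale_right: "\<lbrakk>x \<in> H; y \<in> H\<rbrakk> \<Longrightarrow> ip y (r *\<^sub>R x) = r * ip y x"
  using sym scale_left mem_scale by metis

lemma diff_left: "\<lbrakk>x \<in> H; y \<in> H; z \<in> H\<rbrakk> \<Longrightarrow> ip (x - y) z = ip x z - ip y z"
  using add_left[of x "(-1) *\<^sub>R y" z] scale_left[of y z "-1"] mem_scale[of y "-1"] by simp

lemma diff_right: "\<lbrakk>x \<in> H; y \<in> H; z \<in> H\<rbrakk> \<Longrightarrow> ip z (x - y) = ip z x - ip z y"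
  using sym diff_left mem_diff by metis

lemma zero_left: "y \<in> H \<Longrightarrow> ip 0 y = 0"
  using scale_left[of 0 y 0] mem_0 by simp

lemma sum_left: "\<lbrakk>\<And>i. i \<in> I \<Longrightarrow> f i \<in> H; y \<in> H\<rbrakk> \<Longrightarrow> ip (\<Sum>i\<in>I. f i) y = (\<Sum>i\<in>I. ip (f i) y)"
  by (induction I rule: infinite_finite_induct) (simp_all add: zero_left add_left mem_sum)

lemma ip_diff_diff: "\<lbrakk>x \<in> H; y \<in> H\<rbrakk> \<Longrightarrow> ip (x - y) (x - y) = ip x x - 2 * ip x y + ip y y"
  by (simp add: diff_left diff_right mem_diff sym)

lemma Cauchy_Schwarz_square:
  assumes "x \<in> H" "y \<in> H"
  shows "(ip x y)\<^sup>2 \<le> ip x x * ip y y"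
proof -
  have q: "0 \<le> ip x x - 2 * t * ip x y + t\<^sup>2 * ip y y" for t
    using nonneg[OF mem_diff[OF assms(1) mem_scale[OF assms(2), of t]]] assms
    by (simp add: ip_diff_diff mem_scale scale_right scale_left power2_eq_square mult.assoc)
  show ?thesis
  proof (cases "ip y y = 0")
    case True
    have "ip x y = 0"
    proof (rule ccontr)
      assume "ip x y \<noteq> 0"
      \<comment> \<open>At this t the quadratic q takes the value -1.\<close>
      then show False using q[of "(ip x x + 1) / (2 * ip x y)"] True by simp
    qed
    then show ?thesis using True by simp
  next
    case False
    then have "ip y y > 0" using nonneg[OF assms(2)] by linarith
    then show ?thesis using q[of "ip x y / ip y y"]
      by (simp add: power2_eq_square field_simps)
  qed
qed

definition nrm :: "'a \<Rightarrow> real" where "nrm x = sqrt (ip x x)"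

lemma nrm_nonneg: "x \<in> H \<Longrightarrow> 0 \<le> nrm x"
  by (simp add: nrm_def nonneg)

lemma nrm_square: "x \<in> H \<Longrightarrow> (nrm x)\<^sup>2 = ip x x"
  by (simp add: nrm_def nonneg)

lemma Cauchy_Schwarz: "\<lbrakk>x \<in> H; y \<in> H\<rbrakk> \<Longrightarrow> \<bar>ip x y\<bar> \<le> nrm x * nrm y"
  using real_sqrt_le_mono[OF Cauchy_Schwarz_square] by (simp add: nrm_def real_sqrt_mult)

lemma nrm_triangle: 
  assumes "x \<in> H" "y \<in> H"
  shows "nrm (x + y) \<le> nrm x + nrm y"
proof (rule power2_le_imp_le)
  have "(nrm (x + y))\<^sup>2 = ip x x + 2 * ip x y + ip y y"
    using assms by (simp add: nrm_square mem_add add_left add_right sym)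
  also have "\<dots> \<le> (nrm x)\<^sup>2 + 2 * (nrm x * nrm y) + (nrm y)\<^sup>2"
    using Cauchy_Schwarz[OF assms] assms by (simp add: nrm_square)
  also have "\<dots> = (nrm x + nrm y)\<^sup>2" by (simp add: power2_eq_square algebra_simps)
  finally show "(nrm (x + y))\<^sup>2 \<le> (nrm x + nrm y)\<^sup>2" .
qed (use assms nrm_nonneg in \<open>simp add: add_nonneg_nonneg\<close>)

lemma nrm_scale: "x \<in> H \<Longrightarrow> nrm (r *\<^sub>R x) = \<bar>r\<bar> * nrm x"
  by (simp add: nrm_def scale_left scale_right mem_scale real_sqrt_mult mult.assoc[symmetric])

lemma nrm_minus_commute: "\<lbrakk>x \<in> H; y \<in> H\<rbrakk> \<Longrightarrow> nrm (x - y) = nrm (y - x)"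
  using nrm_scale[of "x - y" "-1"] by (simp add: mem_diff)

lemma nrm_sum_le:
  "\<lbrakk>\<And>i. i \<in> I \<Longrightarrow> f i \<in> H\<rbrakk> \<Longrightarrow> nrm (\<Sum>i\<in>I. f i) \<le> (\<Sum>i\<in>I. nrm (f i))"
proof (induction I rule: infinite_finite_induct)
  case (insert i I)
  then show ?case using nrm_triangle[of "f i" "\<Sum>i\<in>I. f i"] by (simp add: mem_sum)
qed (simp_all add: nrm_def zero_left mem_0)

text \<open>Finite dimensionality of \<open>V\<close> enters through finitely many linear functionals that separate its
  points; in the application these are the evaluations at the mesh points.\<close>

lemma Riesz_representer:
  assumes "finite N" "\<forall>\<xi>\<in>N. linear \<xi>" "subspace V" "V \<subseteq> H"
    and "\<And>v. \<lbrakk>v \<in> V; \<forall>\<xi>\<in>N. \<xi> v = (0::real)\<rbrakk> \<Longrightarrow> v = 0"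
    and def: "\<And>v. \<lbrakk>v \<in> V; ip v v = 0\<rbrakk> \<Longrightarrow> v = 0"
    and "\<And>x y. \<lbrakk>x \<in> V; y \<in> V\<rbrakk> \<Longrightarrow> F (x + y) = F x + F y"
    and "\<And>x r. x \<in> V \<Longrightarrow> F (r *\<^sub>R x) = r * F x"
  shows "\<exists>z\<in>V. \<forall>w\<in>V. ip z w = F w"
  using assms
proof (induction N arbitrary: V F rule: finite_induct)
  case empty
  have "V = {0}" using empty.prems(4) subspace_0[OF empty.prems(2)] by auto
  moreover have "F 0 = 0" using empty.prems(7)[of 0 0] subspace_0[OF empty.prems(2)] by simp
  ultimately show ?case using mem_0 zero_left by auto
next
  case (insert \<xi> N)
  have lin: "linear \<xi>" using insert.prems(1) by simp
  define V' where "V' = {v \<in> V. \<xi> v = 0}"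
  have V': "subspace V'" "V' \<subseteq> V"
    unfolding V'_def using insert.prems(2) lin
    by (auto simp: subspace_def linear_0 linear_add linear_scale)
  have rep: "\<exists>z\<in>V'. \<forall>w\<in>V'. ip z w = F' w"
    if "\<And>x y. \<lbrakk>x \<in> V'; y \<in> V'\<rbrakk> \<Longrightarrow> F' (x + y) = F' x + F' y"
      "\<And>x r. x \<in> V' \<Longrightarrow> F' (r *\<^sub>R x) = r * F' x" for F'
  proof (rule insert.IH)
    show "v = 0" if "v \<in> V'" "\<forall>\<xi>\<in>N. \<xi> v = 0" for v
      using that insert.prems(4)[of v] by (auto simp: V'_def)
  qed (use V' that insert.prems in \<open>auto simp: V'_def\<close>)
  show ?case
  proof (cases "V' = V")
    case True
    have "\<exists>z\<in>V'. \<forall>w\<in>V'. ip z w = F w"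
      by (rule rep; rule insert.prems(6,7); use V'(2) in blast)
    then show ?thesis using True by simp
  next
    case False
    then obtain v1 where v1: "v1 \<in> V" "\<xi> v1 \<noteq> 0" by (auto simp: V'_def)
    define v0 where "v0 = (1 / \<xi> v1) *\<^sub>R v1"
    have v0: "v0 \<in> V" "\<xi> v0 = 1"
      using v1 lin insert.prems(2) by (auto simp: v0_def linear_scale subspace_scale)
    have VH: "v \<in> V \<Longrightarrow> v \<in> H" "v \<in> V' \<Longrightarrow> v \<in> H" for v using insert.prems(3) V' by auto
    obtain r where r: "r \<in> V'" "\<And>w. w \<in> V' \<Longrightarrow> ip r w = ip v0 w"
      using rep[of "ip v0"] v0 VH by (auto simp: add_right scale_right)
    obtain z' where z': "z' \<in> V'" "\<And>w. w \<in> V' \<Longrightarrow> ip z' w = F w"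
    proof -
      have "\<exists>z\<in>V'. \<forall>w\<in>V'. ip z w = F w"
        by (rule rep; rule insert.prems(6,7); use V'(2) in blast)
      then show ?thesis using that by blast
    qed
    \<comment> \<open>The representer r of the functional \<open>ip v0\<close> on V' is the
      component of v0 in V'. Removing it makes V the orthogonal sum of V' and the line of e, and the
      representer of F is assembled from both parts.\<close>
    define e where "e = v0 - r"
    have e: "e \<in> V" "\<xi> e = 1" "\<And>w. w \<in> V' \<Longrightarrow> ip e w = 0"
      using v0 r V' insert.prems(2) lin VH
      by (auto simp: e_def diff_left linear_diff V'_def intro: subspace_diff)
    have "e \<noteq> 0" using e(2) linear_0[OF lin] by auto
    then have ee: "ip e e \<noteq> 0" using insert.prems(5) e(1) by blast
    define z where "z = z' + (F e / ip e e) *\<^sub>R e"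
    have zV: "z \<in> V" unfolding z_def
      using z' V' e insert.prems(2) by (auto intro!: subspace_add subspace_scale)
    have "ip z w = F w" if w: "w \<in> V" for w
    proof -
      define w' where "w' = w - \<xi> w *\<^sub>R e"
      have w': "w' \<in> V'" unfolding w'_def V'_def
        using w e insert.prems(2) lin by (auto simp: linear_diff linear_scale intro!: subspace_diff subspace_scale)
      have weq: "w = w' + \<xi> w *\<^sub>R e" by (simp add: w'_def)
      have "ip z w = ip z' w' + \<xi> w * ip z' e + (F e / ip e e) * (ip e w' + \<xi> w * ip e e)"
        unfolding z_def by (subst weq) (use z' e w' VH in
            \<open>simp add: add_left add_right scale_left scale_right mem algebra_simps\<close>)
      also have "ip z' e = 0" using e(3)[OF z'(1)] sym z'(1) e(1) VH by metis
      also have "ip e w' = 0" by (rule e(3)[OF w'])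
      also have "ip z' w' = F w'" by (rule z'(2)[OF w'])
      finally have "ip z w = F w' + \<xi> w * F e" using ee by simp
      also have "\<dots> = F (w' + \<xi> w *\<^sub>R e)"
        using insert.prems(6)[of w' "\<xi> w *\<^sub>R e"] insert.prems(7)[of e "\<xi> w"] w' V'(2) e(1)
          subspace_scale[OF insert.prems(2)] by auto
      finally show ?thesis using weq by simp
    qed
    then show ?thesis using zV by blast
  qed
qed

end

section \<open>Galerkin resolvents and their error\<close>

text \<open>\<open>ip\<close> is the L2 product and \<open>B\<close> the energy form on its domain
  \<open>W\<close>; the eigenpairs are weak ones. \<open>approx\<close> is approximability by
  \<open>V\<close>, stated for finite combinations: measured by the squared norm of their image
  under the operator, the squared error is of order \<delta> in energy and \<delta>^2 in L2. Thus
  \<delta> stands for a multiple of the squared mesh size.\<close>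

locale galerkin = L: semi_inner ip H + E: semi_inner B W
  for ip :: "'a::real_vector \<Rightarrow> 'a \<Rightarrow> real" and H :: "'a set"
    and B :: "'a \<Rightarrow> 'a \<Rightarrow> real" and W :: "'a set" +
  fixes V :: "'a set" and \<phi> :: "nat \<Rightarrow> 'a" and \<mu> :: "nat \<Rightarrow> real" and \<delta> :: real
  assumes W_subset: "W \<subseteq> H" and subspace_V: "subspace V" and V_subset: "V \<subseteq> W"
    and V_definite: "\<And>v. \<lbrakk>v \<in> V; ip v v = 0\<rbrakk> \<Longrightarrow> v = 0"
    and V_finite: "\<exists>N. finite N \<and> (\<forall>\<xi>\<in>N. linear \<xi>) \<and> (\<forall>v\<in>V. (\<forall>\<xi>\<in>N. \<xi> v = (0::real)) \<longrightarrow> v = 0)"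
    and \<phi>_W: "\<phi> j \<in> W" and \<mu>_pos: "0 < \<mu> j"
    and weak: "w \<in> W \<Longrightarrow> B (\<phi> j) w = \<mu> j * ip (\<phi> j) w"
    and orthonormal: "ip (\<phi> i) (\<phi> j) = (if i = j then 1 else 0)"
    and complete: "f \<in> H \<Longrightarrow> (\<lambda>m. L.nrm (f - (\<Sum>j<m. ip f (\<phi> j) *\<^sub>R \<phi> j))) \<longlonglongrightarrow> 0"
    and \<delta>_pos: "0 < \<delta>"
    and approx: "\<exists>v\<in>V. B ((\<Sum>j<m. c j *\<^sub>R \<phi> j) - v) ((\<Sum>j<m. c j *\<^sub>R \<phi> j) - v) \<le> \<delta> * (\<Sum>j<m. (\<mu> j * c j)\<^sup>2)
      \<and> ip ((\<Sum>j<m. c j *\<^sub>R \<phi> j) - v) ((\<Sum>j<m. c j *\<^sub>R \<phi> j) - v) \<le> \<delta>\<^sup>2 * (\<Sum>j<m. (\<mu> j * c j)\<^sup>2)"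
begin

text \<open>This definition and the next two copy \<open>Ph\<close>, \<open>Lh\<close> and
  \<open>Lh_resolvent\<close>, so that unfolding identifies them.\<close>

definition proj :: "'a \<Rightarrow> 'a" where
  "proj f = (THE u. u \<in> V \<and> (\<forall>w\<in>V. ip u w = ip f w))"

definition disc :: "'a \<Rightarrow> 'a" where
  "disc u = (THE z. z \<in> V \<and> (\<forall>w\<in>V. ip z w = B u w))"

definition resolvent :: "real \<Rightarrow> 'a \<Rightarrow> 'a" where
  "resolvent t = inv_into V (\<lambda>u. u + t *\<^sub>R disc u)"

definition comb :: "(nat \<Rightarrow> real) \<Rightarrow> nat \<Rightarrow> 'a" where
  "comb c m = (\<Sum>j<m. c j *\<^sub>R \<phi> j)"

text \<open>The form of the identity plus t times the operator. In it the discrete resolvent is a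
  Riesz representer, and the Galerkin projection of the exact one.\<close>

definition shifted :: "real \<Rightarrow> 'a \<Rightarrow> 'a \<Rightarrow> real" where
  "shifted t x y = ip x y + t * B x y"

lemma VH: "v \<in> V \<Longrightarrow> v \<in> H" and WH: "w \<in> W \<Longrightarrow> w \<in> H" and VW: "v \<in> V \<Longrightarrow> v \<in> W"
  using V_subset W_subset by auto

lemma \<phi>_H: "\<phi> j \<in> H"
  using \<phi>_W WH by blast

lemma semi_inner_shifted: "0 \<le> t \<Longrightarrow> semi_inner (shifted t) W"
  using W_subset
  by unfold_locales
    (auto simp: shifted_def E.subspace_H L.sym E.sym L.add_left E.add_left L.scale_left E.scale_left
      L.nonneg E.nonneg subset_iff algebra_simps)

text \<open>Definiteness is available on \<open>V\<close>; it is what makes the elements described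
  by \<open>THE\<close> unique.\<close>

lemma V_eqI:
  assumes "u \<in> V" "v \<in> V" "\<And>w. w \<in> V \<Longrightarrow> ip u w = ip v w"
  shows "u = v"
proof -
  have "u - v \<in> V" using assms subspace_V subspace_diff by blast
  then have "ip (u - v) (u - v) = 0"
    using assms VH by (simp add: L.diff_left)
  then show ?thesis using V_definite \<open>u - v \<in> V\<close> by force
qed

text \<open>For nonnegative t the shifted form dominates \<open>ip\<close> and is therefore definite
  on \<open>V\<close>; the case t = 0 provides projections and the discrete operator.\<close>

lemma Riesz_shifted:
  assumes "0 \<le> t" "\<And>x y. \<lbrakk>x \<in> V; y \<in> V\<rbrakk> \<Longrightarrow> F (x + y) = F x + F y"
    "\<And>x r. x \<in> V \<Longrightarrow> F (r *\<^sub>R x) = r * F x"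
  shows "\<exists>z\<in>V. \<forall>w\<in>V. shifted t z w = F w"
proof -
  interpret S: semi_inner "shifted t" W using assms(1) by (rule semi_inner_shifted)
  obtain N where N: "finite N" "\<forall>\<xi>\<in>N. linear \<xi>" "\<forall>v\<in>V. (\<forall>\<xi>\<in>N. \<xi> v = (0::real)) \<longrightarrow> v = 0"
    using V_finite by (elim exE conjE)
  show ?thesis
  proof (rule S.Riesz_representer[OF N(1,2) subspace_V V_subset _ _ assms(2,3)])
    fix v assume "v \<in> V" "\<forall>\<xi>\<in>N. \<xi> v = 0"
    then show "v = 0" using N(3) by blast
  next
    fix v assume v: "v \<in> V" "shifted t v v = 0"
    have "0 \<le> t * B v v" using assms(1) E.nonneg[OF VW[OF v(1)]] by simp
    then have "ip v v = 0" using v(2) L.nonneg[OF VH[OF v(1)]] unfolding shifted_def by linarith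
    then show "v = 0" using v(1) V_definite by blast
  qed
qed

lemma Riesz_ip:
  assumes "\<And>x y. \<lbrakk>x \<in> V; y \<in> V\<rbrakk> \<Longrightarrow> F (x + y) = F x + F y"
    "\<And>x r. x \<in> V \<Longrightarrow> F (r *\<^sub>R x) = r * F x"
  shows "\<exists>!z. z \<in> V \<and> (\<forall>w\<in>V. ip z w = F w)"
  using Riesz_shifted[of 0 F] assms V_eqI by (auto simp: shifted_def)

lemma proj:
  assumes "f \<in> H"
  shows "proj f \<in> V" "w \<in> V \<Longrightarrow> ip (proj f) w = ip f w"
  using theI'[OF Riesz_ip[of "ip f"]] assms VH
  by (auto simp: proj_def L.add_right L.scale_right)

lemma disc:
  assumes "u \<in> W"
  shows "disc u \<in> V" "w \<in> V \<Longrightarrow> ip (disc u) w = B u w"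
  using theI'[OF Riesz_ip[of "B u"]] assms VW
  by (auto simp: disc_def E.add_right E.scale_right)

text \<open>\<open>resolvent\<close> is an inverse on \<open>V\<close> by choice, so surjectivity is
  what makes it a right inverse. Preimages come from Riesz representation in the shifted
  form.\<close>

lemma shifted_resolvent:
  assumes t: "0 < t" and g: "g \<in> V"
  shows "resolvent t g \<in> V" "w \<in> V \<Longrightarrow> shifted t (resolvent t g) w = ip g w"
proof -
  let ?T = "\<lambda>u. u + t *\<^sub>R disc u"
  have T: "ip (?T u) w = shifted t u w" if "u \<in> V" "w \<in> V" for u w
    using that disc[OF VW[OF that(1)]] VH
    by (simp add: shifted_def L.add_left L.scale_left L.mem_scale)
  obtain z where z: "z \<in> V" "\<And>w. w \<in> V \<Longrightarrow> shifted t z w = ip g w"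
    using Riesz_shifted[of t "ip g"] t g VH by (auto simp: L.add_right L.scale_right)
  have "?T z \<in> V"
    using z disc VW subspace_V by (intro subspace_add subspace_scale) auto
  then have "?T z = g" using T z g by (intro V_eqI) auto
  then have "g \<in> ?T ` V" using z by blast
  then have r: "resolvent t g \<in> V" "?T (resolvent t g) = g"
    unfolding resolvent_def by (rule inv_into_into, rule f_inv_into_f)
  then show "resolvent t g \<in> V" "w \<in> V \<Longrightarrow> shifted t (resolvent t g) w = ip g w"
    using T[of "resolvent t g" w] by auto
qed

lemma resolvent_proj:
  assumes "0 < t" "f \<in> H"
  shows "resolvent t (proj f) \<in> V" "w \<in> V \<Longrightarrow> shifted t (resolvent t (proj f)) w = ip f w"
  using shifted_resolvent[OF assms(1) proj(1)[OF assms(2)]] proj[OF assms(2)] by auto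

lemma shifted_eqI:
  assumes "0 < t" "u \<in> V" "v \<in> V" "\<And>w. w \<in> V \<Longrightarrow> shifted t u w = shifted t v w"
  shows "u = v"
proof -
  interpret S: semi_inner "shifted t" W using assms(1) by (intro semi_inner_shifted) simp
  have d: "u - v \<in> V" using assms subspace_V subspace_diff by blast
  then have "shifted t (u - v) (u - v) = 0"
    using assms VW by (simp add: S.diff_left)
  moreover have "0 \<le> t * B (u - v) (u - v)" using assms(1) E.nonneg[OF VW[OF d]] by simp
  ultimately have "ip (u - v) (u - v) = 0"
    using L.nonneg[OF VH[OF d]] unfolding shifted_def by linarith
  then show ?thesis using V_definite[OF d] by simp
qed

text \<open>\<open>proj\<close> and \<open>resolvent\<close> are known through the equations they
  satisfy; linearity follows from uniqueness in the shifted form.\<close>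

lemma resolvent_diff:
  assumes "0 < t" "f \<in> H" "g \<in> H"
  shows "resolvent t (proj f) - resolvent t (proj g) = resolvent t (proj (f - g))"
proof (rule shifted_eqI[OF assms(1)])
  interpret S: semi_inner "shifted t" W using assms(1) by (intro semi_inner_shifted) simp
  show "resolvent t (proj f) - resolvent t (proj g) \<in> V"
    using resolvent_proj(1) assms subspace_V by (intro subspace_diff) auto
  show "resolvent t (proj (f - g)) \<in> V"
    using assms by (intro resolvent_proj(1) L.mem_diff)
  show "shifted t (resolvent t (proj f) - resolvent t (proj g)) w = shifted t (resolvent t (proj (f - g))) w"
    if "w \<in> V" for w
    using assms that resolvent_proj[OF assms(1)] VW VH
    by (simp add: S.diff_left L.mem_diff L.diff_left)
qed

text \<open>Test with the solution itself and drop the nonnegative energy.\<close>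

lemma nrm_resolvent_le:
  assumes "0 < t" "f \<in> H"
  shows "L.nrm (resolvent t (proj f)) \<le> L.nrm f"
proof -
  let ?z = "resolvent t (proj f)"
  have z: "?z \<in> V" "?z \<in> H" "?z \<in> W" using resolvent_proj(1)[OF assms] VH VW by auto
  have "(L.nrm ?z)\<^sup>2 \<le> shifted t ?z ?z"
    using z assms E.nonneg by (simp add: L.nrm_square shifted_def)
  also have "\<dots> = ip f ?z" by (rule resolvent_proj(2)[OF assms z(1)])
  also have "\<dots> \<le> L.nrm f * L.nrm ?z" using L.Cauchy_Schwarz[OF assms(2) z(2)] by simp
  finally have "L.nrm ?z * L.nrm ?z \<le> L.nrm f * L.nrm ?z" by (simp add: power2_eq_square)
  then show ?thesis
    using L.nrm_nonneg[OF z(2)] L.nrm_nonneg[OF assms(2)] by (rule mult_self_le_imp_le)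
qed

lemma comb_W: "comb c m \<in> W" and comb_H: "comb c m \<in> H"
  unfolding comb_def using \<phi>_W \<phi>_H by (auto intro!: E.mem L.mem)

lemma ip_comb: "x \<in> H \<Longrightarrow> ip (comb c m) x = (\<Sum>j<m. c j * ip (\<phi> j) x)"
  unfolding comb_def using \<phi>_H by (simp add: L.sum_left L.mem_scale L.scale_left)

lemma B_comb: "x \<in> W \<Longrightarrow> B (comb c m) x = ip (comb (\<lambda>j. \<mu> j * c j) m) x"
  using ip_comb[of x "\<lambda>j. \<mu> j * c j" m] WH[of x] unfolding comb_def
  by (simp add: E.sum_left \<phi>_W E.mem_scale E.scale_left weak mult_ac)

lemma ip_comb_\<phi>: "ip (comb c m) (\<phi> i) = (if i < m then c i else 0)"
  using \<phi>_H by (simp add: ip_comb orthonormal if_distrib cong: if_cong)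

lemma ip_comb_comb: "ip (comb c m) (comb d m) = (\<Sum>j<m. c j * d j)"
proof -
  have "ip (comb c m) (comb d m) = (\<Sum>j<m. c j * ip (\<phi> j) (comb d m))"
    by (rule ip_comb[OF comb_H])
  also have "\<dots> = (\<Sum>j<m. c j * d j)"
    using L.sym[OF \<phi>_H comb_H] by (intro sum.cong) (simp_all add: ip_comb_\<phi>)
  finally show ?thesis .
qed

lemma comb_diff: "comb c m - comb d m = comb (\<lambda>j. c j - d j) m"
  by (simp add: comb_def sum_subtractf scaleR_diff_left)

lemma nrm_comb: "L.nrm (comb c m) = sqrt (\<Sum>j<m. (c j)\<^sup>2)"
  by (simp add: L.nrm_def ip_comb_comb power2_eq_square)

text \<open>Bessel's inequality: the partial expansion p satisfies ip p f = |p|^2, and one factor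
  |p| cancels after Cauchy-Schwarz.\<close>

lemma nrm_expansion_le:
  assumes f: "f \<in> H"
  shows "L.nrm (comb (\<lambda>j. ip f (\<phi> j)) m) \<le> L.nrm f"
proof -
  let ?p = "comb (\<lambda>j. ip f (\<phi> j)) m"
  have "ip ?p f = (\<Sum>j<m. (ip f (\<phi> j))\<^sup>2)"
    using f L.sym[OF f \<phi>_H] by (simp add: ip_comb power2_eq_square)
  also have "\<dots> = (L.nrm ?p)\<^sup>2"
    by (simp add: nrm_comb sum_nonneg)
  finally have "L.nrm ?p * L.nrm ?p \<le> L.nrm f * L.nrm ?p"
    using L.Cauchy_Schwarz[OF comb_H f, of "\<lambda>j. ip f (\<phi> j)" m] by (simp add: power2_eq_square mult.commute)
  then show ?thesis
    using L.nrm_nonneg[OF comb_H] L.nrm_nonneg[OF f] by (rule mult_self_le_imp_le)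
qed

text \<open>On finite combinations the exact resolvent is diagonal. Its weak equation, tested with
  all of \<open>W\<close>, is what the discrete one is compared with.\<close>

lemma shifted_comb:
  assumes "0 < t" "w \<in> W"
  shows "shifted t (comb (\<lambda>j. c j / (1 + t * \<mu> j)) m) w = ip (comb c m) w"
proof -
  have nz: "1 + t * \<mu> j \<noteq> 0" for j using mult_pos_pos[OF assms(1) \<mu>_pos[of j]] by linarith
  have eq: "c j / (1 + t * \<mu> j) + t * (\<mu> j * (c j / (1 + t * \<mu> j))) = c j" for j
  proof -
    have "c j / (1 + t * \<mu> j) + t * (\<mu> j * (c j / (1 + t * \<mu> j))) = c j / (1 + t * \<mu> j) * (1 + t * \<mu> j)"
      unfolding distrib_left mult_1_right by (simp only: ac_simps)
    then show ?thesis using nz[of j] by simp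
  qed
  have "shifted t (comb (\<lambda>j. c j / (1 + t * \<mu> j)) m) w
      = (\<Sum>j<m. (c j / (1 + t * \<mu> j) + t * (\<mu> j * (c j / (1 + t * \<mu> j)))) * ip (\<phi> j) w)"
    using assms WH by (simp add: shifted_def B_comb ip_comb distrib_right sum.distrib sum_distrib_left mult.assoc)
  then show ?thesis using assms WH unfolding eq by (simp add: ip_comb)
qed

text \<open>For \<open>\<delta> \<le> t\<close> the contribution of the \<open>L\<^sub>2\<close> norm does not exceed that of the energy.\<close>

lemma approx_shifted:
  assumes "0 < t" "\<delta> \<le> t"
  shows "\<exists>v\<in>V. shifted t (comb (\<lambda>j. c j / (1 + t * \<mu> j)) m - v) (comb (\<lambda>j. c j / (1 + t * \<mu> j)) m - v)
    \<le> 2 * \<delta> / t * (L.nrm (comb c m))\<^sup>2"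
proof -
  let ?d = "\<lambda>j. c j / (1 + t * \<mu> j)"
  let ?Q = "\<Sum>j<m. (\<mu> j * ?d j)\<^sup>2"
  obtain v where v: "v \<in> V" "B (comb ?d m - v) (comb ?d m - v) \<le> \<delta> * ?Q"
    "ip (comb ?d m - v) (comb ?d m - v) \<le> \<delta>\<^sup>2 * ?Q"
    using approx[where m = m and c = ?d] unfolding comb_def by blast
  have "?Q \<le> (\<Sum>j<m. (c j)\<^sup>2 / t\<^sup>2)"
  proof (rule sum_mono)
    fix j
    have "\<bar>\<mu> j * ?d j\<bar> = \<bar>c j\<bar> * (\<mu> j / (1 + t * \<mu> j))"
      using assms(1) \<mu>_pos[of j] by (simp add: abs_mult add_pos_pos)
    also have "\<dots> \<le> \<bar>c j\<bar> * (1 / t)"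
      using assms(1) \<mu>_pos[of j] by (intro mult_left_mono) (auto simp: field_simps add_pos_pos)
    finally have "\<bar>\<mu> j * ?d j\<bar> \<le> \<bar>c j / t\<bar>" using assms(1) by simp
    then have "(\<mu> j * ?d j)\<^sup>2 \<le> (c j / t)\<^sup>2" using abs_le_square_iff by blast
    then show "(\<mu> j * ?d j)\<^sup>2 \<le> (c j)\<^sup>2 / t\<^sup>2" by (simp add: power_divide)
  qed
  also have "\<dots> = (L.nrm (comb c m))\<^sup>2 / t\<^sup>2"
    by (simp add: nrm_comb sum_nonneg sum_divide_distrib)
  finally have Q: "?Q \<le> (L.nrm (comb c m))\<^sup>2 / t\<^sup>2" .
  have "shifted t (comb ?d m - v) (comb ?d m - v) \<le> \<delta>\<^sup>2 * ?Q + t * (\<delta> * ?Q)"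
    unfolding shifted_def using v assms by (intro add_mono mult_left_mono) auto
  also have "\<dots> = \<delta> * (\<delta> + t) * ?Q" by (simp add: power2_eq_square algebra_simps)
  also have "\<dots> \<le> \<delta> * (2 * t) * ((L.nrm (comb c m))\<^sup>2 / t\<^sup>2)"
    using assms \<delta>_pos Q by (intro mult_mono mult_left_mono) (auto simp: sum_nonneg)
  also have "\<dots> = 2 * \<delta> / t * (L.nrm (comb c m))\<^sup>2"
    using assms by (simp add: power2_eq_square field_simps)
  finally show ?thesis using v(1) by blast
qed

text \<open>If t < \<delta>, both resolvents are contractions and 4 \<delta> / (\<delta> + t)
  exceeds 2, so the triangle inequality suffices. Otherwise Galerkin orthogonality bounds the error
  in the shifted norm by sqrt \<eta> |f| with \<eta> = 2 \<delta> / t, duality supplies a second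
  factor sqrt \<eta> in L2, and \<eta> is at most 4 \<delta> / (\<delta> + t).\<close>

lemma resolvent_error:
  assumes t: "0 < t"
  shows "L.nrm (comb (\<lambda>j. c j / (1 + t * \<mu> j)) m - resolvent t (proj (comb c m)))
    \<le> 4 * (\<delta> / (\<delta> + t)) * L.nrm (comb c m)"
proof -
  interpret S: semi_inner "shifted t" W using t by (intro semi_inner_shifted) simp
  let ?f = "comb c m" and ?z = "comb (\<lambda>j. c j / (1 + t * \<mu> j)) m"
  let ?zh = "resolvent t (proj ?f)"
  define e where "e = ?z - ?zh"
  have zh: "?zh \<in> V" "?zh \<in> W" "?zh \<in> H" using resolvent_proj(1)[OF t comb_H] VW VH by auto
  have eW: "e \<in> W" "e \<in> H" unfolding e_def using zh comb_W comb_H by (auto intro: E.mem_diff L.mem_diff)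
  have N0: "0 \<le> L.nrm ?f" by (rule L.nrm_nonneg[OF comb_H])
  show ?thesis
  proof (cases "\<delta> \<le> t")
    case False
    have "L.nrm ?z \<le> L.nrm ?f"
    proof -
      have "(c j / (1 + t * \<mu> j))\<^sup>2 \<le> (c j)\<^sup>2" for j
      proof -
        have "\<bar>c j / (1 + t * \<mu> j)\<bar> \<le> \<bar>c j\<bar> / 1"
          unfolding abs_divide using t \<mu>_pos[of j] by (intro divide_left_mono) (auto simp: abs_of_pos add_pos_pos)
        then show ?thesis by (metis abs_le_square_iff div_by_1)
      qed
      then show ?thesis unfolding nrm_comb by (intro real_sqrt_le_mono sum_mono)
    qed
    moreover have "L.nrm e \<le> L.nrm ?z + L.nrm ?zh"
      using L.nrm_triangle[OF comb_H L.mem_scale[OF zh(3), of "-1"], of "\<lambda>j. c j / (1 + t * \<mu> j)" m] L.nrm_scale[OF zh(3), of "-1"]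
      by (simp add: e_def)
    ultimately have "L.nrm e \<le> 2 * L.nrm ?f"
      using nrm_resolvent_le[OF t comb_H[of c m]] by linarith
    also have "2 \<le> 4 * (\<delta> / (\<delta> + t))" using False t \<delta>_pos by (simp add: field_simps)
    then have "2 * L.nrm ?f \<le> 4 * (\<delta> / (\<delta> + t)) * L.nrm ?f" by (rule mult_right_mono[OF _ N0])
    finally show ?thesis by (simp add: e_def)
  next
    case True
    \<comment> \<open>Galerkin orthogonality: the exact and the discrete solution satisfy the same
      equation on \<open>V\<close>.\<close>
    have orth: "shifted t e w = 0" if "w \<in> V" for w
      unfolding e_def using that zh VW comb_W
      by (simp add: S.diff_left shifted_comb[OF t] resolvent_proj(2)[OF t comb_H])
    define \<eta> where "\<eta> = 2 * \<delta> / t"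
    have \<eta>: "0 < \<eta>" using t \<delta>_pos by (simp add: \<eta>_def)
    have Se: "S.nrm e \<le> sqrt \<eta> * L.nrm ?f"
    proof -
      obtain v where v: "v \<in> V" "shifted t (?z - v) (?z - v) \<le> \<eta> * (L.nrm ?f)\<^sup>2"
        using approx_shifted[OF t True] unfolding \<eta>_def by blast
      have zv: "?z - v \<in> W" using v VW comb_W by (intro E.mem_diff) auto
      have dV: "?zh - v \<in> V" using zh v subspace_V subspace_diff by blast
      have "shifted t e (?z - v) = shifted t e (e + (?zh - v))" by (simp add: e_def)
      also have "\<dots> = shifted t e e + shifted t e (?zh - v)"
        using eW VW dV by (intro S.add_right) auto
      also have "shifted t e (?zh - v) = 0" using dV by (rule orth)
      finally have "S.nrm e * S.nrm e \<le> S.nrm (?z - v) * S.nrm e"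
        using S.Cauchy_Schwarz[OF eW(1) zv] S.nrm_square[OF eW(1)]
        by (simp add: power2_eq_square mult.commute)
      then have "S.nrm e \<le> S.nrm (?z - v)"
        using S.nrm_nonneg[OF eW(1)] S.nrm_nonneg[OF zv] by (rule mult_self_le_imp_le)
      also have "\<dots> \<le> sqrt (\<eta> * (L.nrm ?f)\<^sup>2)"
        unfolding S.nrm_def using v(2) by (rule real_sqrt_le_mono)
      also have "\<dots> = sqrt \<eta> * L.nrm ?f" using N0 by (simp add: real_sqrt_mult)
      finally show ?thesis .
    qed
    \<comment> \<open>The dual problem has the error e as data, which need not be a finite
      combination. It is solved for the partial expansions of e, and completeness passes to the
      limit.\<close>
    define p where "p = (\<lambda>m. comb (\<lambda>j. ip e (\<phi> j)) m)"
    have pm: "L.nrm (p m') \<le> \<eta> * L.nrm ?f" for m'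
    proof -
      let ?\<psi> = "comb (\<lambda>j. ip e (\<phi> j) / (1 + t * \<mu> j)) m'"
      obtain v where v: "v \<in> V" "shifted t (?\<psi> - v) (?\<psi> - v) \<le> \<eta> * (L.nrm (p m'))\<^sup>2"
        using approx_shifted[OF t True, where c = "\<lambda>j. ip e (\<phi> j)" and m = m'] unfolding \<eta>_def p_def by blast
      have pv: "?\<psi> - v \<in> W" using v VW comb_W by (intro E.mem_diff) auto
      have P0: "0 \<le> L.nrm (p m')" unfolding p_def by (rule L.nrm_nonneg[OF comb_H])
      have "(L.nrm (p m'))\<^sup>2 = ip (p m') e"
        unfolding p_def using L.sym[OF eW(2) \<phi>_H] eW
        by (simp add: ip_comb nrm_comb sum_nonneg power2_eq_square)
      also have "\<dots> = shifted t ?\<psi> e"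
        unfolding p_def by (rule shifted_comb[OF t eW(1), symmetric])
      \<comment> \<open>By orthogonality any element of \<open>V\<close> may be subtracted from the
        dual solution.\<close>
      also have "\<dots> = shifted t (?\<psi> - v) e"
        using orth[OF v(1)] v VW comb_W eW S.sym[of v e] by (simp add: S.diff_left)
      also have "\<dots> \<le> S.nrm (?\<psi> - v) * S.nrm e"
        using S.Cauchy_Schwarz[OF pv eW(1)] by simp
      also have "\<dots> \<le> (sqrt \<eta> * L.nrm (p m')) * (sqrt \<eta> * L.nrm ?f)"
      proof (intro mult_mono Se)
        show "S.nrm (?\<psi> - v) \<le> sqrt \<eta> * L.nrm (p m')"
          using real_sqrt_le_mono[OF v(2)] P0 by (simp add: S.nrm_def real_sqrt_mult)
      qed (use \<eta> P0 S.nrm_nonneg[OF eW(1)] in auto)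
      also have "\<dots> = (\<eta> * L.nrm ?f) * L.nrm (p m')" using \<eta> by simp
      finally have "L.nrm (p m') * L.nrm (p m') \<le> (\<eta> * L.nrm ?f) * L.nrm (p m')"
        by (simp add: power2_eq_square)
      then show ?thesis
        by (rule mult_self_le_imp_le[OF _ P0]) (use \<eta> N0 in simp)
    qed
    have "L.nrm e \<le> L.nrm (e - p m') + \<eta> * L.nrm ?f" for m'
      using L.nrm_triangle[of "e - p m'" "p m'"] pm[of m'] eW comb_H by (simp add: p_def L.mem_diff)
    moreover have "(\<lambda>m'. L.nrm (e - p m') + \<eta> * L.nrm ?f) \<longlonglongrightarrow> 0 + \<eta> * L.nrm ?f"
      using complete[OF eW(2)] unfolding p_def comb_def by (intro tendsto_intros)
    ultimately have "L.nrm e \<le> 0 + \<eta> * L.nrm ?f"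
      by (intro LIMSEQ_le_const) auto
    also have "\<eta> \<le> 4 * (\<delta> / (\<delta> + t))"
      using True t \<delta>_pos by (simp add: \<eta>_def field_simps)
    then have "0 + \<eta> * L.nrm ?f \<le> 4 * (\<delta> / (\<delta> + t)) * L.nrm ?f"
      unfolding add_0 by (rule mult_right_mono[OF _ N0])
    finally show ?thesis by (simp add: e_def)
  qed
qed

text \<open>The data are cut off to their first m coefficients. For these the scalar estimate acts
  on every coefficient and \<open>resolvent_error\<close> on every node. The cut-off itself is
  controlled by the contractivity of the discrete resolvents and vanishes in the limit, since the
  sum w of the weights does not depend on m.\<close>

theorem rational_approximation_error:
  assumes fH: "f \<in> H" and uH: "u \<in> H" and fu: "\<And>j. ip u (\<phi> j) = y j * ip f (\<phi> j)"
    and t: "\<And>l. l \<in> I \<Longrightarrow> 0 < t l" and wt: "\<And>l. l \<in> I \<Longrightarrow> 0 \<le> wt l"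
    and scalar: "\<And>j. \<bar>y j - (\<Sum>l\<in>I. wt l / (1 + t l * \<mu> j))\<bar> \<le> \<epsilon>"
  shows "L.nrm (u - (\<Sum>l\<in>I. wt l *\<^sub>R resolvent (t l) (proj f)))
    \<le> (\<epsilon> + 4 * (\<Sum>l\<in>I. wt l * (\<delta> / (\<delta> + t l)))) * L.nrm f"
proof -
  define fm where "fm = (\<lambda>m. comb (\<lambda>j. ip f (\<phi> j)) m)"
  define um where "um = (\<lambda>m. comb (\<lambda>j. ip u (\<phi> j)) m)"
  define Q where "Q = (\<lambda>g. \<Sum>l\<in>I. wt l *\<^sub>R resolvent (t l) (proj g))"
  define z where "z = (\<lambda>l m. comb (\<lambda>j. ip f (\<phi> j) / (1 + t l * \<mu> j)) m)"
  define qm where "qm = (\<lambda>m. \<Sum>l\<in>I. wt l *\<^sub>R z l m)"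
  define w where "w = (\<Sum>l\<in>I. wt l)"
  have mems: "fm m \<in> H" "um m \<in> H" "z l m \<in> H" "qm m \<in> H" for l m
    unfolding fm_def um_def z_def qm_def by (intro comb_H L.mem_sum L.mem_scale)+
  have R_H: "resolvent (t l) (proj g) \<in> H" if "g \<in> H" "l \<in> I" for g l
    using resolvent_proj(1)[OF t[OF that(2)] that(1)] VH by blast
  have QH: "Q g \<in> H" if "g \<in> H" for g
    unfolding Q_def using R_H that by (intro L.mem_sum L.mem_scale) auto
  have e0: "0 \<le> \<epsilon>" using scalar[of 0] by linarith
  have qm_comb: "qm m = comb (\<lambda>j. (\<Sum>l\<in>I. wt l / (1 + t l * \<mu> j)) * ip f (\<phi> j)) m" for m
  proof -
    have "qm m = (\<Sum>l\<in>I. \<Sum>j<m. (wt l * (ip f (\<phi> j) / (1 + t l * \<mu> j))) *\<^sub>R \<phi> j)"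
      by (simp add: qm_def z_def comb_def scaleR_sum_right)
    also have "\<dots> = (\<Sum>j<m. \<Sum>l\<in>I. (wt l * (ip f (\<phi> j) / (1 + t l * \<mu> j))) *\<^sub>R \<phi> j)"
      by (rule sum.swap)
    finally show ?thesis by (simp add: comb_def scaleR_sum_left sum_distrib_right)
  qed
  have step1: "L.nrm (um m - qm m) \<le> \<epsilon> * L.nrm f" for m
  proof -
    have "um m - qm m = comb (\<lambda>j. (y j - (\<Sum>l\<in>I. wt l / (1 + t l * \<mu> j))) * ip f (\<phi> j)) m"
      unfolding um_def qm_comb comb_diff by (simp add: fu algebra_simps)
    also have "L.nrm \<dots> \<le> sqrt (\<Sum>j<m. (\<epsilon> * ip f (\<phi> j))\<^sup>2)"
      unfolding nrm_comb
    proof (intro real_sqrt_le_mono sum_mono)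
      fix j
      have "\<bar>(y j - (\<Sum>l\<in>I. wt l / (1 + t l * \<mu> j))) * ip f (\<phi> j)\<bar> \<le> \<bar>\<epsilon> * ip f (\<phi> j)\<bar>"
        unfolding abs_mult using scalar[of j] by (intro mult_right_mono) auto
      then show "((y j - (\<Sum>l\<in>I. wt l / (1 + t l * \<mu> j))) * ip f (\<phi> j))\<^sup>2 \<le> (\<epsilon> * ip f (\<phi> j))\<^sup>2"
        using abs_le_square_iff by blast
    qed
    also have "\<dots> = \<epsilon> * L.nrm (fm m)"
      using e0 by (simp add: fm_def nrm_comb power_mult_distrib real_sqrt_mult flip: sum_distrib_left)
    also have "\<dots> \<le> \<epsilon> * L.nrm f" unfolding fm_def by (intro mult_left_mono nrm_expansion_le fH e0)
    finally show ?thesis .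
  qed
  have step2: "L.nrm (qm m - Q (fm m)) \<le> 4 * (\<Sum>l\<in>I. wt l * (\<delta> / (\<delta> + t l))) * L.nrm f" for m
  proof -
    have eq: "qm m - Q (fm m) = (\<Sum>l\<in>I. wt l *\<^sub>R (z l m - resolvent (t l) (proj (fm m))))"
      by (simp add: qm_def Q_def sum_subtractf scaleR_diff_right)
    have "L.nrm (qm m - Q (fm m)) \<le> (\<Sum>l\<in>I. L.nrm (wt l *\<^sub>R (z l m - resolvent (t l) (proj (fm m)))))"
      unfolding eq using mems R_H by (intro L.nrm_sum_le L.mem_scale L.mem_diff) auto
    also have "\<dots> \<le> (\<Sum>l\<in>I. wt l * (4 * (\<delta> / (\<delta> + t l)) * L.nrm f))"
    proof (rule sum_mono)
      fix l assume l: "l \<in> I"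
      have "L.nrm (z l m - resolvent (t l) (proj (fm m))) \<le> 4 * (\<delta> / (\<delta> + t l)) * L.nrm (fm m)"
        using resolvent_error[OF t[OF l], where c = "\<lambda>j. ip f (\<phi> j)" and m = m]
        unfolding z_def fm_def .
      also have "\<dots> \<le> 4 * (\<delta> / (\<delta> + t l)) * L.nrm f"
        unfolding fm_def using t[OF l] \<delta>_pos by (intro mult_left_mono nrm_expansion_le fH) auto
      finally show "L.nrm (wt l *\<^sub>R (z l m - resolvent (t l) (proj (fm m)))) \<le> wt l * (4 * (\<delta> / (\<delta> + t l)) * L.nrm f)"
        unfolding L.nrm_scale[OF L.mem_diff[OF mems(3) R_H[OF mems(1) l]]] abs_of_nonneg[OF wt[OF l]]
        by (rule mult_left_mono[OF _ wt[OF l]])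
    qed
    also have "\<dots> = 4 * (\<Sum>l\<in>I. wt l * (\<delta> / (\<delta> + t l))) * L.nrm f"
      by (simp add: sum_distrib_left sum_distrib_right mult_ac)
    finally show ?thesis .
  qed
  have step3: "L.nrm (Q (fm m) - Q f) \<le> w * L.nrm (f - fm m)" for m
  proof -
    have "Q (fm m) - Q f = (\<Sum>l\<in>I. wt l *\<^sub>R (resolvent (t l) (proj (fm m)) - resolvent (t l) (proj f)))"
      by (simp add: Q_def sum_subtractf scaleR_diff_right)
    also have "\<dots> = (\<Sum>l\<in>I. wt l *\<^sub>R resolvent (t l) (proj (fm m - f)))"
      using resolvent_diff[OF t mems(1) fH] by (intro sum.cong) auto
    finally have eq: "Q (fm m) - Q f = (\<Sum>l\<in>I. wt l *\<^sub>R resolvent (t l) (proj (fm m - f)))" .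
    have "L.nrm (Q (fm m) - Q f) \<le> (\<Sum>l\<in>I. L.nrm (wt l *\<^sub>R resolvent (t l) (proj (fm m - f))))"
      unfolding eq using L.mem_diff[OF mems(1) fH] R_H by (intro L.nrm_sum_le L.mem_scale) simp
    also have "\<dots> \<le> (\<Sum>l\<in>I. wt l * L.nrm (f - fm m))"
    proof (rule sum_mono)
      fix l assume l: "l \<in> I"
      have d: "fm m - f \<in> H" by (intro L.mem_diff mems fH)
      show "L.nrm (wt l *\<^sub>R resolvent (t l) (proj (fm m - f))) \<le> wt l * L.nrm (f - fm m)"
        using nrm_resolvent_le[OF t[OF l] d] wt[OF l] L.nrm_minus_commute[OF mems(1) fH] R_H[OF d l]
        by (simp add: L.nrm_scale mult_left_mono)
    qed
    also have "\<dots> = w * L.nrm (f - fm m)" by (simp add: w_def sum_distrib_right)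
    finally show ?thesis .
  qed
  have bound: "L.nrm (u - Q f) \<le> L.nrm (u - um m) + \<epsilon> * L.nrm f
      + 4 * (\<Sum>l\<in>I. wt l * (\<delta> / (\<delta> + t l))) * L.nrm f + w * L.nrm (f - fm m)" for m
  proof -
    have eq: "u - Q f = ((u - um m) + (um m - qm m)) + ((qm m - Q (fm m)) + (Q (fm m) - Q f))" by simp
    have "L.nrm (u - Q f) \<le> L.nrm ((u - um m) + (um m - qm m)) + L.nrm ((qm m - Q (fm m)) + (Q (fm m) - Q f))"
      by (subst eq) (use mems QH uH fH in \<open>intro L.nrm_triangle L.mem_add L.mem_diff; auto\<close>)
    also have "\<dots> \<le> (L.nrm (u - um m) + L.nrm (um m - qm m)) + (L.nrm (qm m - Q (fm m)) + L.nrm (Q (fm m) - Q f))"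
      using mems QH uH fH by (intro add_mono L.nrm_triangle L.mem_diff) auto
    finally show ?thesis using step1[of m] step2[of m] step3[of m] by linarith
  qed
  have "(\<lambda>m. L.nrm (u - um m) + \<epsilon> * L.nrm f
      + 4 * (\<Sum>l\<in>I. wt l * (\<delta> / (\<delta> + t l))) * L.nrm f + w * L.nrm (f - fm m)) \<longlonglongrightarrow>
      0 + \<epsilon> * L.nrm f + 4 * (\<Sum>l\<in>I. wt l * (\<delta> / (\<delta> + t l))) * L.nrm f + w * 0"
    using complete[OF fH] complete[OF uH] unfolding um_def fm_def comb_def by (intro tendsto_intros)
  then have "L.nrm (u - Q f) \<le> 0 + \<epsilon> * L.nrm f + 4 * (\<Sum>l\<in>I. wt l * (\<delta> / (\<delta> + t l))) * L.nrm f + w * 0"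
    using bound by (intro LIMSEQ_le_const) auto
  then show ?thesis by (simp add: Q_def algebra_simps)
qed

end

section \<open>Square integrable functions and antiderivatives on an interval\<close>

lemma sets_Icc_lebesgue [simp]: "{a..b::real} \<in> sets lebesgue"
  by simp

lemma finite_measure_Icc: "finite_measure (lebesgue_on {a..b::real})"
  by (rule finite_measure_lebesgue_on) (metis cbox_interval lmeasurable_cbox)

lemma L2_intervalD:
  assumes "L2_interval l f"
  shows "f \<in> borel_measurable (lebesgue_on {0..l})" "integrable (lebesgue_on {0..l}) (\<lambda>x. (f x)\<^sup>2)"
  using assms by (auto simp: L2_interval_def)

lemma L2_interval_integrable_mult:
  assumes "L2_interval l f" "L2_interval l g"
  shows "integrable (lebesgue_on {0..l}) (\<lambda>x. f x * g x)"
proof (rule Bochner_Integration.integrable_bound)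
  show "integrable (lebesgue_on {0..l}) (\<lambda>x. (f x)\<^sup>2 + (g x)\<^sup>2)"
    using assms by (auto simp: L2_interval_def)
  show "(\<lambda>x. f x * g x) \<in> borel_measurable (lebesgue_on {0..l})"
    using assms by (auto simp: L2_interval_def)
  show "AE x in lebesgue_on {0..l}. norm (f x * g x) \<le> norm ((f x)\<^sup>2 + (g x)\<^sup>2)"
  proof (rule AE_I2)
    fix x
    have "2 * (\<bar>f x\<bar> * \<bar>g x\<bar>) \<le> \<bar>f x\<bar>\<^sup>2 + \<bar>g x\<bar>\<^sup>2"
      using sum_squares_bound[of "\<bar>f x\<bar>" "\<bar>g x\<bar>"] by simp
    moreover have "0 \<le> \<bar>f x\<bar> * \<bar>g x\<bar>" by simp
    ultimately have "\<bar>f x\<bar> * \<bar>g x\<bar> \<le> (f x)\<^sup>2 + (g x)\<^sup>2" unfolding power2_abs by linarith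
    then show "norm (f x * g x) \<le> norm ((f x)\<^sup>2 + (g x)\<^sup>2)" by (simp add: abs_mult)
  qed
qed

lemma L2_interval_const: "L2_interval l (\<lambda>x. c)"
  using finite_measure.integrable_const[OF finite_measure_Icc] by (simp add: L2_interval_def)

lemma L2_interval_integrable:
  assumes "L2_interval l f"
  shows "integrable (lebesgue_on {0..l}) f"
  using L2_interval_integrable_mult[OF assms L2_interval_const[of l 1]] by simp

lemma L2_interval_bounded_mult:
  assumes "L2_interval l f" "g \<in> borel_measurable (lebesgue_on {0..l})"
    and "AE x in lebesgue_on {0..l}. \<bar>g x\<bar> \<le> M"
  shows "L2_interval l (\<lambda>x. g x * f x)"
  unfolding L2_interval_def
proof
  show m: "(\<lambda>x. g x * f x) \<in> borel_measurable (lebesgue_on {0..l})"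
    using assms by (auto simp: L2_interval_def)
  show "integrable (lebesgue_on {0..l}) (\<lambda>x. (g x * f x)\<^sup>2)"
  proof (rule Bochner_Integration.integrable_bound)
    show "integrable (lebesgue_on {0..l}) (\<lambda>x. M\<^sup>2 * (f x)\<^sup>2)"
      using assms by (auto simp: L2_interval_def)
    show "(\<lambda>x. (g x * f x)\<^sup>2) \<in> borel_measurable (lebesgue_on {0..l})" using m by simp
    show "AE x in lebesgue_on {0..l}. norm ((g x * f x)\<^sup>2) \<le> norm (M\<^sup>2 * (f x)\<^sup>2)"
      using assms(3)
    proof eventually_elim
      case (elim x)
      then have "(g x)\<^sup>2 \<le> M\<^sup>2" by (metis abs_ge_zero order_trans abs_le_square_iff abs_of_nonneg)
      then show ?case by (simp add: power_mult_distrib mult_right_mono)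
    qed
  qed
qed

lemma L2_interval_cmult: "L2_interval l f \<Longrightarrow> L2_interval l (\<lambda>x. c * f x)"
  by (rule L2_interval_bounded_mult[where M = "\<bar>c\<bar>"]) auto

lemma L2_interval_add:
  assumes "L2_interval l f" "L2_interval l g"
  shows "L2_interval l (\<lambda>x. f x + g x)"
proof -
  have "integrable (lebesgue_on {0..l}) (\<lambda>x. (f x)\<^sup>2 + (g x)\<^sup>2 + 2 * (f x * g x))"
    using assms L2_interval_integrable_mult[OF assms]
    by (intro Bochner_Integration.integrable_add integrable_mult_right) (auto simp: L2_interval_def)
  moreover have "(\<lambda>x. (f x)\<^sup>2 + (g x)\<^sup>2 + 2 * (f x * g x)) = (\<lambda>x. (f x + g x)\<^sup>2)"
    by (simp add: fun_eq_iff power2_sum)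
  ultimately show ?thesis
    using borel_measurable_add[OF assms[THEN L2_intervalD(1)]] by (simp add: L2_interval_def)
qed

lemma L2_interval_diff: "\<lbrakk>L2_interval l f; L2_interval l g\<rbrakk> \<Longrightarrow> L2_interval l (\<lambda>x. f x - g x)"
  using L2_interval_add[of l f "\<lambda>x. (-1) * g x"] L2_interval_cmult[of l g "-1"] by simp

lemma L2_interval_continuous:
  assumes "continuous_on {0..l} f"
  shows "L2_interval l f"
proof -
  have m: "f \<in> borel_measurable (lebesgue_on {0..l})"
    using assms by (rule continuous_imp_measurable_on_sets_lebesgue) simp
  have "compact (f ` {0..l})" using assms by (intro compact_continuous_image) auto
  then obtain M where "\<forall>y\<in>f ` {0..l}. norm y \<le> M" using compact_imp_bounded bounded_iff by metis
  then have "AE x in lebesgue_on {0..l}. \<bar>f x\<bar> \<le> M" by (intro AE_I2) auto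
  from L2_interval_bounded_mult[OF L2_interval_const[of l 1] m this] show ?thesis by simp
qed

lemma integrable_lebesgue_on_Icc_subset:
  fixes f :: "real \<Rightarrow> real"
  assumes "integrable (lebesgue_on {a..b}) f" "{c..d} \<subseteq> {a..b}"
  shows "integrable (lebesgue_on {c..d}) f"
  using assms by (rule Equivalence_Lebesgue_Henstock_Integration.integrable_subinterval)

lemma L2_interval_mono:
  assumes "L2_interval l f" "x \<le> l"
  shows "L2_interval x f"
proof -
  have "f \<in> borel_measurable (lebesgue_on {0..x})"
    by (rule measurable_restrict_mono[OF L2_intervalD(1)[OF assms(1)]]) (use assms(2) in auto)
  moreover have "integrable (lebesgue_on {0..x}) (\<lambda>x. (f x)\<^sup>2)"
    by (rule integrable_lebesgue_on_Icc_subset[OF L2_intervalD(2)[OF assms(1)]]) (use assms(2) in auto)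
  ultimately show ?thesis by (simp add: L2_interval_def)
qed

lemma LINT_Icc_eq_integral:
  fixes f :: "real \<Rightarrow> real"
  assumes "integrable (lebesgue_on {a..b}) f"
  shows "(LINT x|lebesgue_on {a..b}. f x) = integral {a..b} f"
  using assms by (intro lebesgue_integral_eq_integral) auto

section \<open>Borel representatives and vanishing integrals\<close>

text \<open>Lebesgue measurable functions are replaced by Borel functions on the whole line, because
  Fubini's theorem and the uniqueness of densities are applied to \<open>lborel\<close>.\<close>

lemma borel_representative:
  fixes f :: "real \<Rightarrow> real"
  assumes "integrable (lebesgue_on {a..b}) f"
  obtains F where "F \<in> borel_measurable lborel" "integrable lborel F" "\<And>x. x \<notin> {a..b} \<Longrightarrow> F x = 0"
    "AE x in lebesgue_on {a..b}. F x = f x"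
proof -
  let ?g = "\<lambda>x. if x \<in> {a..b} then f x else 0"
  have g: "integrable lebesgue ?g"
    by (rule iffD2[OF Lebesgue_Measure.integrable_restrict_UNIV[OF sets_Icc_lebesgue] assms])
  then obtain F0 where F0: "F0 \<in> borel_measurable lborel" "AE x in lborel. ?g x = F0 x"
    using completion_ex_borel_measurable_real[of ?g lborel] by auto
  define F where "F = (\<lambda>x. indicator {a..b} x * F0 x)"
  have Fm: "F \<in> borel_measurable lborel" unfolding F_def using F0(1) by simp
  have ae: "AE x in lebesgue. ?g x = F x"
    using AE_completion[OF F0(2)] by eventually_elim (simp add: F_def indicator_def split: if_splits)
  have "integrable lebesgue F"
    by (rule integrable_cong_AE_imp[OF g _ ae]) (use Fm in \<open>simp add: measurable_completion\<close>)
  then have "integrable lborel F" using Fm by (simp add: integrable_completion)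
  moreover have "AE x in lebesgue_on {a..b}. F x = f x"
    using ae by (subst AE_restrict_space_iff) (auto elim: eventually_mono)
  ultimately show ?thesis using that[of F] Fm by (auto simp: F_def)
qed

lemma LINT_lborel_representative:
  fixes f :: "real \<Rightarrow> real"
  assumes "F \<in> borel_measurable lborel" "\<And>x. x \<notin> {a..b} \<Longrightarrow> F x = 0"
    "AE x in lebesgue_on {a..b}. F x = f x" "f \<in> borel_measurable (lebesgue_on {a..b})"
  shows "(LINT x|lborel. F x) = (LINT x|lebesgue_on {a..b}. f x)"
proof -
  have "(LINT x|lborel. F x) = (LINT x|lebesgue. F x)"
    using assms(1) by (simp add: integral_completion)
  also have "\<dots> = (LINT x|lebesgue. indicator {a..b} x *\<^sub>R F x)"
    using assms(2) by (intro Bochner_Integration.integral_cong) (auto simp: indicator_def)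
  also have "\<dots> = (LINT x|lebesgue_on {a..b}. F x)"
    by (rule integral_restrict_space[symmetric]) simp
  also have "\<dots> = (LINT x|lebesgue_on {a..b}. f x)"
    by (rule integral_cong_AE[OF measurable_restrict_space1[OF measurable_completion[OF assms(1)]] assms(4,3)])
  finally show ?thesis .
qed

text \<open>Extended by 0, the function integrates to 0 over all half-lines up to x. These form an
  intersection-stable generator of the Borel sets, so it integrates to 0 over every Borel set and
  vanishes almost everywhere.\<close>

lemma AE_zero_if_integral_zero:
  fixes D :: "real \<Rightarrow> real"
  assumes D: "integrable (lebesgue_on {0..l}) D" and z: "\<And>x. x \<in> {0..l} \<Longrightarrow> integral {0..x} D = 0"
  shows "AE x in lebesgue_on {0..l}. D x = 0"
proof -
  obtain F where F: "F \<in> borel_measurable lborel" "integrable lborel F" "\<And>x. x \<notin> {0..l} \<Longrightarrow> F x = 0"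
    "AE x in lebesgue_on {0..l}. F x = D x"
    using borel_representative[OF D] by blast
  have atMost: "set_lebesgue_integral lborel {..x} F = 0" for x
  proof -
    \<comment> \<open>Truncation at l reduces half-lines to intervals starting at 0; a negative x
      gives the empty one.\<close>
    define y where "y = min x l"
    have y: "{0..y} \<subseteq> {0..l}" by (auto simp: y_def)
    have sub: "integrable (lebesgue_on {0..y}) D" by (rule integrable_lebesgue_on_Icc_subset[OF D y])
    have "AE t in lebesgue. t \<in> {0..l} \<longrightarrow> F t = D t"
      using F(4) by (subst (asm) AE_restrict_space_iff) auto
    then have ae: "AE t in lebesgue_on {0..y}. indicator {..x} t *\<^sub>R F t = D t"
      by (subst AE_restrict_space_iff) (auto simp: y_def elim: eventually_mono)
    have "set_lebesgue_integral lborel {..x} F = (LINT t|lebesgue_on {0..y}. D t)"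
      unfolding set_lebesgue_integral_def
    proof (rule LINT_lborel_representative[OF _ _ ae])
      show "indicator {..x} t *\<^sub>R F t = 0" if "t \<notin> {0..y}" for t
        using that F(3)[of t] by (auto simp: y_def indicator_def)
    qed (use F sub in auto)
    also have "\<dots> = integral {0..y} D" by (rule LINT_Icc_eq_integral[OF sub])
    also have "\<dots> = 0"
    proof (cases "0 \<le> y")
      case True then show ?thesis using z[of y] by (simp add: y_def)
    qed simp
    finally show ?thesis .
  qed
  have tot: "(LINT x|lborel. F x) = 0"
  proof -
    have "(LINT x|lborel. F x) = set_lebesgue_integral lborel {..l} F"
      unfolding set_lebesgue_integral_def using F(3)
      by (intro Bochner_Integration.integral_cong) (auto simp: indicator_def)
    then show ?thesis using atMost by simp
  qed
  have "set_lebesgue_integral lborel A F = 0" if "A \<in> sets lborel" for A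
  proof -
    have "Int_stable (range (\<lambda>x::real. {..x}))"
      by (auto simp: Int_stable_def)
    moreover have "range (\<lambda>x::real. {..x}) \<subseteq> Pow UNIV" by simp
    moreover have "A \<in> sigma_sets UNIV (range (\<lambda>x::real. {..x}))"
      using that by (simp add: borel_eq_atMost)
    ultimately show ?thesis
    proof (induction rule: sigma_sets_induct_disjoint)
      case (compl A)
      then have A: "A \<in> sets lborel" by (simp add: borel_eq_atMost)
      have "set_lebesgue_integral lborel (UNIV - A) F = (LINT x|lborel. F x - indicator A x *\<^sub>R F x)"
        unfolding set_lebesgue_integral_def
        by (intro Bochner_Integration.integral_cong) (auto simp: indicator_def)
      also have "\<dots> = (LINT x|lborel. F x) - set_lebesgue_integral lborel A F"
        unfolding set_lebesgue_integral_def using F(2) A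
        by (intro Bochner_Integration.integral_diff integrable_mult_indicator) auto
      finally show ?case using tot compl by simp
    next
      case (union A)
      then have A: "A i \<in> sets lborel" for i by (auto simp: borel_eq_atMost)
      have "set_lebesgue_integral lborel (\<Union>i. A i) F = (\<Sum>i. set_lebesgue_integral lborel (A i) F)"
      proof (rule lebesgue_integral_countable_add)
        show "A i \<inter> A j = {}" if "i \<noteq> j" for i j
          using union(1) that by (auto simp: disjoint_family_on_def)
        show "set_integrable lborel (\<Union>i. A i) F"
          unfolding set_integrable_def by (rule integrable_mult_indicator[OF _ F(2)]) (use A in auto)
      qed (rule A)
      then show ?case using union by simp
    next
      case (basic A)
      then show ?case using atMost by auto
    qed (simp add: set_lebesgue_integral_def)
  qed
  then have "AE x in lborel. F x = 0"
    using sigma_finite_measure.density_zero[OF sigma_finite_lborel F(2)] by simp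
  then have "AE x in lebesgue. F x = 0" by (rule AE_completion)
  then have "AE x in lebesgue_on {0..l}. F x = 0"
    by (subst AE_restrict_space_iff) (auto elim: eventually_mono)
  then show ?thesis using F(4) by eventually_elim simp
qed

section \<open>Absolutely continuous functions with square integrable derivative\<close>

text \<open>This singles out the continuous representative of an H1 function: f is pinned down at
  every point of the interval, g only up to null sets. End point values thus have a meaning without
  trace operators.\<close>

definition antideriv :: "real \<Rightarrow> (real \<Rightarrow> real) \<Rightarrow> (real \<Rightarrow> real) \<Rightarrow> bool" where
  "antideriv l f g \<longleftrightarrow> L2_interval l g \<and> (\<forall>x\<in>{0..l}. f x = f 0 + integral {0..x} g)"

lemma L2_interval_integrable_on:
  assumes "L2_interval l g"
  shows "g integrable_on {0..l}"
  using integrable_on_lebesgue_on[OF L2_interval_integrable[OF assms]] by simp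

lemma antideriv_L2: "antideriv l f g \<Longrightarrow> L2_interval l g"
  by (simp add: antideriv_def)

lemma antideriv_eq: "\<lbrakk>antideriv l f g; x \<in> {0..l}\<rbrakk> \<Longrightarrow> f x = f 0 + integral {0..x} g"
  unfolding antideriv_def by blast

lemma antideriv_diff_eq:
  assumes "antideriv l f g" "0 \<le> x" "x \<le> y" "y \<le> l"
  shows "f y - f x = integral {x..y} g"
proof -
  have "g integrable_on {0..y}"
    using L2_interval_integrable_on[OF L2_interval_mono[OF antideriv_L2[OF assms(1)] assms(4)]] .
  then have "integral {0..x} g + integral {x..y} g = integral {0..y} g"
    using assms by (intro Henstock_Kurzweil_Integration.integral_combine) auto
  then show ?thesis using antideriv_eq[OF assms(1), of x] antideriv_eq[OF assms(1), of y] assms by auto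
qed

lemma antideriv_continuous:
  assumes "antideriv l f g"
  shows "continuous_on {0..l} f"
proof -
  have "continuous_on {0..l} (\<lambda>x. f 0 + integral {0..x} g)"
    using L2_interval_integrable_on[OF antideriv_L2[OF assms]]
    by (intro continuous_intros indefinite_integral_continuous_1)
  then show ?thesis
    by (rule continuous_on_eq) (rule antideriv_eq[OF assms, symmetric])
qed

lemma antideriv_mono:
  assumes "antideriv l f g" "x \<le> l"
  shows "antideriv x f g"
  unfolding antideriv_def
proof (intro conjI ballI)
  show "L2_interval x g" using antideriv_L2[OF assms(1)] assms(2) by (rule L2_interval_mono)
  fix y assume "y \<in> {0..x}"
  then show "f y = f 0 + integral {0..y} g" using assms(2) by (intro antideriv_eq[OF assms(1)]) simp
qed

lemma antideriv_cong:
  assumes "antideriv l f g" "\<And>x. x \<in> {0..l} \<Longrightarrow> f x = f' x" "0 \<le> l"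
  shows "antideriv l f' g"
  unfolding antideriv_def
proof (intro conjI ballI antideriv_L2[OF assms(1)])
  fix x assume x: "x \<in> {0..l}"
  have "f' x = f x" "f' 0 = f 0" using assms(2)[of x] assms(2)[of 0] assms(3) x by simp_all
  then show "f' x = f' 0 + integral {0..x} g" by (simp only: antideriv_eq[OF assms(1) x, symmetric])
qed

lemma integral_cong_AE_on:
  fixes g g' :: "real \<Rightarrow> real"
  assumes "AE x in lebesgue_on {0..l}. g x = g' x" "L2_interval l g" "L2_interval l g'" "x \<le> l"
  shows "integral {0..x} g = integral {0..x} g'"
proof -
  have g: "L2_interval x g" "L2_interval x g'" using assms L2_interval_mono by auto
  have "AE t in lebesgue. t \<in> {0..l} \<longrightarrow> g t = g' t"
    using assms(1) by (subst (asm) AE_restrict_space_iff) auto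
  then have "AE t in lebesgue_on {0..x}. g t = g' t"
    using assms(4) by (subst AE_restrict_space_iff) (auto elim: eventually_mono)
  then have "(LINT t|lebesgue_on {0..x}. g t) = (LINT t|lebesgue_on {0..x}. g' t)"
    using g[THEN L2_intervalD(1)] by (intro integral_cong_AE)
  then show ?thesis using LINT_Icc_eq_integral[OF L2_interval_integrable] g by metis
qed

lemma antideriv_cong_AE:
  assumes "antideriv l f g" "L2_interval l g'" "AE x in lebesgue_on {0..l}. g x = g' x"
  shows "antideriv l f g'"
  unfolding antideriv_def
proof (intro conjI ballI assms(2))
  fix x assume x: "x \<in> {0..l}"
  then show "f x = f 0 + integral {0..x} g'"
    using antideriv_eq[OF assms(1) x] integral_cong_AE_on[OF assms(3) antideriv_L2[OF assms(1)] assms(2), of x] by auto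
qed

lemma antideriv_unique_AE:
  assumes "antideriv l f g" "antideriv l f' g'" "\<And>x. x \<in> {0..l} \<Longrightarrow> f x - f' x = c"
  shows "AE x in lebesgue_on {0..l}. g x = g' x"
proof -
  have d: "L2_interval l (\<lambda>x. g x - g' x)" by (rule L2_interval_diff[OF antideriv_L2[OF assms(1)] antideriv_L2[OF assms(2)]])
  have "AE x in lebesgue_on {0..l}. g x - g' x = 0"
  proof (rule AE_zero_if_integral_zero[OF L2_interval_integrable[OF d]])
    fix x assume x: "x \<in> {0..l}"
    then have le: "x \<le> l" "0 \<in> {0..l}" by auto
    have "g integrable_on {0..x}" "g' integrable_on {0..x}"
      using L2_interval_mono[OF antideriv_L2[OF assms(1)] le(1)] L2_interval_mono[OF antideriv_L2[OF assms(2)] le(1)]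
      by (auto intro: L2_interval_integrable_on)
    then have "integral {0..x} (\<lambda>x. g x - g' x) = integral {0..x} g - integral {0..x} g'"
      by (rule Henstock_Kurzweil_Integration.integral_diff)
    also have "\<dots> = (f x - f' x) - (f 0 - f' 0)"
      using antideriv_eq[OF assms(1) x] antideriv_eq[OF assms(2) x] by simp
    finally show "integral {0..x} (\<lambda>x. g x - g' x) = 0" using assms(3)[OF x] assms(3)[OF le(2)] by simp
  qed
  then show ?thesis by eventually_elim simp
qed

lemma antideriv_add:
  assumes "antideriv l f f'" "antideriv l g g'"
  shows "antideriv l (\<lambda>x. f x + g x) (\<lambda>x. f' x + g' x)"
  unfolding antideriv_def
proof (intro conjI ballI)
  show "L2_interval l (\<lambda>x. f' x + g' x)" by (rule L2_interval_add[OF antideriv_L2[OF assms(1)] antideriv_L2[OF assms(2)]])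
  fix x assume x: "x \<in> {0..l}"
  then have "f' integrable_on {0..x}" "g' integrable_on {0..x}"
    using L2_interval_mono[OF antideriv_L2[OF assms(1)], of x] L2_interval_mono[OF antideriv_L2[OF assms(2)], of x]
    by (auto intro: L2_interval_integrable_on)
  then have "integral {0..x} (\<lambda>x. f' x + g' x) = integral {0..x} f' + integral {0..x} g'"
    by (rule Henstock_Kurzweil_Integration.integral_add)
  then show "f x + g x = f 0 + g 0 + integral {0..x} (\<lambda>x. f' x + g' x)"
    using antideriv_eq[OF assms(1) x] antideriv_eq[OF assms(2) x] by simp
qed

lemma antideriv_cmult:
  assumes "antideriv l f f'"
  shows "antideriv l (\<lambda>x. c * f x) (\<lambda>x. c * f' x)"
  unfolding antideriv_def
proof (intro conjI ballI)
  show "L2_interval l (\<lambda>x. c * f' x)" using antideriv_L2[OF assms] by (rule L2_interval_cmult)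
  fix x assume x: "x \<in> {0..l}"
  show "c * f x = c * f 0 + integral {0..x} (\<lambda>x. c * f' x)"
    using antideriv_eq[OF assms(1) x] by (simp add: algebra_simps)
qed

lemma antideriv_of_derivative:
  assumes "0 \<le> l" "\<And>x. x \<in> {0..l} \<Longrightarrow> (f has_real_derivative g x) (at x within {0..l})" "continuous_on {0..l} g"
  shows "antideriv l f g"
  unfolding antideriv_def
proof (intro conjI ballI L2_interval_continuous assms(3))
  fix x assume x: "x \<in> {0..l}"
  have "(g has_integral f x - f 0) {0..x}"
  proof (rule fundamental_theorem_of_calculus)
    fix y assume "y \<in> {0..x}"
    then have "(f has_real_derivative g y) (at y within {0..x})"
      using x by (intro has_field_derivative_subset[OF assms(2)]) auto
    then show "(f has_vector_derivative g y) (at y within {0..x})"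
      by (simp add: has_real_derivative_iff_has_vector_derivative)
  qed (use x in auto)
  then show "f x = f 0 + integral {0..x} g" by (simp add: integral_unique)
qed

lemma antideriv_has_derivative:
  assumes "antideriv l f g" "continuous_on {0..l} g" "x \<in> {0..l}"
  shows "(f has_real_derivative g x) (at x within {0..l})"
proof -
  have "((\<lambda>u. integral {0..u} g) has_real_derivative g x) (at x within {0..l})"
    using integral_has_real_derivative[OF assms(2,3)] .
  then have "((\<lambda>u. f 0 + integral {0..u} g) has_real_derivative g x) (at x within {0..l})"
    by (auto intro!: derivative_eq_intros)
  then show ?thesis
    by (rule has_field_derivative_transform_within[where d = 1])
      (use assms(3) in \<open>auto intro: antideriv_eq[OF assms(1), symmetric]\<close>)
qed

text \<open>Both functions are written as integrals and Fubini is applied to the triangles \<open>s \<le> t\<close> and \<open>t < s\<close>.\<close>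

lemma integration_by_parts_antideriv:
  assumes f: "antideriv l f f'" and g: "antideriv l g g'" and l: "0 \<le> l"
  shows "(LINT x|lebesgue_on {0..l}. f x * g' x) + (LINT x|lebesgue_on {0..l}. f' x * g x) = f l * g l - f 0 * g 0"
proof -
  obtain F where F: "F \<in> borel_measurable lborel" "integrable lborel F" "\<And>x. x \<notin> {0..l} \<Longrightarrow> F x = 0"
    "AE x in lebesgue_on {0..l}. F x = f' x"
    using borel_representative[OF L2_interval_integrable[OF antideriv_L2[OF f]]] by blast
  obtain H where H: "H \<in> borel_measurable lborel" "integrable lborel H" "\<And>x. x \<notin> {0..l} \<Longrightarrow> H x = 0"
    "AE x in lebesgue_on {0..l}. H x = g' x"
    using borel_representative[OF L2_interval_integrable[OF antideriv_L2[OF g]]] by blast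
  have Fm[measurable]: "F \<in> borel_measurable borel" and Hm[measurable]: "H \<in> borel_measurable borel"
    using F(1) H(1) by simp_all
  \<comment> \<open>A single point is a null set, so closed and open half-lines serve alike; the
    closed one belongs to the triangle s \<le> t, the open one to t < s.\<close>
  have prim: "u t = u 0 + (LINT s|lborel. indicator S s * U s)"
    if u: "antideriv l u u'" and t: "t \<in> {0..l}" and U: "U \<in> borel_measurable borel" "\<And>x. x \<notin> {0..l} \<Longrightarrow> U x = 0"
      "AE x in lebesgue_on {0..l}. U x = u' x" and S: "S = {..t} \<or> S = {..<t}" for u u' U t S
  proof -
    have "AE x in lebesgue. x \<in> {0..l} \<longrightarrow> U x = u' x"
      using U(3) by (subst (asm) AE_restrict_space_iff) auto
    moreover have "AE x in lebesgue. x \<noteq> t"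
      using AE_completion[OF AE_lborel_singleton[of t]] .
    ultimately have "AE x in lebesgue. x \<in> {0..t} \<longrightarrow> indicator S x * U x = u' x"
    proof eventually_elim
      case (elim x)
      then show ?case using t S by (auto simp: indicator_def)
    qed
    then have ae: "AE x in lebesgue_on {0..t}. indicator S x * U x = u' x"
      by (subst AE_restrict_space_iff) auto
    have L: "L2_interval t u'" using t antideriv_L2[OF u] by (auto intro: L2_interval_mono)
    have "(LINT s|lborel. indicator S s * U s) = (LINT s|lebesgue_on {0..t}. u' s)"
    proof (rule LINT_lborel_representative[OF _ _ ae L2_intervalD(1)[OF L]])
      show "(\<lambda>x. indicator S x * U x) \<in> borel_measurable lborel" using U(1) S by auto
      show "indicator S x * U x = 0" if "x \<notin> {0..t}" for x
        using that S U(2)[of x] t by (auto simp: indicator_def)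
    qed
    also have "\<dots> = integral {0..t} u'" by (rule LINT_Icc_eq_integral[OF L2_interval_integrable[OF L]])
    finally show ?thesis using antideriv_eq[OF u t] by simp
  qed
  let ?K1 = "\<lambda>s t. indicator {..t} s * F s * H t" and ?K2 = "\<lambda>s t. indicator {..<s} t * F s * H t"
  have "integrable (lborel \<Otimes>\<^sub>M lborel) (\<lambda>(s, t). F s * H t)"
  proof (rule lborel_pair.Fubini_integrable)
    show "(\<lambda>(s, t). F s * H t) \<in> borel_measurable (lborel \<Otimes>\<^sub>M lborel)" by measurable
    show "integrable lborel (\<lambda>s. LINT t|lborel. norm (case (s, t) of (s, t) \<Rightarrow> F s * H t))"
      using F(2) H(2) by (simp add: abs_mult)
    show "AE s in lborel. integrable lborel (\<lambda>t. case (s, t) of (s, t) \<Rightarrow> F s * H t)"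
      using H(2) by simp
  qed
  note FH = this
  have K1: "integrable (lborel \<Otimes>\<^sub>M lborel) (\<lambda>(s, t). ?K1 s t)"
    by (rule Bochner_Integration.integrable_bound[OF FH]) (auto simp: indicator_def abs_mult)
  have K2: "integrable (lborel \<Otimes>\<^sub>M lborel) (\<lambda>(s, t). ?K2 s t)"
    by (rule Bochner_Integration.integrable_bound[OF FH]) (auto simp: indicator_def abs_mult)
  have intF: "(LINT s|lborel. F s) = f l - f 0"
  proof -
    have "(LINT s|lborel. F s) = (LINT s|lborel. indicator {..l} s * F s)"
      using F(3) by (intro Bochner_Integration.integral_cong) (auto simp: indicator_def)
    then show ?thesis using prim[OF f _ Fm F(3,4), of l "{..l}"] l by simp
  qed
  have intH: "(LINT s|lborel. H s) = g l - g 0"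
  proof -
    have "(LINT s|lborel. H s) = (LINT s|lborel. indicator {..l} s * H s)"
      using H(3) by (intro Bochner_Integration.integral_cong) (auto simp: indicator_def)
    then show ?thesis using prim[OF g _ Hm H(3,4), of l "{..l}"] l by simp
  qed
  have mf: "f \<in> borel_measurable (lebesgue_on {0..l})" "g \<in> borel_measurable (lebesgue_on {0..l})"
    using L2_interval_continuous[OF antideriv_continuous] f g by (auto intro: L2_intervalD(1))
  have i1: "(LINT t|lborel. LINT s|lborel. ?K1 s t) = (LINT x|lebesgue_on {0..l}. f x * g' x) - f 0 * (g l - g 0)"
  proof -
    have eq: "(LINT s|lborel. ?K1 s t) = (f t - f 0) * H t" for t
    proof (cases "t \<in> {0..l}")
      case True
      then show ?thesis using prim[OF f True Fm F(3,4), of "{..t}"] by simp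
    qed (simp add: H(3))
    have "(LINT t|lborel. LINT s|lborel. ?K1 s t) = (LINT x|lebesgue_on {0..l}. (f x - f 0) * g' x)"
    proof (rule LINT_lborel_representative)
      show "(\<lambda>t. LINT s|lborel. ?K1 s t) \<in> borel_measurable lborel"
        by (rule borel_measurable_integrable[OF lborel_pair.integrable_snd[OF K1]])
      show "(LINT s|lborel. ?K1 s t) = 0" if "t \<notin> {0..l}" for t using that H(3) by simp
      show "AE t in lebesgue_on {0..l}. (LINT s|lborel. ?K1 s t) = (f t - f 0) * g' t"
        unfolding eq using H(4) by eventually_elim simp
      show "(\<lambda>x. (f x - f 0) * g' x) \<in> borel_measurable (lebesgue_on {0..l})"
        using mf L2_intervalD(1)[OF antideriv_L2[OF g]] by auto
    qed
    also have "\<dots> = (LINT x|lebesgue_on {0..l}. f x * g' x - f 0 * g' x)"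
      by (simp add: algebra_simps)
    also have "\<dots> = (LINT x|lebesgue_on {0..l}. f x * g' x) - (LINT x|lebesgue_on {0..l}. f 0 * g' x)"
      using L2_interval_integrable_mult[OF L2_interval_continuous[OF antideriv_continuous[OF f]] antideriv_L2[OF g]]
        L2_interval_integrable[OF antideriv_L2[OF g]]
      by (intro Bochner_Integration.integral_diff) auto
    also have "(LINT x|lebesgue_on {0..l}. f 0 * g' x) = f 0 * (LINT x|lborel. H x)"
      using LINT_lborel_representative[OF H(1,3,4) L2_intervalD(1)[OF antideriv_L2[OF g]]] by simp
    finally show ?thesis by (simp add: intH)
  qed
  have i2: "(LINT s|lborel. LINT t|lborel. ?K2 s t) = (LINT x|lebesgue_on {0..l}. f' x * g x) - g 0 * (f l - f 0)"
  proof -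
    have eq: "(LINT t|lborel. ?K2 s t) = F s * (g s - g 0)" for s
    proof (cases "s \<in> {0..l}")
      case True
      have "(LINT t|lborel. ?K2 s t) = (LINT t|lborel. F s * (indicator {..<s} t * H t))"
        by (simp add: mult_ac)
      then show ?thesis using prim[OF g True Hm H(3,4), of "{..<s}"] by simp
    qed (simp add: F(3))
    have "(LINT s|lborel. LINT t|lborel. ?K2 s t) = (LINT x|lebesgue_on {0..l}. f' x * (g x - g 0))"
    proof (rule LINT_lborel_representative)
      show "(\<lambda>s. LINT t|lborel. ?K2 s t) \<in> borel_measurable lborel"
        by (rule borel_measurable_integrable[OF lborel_pair.integrable_fst[OF K2]])
      show "(LINT t|lborel. ?K2 s t) = 0" if "s \<notin> {0..l}" for s using that F(3) by simp
      show "AE s in lebesgue_on {0..l}. (LINT t|lborel. ?K2 s t) = f' s * (g s - g 0)"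
        unfolding eq using F(4) by eventually_elim simp
      show "(\<lambda>x. f' x * (g x - g 0)) \<in> borel_measurable (lebesgue_on {0..l})"
        using mf L2_intervalD(1)[OF antideriv_L2[OF f]] by auto
    qed
    also have "\<dots> = (LINT x|lebesgue_on {0..l}. f' x * g x - g 0 * f' x)"
      by (simp add: algebra_simps)
    also have "\<dots> = (LINT x|lebesgue_on {0..l}. f' x * g x) - (LINT x|lebesgue_on {0..l}. g 0 * f' x)"
      using L2_interval_integrable_mult[OF antideriv_L2[OF f] L2_interval_continuous[OF antideriv_continuous[OF g]]]
        L2_interval_integrable[OF antideriv_L2[OF f]]
      by (intro Bochner_Integration.integral_diff) auto
    also have "(LINT x|lebesgue_on {0..l}. g 0 * f' x) = g 0 * (LINT x|lborel. F x)"
      using LINT_lborel_representative[OF F(1,3,4) L2_intervalD(1)[OF antideriv_L2[OF f]]] by simp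
    finally show ?thesis by (simp add: intF)
  qed
  have "(LINT t|lborel. LINT s|lborel. ?K1 s t) + (LINT s|lborel. LINT t|lborel. ?K2 s t)
      = integral\<^sup>L (lborel \<Otimes>\<^sub>M lborel) (\<lambda>(s, t). ?K1 s t) + integral\<^sup>L (lborel \<Otimes>\<^sub>M lborel) (\<lambda>(s, t). ?K2 s t)"
    using lborel_pair.integral_snd[OF K1] lborel_pair.integral_fst[OF K2] by simp
  also have "\<dots> = integral\<^sup>L (lborel \<Otimes>\<^sub>M lborel) (\<lambda>p. (case p of (s, t) \<Rightarrow> ?K1 s t) + (case p of (s, t) \<Rightarrow> ?K2 s t))"
    using K1 K2 by (intro Bochner_Integration.integral_add[symmetric])
  also have "(\<lambda>p. (case p of (s, t) \<Rightarrow> ?K1 s t) + (case p of (s, t) \<Rightarrow> ?K2 s t)) = (\<lambda>(s, t). F s * H t)"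
    by (auto simp: fun_eq_iff indicator_def)
  also have "integral\<^sup>L (lborel \<Otimes>\<^sub>M lborel) (\<lambda>(s, t). F s * H t) = (f l - f 0) * (g l - g 0)"
    using lborel_pair.integral_fst[OF FH] by (simp add: intF intH)
  finally show ?thesis unfolding i1 i2 by (simp add: algebra_simps)
qed

section \<open>Weak derivatives and the lemma of du Bois-Reymond\<close>

lemma weak_deriv_antideriv:
  assumes fg: "antideriv l f g" and l: "0 < l"
  shows "weak_deriv l f g"
  unfolding weak_deriv_def
proof (intro conjI allI impI)
  show "L2_interval l g" using fg by (rule antideriv_L2)
  fix \<psi> \<psi>' :: "real \<Rightarrow> real" and c d
  assume cd: "0 < c" "d < l" and z: "\<forall>x. x \<notin> {c..d} \<longrightarrow> \<psi> x = 0"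
    and D: "\<forall>x. (\<psi> has_real_derivative \<psi>' x) (at x)" and C: "continuous_on UNIV \<psi>'"
  have "antideriv l \<psi> \<psi>'"
    using l D C by (intro antideriv_of_derivative) (auto intro: has_field_derivative_at_within continuous_on_subset)
  moreover have "\<psi> 0 = 0" "\<psi> l = 0" using z cd by auto
  ultimately show "(LINT x|lebesgue_on {0..l}. f x * \<psi>' x) = - (LINT x|lebesgue_on {0..l}. g x * \<psi> x)"
    using integration_by_parts_antideriv[OF fg, of \<psi> \<psi>'] l by simp
qed

text \<open>Stated as an equality of predicates, so that \<open>wderiv\<close>, a choice from the
  predicate, is the same function on both sides.\<close>

lemma weak_deriv_cong_AE:
  assumes "f \<in> borel_measurable (lebesgue_on {0..l})" "f' \<in> borel_measurable (lebesgue_on {0..l})"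
    and "AE x in lebesgue_on {0..l}. f x = f' x"
  shows "weak_deriv l f = weak_deriv l f'"
proof -
  have "(LINT x|lebesgue_on {0..l}. f x * \<psi> x) = (LINT x|lebesgue_on {0..l}. f' x * \<psi> x)"
    if "continuous_on UNIV \<psi>" for \<psi> :: "real \<Rightarrow> real"
  proof (rule integral_cong_AE)
    have "\<psi> \<in> borel_measurable (lebesgue_on {0..l})"
      using that by (intro continuous_imp_measurable_on_sets_lebesgue continuous_on_subset[OF that]) auto
    then show "(\<lambda>x. f x * \<psi> x) \<in> borel_measurable (lebesgue_on {0..l})"
      "(\<lambda>x. f' x * \<psi> x) \<in> borel_measurable (lebesgue_on {0..l})"
      using assms by auto
    show "AE x in lebesgue_on {0..l}. f x * \<psi> x = f' x * \<psi> x"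
      using assms(3) by eventually_elim simp
  qed
  then show ?thesis unfolding weak_deriv_def fun_eq_iff by auto
qed

text \<open>A trapezoidal cut-off tending to the indicator of the open interval. Continuity is the
  right smoothness, as plateaus enter as derivatives of the C1 test functions.\<close>

definition plateau :: "nat \<Rightarrow> real \<Rightarrow> real \<Rightarrow> real \<Rightarrow> real" where
  "plateau n c d x = max 0 (min 1 (real n * (x - c))) * max 0 (min 1 (real n * (d - x)))"

lemma plateau_continuous: "continuous_on S (plateau n c d)"
  unfolding plateau_def by (intro continuous_intros)

lemma plateau_bounds: "0 \<le> plateau n c d x" "plateau n c d x \<le> 1"
  unfolding plateau_def by (auto intro!: mult_nonneg_nonneg mult_le_one)

lemma plateau_zero: "x \<notin> {c..d} \<Longrightarrow> plateau n c d x = 0"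
proof -
  assume "x \<notin> {c..d}"
  then consider "x < c" | "d < x" by fastforce
  then have "real n * (x - c) \<le> 0 \<or> real n * (d - x) \<le> 0"
    by cases (auto intro: mult_nonneg_nonpos)
  then show "plateau n c d x = 0" unfolding plateau_def by auto
qed

lemma plateau_tendsto: "(\<lambda>n. plateau n c d x) \<longlonglongrightarrow> indicator {c<..<d} x"
proof (cases "x \<in> {c<..<d}")
  case True
  have "\<forall>\<^sub>F n in sequentially. plateau n c d x = 1"
  proof -
    have "filterlim (\<lambda>n. real n * (x - c)) at_top sequentially" "filterlim (\<lambda>n. real n * (d - x)) at_top sequentially"
      using True by (auto intro!: filterlim_at_top_mult_tendsto_pos[OF tendsto_const] filterlim_real_sequentially)
    then have "\<forall>\<^sub>F n in sequentially. 1 \<le> real n * (x - c)" "\<forall>\<^sub>F n in sequentially. 1 \<le> real n * (d - x)"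
      by (auto simp: filterlim_at_top)
    then show ?thesis by eventually_elim (simp add: plateau_def)
  qed
  then show ?thesis using True by (simp add: tendsto_eventually)
next
  case False
  have "plateau n c d x = 0" for n
  proof -
    have "real n * (x - c) \<le> 0 \<or> real n * (d - x) \<le> 0"
      using False by (auto simp: not_less intro: mult_nonneg_nonpos)
    then show ?thesis unfolding plateau_def by auto
  qed
  then show ?thesis using False by simp
qed

lemma plateau_LINT_tendsto:
  assumes F: "integrable (lebesgue_on {0..l}) F" and cd: "0 \<le> c" "c \<le> d" "d \<le> l"
  shows "(\<lambda>n. LINT x|lebesgue_on {0..l}. F x * plateau n c d x) \<longlonglongrightarrow> integral {c..d} F"
proof -
  let ?M = "lebesgue_on {0..l}"
  have pm: "plateau n c d \<in> borel_measurable ?M" for n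
    by (rule continuous_imp_measurable_on_sets_lebesgue[OF plateau_continuous]) simp
  have ind: "(\<lambda>x. indicator {c<..<d} x :: real) \<in> borel_measurable ?M"
    by (intro measurable_restrict_space1 borel_measurable_indicator) simp
  have "(\<lambda>n. LINT x|?M. F x * plateau n c d x) \<longlonglongrightarrow> (LINT x|?M. F x * indicator {c<..<d} x)"
  proof (rule integral_dominated_convergence[where w = "\<lambda>x. norm (F x)"])
    show "AE x in ?M. (\<lambda>n. F x * plateau n c d x) \<longlonglongrightarrow> F x * indicator {c<..<d} x"
      by (intro AE_I2 tendsto_intros plateau_tendsto)
    show "AE x in ?M. norm (F x * plateau n c d x) \<le> norm (F x)" for n
      using plateau_bounds by (intro AE_I2) (simp add: abs_mult mult_left_le)
  qed (use F pm ind in auto)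
  also have "(LINT x|?M. F x * indicator {c<..<d} x) = integral {0..l} (\<lambda>x. F x * indicator {c<..<d} x)"
    using integrable_mult_indicator[of "{c<..<d}" ?M F] F cd
    by (intro LINT_Icc_eq_integral Bochner_Integration.integrable_bound[OF F] AE_I2 borel_measurable_times ind)
      (auto simp: indicator_def)
  also have "(\<lambda>x. F x * indicator {c<..<d} x) = (\<lambda>x. if x \<in> {c<..<d} then F x else 0)"
    by (simp add: fun_eq_iff indicator_def)
  also have "integral {0..l} \<dots> = integral ({c<..<d} \<inter> {0..l}) F"
    by (rule integral_restrict_Int)
  also have "{c<..<d} \<inter> {0..l} = {c<..<d}" using cd by auto
  also have "integral {c<..<d} F = integral {c..d} F"
    using integral_open_interval_real[of c d F] by simp
  finally show ?thesis .
qed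

text \<open>Total integral 0 makes the primitive vanish again beyond M; hence it is an admissible
  test function for \<open>weak_deriv\<close>.\<close>

lemma compactly_supported_primitive:
  fixes q :: "real \<Rightarrow> real"
  assumes q: "continuous_on UNIV q" and m: "0 < m" "m < M" "M < l" and z: "\<And>x. x \<notin> {m..M} \<Longrightarrow> q x = 0"
    and tot: "integral {0..l} q = 0"
  defines "\<psi> \<equiv> \<lambda>x. integral {0..x} q"
  shows "x \<notin> {m..M} \<Longrightarrow> \<psi> x = 0" and "(\<psi> has_real_derivative q x) (at x)"
proof -
  have below: "\<psi> x = 0" if "x < m" for x
  proof -
    have "integral {0..x} q = integral {0..x} (\<lambda>_. 0)"
      using that z by (intro Henstock_Kurzweil_Integration.integral_cong) auto
    then show ?thesis by (simp add: \<psi>_def)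
  qed
  show "\<psi> x = 0" if "x \<notin> {m..M}" for x
  proof (cases "x < m")
    case False
    then have xM: "M < x" using that by auto
    have int: "q integrable_on {0..M}" by (rule integrable_continuous_real[OF continuous_on_subset[OF q]]) simp
    have ext: "integral {0..y} q = integral {0..M} q" if "M \<le> y" for y
    proof (rule integral_unique)
      show "(q has_integral integral {0..M} q) {0..y}"
      proof (rule has_integral_on_superset[OF integrable_integral[OF int]])
        show "q x = 0" if "x \<notin> {0..M}" for x using that m(1) by (intro z) auto
      qed (use \<open>M \<le> y\<close> in auto)
    qed
    show ?thesis using ext[of x] ext[of l] tot xM m by (simp add: \<psi>_def)
  qed (rule below)
  show "(\<psi> has_real_derivative q x) (at x)" for x
  proof (cases "x < m")
    case True
    have "((\<lambda>x. 0) has_real_derivative 0) (at x)" by simp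
    then have "(\<psi> has_real_derivative 0) (at x)"
    proof (rule has_field_derivative_transform_within_open)
      show "open {..<m}" "x \<in> {..<m}" using True by auto
      show "0 = \<psi> y" if "y \<in> {..<m}" for y using below that by simp
    qed
    then show ?thesis using z[of x] True by simp
  next
    case False
    then have x: "0 < x" using m by simp
    have "(\<psi> has_real_derivative q x) (at x within {0..x + 1})"
      unfolding \<psi>_def using x
      by (intro integral_has_real_derivative continuous_on_subset[OF q]) auto
    moreover have "at x within {0..x + 1} = at x"
      using x by (intro at_within_interior) auto
    ultimately show ?thesis by simp
  qed
qed

text \<open>Two plateaus, each weighted with the integral of the other, differ by a function of
  integral 0, whose primitive is a test function. As the plateaus become sharp, F turns out to have
  the same mean over any two intervals inside (0, l), and subtracting this mean leaves a function
  with vanishing integrals.\<close>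

lemma du_Bois_Reymond:
  assumes l: "0 < l" and F: "integrable (lebesgue_on {0..l}) F"
    and orth: "\<And>\<psi> \<psi>' c d. \<lbrakk>0 < c; d < l; \<And>x. x \<notin> {c..d} \<Longrightarrow> \<psi> x = 0;
      \<And>x. (\<psi> has_real_derivative \<psi>' x) (at x); continuous_on UNIV \<psi>'\<rbrakk> \<Longrightarrow>
      (LINT x|lebesgue_on {0..l}. F x * \<psi>' x) = 0"
  shows "\<exists>C. AE x in lebesgue_on {0..l}. F x = C"
proof -
  let ?M = "lebesgue_on {0..l}"
  have one: "integrable ?M (\<lambda>x. 1::real)" by (rule L2_interval_integrable[OF L2_interval_const])
  have Fp: "integrable ?M (\<lambda>x. F x * plateau n c d x)" for n c d
  proof (rule Bochner_Integration.integrable_bound[OF F])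
    have "plateau n c d \<in> borel_measurable ?M"
      by (rule continuous_imp_measurable_on_sets_lebesgue[OF plateau_continuous]) simp
    then show "(\<lambda>x. F x * plateau n c d x) \<in> borel_measurable ?M" using F by auto
    show "AE x in ?M. norm (F x * plateau n c d x) \<le> norm (F x)"
      using plateau_bounds by (intro AE_I2) (simp add: abs_mult mult_left_le)
  qed
  have ratio: "(d0 - c0) * integral {c..d} F = (d - c) * integral {c0..d0} F"
    if cd: "0 < c" "c < d" "d < l" and cd0: "0 < c0" "c0 < d0" "d0 < l" for c d c0 d0
  proof -
    define I where "I = (\<lambda>n. LINT x|?M. 1 * plateau n c d x)"
    define J where "J = (\<lambda>n. LINT x|?M. 1 * plateau n c0 d0 x)"
    have e: "J n * (LINT x|?M. F x * plateau n c d x) = I n * (LINT x|?M. F x * plateau n c0 d0 x)" for n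
    proof -
      define q where "q = (\<lambda>x. J n * plateau n c d x - I n * plateau n c0 d0 x)"
      have qc: "continuous_on S q" for S unfolding q_def by (intro continuous_intros plateau_continuous)
      have Pint: "(LINT x|?M. plateau n c d x) = integral {0..l} (plateau n c d)"
        "plateau n c d integrable_on {0..l}" for c d
        by (auto intro!: LINT_Icc_eq_integral L2_interval_integrable L2_interval_continuous plateau_continuous integrable_continuous_real)
      have "integral {0..l} q = J n * integral {0..l} (plateau n c d) - I n * integral {0..l} (plateau n c0 d0)"
        unfolding q_def using Pint(2) by (subst Henstock_Kurzweil_Integration.integral_diff) (auto intro!: integrable_on_mult_right)
      then have tot: "integral {0..l} q = 0" using Pint(1) by (simp add: I_def J_def)
      have m: "0 < min c c0" "min c c0 < max d d0" "max d d0 < l" using cd cd0 by auto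
      have z: "q x = 0" if "x \<notin> {min c c0..max d d0}" for x
      proof -
        have "x \<notin> {c..d}" "x \<notin> {c0..d0}" using that by (auto simp: min_le_iff_disj le_max_iff_disj)
        then show ?thesis by (simp add: q_def plateau_zero)
      qed
      have "0 = (LINT x|?M. F x * q x)"
      proof (rule orth[symmetric, of "min c c0" "max d d0" "\<lambda>x. integral {0..x} q"])
        show "integral {0..x} q = 0" if "x \<notin> {min c c0..max d d0}" for x
          by (rule compactly_supported_primitive(1)[OF qc m z tot that])
        show "((\<lambda>x. integral {0..x} q) has_real_derivative q x) (at x)" for x
          by (rule compactly_supported_primitive(2)[OF qc m z tot])
      qed (use m qc in auto)
      also have "(LINT x|?M. F x * q x) = (LINT x|?M. J n * (F x * plateau n c d x) - I n * (F x * plateau n c0 d0 x))"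
        by (simp add: q_def algebra_simps)
      also have "\<dots> = J n * (LINT x|?M. F x * plateau n c d x) - I n * (LINT x|?M. F x * plateau n c0 d0 x)"
        using Fp by (subst Bochner_Integration.integral_diff) auto
      finally show ?thesis by simp
    qed
    have "(\<lambda>n. J n * (LINT x|?M. F x * plateau n c d x)) \<longlonglongrightarrow> integral {c0..d0} (\<lambda>x. 1) * integral {c..d} F"
      unfolding J_def using cd cd0 by (intro tendsto_mult plateau_LINT_tendsto[OF one] plateau_LINT_tendsto[OF F]) auto
    then have l1: "(\<lambda>n. I n * (LINT x|?M. F x * plateau n c0 d0 x)) \<longlonglongrightarrow> integral {c0..d0} (\<lambda>x. 1) * integral {c..d} F"
      unfolding e .
    have l2: "(\<lambda>n. I n * (LINT x|?M. F x * plateau n c0 d0 x)) \<longlonglongrightarrow> integral {c..d} (\<lambda>x. 1) * integral {c0..d0} F"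
      unfolding I_def using cd cd0 by (intro tendsto_mult plateau_LINT_tendsto[OF one] plateau_LINT_tendsto[OF F]) auto
    show ?thesis using LIMSEQ_unique[OF l1 l2] cd cd0 by simp
  qed
  \<comment> \<open>The mean of F over a reference interval; any fixed one inside (0, l) would
    do.\<close>
  define C where "C = integral {l / 3..l / 2} F / (l / 2 - l / 3)"
  have FC: "integrable ?M (\<lambda>x. F x - C)"
    using F L2_interval_integrable[OF L2_interval_const[of l C]] by (rule Bochner_Integration.integrable_diff)
  have Fint: "F integrable_on {0..l}" using integrable_on_lebesgue_on[OF F] by simp
  have FCint: "(\<lambda>x. F x - C) integrable_on {0..l}" using integrable_on_lebesgue_on[OF FC] by simp
  define P where "P = (\<lambda>x. integral {0..x} (\<lambda>x. F x - C))"
  have Pc: "continuous_on {0..l} P" unfolding P_def by (rule indefinite_integral_continuous_1[OF FCint])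
  have diff: "P d = P c" if cd: "0 < c" "c < d" "d < l" for c d
  proof -
    have "integral {c..d} F = (d - c) * C"
      using ratio[OF cd, of "l / 3" "l / 2"] l by (simp add: C_def field_simps)
    moreover have "F integrable_on {c..d}" by (rule integrable_on_subinterval[OF Fint]) (use cd in auto)
    then have "integral {c..d} (\<lambda>x. F x - C) = integral {c..d} F - (d - c) * C"
      using cd by (subst Henstock_Kurzweil_Integration.integral_diff) auto
    moreover have "integral {0..c} (\<lambda>x. F x - C) + integral {c..d} (\<lambda>x. F x - C) = integral {0..d} (\<lambda>x. F x - C)"
      using cd by (intro Henstock_Kurzweil_Integration.integral_combine integrable_on_subinterval[OF FCint]) auto
    ultimately show ?thesis by (simp add: P_def)
  qed
  have const: "P x = P (l / 2)" if "x \<in> {0<..<l}" for x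
    using diff[of x "l / 2"] diff[of "l / 2" x] that l by (cases x "l / 2" rule: linorder_cases) auto
  \<comment> \<open>Test functions reach only intervals away from the boundary; continuity of P adds
    the end points.\<close>
  have const': "P x = P (l / 2)" if "x \<in> {0..l}" for x
  proof (rule continuous_constant_on_closure[OF _ const])
    show "continuous_on (closure {0<..<l}) P" "x \<in> closure {0<..<l}"
      using Pc that l by simp_all
  qed
  have "P 0 = 0" by (simp add: P_def)
  then have "P x = 0" if "x \<in> {0..l}" for x using const'[OF that] const'[of 0] l by simp
  then have "AE x in ?M. F x - C = 0"
    by (intro AE_zero_if_integral_zero[OF FC]) (auto simp: P_def)
  then have "AE x in ?M. F x = C" by eventually_elim simp
  then show ?thesis by blast
qed

text \<open>Subtracting the primitive of g leaves a function with weak derivative 0.\<close>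

lemma weak_deriv_imp_AE:
  assumes l: "0 < l" and f: "integrable (lebesgue_on {0..l}) f" and fg: "weak_deriv l f g"
  shows "\<exists>C. AE x in lebesgue_on {0..l}. f x = C + integral {0..x} g"
proof -
  have g: "L2_interval l g" using fg by (simp add: weak_deriv_def)
  define G where "G = (\<lambda>x. integral {0..x} g)"
  have G: "antideriv l G g" unfolding antideriv_def G_def using g by simp
  have Gi: "L2_interval l G" by (rule L2_interval_continuous[OF antideriv_continuous[OF G]])
  have "\<exists>C. AE x in lebesgue_on {0..l}. f x - G x = C"
  proof (rule du_Bois_Reymond[OF l])
    show "integrable (lebesgue_on {0..l}) (\<lambda>x. f x - G x)"
      using f L2_interval_integrable[OF Gi] by (rule Bochner_Integration.integrable_diff)
    fix \<psi> \<psi>' :: "real \<Rightarrow> real" and c d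
    assume cd: "0 < c" "d < l" and z: "\<And>x. x \<notin> {c..d} \<Longrightarrow> \<psi> x = 0"
      and D: "\<And>x. (\<psi> has_real_derivative \<psi>' x) (at x)" and C: "continuous_on UNIV \<psi>'"
    have w: "(LINT x|lebesgue_on {0..l}. u x * \<psi>' x) = - (LINT x|lebesgue_on {0..l}. g x * \<psi> x)"
      if "weak_deriv l u g" for u
      using that cd z D C unfolding weak_deriv_def by blast
    have \<psi>': "\<psi>' \<in> borel_measurable (lebesgue_on {0..l})" "L2_interval l \<psi>'"
      using L2_interval_continuous[OF continuous_on_subset[OF C]] L2_intervalD(1) by auto
    have "bounded (\<psi>' ` {0..l})"
      using C by (intro compact_imp_bounded compact_continuous_image continuous_on_subset[OF C]) auto
    then obtain B where B: "\<forall>y\<in>\<psi>' ` {0..l}. norm y \<le> B" unfolding bounded_iff by blast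
    have fi: "integrable (lebesgue_on {0..l}) (\<lambda>x. f x * \<psi>' x)"
    proof (rule Bochner_Integration.integrable_bound)
      show "integrable (lebesgue_on {0..l}) (\<lambda>x. B * f x)" using f by simp
      show "(\<lambda>x. f x * \<psi>' x) \<in> borel_measurable (lebesgue_on {0..l})" using f \<psi>' by auto
      show "AE x in lebesgue_on {0..l}. norm (f x * \<psi>' x) \<le> norm (B * f x)"
      proof (rule AE_I2)
        fix x assume "x \<in> space (lebesgue_on {0..l})"
        then have "\<bar>\<psi>' x\<bar> \<le> \<bar>B\<bar>" using B by force
        then have "\<bar>\<psi>' x\<bar> * \<bar>f x\<bar> \<le> \<bar>B\<bar> * \<bar>f x\<bar>" by (rule mult_right_mono) simp
        then show "norm (f x * \<psi>' x) \<le> norm (B * f x)"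
          by (simp add: abs_mult mult.commute)
      qed
    qed
    have "(LINT x|lebesgue_on {0..l}. (f x - G x) * \<psi>' x) = (LINT x|lebesgue_on {0..l}. f x * \<psi>' x - G x * \<psi>' x)"
      by (simp add: algebra_simps)
    also have "\<dots> = (LINT x|lebesgue_on {0..l}. f x * \<psi>' x) - (LINT x|lebesgue_on {0..l}. G x * \<psi>' x)"
      using fi L2_interval_integrable_mult[OF Gi \<psi>'(2)] by (rule Bochner_Integration.integral_diff)
    also have "\<dots> = 0" using w[OF fg] w[OF weak_deriv_antideriv[OF G l]] by simp
    finally show "(LINT x|lebesgue_on {0..l}. (f x - G x) * \<psi>' x) = 0" .
  qed
  then obtain C where C: "AE x in lebesgue_on {0..l}. f x - G x = C" by blast
  then have "AE x in lebesgue_on {0..l}. f x = C + integral {0..x} g"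
    by eventually_elim (simp add: G_def)
  then show ?thesis by blast
qed

text \<open>The points of disagreement inside the interval form an open null set, so there are none;
  continuity adds the end points.\<close>

lemma AE_eq_continuous_imp_eq:
  fixes f g :: "real \<Rightarrow> real"
  assumes l: "0 < l" and fg: "continuous_on {0..l} f" "continuous_on {0..l} g"
    and ae: "AE x in lebesgue_on {0..l}. f x = g x" and x: "x \<in> {0..l}"
  shows "f x = g x"
proof -
  have "AE x in lebesgue_on {0..l}. f x - g x = 0" using ae by eventually_elim simp
  then have d: "AE x in lebesgue. x \<in> {0..l} \<longrightarrow> f x - g x = 0"
    by (subst (asm) AE_restrict_space_iff) auto
  have "f y - g y = 0" if y: "y \<in> {0<..<l}" for y
  proof (rule ccontr)
    assume ne: "f y - g y \<noteq> 0"
    have "continuous_on {0<..<l} (\<lambda>x. f x - g x)"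
      using fg by (intro continuous_intros) (auto intro: continuous_on_subset)
    then have "open ({0<..<l} \<inter> (\<lambda>x. f x - g x) -` (- {0}))"
      by (intro continuous_open_preimage) auto
    moreover have "y \<in> {0<..<l} \<inter> (\<lambda>x. f x - g x) -` (- {0})" using y ne by simp
    ultimately obtain e where e: "0 < e" "ball y e \<subseteq> {0<..<l} \<inter> (\<lambda>x. f x - g x) -` (- {0})"
      by (rule openE)
    have "AE x in lebesgue. x \<notin> ball y e"
      using d by eventually_elim (use e in force)
    then have "ball y e \<in> null_sets lebesgue"
      by (simp add: AE_iff_null_sets)
    then show False using e(1) by (metis open_ball ball_eq_empty negligible_iff_null_sets open_not_negligible not_le)
  qed
  then have "f x - g x = 0"
    using continuous_constant_on_closure[of "{0<..<l}" "\<lambda>x. f x - g x" 0 x] fg x l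
    by (simp add: closure_greaterThanLessThan continuous_intros)
  then show ?thesis by simp
qed

lemma weak_deriv_continuous_imp_antideriv:
  assumes l: "0 < l" and f: "continuous_on {0..l} f" and fg: "weak_deriv l f g"
  shows "antideriv l f g"
proof -
  obtain C where C: "AE x in lebesgue_on {0..l}. f x = C + integral {0..x} g"
    using weak_deriv_imp_AE[OF l L2_interval_integrable[OF L2_interval_continuous[OF f]] fg] by blast
  have g: "L2_interval l g" using fg by (simp add: weak_deriv_def)
  have eq: "f x = C + integral {0..x} g" if "x \<in> {0..l}" for x
  proof (rule AE_eq_continuous_imp_eq[OF l f _ C that])
    show "continuous_on {0..l} (\<lambda>x. C + integral {0..x} g)"
      using L2_interval_integrable_on[OF g] by (intro continuous_intros indefinite_integral_continuous_1)
  qed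
  have "f 0 = C" using eq[of 0] l by simp
  then show ?thesis unfolding antideriv_def using g eq by simp
qed

lemma antideriv_weak_deriv_AE:
  assumes l: "0 < l" and fg: "antideriv l f g" and w: "weak_deriv l f g'"
  shows "AE x in lebesgue_on {0..l}. g' x = g x"
  using antideriv_unique_AE[OF weak_deriv_continuous_imp_antideriv[OF l antideriv_continuous[OF fg] w] fg, of 0] by simp

text \<open>\<open>wderiv\<close> is an unspecified choice; any known derivative g becomes a
  statement about the chosen one, up to null sets.\<close>

lemma antideriv_wderiv:
  assumes l: "0 < l" and fg: "antideriv l f g"
  shows "antideriv l f (wderiv l f)" "AE x in lebesgue_on {0..l}. wderiv l f x = g x"
proof -
  have w: "weak_deriv l f (wderiv l f)"
    unfolding wderiv_def by (rule someI[of _ g]) (rule weak_deriv_antideriv[OF fg l])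
  show "antideriv l f (wderiv l f)"
    by (rule weak_deriv_continuous_imp_antideriv[OF l antideriv_continuous[OF fg] w])
  show "AE x in lebesgue_on {0..l}. wderiv l f x = g x"
    by (rule antideriv_weak_deriv_AE[OF l fg w])
qed

section \<open>Lipschitz functions as integrals\<close>

text \<open>Lebesgue measure will be recognised by its values on open intervals, whereas Stieltjes
  measures are given on half-open ones; by continuity of F the end point is null.\<close>

lemma emeasure_interval_measure_Ioo:
  assumes "a \<le> b" "\<And>x y. x \<le> y \<Longrightarrow> F x \<le> F y" "continuous_on UNIV F"
  shows "emeasure (interval_measure F) {a<..<b} = ennreal (F b - F a)"
proof (cases "a = b")
  case False
  then have ab: "a < b" using assms(1) by simp
  have cr: "continuous (at_right x) F" for x
    using assms(3) by (simp add: continuous_on_eq_continuous_at continuous_at_imp_continuous_within)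
  have Ioc: "emeasure (interval_measure F) {a<..b} = ennreal (F b - F a)"
    using assms(1,2) cr by (rule emeasure_interval_measure_Ioc)
  have pt: "emeasure (interval_measure F) {b} = 0"
    using emeasure_interval_measure_Icc[OF order.refl assms(2,3), of b] by simp
  have "{a<..b} = {a<..<b} \<union> {b}" using ab by auto
  then have "emeasure (interval_measure F) {a<..b} \<le> emeasure (interval_measure F) {a<..<b} + emeasure (interval_measure F) {b}"
    using emeasure_subadditive[of "{a<..<b}" "interval_measure F" "{b}"] by simp
  moreover have "emeasure (interval_measure F) {a<..<b} \<le> emeasure (interval_measure F) {a<..b}"
    by (rule emeasure_mono) auto
  ultimately show ?thesis using Ioc pt by (simp add: antisym)
qed simp

text \<open>If \<open>F\<^sub>1\<close> and \<open>F\<^sub>2\<close> are nondecreasing with sum \<open>K x\<close>, their Stieltjes measures add up to \<open>K\<close> times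
  Lebesgue measure, so that \<open>F\<^sub>1\<close> has a density between 0 and \<open>K\<close>.\<close>

lemma interval_measure_density:
  fixes F1 F2 :: "real \<Rightarrow> real"
  assumes K: "0 < K" and mono: "\<And>x y. x \<le> y \<Longrightarrow> F1 x \<le> F1 y" "\<And>x y. x \<le> y \<Longrightarrow> F2 x \<le> F2 y"
    and cont: "continuous_on UNIV F1" "continuous_on UNIV F2" and sum: "\<And>x. F1 x + F2 x = K * x"
  obtains f where "f \<in> borel_measurable lborel" "density lborel f = interval_measure F1" "AE x in lborel. f x \<le> ennreal K"
proof -
  define N1 where "N1 = interval_measure F1"
  define N2 where "N2 = interval_measure F2"
  define N where "N = measure_of UNIV (sets borel) (\<lambda>A. emeasure N1 A + emeasure N2 A)"
  have sets: "sets N1 = sets borel" "sets N2 = sets borel" by (simp_all add: N1_def N2_def)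
  have setsN: "sets N = sets borel" unfolding N_def by (metis sets.sets_measure_of_eq space_borel)
  have emN: "emeasure N A = emeasure N1 A + emeasure N2 A" if A: "A \<in> sets borel" for A
    unfolding N_def
  proof (rule emeasure_measure_of_sigma)
    show "sigma_algebra UNIV (sets borel)" using sets.sigma_algebra_axioms[of borel] by simp
    show "positive (sets borel) (\<lambda>A. emeasure N1 A + emeasure N2 A)" by (simp add: positive_def)
    show "countably_additive (sets borel) (\<lambda>A. emeasure N1 A + emeasure N2 A)"
    proof (rule countably_additiveI)
      fix B :: "nat \<Rightarrow> real set"
      assume B: "range B \<subseteq> sets borel" "disjoint_family B"
      have "(\<Sum>i. emeasure N1 (B i) + emeasure N2 (B i)) = (\<Sum>i. emeasure N1 (B i)) + (\<Sum>i. emeasure N2 (B i))"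
        by (rule suminf_add[symmetric]) auto
      also have "(\<Sum>i. emeasure N1 (B i)) = emeasure N1 (\<Union>i. B i)" using B sets by (intro suminf_emeasure) auto
      also have "(\<Sum>i. emeasure N2 (B i)) = emeasure N2 (\<Union>i. B i)" using B sets by (intro suminf_emeasure) auto
      finally show "(\<Sum>i. emeasure N1 (B i) + emeasure N2 (B i)) = emeasure N1 (\<Union>i. B i) + emeasure N2 (\<Union>i. B i)" .
    qed
  qed (rule A)
  \<comment> \<open>The sum of the two measures is K times Lebesgue measure, since they agree on
    open intervals. Hence each of the two is absolutely continuous.\<close>
  have lb: "lborel = density N (\<lambda>_. ennreal (1 / K))"
  proof (rule lborel_eqI)
    fix l u :: real assume "\<And>b. b \<in> Basis \<Longrightarrow> l \<bullet> b \<le> u \<bullet> b"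
    then have lu: "l \<le> u" by simp
    have "emeasure N {l<..<u} = ennreal (F1 u - F1 l) + ennreal (F2 u - F2 l)"
      unfolding emN[OF borel_open[OF open_greaterThanLessThan]] N1_def N2_def
      using emeasure_interval_measure_Ioo[OF lu mono(1) cont(1)] emeasure_interval_measure_Ioo[OF lu mono(2) cont(2)] by simp
    also have "\<dots> = ennreal ((F1 u - F1 l) + (F2 u - F2 l))"
      using mono lu by (intro ennreal_plus[symmetric]) simp_all
    also have "(F1 u - F1 l) + (F2 u - F2 l) = K * (u - l)"
      using sum[of u] sum[of l] by (simp add: algebra_simps)
    finally have "emeasure N {l<..<u} = ennreal (K * (u - l))" .
    moreover have "emeasure (density N (\<lambda>_. ennreal (1 / K))) {l<..<u} = ennreal (1 / K) * emeasure N {l<..<u}"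
      by (rule emeasure_density_const) (simp add: setsN)
    ultimately show "emeasure (density N (\<lambda>_. ennreal (1 / K))) (box l u) = ennreal (\<Prod>b\<in>Basis. (u - l) \<bullet> b)"
      using K lu by (simp add: box_real ennreal_mult[symmetric])
  qed (simp add: setsN)
  have sc: "emeasure lborel A = ennreal (1 / K) * (emeasure N1 A + emeasure N2 A)" if "A \<in> sets borel" for A
    by (subst lb, subst emeasure_density_const) (use that setsN emN in auto)
  have ac: "absolutely_continuous lborel N1" "absolutely_continuous lborel N2"
  proof -
    have "emeasure N1 A = 0 \<and> emeasure N2 A = 0" if "A \<in> null_sets lborel" for A
    proof -
      have "A \<in> sets borel" "emeasure lborel A = 0" using that by auto
      then have "ennreal (1 / K) * (emeasure N1 A + emeasure N2 A) = 0" using sc by simp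
      then show ?thesis using K by (simp add: ennreal_eq_0_iff not_le)
    qed
    then show "absolutely_continuous lborel N1" "absolutely_continuous lborel N2"
      unfolding absolutely_continuous_def using sets by (auto simp: null_sets_def)
  qed
  obtain f1 where f1: "f1 \<in> borel_measurable lborel" "density lborel f1 = N1"
    using sigma_finite_measure.Radon_Nikodym[OF sigma_finite_lborel ac(1)] sets by auto
  obtain f2 where f2: "f2 \<in> borel_measurable lborel" "density lborel f2 = N2"
    using sigma_finite_measure.Radon_Nikodym[OF sigma_finite_lborel ac(2)] sets by auto
  have fm[measurable]: "f1 \<in> borel_measurable borel" "f2 \<in> borel_measurable borel" using f1 f2 by simp_all
  let ?h = "\<lambda>x. ennreal (1 / K) * (f1 x + f2 x)"
  \<comment> \<open>By uniqueness of densities f1 + f2 = K almost everywhere, and f2 is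
    nonnegative.\<close>
  have "density lborel ?h = density lborel (\<lambda>_. 1)"
  proof (rule measure_eqI)
    fix A assume "A \<in> sets (density lborel ?h)"
    then have A[measurable]: "A \<in> sets borel" by simp
    have "emeasure (density lborel ?h) A = (\<integral>\<^sup>+x. ?h x * indicator A x \<partial>lborel)"
      by (rule emeasure_density) simp_all
    also have "\<dots> = (\<integral>\<^sup>+x. ennreal (1 / K) * (f1 x * indicator A x + f2 x * indicator A x) \<partial>lborel)"
      by (simp add: distrib_right mult.assoc)
    also have "\<dots> = ennreal (1 / K) * ((\<integral>\<^sup>+x. f1 x * indicator A x \<partial>lborel) + (\<integral>\<^sup>+x. f2 x * indicator A x \<partial>lborel))"
      by (subst nn_integral_cmult, simp, subst nn_integral_add) simp_all
    also have "(\<integral>\<^sup>+x. f1 x * indicator A x \<partial>lborel) = emeasure N1 A"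
      unfolding f1(2)[symmetric] by (rule emeasure_density[symmetric]) simp_all
    also have "(\<integral>\<^sup>+x. f2 x * indicator A x \<partial>lborel) = emeasure N2 A"
      unfolding f2(2)[symmetric] by (rule emeasure_density[symmetric]) simp_all
    finally show "emeasure (density lborel ?h) A = emeasure (density lborel (\<lambda>_. 1)) A"
      using sc[OF A] by (simp add: density_1)
  qed simp
  then have "AE x in lborel. ?h x = 1"
    by (subst (asm) sigma_finite_measure.density_unique_iff[OF sigma_finite_lborel]) simp_all
  then have "AE x in lborel. f1 x \<le> ennreal K"
  proof eventually_elim
    case (elim x)
    have "f1 x \<le> f1 x + f2 x" by simp
    also have "\<dots> = ennreal K * (ennreal (1 / K) * (f1 x + f2 x))"
      using K by (simp add: mult.assoc[symmetric] ennreal_mult[symmetric])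
    also have "\<dots> = ennreal K" using elim by simp
    finally show ?case .
  qed
  then show ?thesis using that[of f1] f1 by (simp add: N1_def)
qed

text \<open>Adding the function to K x and subtracting it from K x gives nondecreasing functions
  with sum 2 K x. The density of the first Stieltjes measure lies between 0 and 2 K, and subtracting
  K from it leaves a bounded derivative. The function is extended constantly beyond the interval,
  since these measures live on the whole line.\<close>

lemma Lipschitz_antideriv:
  fixes a :: "real \<Rightarrow> real"
  assumes l: "0 < l" and lip: "\<And>x y. \<lbrakk>x \<in> {0..l}; y \<in> {0..l}\<rbrakk> \<Longrightarrow> \<bar>a x - a y\<bar> \<le> M * \<bar>x - y\<bar>"
  shows "\<exists>a'. antideriv l a a'"
proof -
  \<comment> \<open>Positive even if M is not.\<close>
  define K where "K = \<bar>M\<bar> + 1"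
  have K: "0 < K" by (simp add: K_def)
  define c where "c = (\<lambda>x. max 0 (min l x))"
  define b where "b = (\<lambda>x. a (c x))"
  have b_lip: "\<bar>b x - b y\<bar> \<le> K * \<bar>x - y\<bar>" for x y
  proof -
    have "\<bar>b x - b y\<bar> \<le> M * \<bar>c x - c y\<bar>" unfolding b_def using l by (intro lip) (auto simp: c_def)
    also have "\<dots> \<le> K * \<bar>c x - c y\<bar>" by (intro mult_right_mono) (auto simp: K_def)
    also have "\<dots> \<le> K * \<bar>x - y\<bar>" using K by (intro mult_left_mono) (auto simp: c_def max_def min_def)
    finally show ?thesis .
  qed
  have b_cont: "continuous_on UNIV b"
  proof -
    have "K-lipschitz_on UNIV b"
      using K b_lip by (intro lipschitz_onI) (auto simp: dist_real_def)
    then show ?thesis by (rule lipschitz_on_continuous_on)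
  qed
  define F1 where "F1 = (\<lambda>x. K * x + b x)"
  define F2 where "F2 = (\<lambda>x. K * x - b x)"
  have m1: "F1 x \<le> F1 y" and m2: "F2 x \<le> F2 y" if "x \<le> y" for x y
    using b_lip[of x y] that by (auto simp: F1_def F2_def abs_if algebra_simps split: if_splits)
  have c1: "continuous_on UNIV F1" and c2: "continuous_on UNIV F2"
    unfolding F1_def F2_def using b_cont by (auto intro!: continuous_intros)
  obtain f where f: "f \<in> borel_measurable lborel" "density lborel f = interval_measure F1" "AE x in lborel. f x \<le> ennreal (2 * K)"
    using interval_measure_density[of "2 * K" F1 F2] K m1 m2 c1 c2 by (auto simp: F1_def F2_def)
  have fm[measurable]: "f \<in> borel_measurable borel" using f(1) by simp
  \<comment> \<open>The density is extended real and bounded only almost everywhere; truncation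
    makes it real and bounded at every point.\<close>
  define g where "g = (\<lambda>x. min (2 * K) (enn2real (f x)))"
  have gm[measurable]: "g \<in> borel_measurable borel" unfolding g_def by measurable
  have g_bounds: "0 \<le> g x" "g x \<le> 2 * K" for x using K by (simp_all add: g_def)
  have g_int: "(g has_integral F1 x - F1 0) {0..x}" if x: "0 \<le> x" for x
  proof -
    let ?h = "\<lambda>t. if t \<in> {0..x} then g t else 0"
    have "(\<integral>\<^sup>+t. ennreal (?h t) \<partial>lborel) = (\<integral>\<^sup>+t. f t * indicator {0..x} t \<partial>lborel)"
    proof (rule nn_integral_cong_AE)
      show "AE t in lborel. ennreal (?h t) = f t * indicator {0..x} t"
        using f(3)
      proof eventually_elim
        case (elim t)
        then have fin: "f t < top" using order.strict_trans1[OF elim ennreal_less_top] by simp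
        then have "enn2real (f t) \<le> 2 * K" using elim K by (metis enn2real_leI less_imp_le mult_pos_pos zero_less_numeral)
        then have "ennreal (g t) = f t" using fin by (simp add: g_def min_absorb2)
        then show ?case by (auto simp: indicator_def)
      qed
    qed
    also have "\<dots> = emeasure (interval_measure F1) {0..x}"
      unfolding f(2)[symmetric] by (rule emeasure_density[symmetric]) simp_all
    also have "\<dots> = ennreal (F1 x - F1 0)"
      by (rule emeasure_interval_measure_Icc[OF x m1 c1])
    finally have "(\<integral>\<^sup>+t. ennreal (?h t) \<partial>lborel) = ennreal (F1 x - F1 0)" .
    then have "(?h has_integral F1 x - F1 0) UNIV"
    proof (rule nn_integral_has_integral[rotated 2])
      show "?h \<in> borel_measurable borel" by measurable
      show "0 \<le> ?h t" for t using g_bounds by simp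
      show "0 \<le> F1 x - F1 0" using m1[OF x] by simp
    qed
    then show ?thesis by (simp only: has_integral_restrict_UNIV)
  qed
  have "antideriv l a (\<lambda>x. g x - K)"
    unfolding antideriv_def
  proof (intro conjI ballI)
    have "(\<lambda>x. g x - K) \<in> borel_measurable lebesgue"
      by (rule measurable_completion) simp
    then have m: "(\<lambda>x. g x - K) \<in> borel_measurable (lebesgue_on {0..l})" by (rule measurable_restrict_space1)
    have "\<bar>g x - K\<bar> \<le> K" for x using g_bounds[of x] by (simp add: abs_le_iff)
    then have ae: "AE x in lebesgue_on {0..l}. \<bar>g x - K\<bar> \<le> K" by (intro AE_I2)
    show "L2_interval l (\<lambda>x. g x - K)"
      using L2_interval_bounded_mult[OF L2_interval_const[of l 1] m ae] by simp
    fix x assume x: "x \<in> {0..l}"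
    then have x0: "0 \<le> x" by simp
    have "((\<lambda>t. g t - K) has_integral (F1 x - F1 0) - (x - 0) *\<^sub>R K) {0..x}"
      by (rule has_integral_diff[OF g_int[OF x0] has_integral_const_real[of K 0 x, unfolded content_real[OF x0]]])
    then have "integral {0..x} (\<lambda>t. g t - K) = b x - b 0"
      by (simp add: integral_unique F1_def mult.commute)
    moreover have "b x = a x" "b 0 = a 0" using x l by (simp_all add: b_def c_def)
    ultimately show "a x = a 0 + integral {0..x} (\<lambda>t. g t - K)" by simp
  qed
  then show ?thesis by blast
qed

section \<open>Products and the regularity of H2 functions\<close>

lemma L2_interval_continuous_mult:
  assumes "continuous_on {0..l} g" "L2_interval l f"
  shows "L2_interval l (\<lambda>x. g x * f x)"
proof -
  have m: "g \<in> borel_measurable (lebesgue_on {0..l})" by (rule L2_intervalD(1)[OF L2_interval_continuous[OF assms(1)]])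
  have "compact (g ` {0..l})" using assms(1) by (intro compact_continuous_image) auto
  then obtain M where "\<forall>y\<in>g ` {0..l}. norm y \<le> M" using compact_imp_bounded bounded_iff by metis
  then have "AE x in lebesgue_on {0..l}. \<bar>g x\<bar> \<le> M" by (intro AE_I2) auto
  with assms(2) m show ?thesis by (rule L2_interval_bounded_mult)
qed

text \<open>Integration by parts on each interval from 0 to x is the product rule in integrated
  form.\<close>

lemma antideriv_mult:
  assumes f: "antideriv l f f'" and g: "antideriv l g g'"
  shows "antideriv l (\<lambda>x. f x * g x) (\<lambda>x. f x * g' x + f' x * g x)"
proof -
  have L: "L2_interval l (\<lambda>x. f x * g' x)" "L2_interval l (\<lambda>x. f' x * g x)"
    using L2_interval_continuous_mult[OF antideriv_continuous[OF f] antideriv_L2[OF g]]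
      L2_interval_continuous_mult[OF antideriv_continuous[OF g] antideriv_L2[OF f]]
    by (simp_all add: mult.commute)
  show ?thesis
    unfolding antideriv_def
  proof (intro conjI ballI L2_interval_add L)
    fix x assume x: "x \<in> {0..l}"
    then have le: "x \<le> l" "0 \<le> x" by auto
    note Lx = L(1)[THEN L2_interval_mono, OF le(1)] L(2)[THEN L2_interval_mono, OF le(1)]
    have "integral {0..x} (\<lambda>x. f x * g' x + f' x * g x) = integral {0..x} (\<lambda>x. f x * g' x) + integral {0..x} (\<lambda>x. f' x * g x)"
      by (rule Henstock_Kurzweil_Integration.integral_add[OF L2_interval_integrable_on[OF Lx(1)] L2_interval_integrable_on[OF Lx(2)]])
    also have "\<dots> = (LINT x|lebesgue_on {0..x}. f x * g' x) + (LINT x|lebesgue_on {0..x}. f' x * g x)"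
      by (simp only: LINT_Icc_eq_integral[OF L2_interval_integrable[OF Lx(1)]] LINT_Icc_eq_integral[OF L2_interval_integrable[OF Lx(2)]])
    also have "\<dots> = f x * g x - f 0 * g 0"
      by (rule integration_by_parts_antideriv[OF antideriv_mono[OF f le(1)] antideriv_mono[OF g le(1)] le(2)])
    finally show "f x * g x = f 0 * g 0 + integral {0..x} (\<lambda>x. f x * g' x + f' x * g x)" by simp
  qed
qed

text \<open>\<open>wderiv\<close> of u is known only up to null sets, but having a weak derivative
  itself it agrees almost everywhere with a continuous d. The flux a d is then a product of
  absolutely continuous functions, the Lipschitz coefficient being one of them.\<close>

lemma H2_interval_regular:
  assumes l: "0 < l" and lip: "\<And>x y. \<lbrakk>x \<in> {0..l}; y \<in> {0..l}\<rbrakk> \<Longrightarrow> \<bar>a x - a y\<bar> \<le> M * \<bar>x - y\<bar>"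
    and u: "continuous_on {0..l} u" "H2_interval l u"
  shows "\<exists>d. continuous_on {0..l} d \<and> antideriv l u d \<and>
    antideriv l (\<lambda>x. a x * d x) (wderiv l (\<lambda>y. a y * wderiv l u y))"
proof -
  let ?v = "wderiv l u"
  obtain g1 where "weak_deriv l u g1" using u(2) by (auto simp: H2_interval_def H1_interval_def)
  then have uv: "antideriv l u ?v"
    using antideriv_wderiv(1)[OF l weak_deriv_continuous_imp_antideriv[OF l u(1)]] by blast
  obtain g2 where g2: "weak_deriv l ?v g2" using u(2) by (auto simp: H2_interval_def H1_interval_def)
  have Lg2: "L2_interval l g2" using g2 by (simp add: weak_deriv_def)
  obtain C where C: "AE x in lebesgue_on {0..l}. ?v x = C + integral {0..x} g2"
    using weak_deriv_imp_AE[OF l L2_interval_integrable[OF antideriv_L2[OF uv]] g2] by blast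
  define d where "d = (\<lambda>x. C + integral {0..x} g2)"
  have d: "antideriv l d g2" unfolding antideriv_def d_def using Lg2 by simp
  have dc: "continuous_on {0..l} d" by (rule antideriv_continuous[OF d])
  have vd: "AE x in lebesgue_on {0..l}. ?v x = d x" using C by (simp add: d_def)
  have ud: "antideriv l u d" by (rule antideriv_cong_AE[OF uv L2_interval_continuous[OF dc] vd])
  obtain a' where a': "antideriv l a a'" using Lipschitz_antideriv[OF l lip] by blast
  have p: "antideriv l (\<lambda>x. a x * d x) (\<lambda>x. a x * g2 x + a' x * d x)" by (rule antideriv_mult[OF a' d])
  have "weak_deriv l (\<lambda>y. a y * ?v y) = weak_deriv l (\<lambda>x. a x * d x)"
  proof (rule weak_deriv_cong_AE)
    have am: "a \<in> borel_measurable (lebesgue_on {0..l})"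
      by (rule L2_intervalD(1)[OF L2_interval_continuous[OF antideriv_continuous[OF a']]])
    show "(\<lambda>y. a y * ?v y) \<in> borel_measurable (lebesgue_on {0..l})"
      by (rule borel_measurable_times[OF am L2_intervalD(1)[OF antideriv_L2[OF uv]]])
    show "(\<lambda>y. a y * d y) \<in> borel_measurable (lebesgue_on {0..l})"
      by (rule borel_measurable_times[OF am L2_intervalD(1)[OF L2_interval_continuous[OF dc]]])
    show "AE x in lebesgue_on {0..l}. a x * ?v x = a x * d x" using vd by eventually_elim simp
  qed
  then have "wderiv l (\<lambda>y. a y * ?v y) = wderiv l (\<lambda>x. a x * d x)" by (simp add: wderiv_def)
  then have "antideriv l (\<lambda>x. a x * d x) (wderiv l (\<lambda>y. a y * ?v y))"
    using antideriv_wderiv(1)[OF l p] by simp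
  then show ?thesis using dc ud by blast
qed

section \<open>Piecewise affine interpolation\<close>

text \<open>The squared deviation of f from its mean m has a nonnegative integral.\<close>

lemma integral_square_le:
  fixes f :: "real \<Rightarrow> real"
  assumes ab: "a \<le> b" and f: "f integrable_on {a..b}" and f2: "(\<lambda>x. (f x)\<^sup>2) integrable_on {a..b}"
  shows "(integral {a..b} f)\<^sup>2 \<le> (b - a) * integral {a..b} (\<lambda>x. (f x)\<^sup>2)"
proof (cases "a = b")
  case False
  then have ab': "0 < b - a" using ab by simp
  define I where "I = integral {a..b} f"
  define m where "m = I / (b - a)"
  have hi: "((\<lambda>x. (f x)\<^sup>2 - 2 * m * f x + m\<^sup>2) has_integral
      integral {a..b} (\<lambda>x. (f x)\<^sup>2) - 2 * m * I + (b - a) *\<^sub>R m\<^sup>2) {a..b}"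
    unfolding I_def
    by (intro has_integral_add has_integral_diff has_integral_mult_right integrable_integral f f2)
      (use has_integral_const_real[of "m\<^sup>2" a b] ab in simp)
  have "0 \<le> integral {a..b} (\<lambda>x. (f x)\<^sup>2) - 2 * m * I + (b - a) *\<^sub>R m\<^sup>2"
  proof (rule has_integral_nonneg[OF hi])
    fix x
    have "(f x)\<^sup>2 - 2 * m * f x + m\<^sup>2 = (f x - m)\<^sup>2" by (simp add: power2_eq_square algebra_simps)
    then show "0 \<le> (f x)\<^sup>2 - 2 * m * f x + m\<^sup>2" by simp
  qed
  moreover have "2 * m * I = 2 * (I\<^sup>2 / (b - a))" "(b - a) *\<^sub>R m\<^sup>2 = I\<^sup>2 / (b - a)"
    using ab' by (simp_all add: m_def power2_eq_square)
  ultimately have "I\<^sup>2 / (b - a) \<le> integral {a..b} (\<lambda>x. (f x)\<^sup>2)" by simp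
  then show ?thesis using ab' by (simp add: I_def pos_divide_le_eq mult.commute)
qed simp

lemma L2_interval_sub_integrable:
  assumes "L2_interval l f" "0 \<le> a" "b \<le> l"
  shows "f integrable_on {a..b}" "(\<lambda>x. (f x)\<^sup>2) integrable_on {a..b}"
proof -
  have "(\<lambda>x. (f x)\<^sup>2) integrable_on {0..l}"
    using integrable_on_lebesgue_on[OF L2_intervalD(2)[OF assms(1)]] by simp
  then show "f integrable_on {a..b}" "(\<lambda>x. (f x)\<^sup>2) integrable_on {a..b}"
    using assms by (auto intro: integrable_on_subinterval[OF L2_interval_integrable_on[OF assms(1)]] integrable_on_subinterval)
qed

lemma antideriv_increment_square_le:
  assumes fg: "antideriv l f g" and ab: "0 \<le> a" "b \<le> l" and x: "x \<in> {a..b}" and y: "y \<in> {a..b}"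
  shows "(f x - f y)\<^sup>2 \<le> (b - a) * integral {a..b} (\<lambda>x. (g x)\<^sup>2)"
proof -
  have main: "(f v - f u)\<^sup>2 \<le> (b - a) * integral {a..b} (\<lambda>x. (g x)\<^sup>2)" if uv: "a \<le> u" "u \<le> v" "v \<le> b" for u v
  proof -
    have int: "g integrable_on {u..v}" "(\<lambda>x. (g x)\<^sup>2) integrable_on {u..v}" "(\<lambda>x. (g x)\<^sup>2) integrable_on {a..b}"
      by (rule L2_interval_sub_integrable[OF antideriv_L2[OF fg]]; use uv ab in simp)+
    have "(f v - f u)\<^sup>2 = (integral {u..v} g)\<^sup>2"
      using antideriv_diff_eq[OF fg, of u v] uv ab by simp
    also have "\<dots> \<le> (v - u) * integral {u..v} (\<lambda>x. (g x)\<^sup>2)"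
      by (rule integral_square_le[OF uv(2) int(1,2)])
    also have "\<dots> \<le> (b - a) * integral {a..b} (\<lambda>x. (g x)\<^sup>2)"
      using uv int by (intro mult_mono integral_subset_le integral_nonneg) auto
    finally show ?thesis .
  qed
  show ?thesis
  proof (cases "x \<le> y")
    case True
    then show ?thesis using main[of x y] x y by (simp add: power2_commute)
  next
    case False
    then show ?thesis using main[of y x] x y by simp
  qed
qed

text \<open>By the mean value theorem the interpolating slope s equals d at some inner point y. The
  difference d x - d y is compared through the flux a d, so that the flux derivative g and the
  Lipschitz constant of a enter in place of a second derivative of z. The second bound holds since z
  - w vanishes at the left node.\<close>

lemma local_interpolation_error:
  fixes a z d g w :: "real \<Rightarrow> real"
  assumes a0: "0 < a0" "\<And>x. x \<in> {0..l} \<Longrightarrow> a0 \<le> a x"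
    and lip: "\<And>x y. \<lbrakk>x \<in> {0..l}; y \<in> {0..l}\<rbrakk> \<Longrightarrow> \<bar>a x - a y\<bar> \<le> M * \<bar>x - y\<bar>" and M: "0 \<le> M"
    and zd: "antideriv l z d" and dc: "continuous_on {0..l} d"
    and p: "antideriv l (\<lambda>x. a x * d x) g"
    and c: "0 \<le> c" "0 < h" "c + h \<le> l"
  defines "s \<equiv> (z (c + h) - z c) / h"
  assumes w: "\<And>x. x \<in> {c..c + h} \<Longrightarrow> w x = z c + s * (x - c)"
  shows "integral {c..c + h} (\<lambda>x. (d x - s)\<^sup>2) \<le>
      h\<^sup>2 * (2 * M\<^sup>2 / a0 ^ 4 * integral {c..c + h} (\<lambda>x. (a x * d x)\<^sup>2) + 2 / a0\<^sup>2 * integral {c..c + h} (\<lambda>x. (g x)\<^sup>2))"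
    and "integral {c..c + h} (\<lambda>x. (z x - w x)\<^sup>2) \<le> h\<^sup>2 * integral {c..c + h} (\<lambda>x. (d x - s)\<^sup>2)"
proof -
  let ?S = "{c..c + h}"
  have S: "?S \<subseteq> {0..l}" using c by auto
  have dcS: "continuous_on ?S d" by (rule continuous_on_subset[OF dc S])
  have pc: "continuous_on ?S (\<lambda>x. a x * d x)" by (rule continuous_on_subset[OF antideriv_continuous[OF p] S])
  define G where "G = integral ?S (\<lambda>x. (g x)\<^sup>2)"
  obtain y where "c < y" "y < c + h" "z (c + h) - z c = d y * (c + h - c)"
  proof (rule mvt)
    show "c < c + h" using c by simp
    show "continuous_on {c..c + h} z" by (rule continuous_on_subset[OF antideriv_continuous[OF zd] S])
    fix x assume x: "c < x" "x < c + h"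
    have "(z has_real_derivative d x) (at x within {0..l})"
      by (rule antideriv_has_derivative[OF zd dc]) (use x c in auto)
    moreover have "at x within {0..l} = at x" using x c by (intro at_within_interior) auto
    ultimately show "(z has_derivative (*) (d x)) (at x)" by (simp add: has_field_derivative_def)
  qed
  then have y: "y \<in> {c<..<c + h}" "s = d y" using c by (simp_all add: s_def)
  have yS: "y \<in> ?S" using y by auto
  have point: "(d x - s)\<^sup>2 \<le> 2 * M\<^sup>2 * h\<^sup>2 / a0 ^ 4 * (a x * d x)\<^sup>2 + 2 / a0\<^sup>2 * (h * G)" if x: "x \<in> ?S" for x
  proof -
    have xy: "x \<in> {0..l}" "y \<in> {0..l}" using x yS S by auto
    have ap: "0 < a x" "0 < a y" using a0(1) a0(2)[OF xy(1)] a0(2)[OF xy(2)] by linarith+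
    \<comment> \<open>A accounts for the variation of a between x and y, Bq for that of the
      flux.\<close>
    define A where "A = (a x * d x) * ((a y - a x) / (a x * a y))"
    define Bq where "Bq = (a x * d x - a y * d y) / a y"
    have split: "d x - d y = A + Bq"
      using ap by (simp add: A_def Bq_def field_simps)
    have "A\<^sup>2 \<le> M\<^sup>2 * h\<^sup>2 / a0 ^ 4 * (a x * d x)\<^sup>2"
    proof -
      have "\<bar>a y - a x\<bar> \<le> M * \<bar>y - x\<bar>" using lip[OF xy(2,1)] .
      also have "\<dots> \<le> M * h" using x yS M by (intro mult_left_mono) auto
      finally have 1: "\<bar>a y - a x\<bar> \<le> M * h" .
      have 2: "a0 * a0 \<le> a x * a y" using a0 xy ap by (intro mult_mono) auto
      have "\<bar>(a y - a x) / (a x * a y)\<bar> \<le> (M * h) / (a0 * a0)"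
        unfolding abs_divide using 1 2 ap a0(1) by (intro frac_le) auto
      then have "\<bar>(a y - a x) / (a x * a y)\<bar>\<^sup>2 \<le> ((M * h) / (a0 * a0))\<^sup>2"
        by (intro power_mono) auto
      also have "\<dots> = M\<^sup>2 * h\<^sup>2 / a0 ^ 4"
        by (simp add: power_divide power_mult_distrib power2_eq_square power4_eq_xxxx mult_ac)
      finally have "(a x * d x)\<^sup>2 * ((a y - a x) / (a x * a y))\<^sup>2 \<le> (a x * d x)\<^sup>2 * (M\<^sup>2 * h\<^sup>2 / a0 ^ 4)"
        unfolding power2_abs by (rule mult_left_mono) simp
      then show ?thesis unfolding A_def by (simp only: power_mult_distrib mult.commute)
    qed
    moreover have "Bq\<^sup>2 \<le> 1 / a0\<^sup>2 * (h * G)"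
    proof -
      have "(a x * d x - a y * d y)\<^sup>2 \<le> h * G"
        using antideriv_increment_square_le[OF p c(1,3) x yS] by (simp add: G_def)
      moreover from this have "0 \<le> h * G" by (rule order.trans[OF zero_le_power2])
      moreover have "a0\<^sup>2 \<le> (a y)\<^sup>2" using a0(1) a0(2)[OF xy(2)] by (intro power_mono) auto
      ultimately have "(a x * d x - a y * d y)\<^sup>2 / (a y)\<^sup>2 \<le> (h * G) / a0\<^sup>2"
        using a0(1) by (intro frac_le) auto
      then show ?thesis by (simp add: Bq_def power_divide)
    qed
    moreover have "(A + Bq)\<^sup>2 \<le> 2 * A\<^sup>2 + 2 * Bq\<^sup>2"
      using sum_squares_bound[of A Bq] by (simp add: power2_sum)
    moreover have "2 * M\<^sup>2 * h\<^sup>2 / a0 ^ 4 * (a x * d x)\<^sup>2 + 2 / a0\<^sup>2 * (h * G)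
        = 2 * (M\<^sup>2 * h\<^sup>2 / a0 ^ 4 * (a x * d x)\<^sup>2) + 2 * (1 / a0\<^sup>2 * (h * G))"
      by simp
    ultimately show ?thesis unfolding y(2) split by linarith
  qed
  have ids: "(\<lambda>x. (d x - s)\<^sup>2) integrable_on ?S" "(\<lambda>x. d x - s) integrable_on ?S"
    by (intro integrable_continuous_real continuous_intros dcS)+
  have ip: "(\<lambda>x. (a x * d x)\<^sup>2) integrable_on ?S"
    by (intro integrable_continuous_real continuous_on_power pc)
  have "integral ?S (\<lambda>x. (d x - s)\<^sup>2) \<le> integral ?S (\<lambda>x. 2 * M\<^sup>2 * h\<^sup>2 / a0 ^ 4 * (a x * d x)\<^sup>2 + 2 / a0\<^sup>2 * (h * G))"
    by (rule integral_le[OF ids(1) _ point]) (intro integrable_add integrable_on_mult_right ip integrable_const_ivl)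
  also have "\<dots> = 2 * M\<^sup>2 * h\<^sup>2 / a0 ^ 4 * integral ?S (\<lambda>x. (a x * d x)\<^sup>2) + h * (2 / a0\<^sup>2 * (h * G))"
    by (subst Henstock_Kurzweil_Integration.integral_add[OF integrable_on_mult_right[OF ip] integrable_const_ivl]) (use c in simp)
  also have "\<dots> = h\<^sup>2 * (2 * M\<^sup>2 / a0 ^ 4 * integral ?S (\<lambda>x. (a x * d x)\<^sup>2) + 2 / a0\<^sup>2 * G)"
    by (simp add: power2_eq_square algebra_simps)
  finally show "integral ?S (\<lambda>x. (d x - s)\<^sup>2) \<le>
      h\<^sup>2 * (2 * M\<^sup>2 / a0 ^ 4 * integral ?S (\<lambda>x. (a x * d x)\<^sup>2) + 2 / a0\<^sup>2 * integral ?S (\<lambda>x. (g x)\<^sup>2))"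
    by (simp add: G_def)
  define E where "E = integral ?S (\<lambda>x. (d x - s)\<^sup>2)"
  have point2: "(z x - w x)\<^sup>2 \<le> h * E" if x: "x \<in> ?S" for x
  proof -
    have sub: "{c..x} \<subseteq> ?S" using x by auto
    have "z x - z c = integral {c..x} d" using antideriv_diff_eq[OF zd, of c x] x c by simp
    moreover have "integral {c..x} (\<lambda>x. d x - s) = integral {c..x} d - s * (x - c)"
      using x by (subst Henstock_Kurzweil_Integration.integral_diff[OF integrable_continuous_real[OF continuous_on_subset[OF dcS sub]] integrable_const_ivl]) (simp add: mult.commute)
    ultimately have "z x - w x = integral {c..x} (\<lambda>x. d x - s)" using w[OF x] by simp
    then have "(z x - w x)\<^sup>2 \<le> (x - c) * integral {c..x} (\<lambda>x. (d x - s)\<^sup>2)"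
      using integral_square_le[of c x "\<lambda>x. d x - s"] x integrable_on_subinterval[OF ids(1) sub] integrable_on_subinterval[OF ids(2) sub] by simp
    also have "\<dots> \<le> h * E"
      unfolding E_def using x c integrable_on_subinterval[OF ids(1) sub] ids(1) sub
      by (intro mult_mono integral_subset_le integral_nonneg) auto
    finally show ?thesis .
  qed
  have wc: "continuous_on ?S w"
    by (rule continuous_on_eq[of _ "\<lambda>x. z c + s * (x - c)"]) (auto intro!: continuous_intros simp: w)
  have zc: "continuous_on ?S z" by (rule continuous_on_subset[OF antideriv_continuous[OF zd] S])
  have "integral ?S (\<lambda>x. (z x - w x)\<^sup>2) \<le> integral ?S (\<lambda>x. h * E)"
    by (rule integral_le[OF _ integrable_const_ivl point2])
      (intro integrable_continuous_real continuous_on_power continuous_on_diff zc wc)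
  also have "\<dots> = h\<^sup>2 * E" using c by (simp add: power2_eq_square)
  finally show "integral ?S (\<lambda>x. (z x - w x)\<^sup>2) \<le> h\<^sup>2 * integral ?S (\<lambda>x. (d x - s)\<^sup>2)"
    by (simp add: E_def)
qed

section \<open>Interpolation on a subdivided edge\<close>

lemma integral_subdivision:
  fixes f :: "real \<Rightarrow> real"
  assumes h: "0 \<le> h" and f: "f integrable_on {0..real n * h}" and m: "m \<le> n"
  shows "integral {0..real m * h} f = (\<Sum>i<m. integral {real i * h..real (Suc i) * h} f)"
  using m
proof (induction m)
  case (Suc m)
  have le: "real m * h \<le> real (Suc m) * h" "real (Suc m) * h \<le> real n * h" "0 \<le> real m * h"
    using Suc.prems h by (auto intro!: mult_right_mono)
  have "f integrable_on {0..real (Suc m) * h}"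
    by (rule integrable_on_subinterval[OF f]) (use le in auto)
  then have "integral {0..real m * h} f + integral {real m * h..real (Suc m) * h} f = integral {0..real (Suc m) * h} f"
    using le by (intro Henstock_Kurzweil_Integration.integral_combine) auto
  then show ?case using Suc by simp
qed simp

text \<open>Rounding down gives one formula on the whole line, independent of the number of cells.
  At the last node the value of z beyond the edge is multiplied by 0.\<close>

definition nodal_interp :: "real \<Rightarrow> (real \<Rightarrow> real) \<Rightarrow> real \<Rightarrow> real" where
  "nodal_interp h z x = z (of_int \<lfloor>x / h\<rfloor> * h) +
     (x / h - of_int \<lfloor>x / h\<rfloor>) * (z ((of_int \<lfloor>x / h\<rfloor> + 1) * h) - z (of_int \<lfloor>x / h\<rfloor> * h))"

lemma nodal_interp_cell:
  assumes h: "0 < h" and x: "x \<in> {real i * h..real (Suc i) * h}"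
  shows "nodal_interp h z x = z (real i * h) + (z (real (Suc i) * h) - z (real i * h)) / h * (x - real i * h)"
proof (cases "x = real (Suc i) * h")
  case True
  then have "x / h = real (Suc i)" using h by simp
  then have fl: "\<lfloor>x / h\<rfloor> = int (Suc i)" "x / h - of_int \<lfloor>x / h\<rfloor> = 0" by simp_all
  have "nodal_interp h z x = z (real (Suc i) * h)"
    unfolding nodal_interp_def fl(2) unfolding fl(1) by simp
  moreover have "(x - real i * h) = h" using True by (simp add: algebra_simps)
  ultimately show ?thesis using h by simp
next
  case False
  then have "real i \<le> x / h" "x / h < real i + 1" using x h by (auto simp: field_simps)
  then have fl: "\<lfloor>x / h\<rfloor> = int i" by (simp add: floor_eq_iff)
  have "x / h - real i = (x - real i * h) / h" using h by (simp add: diff_divide_distrib)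
  then show ?thesis unfolding nodal_interp_def fl by (simp add: add.commute)
qed

definition cell_affine :: "real \<Rightarrow> nat \<Rightarrow> (real \<Rightarrow> real) \<Rightarrow> bool" where
  "cell_affine h n u \<longleftrightarrow> (\<forall>i<n. \<exists>p q. \<forall>x\<in>{real i * h..real (Suc i) * h}. u x = p + q * x)"

lemma cell_affine_nodal_interp:
  assumes "0 < h"
  shows "cell_affine h n (nodal_interp h z)"
  unfolding cell_affine_def
proof (intro allI impI)
  fix i
  define s where "s = (z (real (Suc i) * h) - z (real i * h)) / h"
  have "\<forall>x\<in>{real i * h..real (Suc i) * h}. nodal_interp h z x = (z (real i * h) - s * (real i * h)) + s * x"
  proof
    fix x assume "x \<in> {real i * h..real (Suc i) * h}"
    then show "nodal_interp h z x = (z (real i * h) - s * (real i * h)) + s * x"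
      unfolding nodal_interp_cell[OF assms \<open>x \<in> _\<close>] s_def[symmetric] right_diff_distrib by linarith
  qed
  then show "\<exists>p q. \<forall>x\<in>{real i * h..real (Suc i) * h}. nodal_interp h z x = p + q * x" by blast
qed

text \<open>Neighbouring closed cells share a node, where both affine formulas hold; differences
  across it are split there, and the larger constant serves for both parts.\<close>

lemma cell_affine_Lipschitz:
  assumes h: "0 \<le> h" and u: "cell_affine h n u"
  shows "\<exists>K\<ge>0. \<forall>x\<in>{0..real n * h}. \<forall>y\<in>{0..real n * h}. \<bar>u x - u y\<bar> \<le> K * \<bar>x - y\<bar>"
proof -
  have "\<exists>K\<ge>0. \<forall>x\<in>{0..real m * h}. \<forall>y\<in>{0..real m * h}. \<bar>u x - u y\<bar> \<le> K * \<bar>x - y\<bar>" if "m \<le> n" for m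
    using that
  proof (induction m)
    case (Suc m)
    then obtain K where K: "0 \<le> K" "\<And>x y. \<lbrakk>x \<in> {0..real m * h}; y \<in> {0..real m * h}\<rbrakk> \<Longrightarrow> \<bar>u x - u y\<bar> \<le> K * \<bar>x - y\<bar>"
      by auto
    obtain p q where pq: "\<And>x. x \<in> {real m * h..real (Suc m) * h} \<Longrightarrow> u x = p + q * x"
      using u Suc.prems unfolding cell_affine_def by (meson Suc_le_eq)
    define L where "L = max K \<bar>q\<bar>"
    have L: "K \<le> L" "\<bar>q\<bar> \<le> L" by (simp_all add: L_def)
    have right: "\<bar>u x - u y\<bar> \<le> L * \<bar>x - y\<bar>" if "x \<in> {real m * h..real (Suc m) * h}" "y \<in> {real m * h..real (Suc m) * h}" for x y
    proof -
      have "u x - u y = q * (x - y)" using pq[OF that(1)] pq[OF that(2)] by (simp add: algebra_simps)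
      then show ?thesis using L(2) by (simp add: abs_mult mult_right_mono)
    qed
    have left: "\<bar>u x - u y\<bar> \<le> L * \<bar>x - y\<bar>" if "x \<in> {0..real m * h}" "y \<in> {0..real m * h}" for x y
      using K(2)[OF that] mult_right_mono[OF L(1), of "\<bar>x - y\<bar>"] by linarith
    have mh: "0 \<le> real m * h" "real m * h \<le> real (Suc m) * h" using h by (auto intro: mult_right_mono)
    have cross: "\<bar>u x - u y\<bar> \<le> L * \<bar>x - y\<bar>" if x: "x \<in> {0..real m * h}" and y: "y \<in> {real m * h..real (Suc m) * h}" for x y
    proof -
      have "\<bar>u x - u y\<bar> \<le> \<bar>u x - u (real m * h)\<bar> + \<bar>u (real m * h) - u y\<bar>" by simp
      also have "\<dots> \<le> L * \<bar>x - real m * h\<bar> + L * \<bar>real m * h - y\<bar>"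
        using x y mh by (intro add_mono left right) auto
      also have "\<dots> = L * \<bar>x - y\<bar>" using x y by (simp add: algebra_simps)
      finally show ?thesis .
    qed
    have "\<bar>u x - u y\<bar> \<le> L * \<bar>x - y\<bar>" if x: "x \<in> {0..real (Suc m) * h}" and y: "y \<in> {0..real (Suc m) * h}" for x y
    proof -
      have "x \<in> {0..real m * h} \<or> x \<in> {real m * h..real (Suc m) * h}" "y \<in> {0..real m * h} \<or> y \<in> {real m * h..real (Suc m) * h}"
        using x y by auto
      then show ?thesis
        using left[of x y] right[of x y] cross[of x y] cross[of y x] by (metis abs_minus_commute)
    qed
    moreover have "0 \<le> L" using K(1) L(1) by simp
    ultimately show ?case by blast
  qed (auto intro: exI[of _ 0])
  then show ?thesis by blast
qed

text \<open>At a node this is the slope of the cell on its right.\<close>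

definition nodal_slope :: "real \<Rightarrow> (real \<Rightarrow> real) \<Rightarrow> real \<Rightarrow> real" where
  "nodal_slope h z x = (z ((of_int \<lfloor>x / h\<rfloor> + 1) * h) - z (of_int \<lfloor>x / h\<rfloor> * h)) / h"

lemma nodal_slope_cell:
  assumes h: "0 < h" and x: "x \<in> {real i * h..<real (Suc i) * h}"
  shows "nodal_slope h z x = (z (real (Suc i) * h) - z (real i * h)) / h"
proof -
  have "real i \<le> x / h" "x / h < real i + 1" using x h by (auto simp: field_simps)
  then have fl: "\<lfloor>x / h\<rfloor> = int i" by (simp add: floor_eq_iff)
  show ?thesis unfolding nodal_slope_def fl by (simp add: add.commute)
qed

lemma has_integral_nodal_slope:
  assumes h: "0 < h" and x: "x \<in> {real i * h..real (Suc i) * h}"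
  shows "(nodal_slope h z has_integral nodal_interp h z x - nodal_interp h z (real i * h)) {real i * h..x}"
proof -
  let ?s = "(z (real (Suc i) * h) - z (real i * h)) / h"
  have i: "real i * h \<in> {real i * h..real (Suc i) * h}" using h by (auto intro: mult_right_mono)
  have "((\<lambda>_. ?s) has_integral (x - real i * h) *\<^sub>R ?s) {real i * h..x}"
    using has_integral_const_real[of ?s "real i * h" x] x by simp
  then have "(nodal_slope h z has_integral (x - real i * h) *\<^sub>R ?s) {real i * h..x}"
  proof (rule has_integral_spike_finite[where S = "{real (Suc i) * h}", rotated 2])
    fix y assume "y \<in> {real i * h..x} - {real (Suc i) * h}"
    then have "y \<in> {real i * h..<real (Suc i) * h}" using x by auto
    then show "nodal_slope h z y = ?s" by (rule nodal_slope_cell[OF h])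
  qed simp
  then show ?thesis
    unfolding nodal_interp_cell[OF h x] nodal_interp_cell[OF h i] by (simp add: mult.commute)
qed

lemma antideriv_nodal_interp:
  assumes h: "0 < h"
  shows "antideriv (real n * h) (nodal_interp h z) (nodal_slope h z)"
proof -
  have nodes: "(nodal_slope h z has_integral nodal_interp h z (real m * h) - nodal_interp h z 0) {0..real m * h}" for m
  proof (induction m)
    case (Suc m)
    have mem: "real (Suc m) * h \<in> {real m * h..real (Suc m) * h}" using h by (auto intro: mult_right_mono)
    show ?case
      using has_integral_combine[OF _ _ Suc has_integral_nodal_slope[OF h mem, of z]] mem h by simp
  qed (simp add: has_integral_refl)
  have all: "(nodal_slope h z has_integral nodal_interp h z x - nodal_interp h z 0) {0..x}" if x: "0 \<le> x" for x
  proof -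
    define i where "i = nat \<lfloor>x / h\<rfloor>"
    have "real i \<le> x / h" "x / h \<le> real i + 1" using x h by (simp_all add: i_def)
    then have mem: "x \<in> {real i * h..real (Suc i) * h}" using h by (simp add: field_simps)
    show ?thesis
      using has_integral_combine[OF _ _ nodes[of i] has_integral_nodal_slope[OF h mem, of z]] mem h by simp
  qed
  have nh: "0 \<le> real n * h" using h by simp
  have "nodal_slope h z integrable_on {0..real n * h}" using all[OF nh] by blast
  then have m: "nodal_slope h z \<in> borel_measurable (lebesgue_on {0..real n * h})"
    by (rule integrable_imp_measurable)
  \<comment> \<open>The index n is included because rounding down gives n at the right end
    point.\<close>
  define B where "B = (\<Sum>i\<le>n. \<bar>(z (real (Suc i) * h) - z (real i * h)) / h\<bar>)"
  have "\<bar>nodal_slope h z x\<bar> \<le> B" if x: "x \<in> {0..real n * h}" for x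
  proof -
    define i where "i = nat \<lfloor>x / h\<rfloor>"
    have xh: "0 \<le> x / h" "x / h \<le> real n" using x h by (auto simp: field_simps)
    then have "real i \<le> x / h" "x / h < real i + 1" unfolding i_def by linarith+
    moreover from this have "real i \<le> real n" using xh by linarith
    ultimately have mem: "x \<in> {real i * h..<real (Suc i) * h}" "i \<le> n" using h by (auto simp: field_simps)
    have "\<bar>(z (real (Suc i) * h) - z (real i * h)) / h\<bar> \<le> B"
      unfolding B_def using mem(2) by (intro member_le_sum) auto
    then show ?thesis using nodal_slope_cell[OF h mem(1)] by simp
  qed
  then have ae: "AE x in lebesgue_on {0..real n * h}. \<bar>nodal_slope h z x\<bar> \<le> B" by (intro AE_I2) simp
  show ?thesis
    unfolding antideriv_def
  proof (intro conjI ballI)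
    show "L2_interval (real n * h) (nodal_slope h z)"
      using L2_interval_bounded_mult[OF L2_interval_const[of _ 1] m ae] by simp
    fix x assume "x \<in> {0..real n * h}"
    then have "integral {0..x} (nodal_slope h z) = nodal_interp h z x - nodal_interp h z 0"
      using all[of x] by (intro integral_unique) simp
    then show "nodal_interp h z x = nodal_interp h z 0 + integral {0..x} (nodal_slope h z)" by simp
  qed
qed

lemma nodal_interpolation_error:
  fixes a z d g :: "real \<Rightarrow> real"
  assumes a0: "0 < a0" "\<And>x. x \<in> {0..l} \<Longrightarrow> a0 \<le> a x"
    and lip: "\<And>x y. \<lbrakk>x \<in> {0..l}; y \<in> {0..l}\<rbrakk> \<Longrightarrow> \<bar>a x - a y\<bar> \<le> M * \<bar>x - y\<bar>" and M: "0 \<le> M"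
    and zd: "antideriv l z d" and dc: "continuous_on {0..l} d"
    and p: "antideriv l (\<lambda>x. a x * d x) g"
    and h: "0 < h" "real n * h = l"
  shows "integral {0..l} (\<lambda>x. (d x - nodal_slope h z x)\<^sup>2) \<le>
      h\<^sup>2 * (2 * M\<^sup>2 / a0 ^ 4 * integral {0..l} (\<lambda>x. (a x * d x)\<^sup>2) + 2 / a0\<^sup>2 * integral {0..l} (\<lambda>x. (g x)\<^sup>2))"
    and "integral {0..l} (\<lambda>x. (z x - nodal_interp h z x)\<^sup>2) \<le>
      h\<^sup>2 * integral {0..l} (\<lambda>x. (d x - nodal_slope h z x)\<^sup>2)"
proof -
  have w: "antideriv l (nodal_interp h z) (nodal_slope h z)"
    using antideriv_nodal_interp[OF h(1), of n z] h(2) by simp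
  have int: "(\<lambda>x. (f x)\<^sup>2) integrable_on {0..real n * h}" if "L2_interval l f" for f
    using L2_interval_sub_integrable(2)[OF that, of 0 "real n * h"] h(2) by simp
  have sub: "integral {0..l} (\<lambda>x. (f x)\<^sup>2) = (\<Sum>i<n. integral {real i * h..real (Suc i) * h} (\<lambda>x. (f x)\<^sup>2))"
    if "L2_interval l f" for f
    using integral_subdivision[OF less_imp_le[OF h(1)] int[OF that], of n] h(2) by simp
  note Ld = L2_interval_continuous[OF dc]
  have L1: "L2_interval l (\<lambda>x. d x - nodal_slope h z x)" by (rule L2_interval_diff[OF Ld antideriv_L2[OF w]])
  have L2: "L2_interval l (\<lambda>x. z x - nodal_interp h z x)"
    by (rule L2_interval_diff[OF L2_interval_continuous[OF antideriv_continuous[OF zd]] L2_interval_continuous[OF antideriv_continuous[OF w]]])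
  have L3: "L2_interval l (\<lambda>x. a x * d x)" by (rule L2_interval_continuous[OF antideriv_continuous[OF p]])
  have cell: "integral {real i * h..real (Suc i) * h} (\<lambda>x. (d x - nodal_slope h z x)\<^sup>2) \<le>
      h\<^sup>2 * (2 * M\<^sup>2 / a0 ^ 4 * integral {real i * h..real (Suc i) * h} (\<lambda>x. (a x * d x)\<^sup>2)
        + 2 / a0\<^sup>2 * integral {real i * h..real (Suc i) * h} (\<lambda>x. (g x)\<^sup>2))
    \<and> integral {real i * h..real (Suc i) * h} (\<lambda>x. (z x - nodal_interp h z x)\<^sup>2) \<le>
      h\<^sup>2 * integral {real i * h..real (Suc i) * h} (\<lambda>x. (d x - nodal_slope h z x)\<^sup>2)" if i: "i < n" for i
  proof -
    define s where "s = (z (real i * h + h) - z (real i * h)) / h"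
    have e: "real (Suc i) * h = real i * h + h" by (simp add: algebra_simps)
    have le: "real (Suc i) * h \<le> l" unfolding h(2)[symmetric] using i h(1) by (intro mult_right_mono) auto
    have w': "nodal_interp h z x = z (real i * h) + s * (x - real i * h)" if "x \<in> {real i * h..real i * h + h}" for x
      using nodal_interp_cell[OF h(1), of x i z] that unfolding s_def e by simp
    \<comment> \<open>At the right node \<open>nodal_slope\<close> already belongs to the next cell;
      a single point does not affect the integral.\<close>
    have "integral {real i * h..real i * h + h} (\<lambda>x. (d x - nodal_slope h z x)\<^sup>2)
        = integral {real i * h..real i * h + h} (\<lambda>x. (d x - s)\<^sup>2)"
    proof (rule integral_spike[of "{real i * h + h}"])
      fix x assume "x \<in> {real i * h..real i * h + h} - {real i * h + h}"
      then have "x \<in> {real i * h..<real (Suc i) * h}" unfolding e by auto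
      then show "(d x - s)\<^sup>2 = (d x - nodal_slope h z x)\<^sup>2"
        using nodal_slope_cell[OF h(1), of x i z] unfolding s_def e by simp
    qed simp
    moreover note local_interpolation_error[OF a0 lip M zd dc p, of "real i * h" h "nodal_interp h z", folded s_def, OF _ _ _ _ h(1) _ w']
    ultimately show ?thesis using h(1) le unfolding e by simp
  qed
  have "integral {0..l} (\<lambda>x. (d x - nodal_slope h z x)\<^sup>2) \<le>
      (\<Sum>i<n. h\<^sup>2 * (2 * M\<^sup>2 / a0 ^ 4 * integral {real i * h..real (Suc i) * h} (\<lambda>x. (a x * d x)\<^sup>2)
        + 2 / a0\<^sup>2 * integral {real i * h..real (Suc i) * h} (\<lambda>x. (g x)\<^sup>2)))"
    unfolding sub[OF L1] using cell by (intro sum_mono) blast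
  also have "\<dots> = h\<^sup>2 * (2 * M\<^sup>2 / a0 ^ 4 * integral {0..l} (\<lambda>x. (a x * d x)\<^sup>2) + 2 / a0\<^sup>2 * integral {0..l} (\<lambda>x. (g x)\<^sup>2))"
    unfolding sub[OF L3] sub[OF antideriv_L2[OF p]] by (simp only: sum_distrib_left sum.distrib distrib_left)
  finally show "integral {0..l} (\<lambda>x. (d x - nodal_slope h z x)\<^sup>2) \<le>
      h\<^sup>2 * (2 * M\<^sup>2 / a0 ^ 4 * integral {0..l} (\<lambda>x. (a x * d x)\<^sup>2) + 2 / a0\<^sup>2 * integral {0..l} (\<lambda>x. (g x)\<^sup>2))" .
  have "integral {0..l} (\<lambda>x. (z x - nodal_interp h z x)\<^sup>2) \<le>
      (\<Sum>i<n. h\<^sup>2 * integral {real i * h..real (Suc i) * h} (\<lambda>x. (d x - nodal_slope h z x)\<^sup>2))"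
    unfolding sub[OF L2] using cell by (intro sum_mono) blast
  then show "integral {0..l} (\<lambda>x. (z x - nodal_interp h z x)\<^sup>2) \<le>
      h\<^sup>2 * integral {0..l} (\<lambda>x. (d x - nodal_slope h z x)\<^sup>2)"
    unfolding sub[OF L1] by (simp only: sum_distrib_left)
qed

section \<open>Continuous functions on metric graphs\<close>

text \<open>Connectedness ensures that any two points are joined by a path, so that
  \<open>gdist\<close> is an infimum over a nonempty set.\<close>

locale metric_graph =
  fixes G :: "('v, 'e) pre_digraph" and len :: "'e \<Rightarrow> real"
  assumes cmg: "compact_metric_graph G len" and conn: "Digraph_Component.connected G"
begin

sublocale fin_digraph G
  using cmg by (simp add: compact_metric_graph_def)

lemma arcs_nonempty: "arcs G \<noteq> {}" and len_pos: "e \<in> arcs G \<Longrightarrow> 0 < len e"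
  using cmg by (auto simp: compact_metric_graph_def)

lemma mem_gpoints: "(e, x) \<in> gpoints G len \<longleftrightarrow> e \<in> arcs G \<and> x \<in> {0..len e}"
  by (auto simp: gpoints_def)

lemma end_point_mem: "fst h \<in> arcs G \<Longrightarrow> end_point len h \<in> gpoints G len"
  using len_pos by (auto simp: gpoints_def end_point_def less_imp_le)

lemma mem_ends_at: "h \<in> ends_at G v \<longleftrightarrow> fst h \<in> arcs G \<and> end_vertex G h = v"
  by (cases h) (auto simp: ends_at_def)

lemma end_vertex_verts: "fst h \<in> arcs G \<Longrightarrow> end_vertex G h \<in> verts G"
  by (simp add: end_vertex_def)

text \<open>Every arc has exactly two ends, each at one vertex; those of a loop are distinct as
  ends. Squared traces and the boundary terms of integration by parts are regrouped this
  way.\<close>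

lemma ends_partition:
  fixes F :: "'e \<times> bool \<Rightarrow> real"
  shows "(\<Sum>v\<in>verts G. \<Sum>h\<in>ends_at G v. F h) = (\<Sum>e\<in>arcs G. F (e, False) + F (e, True))"
proof -
  have fin: "finite (arcs G \<times> (UNIV :: bool set))" by simp
  have "(\<Sum>v\<in>verts G. \<Sum>h\<in>ends_at G v. F h) = (\<Sum>v\<in>verts G. sum F {h \<in> arcs G \<times> UNIV. end_vertex G h = v})"
    by (simp add: ends_at_def)
  also have "\<dots> = sum F (arcs G \<times> UNIV)"
    by (rule sum.group[OF fin]) (use end_vertex_verts in auto)
  also have "\<dots> = (\<Sum>e\<in>arcs G. \<Sum>b\<in>UNIV. F (e, b))"
    by (simp add: sum.cartesian_product)
  finally show ?thesis by (simp add: UNIV_bool)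
qed

section \<open>Paths and distances\<close>

lemma path_length_nonneg: "path_length G len p q r \<Longrightarrow> 0 \<le> r"
  by (induction rule: path_length.induct) auto

lemma path_length_mem: "path_length G len p q r \<Longrightarrow> q \<in> gpoints G len"
  by (induction rule: path_length.induct) (auto simp: mem_ends_at intro: end_point_mem)

lemma gdist_le: "path_length G len p q r \<Longrightarrow> gdist G len p q \<le> r"
  unfolding gdist_def using path_length_nonneg by (intro cInf_lower bdd_belowI[of _ 0]) auto

lemma gdist_along_le:
  assumes "(e, x) \<in> gpoints G len" "(e, y) \<in> gpoints G len"
  shows "gdist G len (e, x) (e, y) \<le> \<bar>x - y\<bar>"
  using gdist_le[OF path_length.along[OF path_length.trivial[OF assms(1)] assms(2)]] by simp

lemma gdist_ends_le:
  assumes "h \<in> ends_at G v" "h' \<in> ends_at G v"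
  shows "gdist G len (end_point len h) (end_point len h') \<le> 0"
  using assms
  by (intro gdist_le path_length.through[OF path_length.trivial]) (auto simp: mem_ends_at intro: end_point_mem)

text \<open>Induction along an undirected walk: pass at no cost to an end of the next edge, then
  traverse that edge in whichever direction is required.\<close>

lemma path_to_vertex:
  assumes p: "p \<in> gpoints G len" and v: "v \<in> verts G"
  shows "\<exists>h\<in>ends_at G v. \<exists>r. path_length G len p (end_point len h) r"
proof -
  let ?R = "\<lambda>v. \<exists>h\<in>ends_at G v. \<exists>r. path_length G len p (end_point len h) r"
  obtain e x where ex: "p = (e, x)" "e \<in> arcs G" using p by (auto simp: gpoints_def)
  have "path_length G len p (e, 0) (0 + \<bar>x - 0\<bar>)"
    using path_length.trivial[OF p] ex len_pos[OF ex(2)] unfolding ex(1)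
    by (intro path_length.along) (auto simp: mem_gpoints)
  then have start: "?R (tail G e)"
    using ex by (intro bexI[of _ "(e, False)"]) (auto simp: end_point_def mem_ends_at end_vertex_def)
  have edge: "?R w" if R: "?R u" and uw: "(u, w) \<in> arcs_ends (mk_symmetric G)" for u w
  proof -
    have "\<exists>f\<in>arcs G. tail G f = u \<and> head G f = w \<or> tail G f = w \<and> head G f = u"
      using uw by (auto simp: parcs_mk_symmetric arcs_ends_def arc_to_ends_def)
    then obtain f b where f: "f \<in> arcs G" "end_vertex G (f, b) = u" "end_vertex G (f, \<not> b) = w"
      unfolding end_vertex_def by (metis fst_conv snd_conv)
    obtain h r where h: "h \<in> ends_at G u" "path_length G len p (end_point len h) r" using R by blast
    have "path_length G len p (end_point len (f, b)) r"
      by (rule path_length.through[OF h(2,1)]) (simp add: mem_ends_at f)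
    then have "path_length G len p (f, if b then len f else 0) r" by (cases b) (simp_all add: end_point_def)
    from path_length.along[OF this, of "if \<not> b then len f else 0"]
    have "\<exists>r. path_length G len p (end_point len (f, \<not> b)) r"
      using f(1) len_pos[OF f(1)] by (auto simp: end_point_def mem_gpoints)
    then show ?thesis using f by (intro bexI[of _ "(f, \<not> b)"]) (auto simp: mem_ends_at)
  qed
  have "tail G e \<in> verts G" using ex by simp
  then have "reachable (mk_symmetric G) (tail G e) v"
    using conn v unfolding Digraph_Component.connected_def strongly_connected_def by simp
  then have "(tail G e, v) \<in> rtrancl_on (verts (mk_symmetric G)) (arcs_ends (mk_symmetric G))"
    by (simp add: reachable_def)
  then show ?thesis
  proof (induction rule: rtrancl_on_induct)
    case base
    show ?case by (rule start)
  next
    case (step u w)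
    then show ?case using edge by blast
  qed
qed

lemma ends_at_nonempty: "v \<in> verts G \<Longrightarrow> ends_at G v \<noteq> {}"
proof -
  assume v: "v \<in> verts G"
  obtain e where "e \<in> arcs G" using arcs_nonempty by blast
  then have "(e, 0) \<in> gpoints G len" using len_pos by (auto simp: mem_gpoints less_imp_le)
  from path_to_vertex[OF this v] show ?thesis by blast
qed

lemma path_exists:
  assumes "p \<in> gpoints G len" "q \<in> gpoints G len"
  shows "\<exists>r. path_length G len p q r"
proof -
  obtain f y where q: "q = (f, y)" "f \<in> arcs G" using assms(2) by (auto simp: gpoints_def)
  obtain h r where h: "h \<in> ends_at G (tail G f)" "path_length G len p (end_point len h) r"
    using path_to_vertex[OF assms(1), of "tail G f"] q by auto
  have "path_length G len p (end_point len (f, False)) r"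
    by (rule path_length.through[OF h(2,1)]) (simp add: mem_ends_at q end_vertex_def)
  then have "path_length G len p (f, 0) r" by (simp add: end_point_def)
  from path_length.along[OF this] show ?thesis using assms(2) q(1) by blast
qed

section \<open>Values at vertices and continuity\<close>

text \<open>Expresses continuity at the vertices without distances: all edge ends at a vertex have
  distance 0 from each other.\<close>

definition matched :: "'e gfun \<Rightarrow> bool" where
  "matched u \<longleftrightarrow> (\<forall>v. \<forall>h\<in>ends_at G v. \<forall>h'\<in>ends_at G v.
     case_prod u (end_point len h) = case_prod u (end_point len h'))"

lemma graph_continuousD:
  assumes u: "graph_continuous G len u" and mem: "(e, x) \<in> gpoints G len" and "0 < \<epsilon>"
  obtains \<delta> where "0 < \<delta>"
    "\<And>e' y. \<lbrakk>(e', y) \<in> gpoints G len; gdist G len (e, x) (e', y) < \<delta>\<rbrakk> \<Longrightarrow> \<bar>u e x - u e' y\<bar> < \<epsilon>"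
proof -
  have "\<forall>\<epsilon>>0. \<exists>\<delta>>0. \<forall>(e', y)\<in>gpoints G len. gdist G len (e, x) (e', y) < \<delta> \<longrightarrow> \<bar>u e x - u e' y\<bar> < \<epsilon>"
    using bspec[OF u[unfolded graph_continuous_def] mem] by simp
  then obtain \<delta> where \<delta>: "0 < \<delta>"
    "\<forall>q\<in>gpoints G len. case q of (e', y) \<Rightarrow> gdist G len (e, x) (e', y) < \<delta> \<longrightarrow> \<bar>u e x - u e' y\<bar> < \<epsilon>"
    using assms(3) by meson
  show ?thesis
  proof (rule that[OF \<delta>(1)])
    fix e' y assume "(e', y) \<in> gpoints G len" "gdist G len (e, x) (e', y) < \<delta>"
    then show "\<bar>u e x - u e' y\<bar> < \<epsilon>" using bspec[OF \<delta>(2), of "(e', y)"] by simp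
  qed
qed

lemma graph_continuous_matched:
  assumes "graph_continuous G len u"
  shows "matched u"
  unfolding matched_def
proof (intro allI ballI)
  fix v h h' assume h: "h \<in> ends_at G v" "h' \<in> ends_at G v"
  obtain e x where p: "end_point len h = (e, x)" by (cases "end_point len h")
  obtain e' y where q: "end_point len h' = (e', y)" by (cases "end_point len h'")
  have mem: "(e, x) \<in> gpoints G len" "(e', y) \<in> gpoints G len"
    using h end_point_mem[of h] end_point_mem[of h'] p q by (auto simp: mem_ends_at)
  have d: "gdist G len (e, x) (e', y) \<le> 0" using gdist_ends_le[OF h] p q by simp
  have "\<bar>u e x - u e' y\<bar> < \<epsilon>" if eps: "\<epsilon> > 0" for \<epsilon>
  proof -
    obtain \<delta> where "0 < \<delta>"
      "\<And>e' y. \<lbrakk>(e', y) \<in> gpoints G len; gdist G len (e, x) (e', y) < \<delta>\<rbrakk> \<Longrightarrow> \<bar>u e x - u e' y\<bar> < \<epsilon>"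
      using graph_continuousD[OF assms mem(1) eps] by blast
    then show ?thesis using mem(2) d by simp
  qed
  then have "\<bar>u e x - u e' y\<bar> \<le> 0" by (rule dense_ge[OF less_imp_le])
  then show "case_prod u (end_point len h) = case_prod u (end_point len h')" by (simp add: p q)
qed

lemma graph_continuous_edge:
  assumes "graph_continuous G len u" "e \<in> arcs G"
  shows "continuous_on {0..len e} (u e)"
  unfolding continuous_on_iff
proof (intro ballI allI impI)
  fix x \<epsilon> :: real assume x: "x \<in> {0..len e}" and "0 < \<epsilon>"
  have mem: "(e, x) \<in> gpoints G len" using x assms(2) by (simp add: mem_gpoints)
  obtain \<delta> where \<delta>: "0 < \<delta>"
    "\<And>e' y. \<lbrakk>(e', y) \<in> gpoints G len; gdist G len (e, x) (e', y) < \<delta>\<rbrakk> \<Longrightarrow> \<bar>u e x - u e' y\<bar> < \<epsilon>"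
    using graph_continuousD[OF assms(1) mem \<open>0 < \<epsilon>\<close>] by blast
  show "\<exists>\<delta>>0. \<forall>y\<in>{0..len e}. dist y x < \<delta> \<longrightarrow> dist (u e y) (u e x) < \<epsilon>"
  proof (intro exI[of _ \<delta>] conjI ballI impI \<delta>(1))
    fix y assume y: "y \<in> {0..len e}" "dist y x < \<delta>"
    have my: "(e, y) \<in> gpoints G len" using y assms(2) by (simp add: mem_gpoints)
    have "gdist G len (e, x) (e, y) < \<delta>"
      using gdist_along_le[OF mem my] y(2) by (simp add: dist_real_def)
    then have "\<bar>u e x - u e y\<bar> < \<epsilon>" using \<delta>(2)[OF my] by blast
    then show "dist (u e y) (u e x) < \<epsilon>" by (simp add: dist_real_def abs_minus_commute)
  qed
qed

text \<open>Along a path the function varies by at most K times the length, since edges have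
  Lipschitz constants and passages through vertices change nothing. Finitely many edges allow a
  common K.\<close>

lemma graph_continuousI:
  assumes m: "matched u" and lip: "\<And>e. e \<in> arcs G \<Longrightarrow>
    \<exists>K\<ge>0. \<forall>x\<in>{0..len e}. \<forall>y\<in>{0..len e}. \<bar>u e x - u e y\<bar> \<le> K * \<bar>x - y\<bar>"
  shows "graph_continuous G len u"
proof -
  obtain k where k: "\<And>e. e \<in> arcs G \<Longrightarrow> 0 \<le> k e \<and> (\<forall>x\<in>{0..len e}. \<forall>y\<in>{0..len e}. \<bar>u e x - u e y\<bar> \<le> k e * \<bar>x - y\<bar>)"
    using lip by metis
  define K where "K = (\<Sum>e\<in>arcs G. k e) + 1"
  have K: "k e \<le> K" if "e \<in> arcs G" for e
    unfolding K_def using member_le_sum[OF that, of k] k by fastforce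
  have K0: "0 < K" unfolding K_def using sum_nonneg[of "arcs G" k] k by (simp add: add_nonneg_pos)
  have path: "\<bar>case_prod u p - case_prod u q\<bar> \<le> K * r" if "path_length G len p q r" for p q r
    using that
  proof (induction rule: path_length.induct)
    case (along p e x r y)
    have mem: "e \<in> arcs G" "x \<in> {0..len e}" "y \<in> {0..len e}"
      using path_length_mem[OF along.hyps(1)] along.hyps(2) by (auto simp: mem_gpoints)
    have "\<bar>u e x - u e y\<bar> \<le> k e * \<bar>x - y\<bar>" using k[OF mem(1)] mem(2,3) by blast
    also have "\<dots> \<le> K * \<bar>x - y\<bar>" by (rule mult_right_mono[OF K[OF mem(1)]]) simp
    finally show ?case using along.IH by (simp add: distrib_left)
  next
    case (through p h r v h')
    have "case_prod u (end_point len h) = case_prod u (end_point len h')"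
      using m through.hyps unfolding matched_def by blast
    then show ?case using through.IH by simp
  qed simp
  have dist: "\<bar>case_prod u p - case_prod u q\<bar> < \<epsilon>"
    if "p \<in> gpoints G len" "q \<in> gpoints G len" "gdist G len p q < \<epsilon> / K" for p q \<epsilon>
  proof -
    note d = that(3)
    have "{r. path_length G len p q r} \<noteq> {}" using path_exists[OF that(1,2)] by blast
    moreover have "bdd_below {r. path_length G len p q r}"
      using path_length_nonneg by (intro bdd_belowI[of _ 0]) auto
    ultimately obtain r where r: "path_length G len p q r" "r < \<epsilon> / K"
      using d unfolding gdist_def by (auto simp: cInf_less_iff)
    have "K * r < \<epsilon>" using r(2) K0 by (simp add: pos_less_divide_eq mult.commute)
    then show ?thesis using path[OF r(1)] by linarith
  qed
  show ?thesis
    unfolding graph_continuous_def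
  proof (clarify)
    fix e x and \<epsilon> :: real assume ex: "(e, x) \<in> gpoints G len" and e: "0 < \<epsilon>"
    show "\<exists>\<delta>>0. \<forall>(e', y)\<in>gpoints G len. gdist G len (e, x) (e', y) < \<delta> \<longrightarrow> \<bar>u e x - u e' y\<bar> < \<epsilon>"
      using dist[OF ex, where \<epsilon> = \<epsilon>] e K0 by (intro exI[of _ "\<epsilon> / K"]) auto
  qed
qed

lemma graph_LipschitzD:
  assumes "graph_Lipschitz G len u"
  shows "matched u" and "\<exists>M\<ge>0. \<forall>e\<in>arcs G. \<forall>x\<in>{0..len e}. \<forall>y\<in>{0..len e}. \<bar>u e x - u e y\<bar> \<le> M * \<bar>x - y\<bar>"
proof -
  obtain M where M: "\<And>e x e' y. \<lbrakk>(e, x) \<in> gpoints G len; (e', y) \<in> gpoints G len\<rbrakk> \<Longrightarrow>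
      \<bar>u e x - u e' y\<bar> \<le> M * gdist G len (e, x) (e', y)"
  proof -
    obtain M where M: "\<forall>p\<in>gpoints G len. case p of (e, x) \<Rightarrow> \<forall>q\<in>gpoints G len. case q of (e', y) \<Rightarrow>
        \<bar>u e x - u e' y\<bar> \<le> M * gdist G len (e, x) (e', y)"
      using assms unfolding graph_Lipschitz_def by (elim exE)
    show ?thesis
    proof (rule that[of M])
      fix e x e' y assume "(e, x) \<in> gpoints G len" "(e', y) \<in> gpoints G len"
      then show "\<bar>u e x - u e' y\<bar> \<le> M * gdist G len (e, x) (e', y)"
        using bspec[OF M, of "(e, x)"] by fastforce
    qed
  qed
  have gd0: "0 \<le> gdist G len p q" if "p \<in> gpoints G len" "q \<in> gpoints G len" for p q
    unfolding gdist_def using path_exists[OF that] path_length_nonneg by (intro cInf_greatest) auto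
  have M': "\<bar>u e x - u e' y\<bar> \<le> \<bar>M\<bar> * gdist G len (e, x) (e', y)"
    if "(e, x) \<in> gpoints G len" "(e', y) \<in> gpoints G len" for e x e' y
    using M[OF that] mult_right_mono[OF abs_ge_self[of M] gd0[OF that]] by linarith
  show "matched u"
    unfolding matched_def
  proof (intro allI ballI)
    fix v h h' assume h: "h \<in> ends_at G v" "h' \<in> ends_at G v"
    obtain e x where p: "end_point len h = (e, x)" by (cases "end_point len h")
    obtain e' y where q: "end_point len h' = (e', y)" by (cases "end_point len h'")
    have mem: "(e, x) \<in> gpoints G len" "(e', y) \<in> gpoints G len"
      using h end_point_mem[of h] end_point_mem[of h'] p q by (auto simp: mem_ends_at)
    have "gdist G len (e, x) (e', y) = 0" using gdist_ends_le[OF h] gd0[OF mem] p q by simp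
    then have "\<bar>u e x - u e' y\<bar> \<le> 0" using M'[OF mem] by simp
    then show "case_prod u (end_point len h) = case_prod u (end_point len h')" by (simp add: p q)
  qed
  have "\<bar>u e x - u e y\<bar> \<le> \<bar>M\<bar> * \<bar>x - y\<bar>" if "e \<in> arcs G" "x \<in> {0..len e}" "y \<in> {0..len e}" for e x y
  proof -
    have mem: "(e, x) \<in> gpoints G len" "(e, y) \<in> gpoints G len" using that by (simp_all add: mem_gpoints)
    show ?thesis using M'[OF mem] mult_left_mono[OF gdist_along_le[OF mem], of "\<bar>M\<bar>"] by linarith
  qed
  then show "\<exists>M\<ge>0. \<forall>e\<in>arcs G. \<forall>x\<in>{0..len e}. \<forall>y\<in>{0..len e}. \<bar>u e x - u e y\<bar> \<le> M * \<bar>x - y\<bar>"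
    by (intro exI[of _ "\<bar>M\<bar>"]) auto
qed

lemma vertex_value_eq:
  assumes "matched u" "h \<in> ends_at G v"
  shows "vertex_value G len u v = case_prod u (end_point len h)"
  unfolding vertex_value_def
proof (rule the_equality)
  show "\<forall>h'\<in>ends_at G v. case_prod u (end_point len h') = case_prod u (end_point len h)"
    using assms unfolding matched_def by blast
  show "c = case_prod u (end_point len h)" if "\<forall>h\<in>ends_at G v. case_prod u (end_point len h) = c" for c
    using bspec[OF that assms(2)] by simp
qed

lemma matched_combination:
  assumes "matched u" "matched w"
  shows "matched (\<lambda>e x. c * u e x + d * w e x)"
  unfolding matched_def
proof (intro allI ballI)
  fix v h h' assume h: "h \<in> ends_at G v" "h' \<in> ends_at G v"
  have "case_prod u (end_point len h) = case_prod u (end_point len h')"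
    "case_prod w (end_point len h) = case_prod w (end_point len h')"
    using assms h unfolding matched_def by blast+
  then show "case_prod (\<lambda>e x. c * u e x + d * w e x) (end_point len h)
      = case_prod (\<lambda>e x. c * u e x + d * w e x) (end_point len h')"
    by (simp add: case_prod_unfold)
qed

lemma vertex_value_combination:
  assumes "matched u" "matched w" "v \<in> verts G"
  shows "vertex_value G len (\<lambda>e x. c * u e x + d * w e x) v = c * vertex_value G len u v + d * vertex_value G len w v"
proof -
  obtain h where h: "h \<in> ends_at G v" using ends_at_nonempty[OF assms(3)] by blast
  show ?thesis
    using vertex_value_eq[OF assms(1) h] vertex_value_eq[OF assms(2) h] vertex_value_eq[OF matched_combination[OF assms(1,2)] h]
    by (simp add: case_prod_unfold)
qed

text \<open>Cellwise affine functions are Lipschitz on each edge, so continuity on the graph amounts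
  to matching values.\<close>

lemma Vh_iff:
  assumes n: "mesh G n"
  shows "u \<in> Vh G len n \<longleftrightarrow> matched u \<and> (\<forall>e x. (e, x) \<notin> gpoints G len \<longrightarrow> u e x = 0) \<and>
    (\<forall>e\<in>arcs G. cell_affine (len e / real (n e)) (n e) (u e))"
proof -
  have h: "0 \<le> len e / real (n e)" "real (n e) * (len e / real (n e)) = len e" if "e \<in> arcs G" for e
    using len_pos[OF that] n that by (auto simp: mesh_def)
  have "graph_continuous G len u"
    if "matched u" "\<forall>e\<in>arcs G. cell_affine (len e / real (n e)) (n e) (u e)"
  proof (rule graph_continuousI[OF that(1)])
    fix e assume e: "e \<in> arcs G"
    show "\<exists>K\<ge>0. \<forall>x\<in>{0..len e}. \<forall>y\<in>{0..len e}. \<bar>u e x - u e y\<bar> \<le> K * \<bar>x - y\<bar>"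
      using cell_affine_Lipschitz[OF h(1)[OF e], of "n e" "u e"] that(2) e unfolding h(2)[OF e] by blast
  qed
  then show ?thesis
    unfolding Vh_def cell_affine_def using graph_continuous_matched by auto
qed

end

section \<open>The bilinear form\<close>

lemma Young_square:
  fixes p q t :: real
  assumes "0 < t"
  shows "(p + q)\<^sup>2 \<le> (1 + t) * p\<^sup>2 + (1 + 1 / t) * q\<^sup>2"
proof -
  have "0 \<le> (t * p - q)\<^sup>2 / t" using assms by simp
  also have "(t * p - q)\<^sup>2 / t = t * p\<^sup>2 - 2 * p * q + q\<^sup>2 / t"
    using assms by (simp add: power2_eq_square field_simps)
  finally show ?thesis by (simp add: power2_sum algebra_simps)
qed

lemma LINT_square_eq_integral:
  "L2_interval l f \<Longrightarrow> (LINT x|lebesgue_on {0..l}. (f x)\<^sup>2) = integral {0..l} (\<lambda>x. (f x)\<^sup>2)"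
  by (rule LINT_Icc_eq_integral[OF L2_intervalD(2)])

text \<open>The parameter \<open>t\<close> is needed close to, but different from, 1: the hypotheses on \<open>\<alpha>\<close> leave room in the
  zeroth order term only, and \<open>t > 1\<close> trades it for room in the gradient term.\<close>

lemma trace_inequality:
  assumes l: "0 < l" and fg: "antideriv l f g" and t: "0 < t"
  shows "(f 0)\<^sup>2 + (f l)\<^sup>2 \<le> 2 * (1 + t) / l * (LINT x|lebesgue_on {0..l}. (f x)\<^sup>2)
    + (1 + 1 / t) * l * (LINT x|lebesgue_on {0..l}. (g x)\<^sup>2)"
proof -
  define I where "I = integral {0..l} (\<lambda>x. (g x)\<^sup>2)"
  have Lf: "L2_interval l f" by (rule L2_interval_continuous[OF antideriv_continuous[OF fg]])
  note Lg = antideriv_L2[OF fg]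
  have fi: "(\<lambda>x. (f x)\<^sup>2) integrable_on {0..l}" and gi: "(\<lambda>x. (g x)\<^sup>2) integrable_on {0..l}"
    using L2_interval_sub_integrable(2)[OF Lf, of 0 l] L2_interval_sub_integrable(2)[OF Lg, of 0 l] by simp_all
  define A where "A = 2 * (1 + t)"
  \<comment> \<open>The squared increments from x to the two ends are at most x I and (l - x) I,
    whose sum l I is independent of x; integrating over x then gives the claim.\<close>
  have point: "(f 0)\<^sup>2 + (f l)\<^sup>2 \<le> A * (f x)\<^sup>2 + (1 + 1 / t) * (l * I)" if x: "x \<in> {0..l}" for x
  proof -
    have sub: "integral S (\<lambda>x. (g x)\<^sup>2) \<le> I" if "S \<subseteq> {0..l}" "(\<lambda>x. (g x)\<^sup>2) integrable_on S" for S
      unfolding I_def by (rule integral_subset_le[OF that gi]) simp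
    have s1: "(\<lambda>x. (g x)\<^sup>2) integrable_on {0..x}" and s2: "(\<lambda>x. (g x)\<^sup>2) integrable_on {x..l}"
      using x by (auto intro: integrable_on_subinterval[OF gi])
    have "(f 0 - f x)\<^sup>2 \<le> (x - 0) * integral {0..x} (\<lambda>x. (g x)\<^sup>2)"
      by (rule antideriv_increment_square_le[OF fg]) (use x in auto)
    also have "\<dots> \<le> x * I" using x sub[OF _ s1] by (intro mult_mono) (auto intro: integral_nonneg[OF s1])
    finally have 1: "(f 0 - f x)\<^sup>2 \<le> x * I" .
    have "(f l - f x)\<^sup>2 \<le> (l - x) * integral {x..l} (\<lambda>x. (g x)\<^sup>2)"
      by (rule antideriv_increment_square_le[OF fg]) (use x in auto)
    also have "\<dots> \<le> (l - x) * I" using x sub[OF _ s2] by (intro mult_mono) (auto intro: integral_nonneg[OF s2])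
    finally have 2: "(f l - f x)\<^sup>2 \<le> (l - x) * I" .
    have "(f 0)\<^sup>2 + (f l)\<^sup>2 \<le> A * (f x)\<^sup>2 + (1 + 1 / t) * ((f 0 - f x)\<^sup>2 + (f l - f x)\<^sup>2)"
      using Young_square[OF t, of "f x" "f 0 - f x"] Young_square[OF t, of "f x" "f l - f x"]
      by (simp add: A_def algebra_simps)
    also have "(1 + 1 / t) * ((f 0 - f x)\<^sup>2 + (f l - f x)\<^sup>2) \<le> (1 + 1 / t) * (l * I)"
      using 1 2 t by (intro mult_left_mono) (simp_all add: algebra_simps)
    finally show ?thesis by simp
  qed
  have "integral {0..l} (\<lambda>x. (f 0)\<^sup>2 + (f l)\<^sup>2) \<le> integral {0..l} (\<lambda>x. A * (f x)\<^sup>2 + (1 + 1 / t) * (l * I))"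
    by (rule integral_le[OF integrable_const_ivl _ point]) (intro integrable_add integrable_on_mult_right fi integrable_const_ivl)
  also have "\<dots> = A * integral {0..l} (\<lambda>x. (f x)\<^sup>2) + l * ((1 + 1 / t) * (l * I))"
    by (subst Henstock_Kurzweil_Integration.integral_add[OF integrable_on_mult_right[OF fi] integrable_const_ivl]) (use l in simp)
  finally have "l * ((f 0)\<^sup>2 + (f l)\<^sup>2) \<le> A * integral {0..l} (\<lambda>x. (f x)\<^sup>2) + l * ((1 + 1 / t) * (l * I))"
    using l by simp
  then have "(f 0)\<^sup>2 + (f l)\<^sup>2 \<le> (A * integral {0..l} (\<lambda>x. (f x)\<^sup>2) + l * ((1 + 1 / t) * (l * I))) / l"
    using l by (simp add: pos_le_divide_eq mult.commute)
  also have "\<dots> = A / l * integral {0..l} (\<lambda>x. (f x)\<^sup>2) + (1 + 1 / t) * l * I"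
    using l by (simp add: add_divide_distrib)
  finally show ?thesis unfolding LINT_square_eq_integral[OF Lf] LINT_square_eq_integral[OF Lg] A_def I_def .
qed

section \<open>Function spaces on the graph\<close>

context metric_graph
begin

definition L2s :: "'e gfun set" where
  "L2s = {f. L2_graph G len f}"

definition H1s :: "'e gfun set" where
  "H1s = {w. matched w \<and> (\<forall>e\<in>arcs G. \<exists>g. antideriv (len e) (w e) g)}"

definition gradient :: "'e gfun \<Rightarrow> 'e gfun" where
  "gradient w = (\<lambda>e. wderiv (len e) (w e))"

lemma L2sD: "\<lbrakk>f \<in> L2s; e \<in> arcs G\<rbrakk> \<Longrightarrow> L2_interval (len e) (f e)"
  by (simp add: L2s_def L2_graph_def)

lemma combination_apply: "(c *\<^sub>R f + d *\<^sub>R g) = (\<lambda>e x. c * f e x + d * g e x)" for f g :: "'e gfun"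
  by (simp add: fun_eq_iff)

lemma subspace_L2s: "subspace L2s"
  unfolding subspace_def L2s_def L2_graph_def
  by (auto simp: plus_fun_def zero_fun_def scaleR_fun_def intro: L2_interval_add L2_interval_cmult L2_interval_const)

lemma semi_inner_L2: "semi_inner (L2_inner G len) L2s"
proof
  show "subspace L2s" by (rule subspace_L2s)
  fix x y z :: "'e gfun" and r :: real assume x: "x \<in> L2s"
  show "0 \<le> L2_inner G len x x" unfolding L2_inner_def by (intro sum_nonneg Bochner_Integration.integral_nonneg) simp
  assume y: "y \<in> L2s"
  show "L2_inner G len x y = L2_inner G len y x" by (simp add: L2_inner_def mult.commute)
  show "L2_inner G len (r *\<^sub>R x) y = r * L2_inner G len x y"
    by (simp add: L2_inner_def sum_distrib_left mult.assoc)
  assume z: "z \<in> L2s"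
  have "(LINT t|lebesgue_on {0..len e}. (x e t + y e t) * z e t)
      = (LINT t|lebesgue_on {0..len e}. x e t * z e t) + (LINT t|lebesgue_on {0..len e}. y e t * z e t)" if e: "e \<in> arcs G" for e
    unfolding distrib_right
    by (intro Bochner_Integration.integral_add L2_interval_integrable_mult L2sD x y z e)
  then show "L2_inner G len (x + y) z = L2_inner G len x z + L2_inner G len y z"
    by (simp add: L2_inner_def sum.distrib)
qed

lemma H1sD:
  assumes "w \<in> H1s"
  shows "matched w" "e \<in> arcs G \<Longrightarrow> antideriv (len e) (w e) (gradient w e)"
  using assms antideriv_wderiv(1)[OF len_pos] by (auto simp: H1s_def gradient_def)

lemma H1s_L2s: "w \<in> H1s \<Longrightarrow> w \<in> L2s"
  using L2_interval_continuous[OF antideriv_continuous[OF H1sD(2)]] by (auto simp: L2s_def L2_graph_def)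

lemma gradient_L2s: "w \<in> H1s \<Longrightarrow> gradient w \<in> L2s"
  using antideriv_L2[OF H1sD(2)] by (auto simp: L2s_def L2_graph_def)

lemma gradient_AE:
  assumes "w \<in> H1s" "e \<in> arcs G" "antideriv (len e) (w e) g"
  shows "AE x in lebesgue_on {0..len e}. gradient w e x = g x"
  unfolding gradient_def by (rule antideriv_wderiv(2)[OF len_pos[OF assms(2)] assms(3)])

text \<open>The gradient is linear only almost everywhere, since \<open>wderiv\<close> chooses each
  representative separately; vertex values are exactly linear.\<close>

lemma H1s_combination:
  assumes "u \<in> H1s" "w \<in> H1s"
  shows "c *\<^sub>R u + d *\<^sub>R w \<in> H1s"
    and "e \<in> arcs G \<Longrightarrow> AE x in lebesgue_on {0..len e}. gradient (c *\<^sub>R u + d *\<^sub>R w) e x = c * gradient u e x + d * gradient w e x"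
    and "v \<in> verts G \<Longrightarrow> vertex_value G len (c *\<^sub>R u + d *\<^sub>R w) v = c * vertex_value G len u v + d * vertex_value G len w v"
proof -
  have ad: "antideriv (len e) ((c *\<^sub>R u + d *\<^sub>R w) e) (\<lambda>x. c * gradient u e x + d * gradient w e x)" if e: "e \<in> arcs G" for e
    unfolding combination_apply by (intro antideriv_add antideriv_cmult H1sD(2) assms e)
  show mem: "c *\<^sub>R u + d *\<^sub>R w \<in> H1s"
    using matched_combination[OF H1sD(1)[OF assms(1)] H1sD(1)[OF assms(2)], of c d] ad
    unfolding H1s_def combination_apply[symmetric] by blast
  show "AE x in lebesgue_on {0..len e}. gradient (c *\<^sub>R u + d *\<^sub>R w) e x = c * gradient u e x + d * gradient w e x" if e: "e \<in> arcs G"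
    by (rule gradient_AE[OF mem e ad[OF e]])
  show "vertex_value G len (c *\<^sub>R u + d *\<^sub>R w) v = c * vertex_value G len u v + d * vertex_value G len w v" if "v \<in> verts G"
    unfolding combination_apply by (rule vertex_value_combination[OF H1sD(1)[OF assms(1)] H1sD(1)[OF assms(2)] that])
qed

lemma zero_H1s: "0 \<in> H1s"
proof -
  have "antideriv l (\<lambda>x. 0) (\<lambda>x. 0)" for l
    unfolding antideriv_def by (simp add: L2_interval_const)
  then show ?thesis by (auto simp: H1s_def matched_def zero_fun_def)
qed

lemma subspace_H1s: "subspace H1s"
  unfolding subspace_def
proof (intro conjI ballI allI zero_H1s)
  fix u w :: "'e gfun" and c :: real assume u: "u \<in> H1s"
  show "c *\<^sub>R u \<in> H1s" using H1s_combination(1)[OF u u, of c 0] by simp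
  assume w: "w \<in> H1s"
  show "u + w \<in> H1s" using H1s_combination(1)[OF u w, of 1 1] by simp
qed

definition mass :: "'e gfun \<Rightarrow> real" where "mass w = L2_inner G len w w"

lemma mass_eq: "mass w = (\<Sum>e\<in>arcs G. LINT x|lebesgue_on {0..len e}. (w e x)\<^sup>2)"
  by (simp add: mass_def L2_inner_def power2_eq_square)

lemma mass_nonneg: "0 \<le> mass w"
  unfolding mass_eq by (intro sum_nonneg Bochner_Integration.integral_nonneg) simp

definition trace :: "'e gfun \<Rightarrow> real" where
  "trace w = (\<Sum>e\<in>arcs G. (w e 0)\<^sup>2 + (w e (len e))\<^sup>2)"

text \<open>Each vertex value is counted once per edge end. This weighting by the degree is what
  brings the minimal degree into the hypothesis on \<alpha>.\<close>

lemma trace_eq: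
  assumes "matched w"
  shows "(\<Sum>v\<in>verts G. real (gdegree G v) * (vertex_value G len w v)\<^sup>2) = trace w"
proof -
  have "(\<Sum>v\<in>verts G. real (gdegree G v) * (vertex_value G len w v)\<^sup>2)
      = (\<Sum>v\<in>verts G. \<Sum>h\<in>ends_at G v. (case_prod w (end_point len h))\<^sup>2)"
  proof (rule sum.cong[OF refl])
    fix v
    have "(\<Sum>h\<in>ends_at G v. (case_prod w (end_point len h))\<^sup>2) = (\<Sum>h\<in>ends_at G v. (vertex_value G len w v)\<^sup>2)"
      by (rule sum.cong[OF refl]) (simp only: vertex_value_eq[OF assms])
    then show "real (gdegree G v) * (vertex_value G len w v)\<^sup>2 = (\<Sum>h\<in>ends_at G v. (case_prod w (end_point len h))\<^sup>2)"
      by (simp only: gdegree_def sum_constant)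
  qed
  also have "\<dots> = trace w"
    by (subst ends_partition) (simp add: trace_def end_point_def)
  finally show ?thesis .
qed

lemma gdegree_pos: "v \<in> verts G \<Longrightarrow> 1 \<le> gdegree G v"
proof -
  assume v: "v \<in> verts G"
  have "finite (ends_at G v)" by (rule finite_subset[of _ "arcs G \<times> UNIV"]) (auto simp: ends_at_def)
  then show ?thesis using ends_at_nonempty[OF v] by (simp add: gdegree_def Suc_le_eq card_gt_0_iff)
qed

abbreviation "lmin \<equiv> Min (len ` arcs G)"
abbreviation "lmax \<equiv> Max (len ` arcs G)"

lemma lmin: "0 < lmin" "e \<in> arcs G \<Longrightarrow> lmin \<le> len e" and lmax: "e \<in> arcs G \<Longrightarrow> len e \<le> lmax" "0 < lmax"
proof -
  have f: "finite (len ` arcs G)" "len ` arcs G \<noteq> {}" using arcs_nonempty by auto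
  show "0 < lmin" using f len_pos by (simp add: Min_gr_iff)
  show "lmin \<le> len e" if "e \<in> arcs G" using f that by (intro Min_le) auto
  show le: "len e \<le> lmax" if "e \<in> arcs G" for e using f that by (intro Max_ge) auto
  obtain e where "e \<in> arcs G" using arcs_nonempty by blast
  then show "0 < lmax" using le[of e] len_pos[of e] by linarith
qed

lemma trace_le:
  assumes w: "w \<in> H1s" and t: "0 < t"
  shows "trace w \<le> 2 * (1 + t) / lmin * mass w + (1 + 1 / t) * lmax * mass (gradient w)"
proof -
  have "trace w \<le> (\<Sum>e\<in>arcs G. 2 * (1 + t) / lmin * (LINT x|lebesgue_on {0..len e}. (w e x)\<^sup>2)
    + (1 + 1 / t) * lmax * (LINT x|lebesgue_on {0..len e}. (gradient w e x)\<^sup>2))"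
    unfolding trace_def
  proof (rule sum_mono)
    fix e assume e: "e \<in> arcs G"
    have "(w e 0)\<^sup>2 + (w e (len e))\<^sup>2 \<le> 2 * (1 + t) / len e * (LINT x|lebesgue_on {0..len e}. (w e x)\<^sup>2)
        + (1 + 1 / t) * len e * (LINT x|lebesgue_on {0..len e}. (gradient w e x)\<^sup>2)"
      by (rule trace_inequality[OF len_pos[OF e] H1sD(2)[OF w e] t])
    also have "\<dots> \<le> 2 * (1 + t) / lmin * (LINT x|lebesgue_on {0..len e}. (w e x)\<^sup>2)
        + (1 + 1 / t) * lmax * (LINT x|lebesgue_on {0..len e}. (gradient w e x)\<^sup>2)"
      using t lmin(1) lmin(2)[OF e] lmax(1)[OF e] len_pos[OF e]
      by (intro add_mono mult_right_mono mult_left_mono divide_left_mono Bochner_Integration.integral_nonneg) auto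
    finally show "(w e 0)\<^sup>2 + (w e (len e))\<^sup>2 \<le> 2 * (1 + t) / lmin * (LINT x|lebesgue_on {0..len e}. (w e x)\<^sup>2)
        + (1 + 1 / t) * lmax * (LINT x|lebesgue_on {0..len e}. (gradient w e x)\<^sup>2)" .
  qed
  then show ?thesis by (simp add: mass_eq sum.distrib sum_distrib_left)
qed

end

section \<open>Coercivity and boundedness of the form\<close>

locale graph_problem = metric_graph G len
  for G :: "('v, 'e) pre_digraph" and len :: "'e \<Rightarrow> real" +
  fixes a \<kappa> :: "'e gfun" and \<kappa>0 a0 \<alpha> :: real
  assumes \<kappa>_Linf: "Linf_graph G len \<kappa>" and \<kappa>0: "0 < \<kappa>0"
    and \<kappa>_ge: "\<And>e. e \<in> arcs G \<Longrightarrow> AE x in lebesgue_on {0..len e}. \<kappa>0 \<le> \<kappa> e x"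
    and a_Lip: "graph_Lipschitz G len a" and a0: "0 < a0"
    and a_ge: "\<And>e x. (e, x) \<in> gpoints G len \<Longrightarrow> a0 \<le> a e x"
    and \<alpha>: "0 \<le> \<alpha> \<or>
      (let d0 = Min (gdegree G ` verts G); S = \<bar>\<alpha>\<bar> / real d0
       in 4 * S / Min (len ` arcs G) < \<kappa>0\<^sup>2 \<and> 2 * S * Max (len ` arcs G) \<le> a0)"
begin

abbreviation "form \<equiv> bilinear_form G len a \<kappa> \<alpha>"

lemma a_continuous: "e \<in> arcs G \<Longrightarrow> continuous_on {0..len e} (a e)"
proof -
  assume e: "e \<in> arcs G"
  obtain M where M: "0 \<le> M" "\<And>x y. \<lbrakk>x \<in> {0..len e}; y \<in> {0..len e}\<rbrakk> \<Longrightarrow> \<bar>a e x - a e y\<bar> \<le> M * \<bar>x - y\<bar>"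
    using graph_LipschitzD(2)[OF a_Lip] e by blast
  have "M-lipschitz_on {0..len e} (a e)"
    using M by (intro lipschitz_onI) (auto simp: dist_real_def)
  then show ?thesis by (rule lipschitz_on_continuous_on)
qed

lemma \<kappa>_bound: "\<exists>K>0. \<forall>e\<in>arcs G. (\<lambda>x. (\<kappa> e x)\<^sup>2) \<in> borel_measurable (lebesgue_on {0..len e}) \<and>
  (AE x in lebesgue_on {0..len e}. \<bar>(\<kappa> e x)\<^sup>2\<bar> \<le> K)"
proof -
  obtain m where m: "\<And>e. e \<in> arcs G \<Longrightarrow> AE x in lebesgue_on {0..len e}. \<bar>\<kappa> e x\<bar> \<le> m e"
    using \<kappa>_Linf unfolding Linf_graph_def by metis
  define K where "K = (\<Sum>e\<in>arcs G. (m e)\<^sup>2) + 1"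
  have K: "(m e)\<^sup>2 \<le> K" if "e \<in> arcs G" for e
    unfolding K_def using member_le_sum[OF that, of "\<lambda>e. (m e)\<^sup>2"] by fastforce
  have "0 < K" unfolding K_def by (intro add_nonneg_pos sum_nonneg) auto
  moreover have "AE x in lebesgue_on {0..len e}. \<bar>(\<kappa> e x)\<^sup>2\<bar> \<le> K" if e: "e \<in> arcs G" for e
    using m[OF e]
  proof eventually_elim
    case (elim x)
    have "\<bar>\<kappa> e x\<bar>\<^sup>2 \<le> (m e)\<^sup>2" by (rule power_mono[OF elim]) simp
    then show ?case using K[OF e] by simp
  qed
  moreover have "(\<lambda>x. (\<kappa> e x)\<^sup>2) \<in> borel_measurable (lebesgue_on {0..len e})" if "e \<in> arcs G" for e
    using \<kappa>_Linf that unfolding Linf_graph_def by (intro borel_measurable_power) blast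
  ultimately show ?thesis by (intro exI[of _ K]) blast
qed

lemma \<kappa>_mult_L2s: "f \<in> L2s \<Longrightarrow> (\<lambda>e x. (\<kappa> e x)\<^sup>2 * f e x) \<in> L2s"
  using \<kappa>_bound L2_interval_bounded_mult unfolding L2s_def L2_graph_def by blast

lemma a_mult_L2s: "f \<in> L2s \<Longrightarrow> (\<lambda>e x. a e x * f e x) \<in> L2s"
  using L2_interval_continuous_mult[OF a_continuous] unfolding L2s_def L2_graph_def by blast

lemma form_eq: "form f g = L2_inner G len (\<lambda>e x. (\<kappa> e x)\<^sup>2 * f e x) g
    + L2_inner G len (\<lambda>e x. a e x * gradient f e x) (gradient g)
    + \<alpha> * (\<Sum>v\<in>verts G. vertex_value G len f v * vertex_value G len g v)"
  by (simp add: bilinear_form_def L2_inner_def gradient_def sum_distrib_left mult.assoc)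

lemma L2_inner_cong_AE:
  assumes "f \<in> L2s" "f' \<in> L2s" "g \<in> L2s" "\<And>e. e \<in> arcs G \<Longrightarrow> AE x in lebesgue_on {0..len e}. f e x = f' e x"
  shows "L2_inner G len f g = L2_inner G len f' g"
  unfolding L2_inner_def
proof (intro sum.cong refl integral_cong_AE)
  fix e assume e: "e \<in> arcs G"
  show "(\<lambda>x. f e x * g e x) \<in> borel_measurable (lebesgue_on {0..len e})" "(\<lambda>x. f' e x * g e x) \<in> borel_measurable (lebesgue_on {0..len e})"
    using L2_intervalD(1)[OF L2sD[OF assms(1) e]] L2_intervalD(1)[OF L2sD[OF assms(2) e]] L2_intervalD(1)[OF L2sD[OF assms(3) e]]
    by (auto intro: borel_measurable_times)
  show "AE x in lebesgue_on {0..len e}. f e x * g e x = f' e x * g e x"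
    using assms(4)[OF e] by eventually_elim simp
qed

lemma form_sym: "form f g = form g f"
  unfolding form_eq L2_inner_def by (simp add: mult_ac)

lemma form_combination:
  assumes u: "u \<in> H1s" and w: "w \<in> H1s" and z: "z \<in> H1s"
  shows "form (c *\<^sub>R u + d *\<^sub>R w) z = c * form u z + d * form w z"
proof -
  interpret L: semi_inner "L2_inner G len" L2s by (rule semi_inner_L2)
  let ?s = "c *\<^sub>R u + d *\<^sub>R w"
  let ?k = "\<lambda>f e x. (\<kappa> e x)\<^sup>2 * f e x" and ?a = "\<lambda>f e x. a e x * f e x"
  have lin: "L2_inner G len (c *\<^sub>R f + d *\<^sub>R g) h = c * L2_inner G len f h + d * L2_inner G len g h"
    if "f \<in> L2s" "g \<in> L2s" "h \<in> L2s" for f g h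
    using that by (simp add: L.add_left L.scale_left L.mem_scale)
  have k: "L2_inner G len (?k ?s) z = c * L2_inner G len (?k u) z + d * L2_inner G len (?k w) z"
  proof -
    have "?k ?s = c *\<^sub>R ?k u + d *\<^sub>R ?k w" by (simp add: fun_eq_iff algebra_simps)
    then show ?thesis using lin[OF \<kappa>_mult_L2s \<kappa>_mult_L2s] H1s_L2s u w z by simp
  qed
  have g: "L2_inner G len (?a (gradient ?s)) (gradient z)
      = c * L2_inner G len (?a (gradient u)) (gradient z) + d * L2_inner G len (?a (gradient w)) (gradient z)"
  proof -
    have gu: "?a (gradient u) \<in> L2s" "?a (gradient w) \<in> L2s" using a_mult_L2s gradient_L2s u w by auto
    have m: "c *\<^sub>R ?a (gradient u) + d *\<^sub>R ?a (gradient w) \<in> L2s"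
      by (intro L.mem_add L.mem_scale gu)
    have "L2_inner G len (?a (gradient ?s)) (gradient z)
        = L2_inner G len (c *\<^sub>R ?a (gradient u) + d *\<^sub>R ?a (gradient w)) (gradient z)"
    proof (rule L2_inner_cong_AE[OF a_mult_L2s[OF gradient_L2s[OF H1s_combination(1)[OF u w]]] m gradient_L2s[OF z]])
      fix e assume e: "e \<in> arcs G"
      show "AE x in lebesgue_on {0..len e}. a e x * gradient ?s e x = (c *\<^sub>R ?a (gradient u) + d *\<^sub>R ?a (gradient w)) e x"
        using H1s_combination(2)[OF u w e, of c d] by eventually_elim (simp add: algebra_simps)
    qed
    then show ?thesis using lin[OF gu gradient_L2s[OF z]] by simp
  qed
  have v: "(\<Sum>v\<in>verts G. vertex_value G len ?s v * vertex_value G len z v)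
      = c * (\<Sum>v\<in>verts G. vertex_value G len u v * vertex_value G len z v)
      + d * (\<Sum>v\<in>verts G. vertex_value G len w v * vertex_value G len z v)"
    using H1s_combination(3)[OF u w] by (simp add: sum_distrib_left algebra_simps flip: sum.distrib)
  show ?thesis unfolding form_eq k g v by (simp add: algebra_simps)
qed

text \<open>In a connected graph with an edge every vertex has degree at least 1.\<close>

lemma vertex_sum_le: "w \<in> H1s \<Longrightarrow> (\<Sum>v\<in>verts G. (vertex_value G len w v)\<^sup>2) \<le> trace w"
  unfolding trace_eq[OF H1sD(1), symmetric]
proof (rule sum_mono)
  fix v assume "v \<in> verts G"
  then have "1 \<le> real (gdegree G v)" using gdegree_pos by fastforce
  then show "(vertex_value G len w v)\<^sup>2 \<le> real (gdegree G v) * (vertex_value G len w v)\<^sup>2"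
    using mult_right_mono[of 1 "real (gdegree G v)" "(vertex_value G len w v)\<^sup>2"] by simp
qed

lemma L2_inner_weight_ge:
  assumes "f \<in> L2s" "(\<lambda>e x. b e x * f e x) \<in> L2s"
    and "\<And>e. e \<in> arcs G \<Longrightarrow> AE x in lebesgue_on {0..len e}. m \<le> b e x"
  shows "m * mass f \<le> L2_inner G len (\<lambda>e x. b e x * f e x) f"
proof -
  have "m * mass f = (\<Sum>e\<in>arcs G. LINT x|lebesgue_on {0..len e}. m * (f e x)\<^sup>2)"
    by (simp add: mass_eq sum_distrib_left)
  also have "\<dots> \<le> L2_inner G len (\<lambda>e x. b e x * f e x) f"
    unfolding L2_inner_def
  proof (intro sum_mono integral_mono_AE)
    fix e assume e: "e \<in> arcs G"
    show "integrable (lebesgue_on {0..len e}) (\<lambda>x. m * (f e x)\<^sup>2)"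
      using L2_intervalD(2)[OF L2sD[OF assms(1) e]] by simp
    show "integrable (lebesgue_on {0..len e}) (\<lambda>x. b e x * f e x * f e x)"
      by (rule L2_interval_integrable_mult[OF L2sD[OF assms(2) e] L2sD[OF assms(1) e]])
    show "AE x in lebesgue_on {0..len e}. m * (f e x)\<^sup>2 \<le> b e x * f e x * f e x"
      using assms(3)[OF e] by eventually_elim (simp add: power2_eq_square mult.assoc mult_right_mono)
  qed
  finally show ?thesis .
qed

lemma L2_inner_weight_le:
  assumes "f \<in> L2s" "(\<lambda>e x. b e x * f e x) \<in> L2s"
    and "\<And>e. e \<in> arcs G \<Longrightarrow> AE x in lebesgue_on {0..len e}. b e x \<le> m"
  shows "L2_inner G len (\<lambda>e x. b e x * f e x) f \<le> m * mass f"
proof -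
  have "L2_inner G len (\<lambda>e x. b e x * f e x) f \<le> (\<Sum>e\<in>arcs G. LINT x|lebesgue_on {0..len e}. m * (f e x)\<^sup>2)"
    unfolding L2_inner_def
  proof (intro sum_mono integral_mono_AE)
    fix e assume e: "e \<in> arcs G"
    show "integrable (lebesgue_on {0..len e}) (\<lambda>x. m * (f e x)\<^sup>2)"
      using L2_intervalD(2)[OF L2sD[OF assms(1) e]] by simp
    show "integrable (lebesgue_on {0..len e}) (\<lambda>x. b e x * f e x * f e x)"
      by (rule L2_interval_integrable_mult[OF L2sD[OF assms(2) e] L2sD[OF assms(1) e]])
    show "AE x in lebesgue_on {0..len e}. b e x * f e x * f e x \<le> m * (f e x)\<^sup>2"
      using assms(3)[OF e] by eventually_elim (simp add: power2_eq_square mult.assoc mult_right_mono)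
  qed
  then show ?thesis by (simp add: mass_eq sum_distrib_left)
qed

lemma form_ge:
  assumes w: "w \<in> H1s"
  shows "\<kappa>0\<^sup>2 * mass w + a0 * mass (gradient w) + \<alpha> * (\<Sum>v\<in>verts G. (vertex_value G len w v)\<^sup>2) \<le> form w w"
proof -
  have "\<kappa>0\<^sup>2 * mass w \<le> L2_inner G len (\<lambda>e x. (\<kappa> e x)\<^sup>2 * w e x) w"
  proof (rule L2_inner_weight_ge[OF H1s_L2s[OF w] \<kappa>_mult_L2s[OF H1s_L2s[OF w]]])
    fix e assume "e \<in> arcs G"
    from \<kappa>_ge[OF this] show "AE x in lebesgue_on {0..len e}. \<kappa>0\<^sup>2 \<le> (\<kappa> e x)\<^sup>2"
      by eventually_elim (use \<kappa>0 in \<open>auto intro: power_mono\<close>)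
  qed
  moreover have "a0 * mass (gradient w) \<le> L2_inner G len (\<lambda>e x. a e x * gradient w e x) (gradient w)"
    using a_ge by (intro L2_inner_weight_ge gradient_L2s[OF w] a_mult_L2s[OF gradient_L2s[OF w]] AE_I2) (auto simp: mem_gpoints)
  ultimately show ?thesis unfolding form_eq by (simp add: power2_eq_square)
qed

text \<open>For negative \<alpha> the vertex terms are at most S times the trace, and the trace
  inequality distributes this loss between mass and gradient.\<close>

lemma form_coercive: "\<exists>c>0. \<forall>w\<in>H1s. c * (mass w + mass (gradient w)) \<le> form w w"
proof (cases "0 \<le> \<alpha>")
  case True
  have "min (\<kappa>0\<^sup>2) a0 * (mass w + mass (gradient w)) \<le> form w w" if w: "w \<in> H1s" for w
  proof -
    have "min (\<kappa>0\<^sup>2) a0 * (mass w + mass (gradient w)) \<le> \<kappa>0\<^sup>2 * mass w + a0 * mass (gradient w)"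
      unfolding distrib_left by (intro add_mono mult_right_mono mass_nonneg) auto
    moreover have "0 \<le> \<alpha> * (\<Sum>v\<in>verts G. (vertex_value G len w v)\<^sup>2)"
      using True by (intro mult_nonneg_nonneg sum_nonneg) auto
    ultimately show ?thesis using form_ge[OF w] by linarith
  qed
  then show ?thesis using \<kappa>0 a0 by (intro exI[of _ "min (\<kappa>0\<^sup>2) a0"]) auto
next
  case False
  define d0 where "d0 = Min (gdegree G ` verts G)"
  define S where "S = \<bar>\<alpha>\<bar> / real d0"
  have hyp: "4 * S / lmin < \<kappa>0\<^sup>2" "2 * S * lmax \<le> a0"
    using \<alpha> False by (auto simp: Let_def d0_def S_def)
  have verts_ne: "verts G \<noteq> {}" using arcs_nonempty tail_in_verts by blast
  have d0: "1 \<le> d0" "v \<in> verts G \<Longrightarrow> d0 \<le> gdegree G v" for v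
    unfolding d0_def using verts_ne gdegree_pos by (auto simp: Min_ge_iff)
  have S: "0 < S" unfolding S_def using False d0(1) by (intro divide_pos_pos) auto
  define Z where "Z = 4 * S / lmin"
  have Z: "0 < Z" "Z < \<kappa>0\<^sup>2" using S lmin(1) hyp(1) by (simp_all add: Z_def)
  \<comment> \<open>The loss is Z (1 + t) / 2 in the mass and at most (1 + 1 / t) / 2 times a0 in
    the gradient. With this t > 1 the former is the mean of Z and \<kappa>0^2, below \<kappa>0^2,
    and the latter is below a0, so both terms keep a positive remainder.\<close>
  define t where "t = \<kappa>0\<^sup>2 / Z"
  have t: "1 < t" using Z by (simp add: t_def)
  define c1 where "c1 = (\<kappa>0\<^sup>2 - Z) / 2"
  define c2 where "c2 = a0 * (1 - 1 / t) / 2"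
  have c: "0 < c1" "0 < c2" using Z t a0 by (simp_all add: c1_def c2_def)
  have "min c1 c2 * (mass w + mass (gradient w)) \<le> form w w" if w: "w \<in> H1s" for w
  proof -
    have "\<bar>\<alpha>\<bar> * (\<Sum>v\<in>verts G. (vertex_value G len w v)\<^sup>2)
        \<le> S * (\<Sum>v\<in>verts G. real (gdegree G v) * (vertex_value G len w v)\<^sup>2)"
      unfolding sum_distrib_left
    proof (rule sum_mono)
      fix v assume v: "v \<in> verts G"
      have "\<bar>\<alpha>\<bar> = S * real d0" using d0(1) by (simp add: S_def)
      also have "\<dots> \<le> S * real (gdegree G v)" using S d0(2)[OF v] by (intro mult_left_mono) auto
      finally have "\<bar>\<alpha>\<bar> * (vertex_value G len w v)\<^sup>2 \<le> S * real (gdegree G v) * (vertex_value G len w v)\<^sup>2"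
        by (rule mult_right_mono) simp
      then show "\<bar>\<alpha>\<bar> * (vertex_value G len w v)\<^sup>2 \<le> S * (real (gdegree G v) * (vertex_value G len w v)\<^sup>2)"
        by (simp only: mult.assoc)
    qed
    also have "\<dots> = S * trace w" by (simp only: trace_eq[OF H1sD(1)[OF w]])
    also have "\<dots> \<le> S * (2 * (1 + t) / lmin * mass w + (1 + 1 / t) * lmax * mass (gradient w))"
      using S t trace_le[OF w, of t] by (intro mult_left_mono) auto
    also have "\<dots> = (Z / 2 * (1 + t)) * mass w + (1 + 1 / t) / 2 * ((2 * S * lmax) * mass (gradient w))"
      by (simp add: Z_def algebra_simps)
    also have "\<dots> \<le> (Z / 2 * (1 + t)) * mass w + (1 + 1 / t) / 2 * (a0 * mass (gradient w))"
      using hyp(2) t by (intro add_left_mono mult_left_mono mult_right_mono mass_nonneg) auto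
    finally have V: "\<bar>\<alpha>\<bar> * (\<Sum>v\<in>verts G. (vertex_value G len w v)\<^sup>2)
        \<le> (Z / 2 * (1 + t)) * mass w + (1 + 1 / t) / 2 * (a0 * mass (gradient w))" .
    have "Z / 2 * (1 + t) = (Z + \<kappa>0\<^sup>2) / 2" using Z by (simp add: t_def field_simps)
    then have 1: "\<kappa>0\<^sup>2 * mass w - (Z / 2 * (1 + t)) * mass w = c1 * mass w"
      by (simp add: c1_def algebra_simps)
    have 2: "a0 * mass (gradient w) - (1 + 1 / t) / 2 * (a0 * mass (gradient w)) = c2 * mass (gradient w)"
      by (simp add: c2_def algebra_simps)
    have "\<alpha> * (\<Sum>v\<in>verts G. (vertex_value G len w v)\<^sup>2) = - (\<bar>\<alpha>\<bar> * (\<Sum>v\<in>verts G. (vertex_value G len w v)\<^sup>2))"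
      using False by simp
    then have "c1 * mass w + c2 * mass (gradient w) \<le> form w w"
      using form_ge[OF w] V 1 2 by linarith
    moreover have "min c1 c2 * (mass w + mass (gradient w)) \<le> c1 * mass w + c2 * mass (gradient w)"
      unfolding distrib_left by (intro add_mono mult_right_mono mass_nonneg) auto
    ultimately show ?thesis by linarith
  qed
  then show ?thesis using c by (intro exI[of _ "min c1 c2"]) auto
qed

lemma a_bound: "\<exists>A>0. \<forall>e\<in>arcs G. \<forall>x\<in>{0..len e}. \<bar>a e x\<bar> \<le> A"
proof -
  have "\<exists>A. \<forall>x\<in>{0..len e}. \<bar>a e x\<bar> \<le> A" if "e \<in> arcs G" for e
  proof -
    have "compact (a e ` {0..len e})" using a_continuous[OF that] by (intro compact_continuous_image) auto
    then obtain A where "\<forall>y\<in>a e ` {0..len e}. norm y \<le> A" using compact_imp_bounded bounded_iff by metis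
    then show ?thesis by (intro exI[of _ A]) auto
  qed
  then obtain m where m: "\<And>e x. \<lbrakk>e \<in> arcs G; x \<in> {0..len e}\<rbrakk> \<Longrightarrow> \<bar>a e x\<bar> \<le> m e" by metis
  define A where "A = (\<Sum>e\<in>arcs G. \<bar>m e\<bar>) + 1"
  have "\<bar>a e x\<bar> \<le> A" if "e \<in> arcs G" "x \<in> {0..len e}" for e x
    using m[OF that] member_le_sum[OF that(1), of "\<lambda>e. \<bar>m e\<bar>"] by (simp add: A_def)
  moreover have "0 < A" unfolding A_def by (intro add_nonneg_pos sum_nonneg) auto
  ultimately show ?thesis by blast
qed

text \<open>The vertex terms are absorbed by the trace inequality with t = 1; the size of the
  constant does not matter.\<close>

lemma form_bounded: "\<exists>C>0. \<forall>w\<in>H1s. form w w \<le> C * (mass w + mass (gradient w))"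
proof -
  obtain K where K: "0 < K" "\<And>e. e \<in> arcs G \<Longrightarrow> AE x in lebesgue_on {0..len e}. \<bar>(\<kappa> e x)\<^sup>2\<bar> \<le> K"
    using \<kappa>_bound by blast
  obtain A where A: "0 < A" "\<And>e x. \<lbrakk>e \<in> arcs G; x \<in> {0..len e}\<rbrakk> \<Longrightarrow> \<bar>a e x\<bar> \<le> A" using a_bound by blast
  define C where "C = K + A + \<bar>\<alpha>\<bar> * (4 / lmin + 2 * lmax)"
  have lp: "0 \<le> \<bar>\<alpha>\<bar> * (4 / lmin)" "0 \<le> \<bar>\<alpha>\<bar> * (2 * lmax)" using lmin(1) lmax(2) by auto
  have C: "0 < C" "K + \<bar>\<alpha>\<bar> * (4 / lmin) \<le> C" "A + \<bar>\<alpha>\<bar> * (2 * lmax) \<le> C"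
    using K(1) A(1) lp by (simp_all add: C_def distrib_left)
  have "form w w \<le> C * (mass w + mass (gradient w))" if w: "w \<in> H1s" for w
  proof -
    have 1: "L2_inner G len (\<lambda>e x. (\<kappa> e x)\<^sup>2 * w e x) w \<le> K * mass w"
    proof (rule L2_inner_weight_le[OF H1s_L2s[OF w] \<kappa>_mult_L2s[OF H1s_L2s[OF w]]])
      fix e assume "e \<in> arcs G"
      from K(2)[OF this] show "AE x in lebesgue_on {0..len e}. (\<kappa> e x)\<^sup>2 \<le> K" by eventually_elim simp
    qed
    have 2: "L2_inner G len (\<lambda>e x. a e x * gradient w e x) (gradient w) \<le> A * mass (gradient w)"
    proof (rule L2_inner_weight_le[OF gradient_L2s[OF w] a_mult_L2s[OF gradient_L2s[OF w]]], rule AE_I2)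
      fix e x assume "e \<in> arcs G" "x \<in> space (lebesgue_on {0..len e})"
      then show "a e x \<le> A" using A(2)[of e x] by (simp add: abs_le_iff)
    qed
    have "\<alpha> * (\<Sum>v\<in>verts G. vertex_value G len w v * vertex_value G len w v)
        \<le> \<bar>\<alpha>\<bar> * (\<Sum>v\<in>verts G. (vertex_value G len w v)\<^sup>2)"
      unfolding power2_eq_square by (intro mult_right_mono sum_nonneg) auto
    also have "\<dots> \<le> \<bar>\<alpha>\<bar> * trace w" using vertex_sum_le[OF w] by (rule mult_left_mono) simp
    also have "\<dots> \<le> \<bar>\<alpha>\<bar> * (2 * (1 + 1) / lmin * mass w + (1 + 1 / 1) * lmax * mass (gradient w))"
      using trace_le[OF w zero_less_one] by (rule mult_left_mono) simp
    finally have "form w w \<le> K * mass w + A * mass (gradient w)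
        + \<bar>\<alpha>\<bar> * (2 * (1 + 1) / lmin * mass w + (1 + 1 / 1) * lmax * mass (gradient w))"
      unfolding form_eq using 1 2 by linarith
    also have "\<dots> = (K + \<bar>\<alpha>\<bar> * (4 / lmin)) * mass w + (A + \<bar>\<alpha>\<bar> * (2 * lmax)) * mass (gradient w)"
      by (simp add: algebra_simps)
    also have "\<dots> \<le> C * mass w + C * mass (gradient w)"
      using C by (intro add_mono mult_right_mono mass_nonneg) auto
    finally show ?thesis by (simp add: distrib_left)
  qed
  then show ?thesis using C(1) by blast
qed

text \<open>Coercivity is what makes the form nonnegative when \<alpha> is negative.\<close>

lemma semi_inner_form: "semi_inner form H1s"
proof
  show "subspace H1s" by (rule subspace_H1s)
  fix x y z :: "'e gfun" and r :: real assume x: "x \<in> H1s"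
  obtain c where c: "0 < c" "\<forall>w\<in>H1s. c * (mass w + mass (gradient w)) \<le> form w w" using form_coercive by blast
  have "0 \<le> c * (mass x + mass (gradient x))"
    using c(1) mass_nonneg[of x] mass_nonneg[of "gradient x"] by simp
  then show "0 \<le> form x x" using c(2) x by (meson order.trans)
  assume y: "y \<in> H1s"
  show "form x y = form y x" by (rule form_sym)
  show "form (r *\<^sub>R x) y = r * form x y" using form_combination[OF x x y, of r 0] by simp
  assume z: "z \<in> H1s"
  show "form (x + y) z = form x z + form y z" using form_combination[OF x y z, of 1 1] by simp
qed

end

section \<open>Finite element functions and eigenfunctions\<close>

lemma cell_affine_zero:
  assumes h: "0 < h" and u: "cell_affine h n u" and z: "\<And>i. i \<le> n \<Longrightarrow> u (real i * h) = 0"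
    and x: "x \<in> {0..real n * h}"
  shows "u x = 0"
proof -
  have "\<forall>x\<in>{0..real m * h}. u x = 0" if "m \<le> n" for m
    using that
  proof (induction m)
    case 0
    then show ?case using z[of 0] by auto
  next
    case (Suc m)
    obtain p q where pq: "\<And>x. x \<in> {real m * h..real (Suc m) * h} \<Longrightarrow> u x = p + q * x"
      using u Suc.prems unfolding cell_affine_def by (meson Suc_le_lessD)
    have le: "real m * h \<le> real (Suc m) * h" using h by simp
    have "p + q * (real m * h) = 0" "p + q * (real (Suc m) * h) = 0"
      using pq[of "real m * h"] pq[of "real (Suc m) * h"] le z[of m] z[of "Suc m"] Suc.prems by auto
    moreover have "q * (real (Suc m) * h) = q * (real m * h) + q * h" by (simp add: algebra_simps)
    ultimately have "q * h = 0" by linarith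
    then have "q = 0" using h by simp
    moreover from this have "p = 0" using \<open>p + q * (real m * h) = 0\<close> by simp
    ultimately have "u x = 0" if "x \<in> {real m * h..real (Suc m) * h}" for x using pq[OF that] by simp
    then show ?case using Suc by fastforce
  qed
  then show ?thesis using x by blast
qed

text \<open>At the head the edge is traversed backwards, hence the sign. The one-sided derivatives
  exist because d is continuous up to the ends.\<close>

lemma end_derivative_eq:
  assumes l: "0 < len e" and d: "continuous_on {0..len e} d" "antideriv (len e) (u e) d"
  shows "end_derivative len u (e, False) = d 0" and "end_derivative len u (e, True) = - d (len e)"
proof -
  have D: "(u e has_real_derivative d x) (at x within {0..len e})" if "x \<in> {0..len e}" for x
    by (rule antideriv_has_derivative[OF d(2,1) that])
  have m: "0 \<in> {0..len e}" "len e \<in> {0..len e}" using l by auto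
  have "vector_derivative (\<lambda>t. u e t) (at 0 within {0..len e}) = d 0"
    using D[OF m(1)] by (intro vector_derivative_within_closed_interval[OF l m(1)]) (simp add: has_real_derivative_iff_has_vector_derivative)
  then show "end_derivative len u (e, False) = d 0" by (simp add: end_derivative_def)
  have img: "(\<lambda>t. len e - t) ` {0..len e} = {0..len e}" by simp
  have "((\<lambda>t. len e - t) has_real_derivative - 1) (at 0 within {0..len e})"
    by (auto intro!: derivative_eq_intros)
  moreover have "(u e has_real_derivative d (len e)) (at (len e - 0) within (\<lambda>t. len e - t) ` {0..len e})"
    unfolding img using D[OF m(2)] by simp
  ultimately have "(u e \<circ> (\<lambda>t. len e - t) has_real_derivative d (len e) * - 1) (at 0 within {0..len e})"
    by (intro DERIV_image_chain)
  then have "vector_derivative (u e \<circ> (\<lambda>t. len e - t)) (at 0 within {0..len e}) = d (len e) * - 1"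
    by (intro vector_derivative_within_closed_interval[OF l m(1)]) (simp add: has_real_derivative_iff_has_vector_derivative)
  then show "end_derivative len u (e, True) = - d (len e)" by (simp add: end_derivative_def comp_def)
qed

section \<open>The finite element space and nodal interpolation\<close>

context metric_graph
begin

lemma mesh_step:
  assumes "mesh G n" "e \<in> arcs G"
  shows "0 < len e / real (n e)" "real (n e) * (len e / real (n e)) = len e"
    "len e / real (n e) \<le> mesh_size G len n" "mesh_size G len n \<le> lmax"
proof -
  have n: "2 \<le> n e" if "e \<in> arcs G" for e using assms(1) that by (simp add: mesh_def)
  show "0 < len e / real (n e)" "real (n e) * (len e / real (n e)) = len e"
    using n[OF assms(2)] len_pos[OF assms(2)] by auto
  have fin: "finite ((\<lambda>e. len e / real (n e)) ` arcs G)" by simp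
  show "len e / real (n e) \<le> mesh_size G len n"
    unfolding mesh_size_def using assms(2) by (intro Max_ge[OF fin]) auto
  show "mesh_size G len n \<le> lmax"
    unfolding mesh_size_def
  proof (rule Max.boundedI[OF fin])
    show "(\<lambda>e. len e / real (n e)) ` arcs G \<noteq> {}" using arcs_nonempty by simp
    fix y assume "y \<in> (\<lambda>e. len e / real (n e)) ` arcs G"
    then obtain f where f: "f \<in> arcs G" "y = len f / real (n f)" by blast
    have "len f / real (n f) \<le> len f / 1"
      using n[OF f(1)] len_pos[OF f(1)] by (intro divide_left_mono) auto
    then show "y \<le> lmax" unfolding f(2) using lmax(1)[OF f(1)] by linarith
  qed
qed

lemma mesh_size_pos: "mesh G n \<Longrightarrow> 0 < mesh_size G len n"
  using arcs_nonempty mesh_step(1,3) by (metis all_not_in_conv order_less_le_trans)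

lemma Vh_subset_H1s:
  assumes n: "mesh G n"
  shows "Vh G len n \<subseteq> H1s"
proof
  fix u assume u: "u \<in> Vh G len n"
  have "\<exists>g. antideriv (len e) (u e) g" if e: "e \<in> arcs G" for e
  proof -
    have "cell_affine (len e / real (n e)) (n e) (u e)" using u e Vh_iff[OF n] by blast
    from cell_affine_Lipschitz[OF less_imp_le[OF mesh_step(1)[OF n e]] this]
    obtain K where "\<And>x y. \<lbrakk>x \<in> {0..len e}; y \<in> {0..len e}\<rbrakk> \<Longrightarrow> \<bar>u e x - u e y\<bar> \<le> K * \<bar>x - y\<bar>"
      unfolding mesh_step(2)[OF n e] by blast
    then show ?thesis by (rule Lipschitz_antideriv[OF len_pos[OF e]])
  qed
  then show "u \<in> H1s" using u Vh_iff[OF n] by (simp add: H1s_def)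
qed

lemma subspace_Vh:
  assumes n: "mesh G n"
  shows "subspace (Vh G len n)"
proof -
  have comb: "c *\<^sub>R u + d *\<^sub>R w \<in> Vh G len n" if u: "u \<in> Vh G len n" and w: "w \<in> Vh G len n" for c d u w
    unfolding Vh_iff[OF n]
  proof (intro conjI allI impI ballI)
    show "matched (c *\<^sub>R u + d *\<^sub>R w)"
      unfolding combination_apply using u w Vh_iff[OF n] by (intro matched_combination) auto
    show "(c *\<^sub>R u + d *\<^sub>R w) e x = 0" if "(e, x) \<notin> gpoints G len" for e x
      using u w Vh_iff[OF n] that by simp
    fix e assume e: "e \<in> arcs G"
    show "cell_affine (len e / real (n e)) (n e) ((c *\<^sub>R u + d *\<^sub>R w) e)"
      unfolding cell_affine_def
    proof (intro allI impI)
      fix i assume i: "i < n e"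
      let ?I = "{real i * (len e / real (n e))..real (Suc i) * (len e / real (n e))}"
      have "cell_affine (len e / real (n e)) (n e) (u e)" "cell_affine (len e / real (n e)) (n e) (w e)"
        using u w e Vh_iff[OF n] by auto
      then obtain p q p' q' where "\<forall>x\<in>?I. u e x = p + q * x" "\<forall>x\<in>?I. w e x = p' + q' * x"
        using i unfolding cell_affine_def by meson
      then have "\<forall>x\<in>?I. (c *\<^sub>R u + d *\<^sub>R w) e x = (c * p + d * p') + (c * q + d * q') * x"
        by (simp add: algebra_simps)
      then show "\<exists>p q. \<forall>x\<in>?I. (c *\<^sub>R u + d *\<^sub>R w) e x = p + q * x" by blast
    qed
  qed
  have "0 \<in> Vh G len n"
    unfolding Vh_iff[OF n] cell_affine_def matched_def
    by (auto simp: case_prod_unfold intro: exI[of _ "0::real"])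
  moreover have "u + w \<in> Vh G len n" if "u \<in> Vh G len n" "w \<in> Vh G len n" for u w
    using comb[OF that, of 1 1] by simp
  moreover have "c *\<^sub>R u \<in> Vh G len n" if "u \<in> Vh G len n" for u c
    using comb[OF that that, of c 0] by simp
  ultimately show ?thesis by (simp add: subspace_def)
qed

text \<open>On the edges a continuous function with square integral 0 vanishes; off the graph
  members of \<open>Vh\<close> are 0 by definition, so v is literally the zero function.\<close>

lemma Vh_definite:
  assumes n: "mesh G n" and v: "v \<in> Vh G len n" and m: "L2_inner G len v v = 0"
  shows "v = 0"
proof -
  have vH: "v \<in> H1s" using Vh_subset_H1s[OF n] v by blast
  have "v e x = 0" if ex: "(e, x) \<in> gpoints G len" for e x
  proof -
    have e: "e \<in> arcs G" "x \<in> {0..len e}" using ex by (simp_all add: mem_gpoints)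
    have "(LINT x|lebesgue_on {0..len e}. (v e x)\<^sup>2) = 0"
      using m e(1) sum_nonneg_eq_0_iff[OF finite_arcs, of "\<lambda>e. LINT x|lebesgue_on {0..len e}. (v e x)\<^sup>2"]
      unfolding mass_def[symmetric] mass_eq by (simp add: Bochner_Integration.integral_nonneg)
    then have "AE x in lebesgue_on {0..len e}. (v e x)\<^sup>2 = 0"
      using integral_nonneg_eq_0_iff_AE[OF L2_intervalD(2)[OF L2sD[OF H1s_L2s[OF vH] e(1)]]] by simp
    then have "AE x in lebesgue_on {0..len e}. v e x = 0" by simp
    then show ?thesis
      by (rule AE_eq_continuous_imp_eq[OF len_pos[OF e(1)] antideriv_continuous[OF H1sD(2)[OF vH e(1)]] continuous_on_const _ e(2)])
  qed
  then have "v e x = 0" for e x using v Vh_iff[OF n] by (cases "(e, x) \<in> gpoints G len") blast+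
  then show ?thesis by (simp add: fun_eq_iff)
qed

lemma Vh_finite:
  assumes n: "mesh G n"
  shows "\<exists>N. finite N \<and> (\<forall>\<xi>\<in>N. linear \<xi>) \<and> (\<forall>v\<in>Vh G len n. (\<forall>\<xi>\<in>N. \<xi> v = (0::real)) \<longrightarrow> v = 0)"
proof -
  define ev :: "'e \<Rightarrow> nat \<Rightarrow> 'e gfun \<Rightarrow> real" where "ev = (\<lambda>e i v. v e (real i * (len e / real (n e))))"
  define N where "N = (\<Union>e\<in>arcs G. ev e ` {..n e})"
  have "finite N" by (simp add: N_def)
  moreover have "linear (ev e i)" for e i by (rule linearI) (simp_all add: ev_def)
  then have "\<forall>\<xi>\<in>N. linear \<xi>" by (auto simp: N_def)
  moreover have "v = 0" if v: "v \<in> Vh G len n" and z: "\<forall>\<xi>\<in>N. \<xi> v = 0" for v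
  proof -
    have "v e x = 0" if ex: "(e, x) \<in> gpoints G len" for e x
    proof -
      have e: "e \<in> arcs G" "x \<in> {0..len e}" using ex by (simp_all add: mem_gpoints)
      have "v e (real i * (len e / real (n e))) = 0" if "i \<le> n e" for i
        using z e(1) that by (auto simp: N_def ev_def)
      moreover have "cell_affine (len e / real (n e)) (n e) (v e)" using v e Vh_iff[OF n] by blast
      ultimately show ?thesis
        using cell_affine_zero[OF mesh_step(1)[OF n e(1)], where n = "n e" and u = "v e" and x = x] e(2)
        unfolding mesh_step(2)[OF n e(1)] by blast
    qed
    then have "v e x = 0" for e x using v Vh_iff[OF n] by (cases "(e, x) \<in> gpoints G len") blast+
    then show ?thesis by (simp add: fun_eq_iff)
  qed
  ultimately show ?thesis by blast
qed

definition interpolant :: "('e \<Rightarrow> nat) \<Rightarrow> 'e gfun \<Rightarrow> 'e gfun" where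
  "interpolant n z = (\<lambda>e x. if (e, x) \<in> gpoints G len then nodal_interp (len e / real (n e)) (z e) x else 0)"

text \<open>Ends of edges are mesh nodes, so interpolation keeps all vertex values and hence the
  matching conditions.\<close>

lemma interpolant_end:
  assumes n: "mesh G n" and h: "fst h \<in> arcs G"
  shows "case_prod (interpolant n z) (end_point len h) = case_prod z (end_point len h)"
proof -
  obtain e b where hb: "h = (e, b)" by (cases h)
  have e: "e \<in> arcs G" using h hb by simp
  let ?s = "len e / real (n e)"
  note s = mesh_step(1,2)[OF n e]
  obtain m where m: "n e = Suc m" using n e by (cases "n e") (auto simp: mesh_def)
  have 0: "nodal_interp ?s (z e) 0 = z e 0"
    using nodal_interp_cell[OF s(1), of 0 0 "z e"] s(1) by simp
  have "real m * ?s \<le> real (Suc m) * ?s" using s(1) by (intro mult_right_mono) auto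
  then have "nodal_interp ?s (z e) (real (Suc m) * ?s) = z e (real m * ?s)
      + (z e (real (Suc m) * ?s) - z e (real m * ?s)) / ?s * (real (Suc m) * ?s - real m * ?s)"
    by (intro nodal_interp_cell[OF s(1)]) auto
  also have "real (Suc m) * ?s - real m * ?s = ?s" by (simp add: left_diff_distrib[symmetric] del: times_divide_eq_right)
  finally have "nodal_interp ?s (z e) (real (Suc m) * ?s) = z e (real (Suc m) * ?s)"
    using s(1) by (simp only: nonzero_divide_mult_cancel_right nonzero_eq_divide_eq) simp
  then have l: "nodal_interp ?s (z e) (len e) = z e (len e)" using s(2) unfolding m by simp
  show ?thesis
    using 0 l e len_pos[OF e] by (cases b) (simp_all add: hb end_point_def interpolant_def mem_gpoints)
qed

lemma interpolant_Vh:
  assumes n: "mesh G n" and z: "matched z"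
  shows "interpolant n z \<in> Vh G len n"
  unfolding Vh_iff[OF n]
proof (intro conjI allI impI ballI)
  show "matched (interpolant n z)"
    unfolding matched_def
  proof (intro allI ballI)
    fix v h h' assume h: "h \<in> ends_at G v" "h' \<in> ends_at G v"
    then have "case_prod z (end_point len h) = case_prod z (end_point len h')" using z unfolding matched_def by blast
    then show "case_prod (interpolant n z) (end_point len h) = case_prod (interpolant n z) (end_point len h')"
      using h interpolant_end[OF n] by (simp add: mem_ends_at)
  qed
  show "interpolant n z e x = 0" if "(e, x) \<notin> gpoints G len" for e x using that by (simp add: interpolant_def)
  fix e assume e: "e \<in> arcs G"
  let ?s = "len e / real (n e)"
  show "cell_affine ?s (n e) (interpolant n z e)"
    unfolding cell_affine_def
  proof (intro allI impI)
    fix i assume i: "i < n e"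
    obtain p q where pq: "\<forall>x\<in>{real i * ?s..real (Suc i) * ?s}. nodal_interp ?s (z e) x = p + q * x"
      using cell_affine_nodal_interp[OF mesh_step(1)[OF n e], of "n e" "z e"] i unfolding cell_affine_def by blast
    have "interpolant n z e x = nodal_interp ?s (z e) x" if x: "x \<in> {real i * ?s..real (Suc i) * ?s}" for x
    proof -
      have "0 \<le> real i * ?s" using mesh_step(1)[OF n e] by (intro mult_nonneg_nonneg) auto
      moreover have "real (Suc i) * ?s \<le> real (n e) * ?s" using i mesh_step(1)[OF n e] by (intro mult_right_mono) auto
      ultimately have "x \<in> {0..len e}" using x mesh_step(2)[OF n e] by auto
      then show ?thesis using e by (simp add: interpolant_def mem_gpoints)
    qed
    then show "\<exists>p q. \<forall>x\<in>{real i * ?s..real (Suc i) * ?s}. interpolant n z e x = p + q * x" using pq by auto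
  qed
qed

lemma antideriv_interpolant:
  assumes "mesh G n" "e \<in> arcs G"
  shows "antideriv (len e) (interpolant n z e) (nodal_slope (len e / real (n e)) (z e))"
  using antideriv_nodal_interp[OF mesh_step(1)[OF assms], of "n e" "z e"] len_pos[OF assms(2)] assms(2)
  unfolding mesh_step(2)[OF assms]
  by (elim antideriv_cong) (simp_all add: interpolant_def mem_gpoints)

end

section \<open>Edge equations and the weak form\<close>

context graph_problem
begin

text \<open>The edge equations -(a z')' + \<kappa>^2 z = r in integrated form, with a continuous
  derivative d and the flux a d. Vertex conditions are kept apart. The condition is linear in the
  pair (z, r), which carries it from eigenfunctions to their combinations.\<close>

definition regular :: "'e gfun \<Rightarrow> 'e gfun \<Rightarrow> bool" where
  "regular z r \<longleftrightarrow> (\<forall>e\<in>arcs G. \<exists>d. continuous_on {0..len e} d \<and> antideriv (len e) (z e) d \<and>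
     antideriv (len e) (\<lambda>x. a e x * d x) (\<lambda>x. (\<kappa> e x)\<^sup>2 * z e x - r e x))"

lemma regular_zero: "regular 0 0"
proof -
  have "antideriv l (\<lambda>x. 0) (\<lambda>x. 0)" for l
    unfolding antideriv_def by (simp add: L2_interval_const)
  then show ?thesis unfolding regular_def by (intro ballI exI[of _ "\<lambda>x. 0"]) (simp add: zero_fun_def)
qed

lemma regular_add_scale:
  assumes "regular z r" "regular y s"
  shows "regular (z + c *\<^sub>R y) (r + c *\<^sub>R s)"
  unfolding regular_def
proof
  fix e assume e: "e \<in> arcs G"
  obtain d where d: "continuous_on {0..len e} d" "antideriv (len e) (z e) d"
    "antideriv (len e) (\<lambda>x. a e x * d x) (\<lambda>x. (\<kappa> e x)\<^sup>2 * z e x - r e x)"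
    using assms(1) e unfolding regular_def by blast
  obtain b where b: "continuous_on {0..len e} b" "antideriv (len e) (y e) b"
    "antideriv (len e) (\<lambda>x. a e x * b x) (\<lambda>x. (\<kappa> e x)\<^sup>2 * y e x - s e x)"
    using assms(2) e unfolding regular_def by blast
  have 1: "antideriv (len e) ((z + c *\<^sub>R y) e) (\<lambda>x. d x + c * b x)"
    using antideriv_add[OF d(2) antideriv_cmult[OF b(2), of c]] by (simp add: plus_fun_def scaleR_fun_def)
  have eq: "(\<lambda>x. a e x * (d x + c * b x)) = (\<lambda>x. a e x * d x + c * (a e x * b x))"
    "(\<lambda>x. (\<kappa> e x)\<^sup>2 * (z + c *\<^sub>R y) e x - (r + c *\<^sub>R s) e x)
      = (\<lambda>x. ((\<kappa> e x)\<^sup>2 * z e x - r e x) + c * ((\<kappa> e x)\<^sup>2 * y e x - s e x))"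
    by (simp_all add: fun_eq_iff algebra_simps)
  have 2: "antideriv (len e) (\<lambda>x. a e x * (d x + c * b x)) (\<lambda>x. (\<kappa> e x)\<^sup>2 * (z + c *\<^sub>R y) e x - (r + c *\<^sub>R s) e x)"
    unfolding eq by (rule antideriv_add[OF d(3) antideriv_cmult[OF b(3)]])
  have 3: "continuous_on {0..len e} (\<lambda>x. d x + c * b x)" by (intro continuous_intros d(1) b(1))
  show "\<exists>d. continuous_on {0..len e} d \<and> antideriv (len e) ((z + c *\<^sub>R y) e) d \<and>
     antideriv (len e) (\<lambda>x. a e x * d x) (\<lambda>x. (\<kappa> e x)\<^sup>2 * (z + c *\<^sub>R y) e x - (r + c *\<^sub>R s) e x)"
    using 1 2 3 by (intro exI[of _ "\<lambda>x. d x + c * b x"]) blast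
qed

lemma regular_sum:
  assumes "\<And>j. regular (\<phi> j) (r j)"
  shows "regular (\<Sum>j<(m::nat). c j *\<^sub>R \<phi> j) (\<Sum>j<m. c j *\<^sub>R r j)"
proof (induction m)
  case 0
  show ?case unfolding lessThan_0 sum.empty by (rule regular_zero)
next
  case (Suc m)
  show ?case unfolding sum.lessThan_Suc by (rule regular_add_scale[OF Suc assms])
qed

text \<open>The eigenvalue equation, valid almost everywhere, replaces the unspecified weak
  derivative of the flux by an explicit integrand.\<close>

lemma eigenfunction_regular:
  assumes u: "u \<in> L_dom G len a \<alpha>"
    and eig: "\<And>e. e \<in> arcs G \<Longrightarrow> AE x in lebesgue_on {0..len e}. L_op len a \<kappa> u e x = m * u e x"
  shows "regular u (m *\<^sub>R u)" and "u \<in> H1s"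
proof -
  have gc: "graph_continuous G len u" and H2: "\<And>e. e \<in> arcs G \<Longrightarrow> H2_interval (len e) (u e)"
    using u by (auto simp: L_dom_def)
  have cont: "continuous_on {0..len e} (u e)" if "e \<in> arcs G" for e by (rule graph_continuous_edge[OF gc that])
  have uL: "u \<in> L2s" using L2_interval_continuous[OF cont] by (simp add: L2s_def L2_graph_def)
  obtain M where "0 \<le> M \<and> (\<forall>e\<in>arcs G. \<forall>x\<in>{0..len e}. \<forall>y\<in>{0..len e}. \<bar>a e x - a e y\<bar> \<le> M * \<bar>x - y\<bar>)"
    using graph_LipschitzD(2)[OF a_Lip] ..
  then have M: "\<bar>a e x - a e y\<bar> \<le> M * \<bar>x - y\<bar>" if "e \<in> arcs G" "x \<in> {0..len e}" "y \<in> {0..len e}" for e x y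
    using that by blast
  show reg: "regular u (m *\<^sub>R u)"
    unfolding regular_def
  proof
    fix e assume e: "e \<in> arcs G"
    obtain d where d: "continuous_on {0..len e} d" "antideriv (len e) (u e) d"
      "antideriv (len e) (\<lambda>x. a e x * d x) (wderiv (len e) (\<lambda>y. a e y * wderiv (len e) (u e) y))"
      using H2_interval_regular[OF len_pos[OF e] M[OF e] cont[OF e] H2[OF e]] by blast
    have "antideriv (len e) (\<lambda>x. a e x * d x) (\<lambda>x. (\<kappa> e x)\<^sup>2 * u e x - m * u e x)"
    proof (rule antideriv_cong_AE[OF d(3)])
      show "L2_interval (len e) (\<lambda>x. (\<kappa> e x)\<^sup>2 * u e x - m * u e x)"
        by (intro L2_interval_diff L2_interval_cmult L2sD[OF uL e] L2sD[OF \<kappa>_mult_L2s[OF uL] e])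
      show "AE x in lebesgue_on {0..len e}. wderiv (len e) (\<lambda>y. a e y * wderiv (len e) (u e) y) x
          = (\<kappa> e x)\<^sup>2 * u e x - m * u e x"
        using eig[OF e] by eventually_elim (simp add: L_op_def)
    qed
    then show "\<exists>d. continuous_on {0..len e} d \<and> antideriv (len e) (u e) d \<and>
        antideriv (len e) (\<lambda>x. a e x * d x) (\<lambda>x. (\<kappa> e x)\<^sup>2 * u e x - (m *\<^sub>R u) e x)"
      using d by (intro exI[of _ d]) simp
  qed
  show "u \<in> H1s"
    using reg graph_continuous_matched[OF gc] unfolding H1s_def regular_def by blast
qed

text \<open>The flux is integrated by parts against w on every edge and the end terms are regrouped
  by vertices. There a and w have common values, and the Kirchhoff condition turns a(v) times the
  sum of the outgoing derivatives into \<alpha> u(v), which gives the vertex part of the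
  form.\<close>

lemma regular_weak_form:
  assumes u: "u \<in> L_dom G len a \<alpha>" "u \<in> H1s" and reg: "regular u r" and r: "r \<in> L2s" and w: "w \<in> H1s"
  shows "form u w = L2_inner G len r w"
proof -
  interpret L: semi_inner "L2_inner G len" L2s by (rule semi_inner_L2)
  obtain d where "\<forall>e\<in>arcs G. continuous_on {0..len e} (d e) \<and> antideriv (len e) (u e) (d e) \<and>
     antideriv (len e) (\<lambda>x. a e x * d e x) (\<lambda>x. (\<kappa> e x)\<^sup>2 * u e x - r e x)"
    using bchoice[OF reg[unfolded regular_def]] ..
  then have d: "continuous_on {0..len e} (d e)" "antideriv (len e) (u e) (d e)"
    "antideriv (len e) (\<lambda>x. a e x * d e x) (\<lambda>x. (\<kappa> e x)\<^sup>2 * u e x - r e x)" if "e \<in> arcs G" for e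
    using that by simp_all
  define p where "p = (\<lambda>e x. a e x * d e x)"
  have dL: "d \<in> L2s" using L2_interval_continuous[OF d(1)] by (simp add: L2s_def L2_graph_def)
  have pL: "p \<in> L2s" unfolding p_def by (rule a_mult_L2s[OF dL])
  note kL = \<kappa>_mult_L2s[OF H1s_L2s[OF u(2)]]
  have grad: "L2_inner G len (\<lambda>e x. a e x * gradient u e x) (gradient w) = L2_inner G len p (gradient w)"
  proof (rule L2_inner_cong_AE[OF a_mult_L2s[OF gradient_L2s[OF u(2)]] pL gradient_L2s[OF w]])
    fix e assume e: "e \<in> arcs G"
    show "AE x in lebesgue_on {0..len e}. a e x * gradient u e x = p e x"
      using gradient_AE[OF u(2) e d(2)[OF e]] by eventually_elim (simp add: p_def)
  qed
  have diff: "L2_inner G len (\<lambda>e x. (\<kappa> e x)\<^sup>2 * u e x - r e x) w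
      = L2_inner G len (\<lambda>e x. (\<kappa> e x)\<^sup>2 * u e x) w - L2_inner G len r w"
    using L.diff_left[OF kL r H1s_L2s[OF w]] by (simp add: fun_diff_def)
  have "L2_inner G len p (gradient w) + L2_inner G len (\<lambda>e x. (\<kappa> e x)\<^sup>2 * u e x - r e x) w
      = (\<Sum>e\<in>arcs G. p e (len e) * w e (len e) - p e 0 * w e 0)"
    unfolding L2_inner_def sum.distrib[symmetric]
  proof (rule sum.cong[OF refl])
    fix e assume e: "e \<in> arcs G"
    show "(LINT x|lebesgue_on {0..len e}. p e x * gradient w e x)
        + (LINT x|lebesgue_on {0..len e}. ((\<kappa> e x)\<^sup>2 * u e x - r e x) * w e x)
      = p e (len e) * w e (len e) - p e 0 * w e 0"
      using integration_by_parts_antideriv[OF d(3)[OF e] H1sD(2)[OF w e] less_imp_le[OF len_pos[OF e]]]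
      by (simp add: p_def)
  qed
  also have "\<dots> = - (\<Sum>v\<in>verts G. \<Sum>h\<in>ends_at G v.
      case_prod a (end_point len h) * end_derivative len u h * case_prod w (end_point len h))"
    unfolding ends_partition sum_negf[symmetric]
  proof (rule sum.cong[OF refl])
    fix e assume e: "e \<in> arcs G"
    show "p e (len e) * w e (len e) - p e 0 * w e 0
      = - (case_prod a (end_point len (e, False)) * end_derivative len u (e, False) * case_prod w (end_point len (e, False))
        + case_prod a (end_point len (e, True)) * end_derivative len u (e, True) * case_prod w (end_point len (e, True)))"
      using end_derivative_eq[where len = len and e = e and u = u and d = "d e", OF len_pos[OF e] d(1,2)[OF e]] by (simp add: p_def end_point_def)
  qed
  also have "(\<Sum>v\<in>verts G. \<Sum>h\<in>ends_at G v.
      case_prod a (end_point len h) * end_derivative len u h * case_prod w (end_point len h))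
    = (\<Sum>v\<in>verts G. \<alpha> * (vertex_value G len u v * vertex_value G len w v))"
  proof (rule sum.cong[OF refl])
    fix v assume v: "v \<in> verts G"
    have "(\<Sum>h\<in>ends_at G v. case_prod a (end_point len h) * end_derivative len u h * case_prod w (end_point len h))
      = (\<Sum>h\<in>ends_at G v. vertex_value G len a v * end_derivative len u h * vertex_value G len w v)"
      by (rule sum.cong[OF refl])
        (simp only: vertex_value_eq[OF graph_LipschitzD(1)[OF a_Lip]] vertex_value_eq[OF H1sD(1)[OF w]])
    also have "\<dots> = vertex_value G len a v * (\<Sum>h\<in>ends_at G v. end_derivative len u h) * vertex_value G len w v"
      by (simp only: sum_distrib_left sum_distrib_right)
    also have "\<dots> = \<alpha> * vertex_value G len u v * vertex_value G len w v"
      using u(1) v by (simp add: L_dom_def)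
    finally show "(\<Sum>h\<in>ends_at G v. case_prod a (end_point len h) * end_derivative len u h * case_prod w (end_point len h))
      = \<alpha> * (vertex_value G len u v * vertex_value G len w v)" by (simp only: mult.assoc)
  qed
  finally show ?thesis unfolding form_eq grad using diff by (simp add: sum_distrib_left)
qed

end

lemma LINT_square_cong_AE:
  assumes "L2_interval l f" "L2_interval l g" "AE x in lebesgue_on {0..l}. f x = g x"
  shows "(LINT x|lebesgue_on {0..l}. (f x)\<^sup>2) = (LINT x|lebesgue_on {0..l}. (g x)\<^sup>2)"
proof (rule integral_cong_AE)
  show "(\<lambda>x. (f x)\<^sup>2) \<in> borel_measurable (lebesgue_on {0..l})" "(\<lambda>x. (g x)\<^sup>2) \<in> borel_measurable (lebesgue_on {0..l})"
    by (intro borel_measurable_power L2_intervalD(1) assms)+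
  show "AE x in lebesgue_on {0..l}. (f x)\<^sup>2 = (g x)\<^sup>2" using assms(3) by eventually_elim simp
qed

section \<open>Approximation from the finite element space\<close>

context graph_problem
begin

text \<open>The flux of z has derivative \<kappa>^2 z - r, so the interpolation error is controlled
  by z, its gradient and r.\<close>

lemma edge_interpolation_error:
  assumes K: "0 < K" "AE x in lebesgue_on {0..len e}. \<bar>(\<kappa> e x)\<^sup>2\<bar> \<le> K"
    and A: "\<And>x. x \<in> {0..len e} \<Longrightarrow> \<bar>a e x\<bar> \<le> A"
    and M: "0 \<le> M" "\<And>x y. \<lbrakk>x \<in> {0..len e}; y \<in> {0..len e}\<rbrakk> \<Longrightarrow> \<bar>a e x - a e y\<bar> \<le> M * \<bar>x - y\<bar>"
    and z: "z \<in> H1s" and r: "r \<in> L2s" and reg: "regular z r" and n: "mesh G n" and e: "e \<in> arcs G"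
  defines "v \<equiv> interpolant n z" and "h \<equiv> len e / real (n e)"
  defines "I \<equiv> \<lambda>w. LINT x|lebesgue_on {0..len e}. (w e x)\<^sup>2"
  shows "I (gradient (z - v)) \<le> h\<^sup>2 * (2 * M\<^sup>2 / a0 ^ 4 * (A\<^sup>2 * I (gradient z)) + 2 / a0\<^sup>2 * (2 * K\<^sup>2 * I z + 2 * I r))"
    and "I (z - v) \<le> h\<^sup>2 * I (gradient (z - v))"
proof -
  obtain d where d: "continuous_on {0..len e} d" "antideriv (len e) (z e) d"
    "antideriv (len e) (\<lambda>x. a e x * d x) (\<lambda>x. (\<kappa> e x)\<^sup>2 * z e x - r e x)"
    using reg e unfolding regular_def by blast
  define s where "s = nodal_slope h (z e)"
  have s: "antideriv (len e) (v e) s" unfolding v_def s_def h_def by (rule antideriv_interpolant[OF n e])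
  have vH: "v \<in> H1s" using Vh_subset_H1s[OF n] interpolant_Vh[OF n H1sD(1)[OF z]] unfolding v_def by blast
  have zv: "z - v \<in> H1s" by (rule subspace_diff[OF subspace_H1s z vH])
  have eq: "(z - v) e = (\<lambda>x. z e x + - 1 * v e x)" by (simp add: fun_eq_iff)
  have zvs: "antideriv (len e) ((z - v) e) (\<lambda>x. d x + - 1 * s x)"
    unfolding eq by (rule antideriv_add[OF d(2) antideriv_cmult[OF s]])
  have L: "L2_interval (len e) (z e)" "L2_interval (len e) (r e)"
    by (rule L2sD[OF H1s_L2s[OF z] e], rule L2sD[OF r e])
  have "I (gradient (z - v)) = (LINT x|lebesgue_on {0..len e}. (d x + - 1 * s x)\<^sup>2)"
    unfolding I_def
    by (rule LINT_square_cong_AE[OF L2sD[OF gradient_L2s[OF zv] e] antideriv_L2[OF zvs] gradient_AE[OF zv e zvs]])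
  also have "\<dots> = integral {0..len e} (\<lambda>x. (d x + - 1 * s x)\<^sup>2)"
    by (rule LINT_square_eq_integral[OF antideriv_L2[OF zvs]])
  finally have I1: "I (gradient (z - v)) = integral {0..len e} (\<lambda>x. (d x - nodal_slope h (z e) x)\<^sup>2)"
    by (simp add: s_def)
  have "I (z - v) = integral {0..len e} (\<lambda>x. ((z - v) e x)\<^sup>2)"
    unfolding I_def by (rule LINT_square_eq_integral[OF L2sD[OF H1s_L2s[OF zv] e]])
  also have "\<dots> = integral {0..len e} (\<lambda>x. (z e x - nodal_interp h (z e) x)\<^sup>2)"
    by (rule Henstock_Kurzweil_Integration.integral_cong) (simp add: v_def interpolant_def mem_gpoints e h_def)
  finally have I2: "I (z - v) = integral {0..len e} (\<lambda>x. (z e x - nodal_interp h (z e) x)\<^sup>2)" .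
  have ge: "a0 \<le> a e x" if "x \<in> {0..len e}" for x using a_ge that e by (simp add: mem_gpoints)
  note err = nodal_interpolation_error[where a = "a e", OF a0 ge M(2) M(1) d(2,1,3) mesh_step(1,2)[OF n e], folded h_def]
  show "I (z - v) \<le> h\<^sup>2 * I (gradient (z - v))" unfolding I1 I2 by (rule err(2))
  note Ld = L2_interval_continuous[OF d(1)]
  have Id: "I (gradient z) = (LINT x|lebesgue_on {0..len e}. (d x)\<^sup>2)"
    unfolding I_def by (rule LINT_square_cong_AE[OF L2sD[OF gradient_L2s[OF z] e] Ld gradient_AE[OF z e d(2)]])
  have Lad: "L2_interval (len e) (\<lambda>x. a e x * d x)" by (rule L2_interval_continuous[OF antideriv_continuous[OF d(3)]])
  have "(LINT x|lebesgue_on {0..len e}. (a e x * d x)\<^sup>2) \<le> (LINT x|lebesgue_on {0..len e}. A\<^sup>2 * (d x)\<^sup>2)"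
  proof (rule integral_mono_AE[OF L2_intervalD(2)[OF Lad]], goal_cases)
    case 1
    show ?case using L2_intervalD(2)[OF Ld] by simp
    case 2
    show ?case
    proof (rule AE_I2)
      fix x assume "x \<in> space (lebesgue_on {0..len e})"
      then have "\<bar>a e x\<bar>\<^sup>2 \<le> A\<^sup>2" using A[of x] by (intro power_mono) auto
      then show "(a e x * d x)\<^sup>2 \<le> A\<^sup>2 * (d x)\<^sup>2" by (simp add: power_mult_distrib mult_right_mono)
    qed
  qed
  then have 1: "integral {0..len e} (\<lambda>x. (a e x * d x)\<^sup>2) \<le> A\<^sup>2 * I (gradient z)"
    unfolding Id LINT_square_eq_integral[OF Lad] by simp
  have "(LINT x|lebesgue_on {0..len e}. ((\<kappa> e x)\<^sup>2 * z e x - r e x)\<^sup>2)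
      \<le> (LINT x|lebesgue_on {0..len e}. 2 * K\<^sup>2 * (z e x)\<^sup>2 + 2 * (r e x)\<^sup>2)"
  proof (rule integral_mono_AE[OF L2_intervalD(2)[OF antideriv_L2[OF d(3)]]], goal_cases)
    case 1
    show ?case by (intro Bochner_Integration.integrable_add integrable_mult_right L2_intervalD(2) L)
    case 2
    show ?case using K(2)
    proof eventually_elim
      case (elim x)
      let ?k = "(\<kappa> e x)\<^sup>2"
      have "\<bar>?k\<bar>\<^sup>2 \<le> K\<^sup>2" by (rule power_mono[OF elim]) simp
      then have "?k\<^sup>2 * (z e x)\<^sup>2 \<le> K\<^sup>2 * (z e x)\<^sup>2" by (intro mult_right_mono) auto
      moreover have "(?k * z e x - r e x)\<^sup>2 + (?k * z e x + r e x)\<^sup>2 = 2 * (?k\<^sup>2 * (z e x)\<^sup>2) + 2 * (r e x)\<^sup>2"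
        by (simp only: power2_sum power2_diff power_mult_distrib)
      moreover have "0 \<le> (?k * z e x + r e x)\<^sup>2" by simp
      ultimately show ?case by linarith
    qed
  qed
  also have "\<dots> = 2 * K\<^sup>2 * I z + 2 * I r"
    unfolding I_def
    by (subst Bochner_Integration.integral_add) (simp_all add: L2_intervalD(2)[OF L(1)] L2_intervalD(2)[OF L(2)])
  finally have 2: "integral {0..len e} (\<lambda>x. ((\<kappa> e x)\<^sup>2 * z e x - r e x)\<^sup>2) \<le> 2 * K\<^sup>2 * I z + 2 * I r"
    unfolding LINT_square_eq_integral[OF antideriv_L2[OF d(3)]] .
  show "I (gradient (z - v)) \<le> h\<^sup>2 * (2 * M\<^sup>2 / a0 ^ 4 * (A\<^sup>2 * I (gradient z)) + 2 / a0\<^sup>2 * (2 * K\<^sup>2 * I z + 2 * I r))"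
    unfolding I1
    by (rule order.trans[OF err(1)], assumption+, intro mult_left_mono add_mono 1 2) auto
qed

lemma interpolation_error:
  "\<exists>C>0. \<forall>z\<in>H1s. \<forall>r\<in>L2s. \<forall>n. regular z r \<longrightarrow> mesh G n \<longrightarrow>
     mass (gradient (z - interpolant n z)) \<le> (mesh_size G len n)\<^sup>2 * (C * (mass z + mass (gradient z) + mass r)) \<and>
     mass (z - interpolant n z) \<le> (mesh_size G len n)\<^sup>2 * mass (gradient (z - interpolant n z))"
proof -
  obtain K where K: "0 < K" "\<And>e. e \<in> arcs G \<Longrightarrow> AE x in lebesgue_on {0..len e}. \<bar>(\<kappa> e x)\<^sup>2\<bar> \<le> K"
    using \<kappa>_bound by blast
  obtain A where A: "\<And>e x. \<lbrakk>e \<in> arcs G; x \<in> {0..len e}\<rbrakk> \<Longrightarrow> \<bar>a e x\<bar> \<le> A" using a_bound by blast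
  obtain M where M0: "0 \<le> M \<and> (\<forall>e\<in>arcs G. \<forall>x\<in>{0..len e}. \<forall>y\<in>{0..len e}. \<bar>a e x - a e y\<bar> \<le> M * \<bar>x - y\<bar>)"
    using graph_LipschitzD(2)[OF a_Lip] ..
  then have M: "0 \<le> M" "\<And>e x y. \<lbrakk>e \<in> arcs G; x \<in> {0..len e}; y \<in> {0..len e}\<rbrakk> \<Longrightarrow> \<bar>a e x - a e y\<bar> \<le> M * \<bar>x - y\<bar>"
    by blast+
  define c1 where "c1 = 2 * M\<^sup>2 / a0 ^ 4 * A\<^sup>2"
  define c2 where "c2 = 2 / a0\<^sup>2 * (2 * K\<^sup>2)"
  define c3 where "c3 = 2 / a0\<^sup>2 * 2"
  define C where "C = c1 + c2 + c3"
  have c: "0 \<le> c1" "0 \<le> c2" "0 < c3" using a0 by (simp_all add: c1_def c2_def c3_def)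
  have "mass (gradient (z - interpolant n z)) \<le> (mesh_size G len n)\<^sup>2 * (C * (mass z + mass (gradient z) + mass r)) \<and>
     mass (z - interpolant n z) \<le> (mesh_size G len n)\<^sup>2 * mass (gradient (z - interpolant n z))"
    if z: "z \<in> H1s" and r: "r \<in> L2s" and reg: "regular z r" and n: "mesh G n" for z r n
  proof -
    let ?I = "\<lambda>w e. LINT x|lebesgue_on {0..len e}. (w e x)\<^sup>2"
    let ?v = "interpolant n z"
    have I0: "0 \<le> ?I w e" for w :: "'e gfun" and e by (intro Bochner_Integration.integral_nonneg) simp
    have hh: "(len e / real (n e))\<^sup>2 \<le> (mesh_size G len n)\<^sup>2" if e: "e \<in> arcs G" for e
      using mesh_step(1,3)[OF n e] by (intro power_mono) auto
    have 1: "?I (gradient (z - ?v)) e \<le> (mesh_size G len n)\<^sup>2 * (C * (?I z e + ?I (gradient z) e + ?I r e))" if e: "e \<in> arcs G" for e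
    proof -
      have "?I (gradient (z - ?v)) e \<le> (len e / real (n e))\<^sup>2 *
          (2 * M\<^sup>2 / a0 ^ 4 * (A\<^sup>2 * ?I (gradient z) e) + 2 / a0\<^sup>2 * (2 * K\<^sup>2 * ?I z e + 2 * ?I r e))"
        by (rule edge_interpolation_error(1)[OF K(1) K(2)[OF e] A[OF e] M(1) M(2)[OF e] z r reg n e])
      also have "\<dots> = (len e / real (n e))\<^sup>2 * (c1 * ?I (gradient z) e + c2 * ?I z e + c3 * ?I r e)"
        by (simp only: c1_def c2_def c3_def distrib_left mult.assoc add.assoc)
      also have "\<dots> \<le> (mesh_size G len n)\<^sup>2 * (C * ?I (gradient z) e + C * ?I z e + C * ?I r e)"
        using c
        by (intro mult_mono[OF hh[OF e]] add_mono mult_right_mono add_nonneg_nonneg mult_nonneg_nonneg I0) (auto simp: C_def)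
      finally show ?thesis by (simp only: distrib_left add_ac)
    qed
    have 2: "?I (z - ?v) e \<le> (mesh_size G len n)\<^sup>2 * ?I (gradient (z - ?v)) e" if e: "e \<in> arcs G" for e
      using edge_interpolation_error(2)[OF K(1) K(2)[OF e] A[OF e] M(1) M(2)[OF e] z r reg n e]
        mult_right_mono[OF hh[OF e] I0] by (rule order.trans)
    have "(\<Sum>e\<in>arcs G. ?I (gradient (z - ?v)) e)
        \<le> (\<Sum>e\<in>arcs G. (mesh_size G len n)\<^sup>2 * (C * (?I z e + ?I (gradient z) e + ?I r e)))"
      by (rule sum_mono) (rule 1)
    moreover have "(\<Sum>e\<in>arcs G. ?I (z - ?v) e) \<le> (\<Sum>e\<in>arcs G. (mesh_size G len n)\<^sup>2 * ?I (gradient (z - ?v)) e)"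
      by (rule sum_mono) (rule 2)
    ultimately show ?thesis
      unfolding mass_eq by (simp only: sum_distrib_left[symmetric] sum.distrib)
  qed
  moreover have "0 < C" using c by (simp add: C_def)
  ultimately show ?thesis by (intro exI[of _ C]) blast
qed

text \<open>The nodal interpolant serves as v. Testing the equation of z with z itself, coercivity
  and Cauchy-Schwarz give \<open>c^2 * (mass z + mass (gradient z)) \<le> mass r\<close>, after
  which the interpolation error depends on r alone.\<close>

lemma Galerkin_approximation:
  "\<exists>C>0. \<forall>z\<in>H1s. \<forall>r\<in>L2s. \<forall>n. regular z r \<longrightarrow> form z z = L2_inner G len r z \<longrightarrow> mesh G n \<longrightarrow>
     (\<exists>v\<in>Vh G len n. form (z - v) (z - v) \<le> C * (mesh_size G len n)\<^sup>2 * mass r \<and>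
        mass (z - v) \<le> (C * (mesh_size G len n)\<^sup>2)\<^sup>2 * mass r)"
proof -
  interpret L: semi_inner "L2_inner G len" L2s by (rule semi_inner_L2)
  obtain c where c: "0 < c" "\<And>w. w \<in> H1s \<Longrightarrow> c * (mass w + mass (gradient w)) \<le> form w w"
    using form_coercive by blast
  obtain b where b: "0 < b" "\<And>w. w \<in> H1s \<Longrightarrow> form w w \<le> b * (mass w + mass (gradient w))"
    using form_bounded by blast
  obtain C0 where C0: "0 < C0" "\<And>z r n. \<lbrakk>z \<in> H1s; r \<in> L2s; regular z r; mesh G n\<rbrakk> \<Longrightarrow>
     mass (gradient (z - interpolant n z)) \<le> (mesh_size G len n)\<^sup>2 * (C0 * (mass z + mass (gradient z) + mass r)) \<and>
     mass (z - interpolant n z) \<le> (mesh_size G len n)\<^sup>2 * mass (gradient (z - interpolant n z))"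
    using interpolation_error by blast
  define C1 where "C1 = C0 * (1 / c\<^sup>2 + 1)"
  \<comment> \<open>One constant has to serve as C in energy and as C^2 in L2; the summand 1 ensures
    C \<ge> 1 and thus C1 \<le> C^2. The factor \<open>lmax^2 + 1\<close> comes from bounding the
    mass of the error by its gradient, with the mesh size at most \<open>lmax\<close>.\<close>
  define C where "C = b * (lmax\<^sup>2 + 1) * C1 + C1 + 1"
  have C1: "0 < C1" using C0(1) c(1) by (simp add: C1_def add_pos_pos)
  have bl: "0 < b * (lmax\<^sup>2 + 1) * C1" using b(1) C1 by (simp add: add_nonneg_pos)
  have C: "0 < C" "b * (lmax\<^sup>2 + 1) * C1 \<le> C" "C1 \<le> C\<^sup>2"
  proof -
    show "0 < C" "b * (lmax\<^sup>2 + 1) * C1 \<le> C" using bl C1 by (simp_all add: C_def)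
    have "C1 \<le> C" "1 \<le> C" using bl C1 by (simp_all add: C_def)
    then have "C1 * 1 \<le> C * C" using C1 by (intro mult_mono) auto
    then show "C1 \<le> C\<^sup>2" by (simp add: power2_eq_square)
  qed
  have "form (z - interpolant n z) (z - interpolant n z) \<le> C * (mesh_size G len n)\<^sup>2 * mass r \<and>
      mass (z - interpolant n z) \<le> (C * (mesh_size G len n)\<^sup>2)\<^sup>2 * mass r"
    if z: "z \<in> H1s" and r: "r \<in> L2s" and reg: "regular z r" and zr: "form z z = L2_inner G len r z" and n: "mesh G n" for z r n
  proof -
    define N where "N = mass z + mass (gradient z)"
    define h where "h = mesh_size G len n"
    define w where "w = z - interpolant n z"
    have N: "mass z \<le> N" "0 \<le> N" using mass_nonneg[of z] mass_nonneg[of "gradient z"] by (simp_all add: N_def)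
    have wH: "w \<in> H1s"
      unfolding w_def using Vh_subset_H1s[OF n] interpolant_Vh[OF n H1sD(1)[OF z]] by (intro subspace_diff[OF subspace_H1s z]) blast
    have "c * N \<le> L2_inner G len r z" using c(2)[OF z] by (simp add: N_def zr)
    then have "(c * N)\<^sup>2 \<le> (L2_inner G len r z)\<^sup>2" using c(1) N(2) by (intro power_mono) auto
    also have "\<dots> \<le> mass r * mass z"
      unfolding mass_def by (rule L.Cauchy_Schwarz_square[OF r H1s_L2s[OF z]])
    also have "\<dots> \<le> mass r * N" by (rule mult_left_mono[OF N(1) mass_nonneg])
    finally have "(c\<^sup>2 * N) * N \<le> mass r * N" by (simp add: power2_eq_square mult_ac)
    then have cN: "c\<^sup>2 * N \<le> mass r"
      using N(2) mass_nonneg[of r] by (cases "N = 0") (simp_all add: mult_le_cancel_right)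
    then have "N \<le> mass r / c\<^sup>2" using c(1) by (simp add: pos_le_divide_eq mult.commute)
    then have "C0 * (mass z + mass (gradient z) + mass r) \<le> C0 * (mass r / c\<^sup>2 + mass r)"
      using C0(1) by (intro mult_left_mono) (simp_all add: N_def)
    also have "\<dots> = C1 * mass r" by (simp add: C1_def algebra_simps)
    finally have "h\<^sup>2 * (C0 * (mass z + mass (gradient z) + mass r)) \<le> h\<^sup>2 * (C1 * mass r)"
      by (rule mult_left_mono) simp
    then have 1: "mass (gradient w) \<le> h\<^sup>2 * (C1 * mass r)" and 2: "mass w \<le> h\<^sup>2 * mass (gradient w)"
      using C0(2)[OF z r reg n] unfolding w_def h_def by linarith+
    have h: "0 \<le> h" "h \<le> lmax"
      unfolding h_def using mesh_size_pos[OF n] mesh_step(4)[OF n] arcs_nonempty by auto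
    have h2: "h\<^sup>2 \<le> lmax\<^sup>2" by (rule power_mono[OF h(2,1)])
    have "mass w \<le> h\<^sup>2 * (h\<^sup>2 * (C1 * mass r))"
      using 2 mult_left_mono[OF 1, of "h\<^sup>2"] by simp
    also have "\<dots> = C1 * ((h\<^sup>2)\<^sup>2 * mass r)" by (simp only: power2_eq_square mult_ac)
    also have "\<dots> \<le> C\<^sup>2 * ((h\<^sup>2)\<^sup>2 * mass r)" by (rule mult_right_mono[OF C(3)]) (simp add: mass_nonneg)
    finally have m: "mass w \<le> (C * h\<^sup>2)\<^sup>2 * mass r" by (simp only: power_mult_distrib mult.assoc)
    have "form w w \<le> b * (mass w + mass (gradient w))" by (rule b(2)[OF wH])
    also have "\<dots> \<le> b * ((lmax\<^sup>2 + 1) * mass (gradient w))"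
      using 2 mult_right_mono[OF h2 mass_nonneg[of "gradient w"]] b(1) by (intro mult_left_mono) (simp_all add: distrib_right)
    also have "\<dots> \<le> b * ((lmax\<^sup>2 + 1) * (h\<^sup>2 * (C1 * mass r)))"
      using b(1) by (intro mult_left_mono 1) auto
    also have "\<dots> = b * (lmax\<^sup>2 + 1) * C1 * (h\<^sup>2 * mass r)" by (simp only: mult_ac)
    also have "\<dots> \<le> C * (h\<^sup>2 * mass r)" by (rule mult_right_mono[OF C(2)]) (simp add: mass_nonneg)
    finally have "form w w \<le> C * h\<^sup>2 * mass r" by (simp only: mult.assoc)
    then show ?thesis using m unfolding w_def h_def by simp
  qed
  then show ?thesis
    using C(1) interpolant_Vh[OF _ H1sD(1)] by (intro exI[of _ C] conjI ballI allI impI) blast+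
qed

end

section \<open>The error estimate\<close>

context graph_problem
begin

lemma partial_expansion_eq:
  fixes \<phi> :: "nat \<Rightarrow> 'e gfun"
  shows "(\<lambda>e x. f e x - (\<Sum>j<m. c j * \<phi> j e x)) = f - (\<Sum>j<m. c j *\<^sub>R \<phi> j)"
  by (simp add: fun_eq_iff sum_fun_apply)

lemma eigenbasisD:
  assumes eb: "eigenbasis G len a \<kappa> \<alpha> \<phi> \<mu>"
  shows "0 < \<mu> j" "\<phi> j \<in> H1s" "regular (\<phi> j) (\<mu> j *\<^sub>R \<phi> j)"
    "L2_inner G len (\<phi> i) (\<phi> j) = (if i = j then 1 else 0)"
    "w \<in> H1s \<Longrightarrow> form (\<phi> j) w = \<mu> j * L2_inner G len (\<phi> j) w"
    "f \<in> L2s \<Longrightarrow> (\<lambda>m. L2_norm G len (f - (\<Sum>j<m. L2_inner G len f (\<phi> j) *\<^sub>R \<phi> j))) \<longlonglongrightarrow> 0"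
proof -
  interpret L: semi_inner "L2_inner G len" L2s by (rule semi_inner_L2)
  have dom: "\<phi> j \<in> L_dom G len a \<alpha>" and eig: "e \<in> arcs G \<Longrightarrow> AE x in lebesgue_on {0..len e}. L_op len a \<kappa> (\<phi> j) e x = \<mu> j * \<phi> j e x" for j e
    using eb unfolding eigenbasis_def by blast+
  show "0 < \<mu> j" "L2_inner G len (\<phi> i) (\<phi> j) = (if i = j then 1 else 0)"
    using eb unfolding eigenbasis_def by blast+
  show mem: "\<phi> j \<in> H1s" and reg: "regular (\<phi> j) (\<mu> j *\<^sub>R \<phi> j)"
    using eigenfunction_regular[OF dom eig] by blast+
  note L2 = H1s_L2s[OF mem]
  show "form (\<phi> j) w = \<mu> j * L2_inner G len (\<phi> j) w" if w: "w \<in> H1s"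
    using regular_weak_form[OF dom mem reg L.mem_scale[OF L2] w] L.scale_left[OF L2 H1s_L2s[OF w]] by simp
  show "(\<lambda>m. L2_norm G len (f - (\<Sum>j<m. L2_inner G len f (\<phi> j) *\<^sub>R \<phi> j))) \<longlonglongrightarrow> 0" if f: "f \<in> L2s"
    using eb f unfolding eigenbasis_def L2s_def partial_expansion_eq by blast
qed

text \<open>Coercivity is tested with a normalised eigenfunction. This confines the arguments 1 /
  \<mu> j of the scalar estimate to a bounded range.\<close>

lemma eigenvalue_ge:
  assumes eb: "eigenbasis G len a \<kappa> \<alpha> \<phi> \<mu>" and c: "0 < c" "\<And>w. w \<in> H1s \<Longrightarrow> c * (mass w + mass (gradient w)) \<le> form w w"
  shows "c \<le> \<mu> j"
proof -
  have m: "mass (\<phi> j) = 1" using eigenbasisD(4)[OF eb] by (simp add: mass_def)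
  have "c * 1 \<le> c * (mass (\<phi> j) + mass (gradient (\<phi> j)))"
    unfolding m using c(1) mass_nonneg[of "gradient (\<phi> j)"] by (intro mult_left_mono) auto
  also have "\<dots> \<le> form (\<phi> j) (\<phi> j)" by (rule c(2)[OF eigenbasisD(2)[OF eb]])
  also have "\<dots> = \<mu> j" using eigenbasisD(5)[OF eb eigenbasisD(2)[OF eb]] m by (simp add: mass_def)
  finally show ?thesis by simp
qed

text \<open>Coefficients are continuous in the L2 norm, so they can be read off from the partial
  sums. Applied to \<open>frac_power_eq\<close>, this yields the coefficients of u from those of
  f.\<close>

lemma expansion_coefficient:
  assumes eb: "eigenbasis G len a \<kappa> \<alpha> \<phi> \<mu>" and f: "f \<in> L2s"
    and lim: "(\<lambda>m. L2_norm G len (f - (\<Sum>j<m. b j *\<^sub>R \<phi> j))) \<longlonglongrightarrow> 0"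
  shows "L2_inner G len f (\<phi> i) = b i"
proof -
  interpret L: semi_inner "L2_inner G len" L2s by (rule semi_inner_L2)
  note \<phi>L = H1s_L2s[OF eigenbasisD(2)[OF eb]] and on = eigenbasisD(4)[OF eb]
  have n1: "L.nrm (\<phi> i) = 1" by (simp add: L.nrm_def on)
  have "\<bar>L2_inner G len f (\<phi> i) - b i\<bar> \<le> L2_norm G len (f - (\<Sum>j<m. b j *\<^sub>R \<phi> j))" if m: "Suc i \<le> m" for m
  proof -
    let ?p = "\<Sum>j<m. b j *\<^sub>R \<phi> j"
    have p: "?p \<in> L2s" by (intro L.mem_sum L.mem_scale \<phi>L)
    have "L2_inner G len ?p (\<phi> i) = (\<Sum>j<m. L2_inner G len (b j *\<^sub>R \<phi> j) (\<phi> i))"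
      by (intro L.sum_left L.mem_scale \<phi>L)
    also have "\<dots> = (\<Sum>j<m. if j = i then b i else 0)"
      by (rule sum.cong[OF refl]) (use L.scale_left[OF \<phi>L \<phi>L] on in auto)
    also have "\<dots> = b i" using m by simp
    finally have "L2_inner G len (f - ?p) (\<phi> i) = L2_inner G len f (\<phi> i) - b i"
      using L.diff_left[OF f p \<phi>L] by simp
    then show ?thesis
      using L.Cauchy_Schwarz[OF L.mem_diff[OF f p] \<phi>L, of i] n1 by (simp add: L.nrm_def L2_norm_def)
  qed
  then have "\<bar>L2_inner G len f (\<phi> i) - b i\<bar> \<le> 0" by (intro LIMSEQ_le_const[OF lim]) blast
  then show ?thesis by simp
qed

lemma galerkin_Vh:
  assumes eb: "eigenbasis G len a \<kappa> \<alpha> \<phi> \<mu>" and n: "mesh G n" and C: "0 < C"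
    and approx: "\<And>z r. \<lbrakk>z \<in> H1s; r \<in> L2s; regular z r; form z z = L2_inner G len r z\<rbrakk> \<Longrightarrow>
     \<exists>v\<in>Vh G len n. form (z - v) (z - v) \<le> C * (mesh_size G len n)\<^sup>2 * mass r \<and>
        mass (z - v) \<le> (C * (mesh_size G len n)\<^sup>2)\<^sup>2 * mass r"
  shows "galerkin (L2_inner G len) L2s form H1s (Vh G len n) \<phi> \<mu> (C * (mesh_size G len n)\<^sup>2)"
proof -
  interpret L: semi_inner "L2_inner G len" L2s by (rule semi_inner_L2)
  interpret E: semi_inner form H1s by (rule semi_inner_form)
  note \<phi>H = eigenbasisD(2)[OF eb] and \<phi>L = H1s_L2s[OF eigenbasisD(2)[OF eb]] and on = eigenbasisD(4)[OF eb]
  have nrm: "L.nrm = L2_norm G len" by (simp add: fun_eq_iff L.nrm_def L2_norm_def)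
  let ?\<delta> = "C * (mesh_size G len n)\<^sup>2"
  show ?thesis
  proof (intro galerkin.intro galerkin_axioms.intro L.semi_inner_axioms E.semi_inner_axioms)
    show "H1s \<subseteq> L2s" using H1s_L2s by blast
    show "subspace (Vh G len n)" by (rule subspace_Vh[OF n])
    show "Vh G len n \<subseteq> H1s" by (rule Vh_subset_H1s[OF n])
    show "v = 0" if "v \<in> Vh G len n" "L2_inner G len v v = 0" for v by (rule Vh_definite[OF n that])
    show "\<exists>N. finite N \<and> (\<forall>\<xi>\<in>N. linear \<xi>) \<and> (\<forall>v\<in>Vh G len n. (\<forall>\<xi>\<in>N. \<xi> v = (0::real)) \<longrightarrow> v = 0)"
      by (rule Vh_finite[OF n])
    show "\<phi> j \<in> H1s" "0 < \<mu> j" "w \<in> H1s \<Longrightarrow> form (\<phi> j) w = \<mu> j * L2_inner G len (\<phi> j) w"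
      "L2_inner G len (\<phi> i) (\<phi> j) = (if i = j then 1 else 0)" for i j w
      using eigenbasisD[OF eb] by blast+
    show "(\<lambda>m. L.nrm (f - (\<Sum>j<m. L2_inner G len f (\<phi> j) *\<^sub>R \<phi> j))) \<longlonglongrightarrow> 0" if "f \<in> L2s" for f
      unfolding nrm by (rule eigenbasisD(6)[OF eb that])
    show "0 < ?\<delta>" using C mesh_size_pos[OF n] by simp
    fix m :: nat and c :: "nat \<Rightarrow> real"
    \<comment> \<open>r is the image of z under the operator; by orthonormality its squared norm is
      the sum in the approximation hypothesis.\<close>
    let ?z = "\<Sum>j<m. c j *\<^sub>R \<phi> j" and ?r = "\<Sum>j<m. c j *\<^sub>R (\<mu> j *\<^sub>R \<phi> j)"
    have z: "?z \<in> H1s" by (intro E.mem_sum E.mem_scale \<phi>H)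
    have r: "?r \<in> L2s" by (intro L.mem_sum L.mem_scale \<phi>L)
    have zL: "?z \<in> L2s" by (rule H1s_L2s[OF z])
    have ip_r: "L2_inner G len ?r w = (\<Sum>j<m. c j * (\<mu> j * L2_inner G len (\<phi> j) w))" if w: "w \<in> L2s" for w
    proof -
      have "L2_inner G len ?r w = (\<Sum>j<m. L2_inner G len (c j *\<^sub>R (\<mu> j *\<^sub>R \<phi> j)) w)"
        by (intro L.sum_left L.mem_scale \<phi>L w)
      then show ?thesis by (simp only: L.scale_left[OF L.mem_scale[OF \<phi>L] w] L.scale_left[OF \<phi>L w])
    qed
    have form_z: "form ?z w = L2_inner G len ?r w" if w: "w \<in> H1s" for w
    proof -
      have "form ?z w = (\<Sum>j<m. c j * (\<mu> j * L2_inner G len (\<phi> j) w))"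
        using eigenbasisD(5)[OF eb w] by (simp add: E.sum_left E.mem_scale \<phi>H w E.scale_left)
      also have "\<dots> = L2_inner G len ?r w"
        by (rule ip_r[OF H1s_L2s[OF w], symmetric])
      finally show ?thesis .
    qed
    have "L2_inner G len ?r (\<phi> i) = (if i < m then \<mu> i * c i else 0)" for i
    proof -
      have "L2_inner G len ?r (\<phi> i) = (\<Sum>j<m. c j * (\<mu> j * L2_inner G len (\<phi> j) (\<phi> i)))"
        by (rule ip_r[OF \<phi>L])
      also have "\<dots> = (\<Sum>j<m. if j = i then \<mu> i * c i else 0)"
        by (rule sum.cong[OF refl]) (simp add: on)
      finally show ?thesis by simp
    qed
    then have ri: "L2_inner G len (\<phi> i) ?r = \<mu> i * c i" if "i < m" for i
      using that by (simp only: L.sym[OF \<phi>L r] if_True)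
    have "mass ?r = (\<Sum>j<m. c j * (\<mu> j * L2_inner G len (\<phi> j) ?r))"
      unfolding mass_def by (rule ip_r[OF r])
    also have "\<dots> = (\<Sum>j<m. (\<mu> j * c j)\<^sup>2)"
      by (rule sum.cong[OF refl]) (simp only: lessThan_iff ri power2_eq_square mult_ac)
    finally have mr: "mass ?r = (\<Sum>j<m. (\<mu> j * c j)\<^sup>2)" .
    show "\<exists>v\<in>Vh G len n. form (?z - v) (?z - v) \<le> ?\<delta> * (\<Sum>j<m. (\<mu> j * c j)\<^sup>2) \<and>
        L2_inner G len (?z - v) (?z - v) \<le> ?\<delta>\<^sup>2 * (\<Sum>j<m. (\<mu> j * c j)\<^sup>2)"
      using approx[OF z r regular_sum[OF eigenbasisD(3)[OF eb]] form_z[OF z]] unfolding mr unfolding mass_def .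
  qed
qed

lemma error_estimate:
  assumes \<beta>: "0 < \<beta>" "\<beta> < 1" and \<sigma>: "\<sigma> < \<beta>" and k0: "0 < k0"
  shows "\<exists>C>0. \<forall>f u n k. L2_graph G len f \<longrightarrow> frac_power_eq G len a \<kappa> \<alpha> \<beta> u f \<longrightarrow> mesh G n \<longrightarrow>
    0 < k \<longrightarrow> k \<le> k0 \<longrightarrow>
      L2_norm G len (\<lambda>e x. u e x - Q_approx G len a \<kappa> \<alpha> n k \<beta> (Ph G len n f) e x)
        \<le> C * (mesh_size G len n powr (2 * \<sigma>) + exp (- pi\<^sup>2 / (2 * k))) * L2_norm G len f"
proof -
  obtain c where c: "0 < c" "\<And>w. w \<in> H1s \<Longrightarrow> c * (mass w + mass (gradient w)) \<le> form w w"
    using form_coercive by blast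
  obtain A where A: "0 < A" "\<And>z r n. \<lbrakk>z \<in> H1s; r \<in> L2s; regular z r; form z z = L2_inner G len r z; mesh G n\<rbrakk> \<Longrightarrow>
     \<exists>v\<in>Vh G len n. form (z - v) (z - v) \<le> A * (mesh_size G len n)\<^sup>2 * mass r \<and>
        mass (z - v) \<le> (A * (mesh_size G len n)\<^sup>2)\<^sup>2 * mass r"
    using Galerkin_approximation by blast
  \<comment> \<open>The scalar estimate is applied at x = 1 / \<mu> j and at x = \<delta>; X bounds
    both.\<close>
  define X where "X = max (1 / c) (A * lmax\<^sup>2)"
  have X: "0 < X" using c(1) by (simp add: X_def less_max_iff_disj)
  obtain D where D: "0 < D" "\<And>k x. \<lbrakk>0 < k; k \<le> k0; 0 < x; x \<le> X\<rbrakk> \<Longrightarrow>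
      \<bar>x powr \<beta> - 2 * k * sin (pi * \<beta>) / pi * (\<Sum>l\<in>{- K_minus \<beta> k..K_plus \<beta> k}.
          exp (2 * \<beta> * of_int l * k) * (x / (x + exp (2 * of_int l * k))))\<bar>
        \<le> D * exp (- pi\<^sup>2 / (2 * k))"
    using sinc_quadrature_error[OF \<beta> X k0] by blast
  \<comment> \<open>The 4 is the constant of \<open>resolvent_error\<close>. The power of
    \<open>lmax\<close> absorbs the surplus \<open>h powr (2 * (\<beta> - \<sigma>))\<close>, whose
    exponent is positive for every admissible \<sigma>, negative ones included.\<close>
  define F where "F = 4 * (A powr \<beta> * lmax powr (2 * (\<beta> - \<sigma>)))"
  have F: "0 < F" using A(1) lmax(2) by (simp add: F_def)
  have "L2_norm G len (\<lambda>e x. u e x - Q_approx G len a \<kappa> \<alpha> n k \<beta> (Ph G len n f) e x)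
      \<le> (5 * D + F) * (mesh_size G len n powr (2 * \<sigma>) + exp (- pi\<^sup>2 / (2 * k))) * L2_norm G len f"
    if f: "L2_graph G len f" and fp: "frac_power_eq G len a \<kappa> \<alpha> \<beta> u f" and n: "mesh G n" and k: "0 < k" "k \<le> k0" for f u n k
  proof -
    define h where "h = mesh_size G len n"
    define \<delta> where "\<delta> = A * h\<^sup>2"
    define E where "E = exp (- pi\<^sup>2 / (2 * k))"
    have h: "0 < h" "h \<le> lmax" using mesh_size_pos[OF n] mesh_step(4)[OF n] arcs_nonempty by (auto simp: h_def)
    obtain \<phi> \<mu> where eb: "eigenbasis G len a \<kappa> \<alpha> \<phi> \<mu>" and fin: "f \<in> L2s" "u \<in> L2s"
      and lim: "(\<lambda>m. L2_norm G len (f - (\<Sum>j<m. (\<mu> j powr \<beta> * L2_inner G len u (\<phi> j)) *\<^sub>R \<phi> j))) \<longlonglongrightarrow> 0"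
      using fp unfolding frac_power_eq_def L2s_def partial_expansion_eq by blast
    interpret g: galerkin "L2_inner G len" L2s form H1s "Vh G len n" \<phi> \<mu> \<delta>
      unfolding \<delta>_def h_def by (rule galerkin_Vh[OF eb n A(1) A(2)[OF _ _ _ _ n]])
    define wt where "wt = (\<lambda>l::int. 2 * k * sin (pi * \<beta>) / pi * exp (2 * \<beta> * of_int l * k))"
    define t where "t = (\<lambda>l::int. exp (2 * of_int l * k))"
    let ?I = "{- K_minus \<beta> k..K_plus \<beta> k}"
    have quad: "\<bar>x powr \<beta> - (\<Sum>l\<in>?I. wt l * (x / (x + t l)))\<bar> \<le> D * E" if "0 < x" "x \<le> X" for x
      using D(2)[OF k that] by (simp only: wt_def t_def E_def sum_distrib_left mult.assoc)
    have Q: "Q_approx G len a \<kappa> \<alpha> n k \<beta> (Ph G len n f) = (\<Sum>l\<in>?I. wt l *\<^sub>R g.resolvent (t l) (g.proj f))"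
    proof -
      have P: "Ph G len n f = g.proj f" by (simp only: Ph_def g.proj_def)
      have R: "Lh_resolvent G len a \<kappa> \<alpha> n s = g.resolvent s" for s
        by (simp add: Lh_resolvent_def g.resolvent_def Lh_def g.disc_def plus_fun_def scaleR_fun_def)
      show ?thesis
        unfolding Q_approx_def P R by (simp add: fun_eq_iff sum_fun_apply wt_def t_def sum_distrib_left mult.assoc)
    qed
    have mu: "0 < \<mu> j" "1 / \<mu> j \<le> X" for j
    proof -
      have "c \<le> \<mu> j" by (rule eigenvalue_ge[OF eb c])
      then show "0 < \<mu> j" "1 / \<mu> j \<le> X" using c(1) by (auto simp: X_def frac_le le_max_iff_disj)
    qed
    have coef: "L2_inner G len u (\<phi> j) = \<mu> j powr - \<beta> * L2_inner G len f (\<phi> j)" for j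
      using expansion_coefficient[OF eb fin(1) lim, of j] mu(1)[of j] by (simp add: powr_minus)
    have scalar: "\<bar>\<mu> j powr - \<beta> - (\<Sum>l\<in>?I. wt l / (1 + t l * \<mu> j))\<bar> \<le> D * E" for j
    proof -
      have p: "(1 / \<mu> j) powr \<beta> = \<mu> j powr - \<beta>" using mu(1)[of j] by (simp add: powr_minus_divide powr_divide)
      have q: "wt l * (1 / \<mu> j / (1 / \<mu> j + t l)) = wt l / (1 + t l * \<mu> j)" for l
      proof -
        have "0 < t l" by (simp add: t_def)
        then have "1 / \<mu> j / (1 / \<mu> j + t l) = 1 / (1 + t l * \<mu> j)"
          using mu(1)[of j] by (simp add: field_simps)
        then show ?thesis by simp
      qed
      have "0 < 1 / \<mu> j" using mu(1)[of j] by simp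
      from quad[OF this mu(2)] show ?thesis unfolding p q .
    qed
    have \<delta>0: "0 < \<delta>" using A(1) h by (simp add: \<delta>_def)
    have "\<delta> \<le> A * lmax\<^sup>2" unfolding \<delta>_def using A(1) h by (intro mult_left_mono power_mono) auto
    then have "\<delta> \<le> X" by (simp add: X_def)
    \<comment> \<open>The Galerkin errors of all nodes form the quadrature of \<delta> powr \<beta>,
      so the scalar estimate at \<delta> bounds them.\<close>
    then have sumd: "(\<Sum>l\<in>?I. wt l * (\<delta> / (\<delta> + t l))) \<le> \<delta> powr \<beta> + D * E"
      using quad[OF \<delta>0] by linarith
    have "\<delta> powr \<beta> = A powr \<beta> * h powr (2 * \<beta>)"
      using A(1) h(1) by (simp add: \<delta>_def powr_mult powr_powr flip: powr_numeral)
    also have "h powr (2 * \<beta>) = h powr (2 * (\<beta> - \<sigma>)) * h powr (2 * \<sigma>)"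
      by (simp add: algebra_simps flip: powr_add)
    also have "A powr \<beta> * (h powr (2 * (\<beta> - \<sigma>)) * h powr (2 * \<sigma>))
        \<le> A powr \<beta> * (lmax powr (2 * (\<beta> - \<sigma>)) * h powr (2 * \<sigma>))"
      using h \<sigma> by (intro mult_left_mono mult_right_mono powr_mono2) auto
    finally have "4 * \<delta> powr \<beta> \<le> F * h powr (2 * \<sigma>)" by (simp add: F_def mult.assoc)
    \<comment> \<open>The quadrature error enters once through the spectrum of the operator and four
      times through \<open>sumd\<close>.\<close>
    then have "D * E + 4 * (\<Sum>l\<in>?I. wt l * (\<delta> / (\<delta> + t l))) \<le> F * h powr (2 * \<sigma>) + 5 * D * E"
      using sumd by linarith
    also have "\<dots> \<le> (5 * D + F) * (h powr (2 * \<sigma>) + E)"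
    proof -
      have "0 \<le> 5 * D * h powr (2 * \<sigma>)" "0 \<le> F * E" using D(1) F by (simp_all add: E_def)
      then show ?thesis by (simp add: algebra_simps)
    qed
    finally have bound: "D * E + 4 * (\<Sum>l\<in>?I. wt l * (\<delta> / (\<delta> + t l))) \<le> (5 * D + F) * (h powr (2 * \<sigma>) + E)" .
    have nrm: "g.L.nrm = L2_norm G len" by (simp add: fun_eq_iff g.L.nrm_def L2_norm_def)
    have "L2_norm G len (u - (\<Sum>l\<in>?I. wt l *\<^sub>R g.resolvent (t l) (g.proj f)))
        \<le> (D * E + 4 * (\<Sum>l\<in>?I. wt l * (\<delta> / (\<delta> + t l)))) * L2_norm G len f"
      unfolding nrm[symmetric]
    proof (rule g.rational_approximation_error[OF fin coef _ _ scalar])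
      show "0 < t l" for l by (simp add: t_def)
      have "0 < sin (pi * \<beta>)" using \<beta> by (intro sin_gt_zero) auto
      then show "0 \<le> wt l" for l using k by (simp add: wt_def)
    qed
    also have "\<dots> \<le> (5 * D + F) * (h powr (2 * \<sigma>) + E) * L2_norm G len f"
      by (rule mult_right_mono[OF bound]) (simp add: nrm[symmetric] g.L.nrm_nonneg[OF fin(1)])
    finally have "L2_norm G len (u - Q_approx G len a \<kappa> \<alpha> n k \<beta> (Ph G len n f))
        \<le> (5 * D + F) * (h powr (2 * \<sigma>) + E) * L2_norm G len f" unfolding Q .
    then show ?thesis by (simp only: fun_diff_def h_def E_def)
  qed
  moreover have "0 < 5 * D + F" using D(1) F by simp
  ultimately show ?thesis by (intro exI[of _ "5 * D + F"]) blast
qed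

end

theorem theorem6p5:
  fixes G :: "('v,'e) pre_digraph" and len :: "'e \<Rightarrow> real"
    and a \<kappa> :: "'e \<Rightarrow> real \<Rightarrow> real"
    and \<kappa>0 a0 \<alpha> \<beta> \<sigma> :: real
  assumes "compact_metric_graph G len" and "Digraph_Component.connected G"
    and "Linf_graph G len \<kappa>" and "0 < \<kappa>0"
    and "\<forall>e\<in>arcs G. AE x in lebesgue_on {0..len e}. \<kappa>0 \<le> \<kappa> e x"
    and "graph_Lipschitz G len a"
    and "0 < a0"
    and "\<exists>(e, x)\<in>gpoints G len. a e x = a0" and "\<forall>(e, x)\<in>gpoints G len. a0 \<le> a e x"
    and "0 \<le> \<alpha> \<or>
      (let d0 = Min (gdegree G ` verts G); S = \<bar>\<alpha>\<bar> / real d0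
       in 4 * S / Min (len ` arcs G) < \<kappa>0\<^sup>2 \<and> 2 * S * Max (len ` arcs G) \<le> a0)"
    and "0 < \<beta>" and "\<beta> < 1" and "\<sigma> < \<beta>"
  shows "\<forall>k0>0. \<exists>C>0. \<forall>f u n k.
    L2_graph G len f \<longrightarrow> frac_power_eq G len a \<kappa> \<alpha> \<beta> u f \<longrightarrow> mesh G n \<longrightarrow>
    0 < k \<longrightarrow> k \<le> k0 \<longrightarrow>
      L2_norm G len (\<lambda>e x. u e x - Q_approx G len a \<kappa> \<alpha> n k \<beta> (Ph G len n f) e x)
        \<le> C * (mesh_size G len n powr (2 * \<sigma>) + exp (- pi\<^sup>2 / (2 * k))) * L2_norm G len f"
proof -
  have "graph_problem G len a \<kappa> \<kappa>0 a0 \<alpha>"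
  proof
    show "a0 \<le> a e x" if "(e, x) \<in> gpoints G len" for e x using assms(9) that by blast
  qed (use assms in simp_all)
  from graph_problem.error_estimate[OF this assms(11-13)] show ?thesis by blast
qed

end
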